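(* Let $F\in\mathcal{DM}^\infty_{loc}(H\Omega)$ with $|\operatorname{div}F|\ll\mu$, let $E$ be a set of locally finite h-perimeter in $\Omega$, and let $\varphi\in C(\Omega)$ have distributional horizontal gradient $\nabla_H\varphi\in L^1_{loc}(H\Omega)$ and satisfy $\operatorname{supp}(\varphi\chi_E)\Subset\Omega$. Let $U\Subset\Omega$ be any open set with $\operatorname{supp}(\varphi\chi_E)\subset U$, and let $\mathrm{Tr}_i,\mathrm{Tr}_e,\mathrm{Tr}$ denote the interior, exterior and average normal traces of $F|_U$ on $\partial^*_HE\cap U$ computed in the open set $U$ (where $E\cap U$ has finite h-perimeter). Then $\mathrm{Tr}_i=\mathrm{Tr}_e=\mathrm{Tr}$ $|D_H\chi_E|$-a.e. in $U$ and $$\int_E\varphi\,d\operatorname{div}F+\int_E\langle F,\nabla_H\varphi\rangle\,dx=\int_{\partial^*_HE}\varphi\,\mathrm{Tr}\,d|D_H\chi_E|.$$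
   Context: Setting and notation. $\mathbb G$ is a stratified group: a connected, simply connected nilpotent Lie group whose Lie algebra admits a stratification $\mathfrak g=V_1\oplus\cdots\oplus V_\iota$ with $[V_1,V_j]=V_{j+1}$, $V_\iota\neq\{0\}$, $V_{\iota+1}=\{0\}$; via exponential (graded) coordinates $\mathbb G$ is identified with $\mathbb R^q$, so that $0$ is the identity and $x^{-1}=-x$. $\delta_r$ ($r>0$) are the intrinsic dilations. $X_1,\dots,X_q$ are the left invariant vector fields agreeing at $0$ with a fixed graded basis, and $X_1,\dots,X_m$ ($m=\dim V_1$) are the horizontal ones; the horizontal subbundle has fibres $H_p\mathbb G=\mathrm{span}\{X_1(p),\dots,X_m(p)\}$, with the left invariant scalar product $\langle\cdot,\cdot\rangle$ making $X_1,\dots,X_m$ orthonormal and norm $|\cdot|$. $Q=\sum_i i\dim V_i$. The Haar measure $\mu$ is Lebesgue measure $\mathcal L^q$ in these coordinates ($dx$). $d$ is a fixed homogeneous distance (continuous, left invariant, $d(\delta_rx,\delta_ry)=rd(x,y)$), $B(x,r)=\{y:d(y,x)<r\}$. $\Omega\subset\mathbb G$ is open. Horizontal calculus. For a function $\varphi$, $\nabla_H\varphi=\sum_{j=1}^m(X_j\varphi)X_j$ with $X_j\varphi$ the distributional derivatives. A horizontal field is a measurable section $F=\sum_{j=1}^mF_jX_j$ of $H\Omega$; $L^p(H\Omega)$ consists of those with $|F|\in L^p(\Omega)$; $L^p_{loc}$ analogously; $\|F\|_{\infty,A}=\operatorname{ess\,sup}_A|F|$; $C^1_c(H\Omega)$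 are those with $C^1$ compactly supported coefficients. The divergence of $F\in L^1_{loc}(H\Omega)$ is the distribution $\varphi\mapsto-\int_\Omega\langle F,\nabla_H\varphi\rangle\,dx$, $\varphi\in C^\infty_c(\Omega)$. $\mathcal{DM}^p(H\Omega)$ ($1\le p\le\infty$) is the space of $F\in L^p(H\Omega)$ whose divergence is a finite signed Radon measure $\operatorname{div}F$ on $\Omega$; $F\in\mathcal{DM}^p_{loc}(H\Omega)$ if $F\in\mathcal{DM}^p(HW)$ for every open $W\Subset\Omega$. BV and perimeter. For $f\in L^1_{loc}(\Omega)$ let $|D_Hf|(\Omega)=\sup\{\int_\Omega f\operatorname{div}\phi\,dx:\phi\in C^1_c(H\Omega),|\phi|\le1\}$. If this is finite, $|D_Hf|$ is a finite Radon measure and there is a $|D_Hf|$-measurable horizontal section $\sigma_f$ with $|\sigma_f|=1$ a.e. and $\int f\operatorname{div}\phi\,dx=-\int\langle\phi,\sigma_f\rangle\,d|D_Hf|$; $D_Hf:=\sigma_f|D_Hf|$. A measurable $E$ has finite (resp. locally finite) h-perimeter in $\Omega$ if $|D_H\chi_E|(\Omega)<\infty$ (resp. $|D_H\chi_E|(U)<\infty$ for every open $U\Subset\Omega$); $\nu_E=-\sigma_{\chi_E}$ is the measure theoretic exterior horizontal normal. The reduced boundary $\partial^*_HE$ is the set of $x$ with $|D_H\chi_E|(B(x,r))>0$ for all $r>0$ such that $\lim_{r\to0}|D_H\chi_E|(B(x,r))^{-1}\int_{B(x,r)}\nu_E\,d|D_H\chi_E|$ exists and has norm $1$. Normal traces.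 For $F\in\mathcal{DM}^\infty(H\Omega)$ and $E\subset\Omega$ of finite h-perimeter in $\Omega$, there exist (as established in the paper) a $|\operatorname{div}F|$-measurable set $E^{1,F}\subset\Omega\setminus\partial^*_HE$, unique up to $|\operatorname{div}F|$-null sets, and functions $\mathrm{Tr}_i(F,\partial^*_HE),\mathrm{Tr}_e(F,\partial^*_HE)\in L^\infty(\partial^*_HE;|D_H\chi_E|)$, unique up to $|D_H\chi_E|$-null sets, such that as measures on $\Omega$: $\operatorname{div}(\chi_EF)=\chi_{E^{1,F}}\operatorname{div}F-\mathrm{Tr}_i(F,\partial^*_HE)|D_H\chi_E|$ and $\operatorname{div}(\chi_EF)=\chi_{E^{1,F}\cup\partial^*_HE}\operatorname{div}F-\mathrm{Tr}_e(F,\partial^*_HE)|D_H\chi_E|$. $E^{1,F}$ is the measure theoretic interior of $E$ with respect to $F$; $\mathrm{Tr}_i,\mathrm{Tr}_e$ are the interior and exterior normal traces, and $\mathrm{Tr}(F,\partial^*_HE):=\frac12(\mathrm{Tr}_i+\mathrm{Tr}_e)$ is the average normal trace. When $\Omega$ is replaced by an open subset $U$, these objects are defined in the same way with $U$ in place of $\Omega$. *)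

theory Defs
  imports "HOL-Analysis.Analysis"
begin

text \<open>Stratified group modelled on a Euclidean space 'a in exponential graded
coordinates: the standard basis of 'a is the fixed graded basis, w b is the degree
(layer) of the basis vector b, gm is the group law.  Haar measure = lebesgue.\<close>

fun iter_pd :: "'a::euclidean_space list \<Rightarrow> ('a \<Rightarrow> real) \<Rightarrow> 'a \<Rightarrow> real" where
  "iter_pd [] f = f"
| "iter_pd (b # bs) f = (\<lambda>x. frechet_derivative (iter_pd bs f) (at x) b)"

definition Cinf_on :: "'a::euclidean_space set \<Rightarrow> ('a \<Rightarrow> 'b::euclidean_space) \<Rightarrow> bool" where
  "Cinf_on S f \<longleftrightarrow> (\<forall>c\<in>Basis. \<forall>bs. set bs \<subseteq> Basis \<longrightarrow>
      (\<forall>x\<in>S. iter_pd bs (\<lambda>y. f y \<bullet> c) differentiable (at x)))"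

definition hlayer :: "('a::euclidean_space \<Rightarrow> nat) \<Rightarrow> nat \<Rightarrow> 'a set" where
  "hlayer w j = span {b\<in>Basis. w b = j}"

definition dil :: "('a::euclidean_space \<Rightarrow> nat) \<Rightarrow> real \<Rightarrow> 'a \<Rightarrow> 'a" where
  "dil w r x = (\<Sum>b\<in>Basis. (r ^ (w b) * (x \<bullet> b)) *\<^sub>R b)"

text \<open>Lie bracket read off from the group law in exponential coordinates.\<close>
definition lie_br :: "('a::euclidean_space \<Rightarrow> 'a \<Rightarrow> 'a) \<Rightarrow> 'a \<Rightarrow> 'a \<Rightarrow> 'a" where
  "lie_br gm x y = Lim (at (0::real))
     (\<lambda>t. (1 / t^2) *\<^sub>R (gm (t *\<^sub>R x) (t *\<^sub>R y) - gm (t *\<^sub>R y) (t *\<^sub>R x)))"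

definition stratified_group :: "('a::euclidean_space \<Rightarrow> 'a \<Rightarrow> 'a) \<Rightarrow> ('a \<Rightarrow> nat) \<Rightarrow> bool" where
  "stratified_group gm w \<longleftrightarrow>
     (\<forall>x y z. gm (gm x y) z = gm x (gm y z)) \<and>
     (\<forall>x. gm 0 x = x \<and> gm x 0 = x) \<and>
     (\<forall>x. gm x (- x) = 0 \<and> gm (- x) x = 0) \<and>
     Cinf_on UNIV (\<lambda>p::'a \<times> 'a. gm (fst p) (snd p)) \<and>
     (\<forall>x s t. gm (s *\<^sub>R x) (t *\<^sub>R x) = (s + t) *\<^sub>R x) \<and>
     (\<forall>b\<in>Basis. w b \<ge> 1) \<and>
     (\<forall>r>0. \<forall>x y. dil w r (gm x y) = gm (dil w r x) (dil w r y)) \<and>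
     (\<forall>j\<ge>1. span {lie_br gm x y | x y. x \<in> hlayer w 1 \<and> y \<in> hlayer w j} = hlayer w (Suc j))"

definition hom_dist :: "('a::euclidean_space \<Rightarrow> 'a \<Rightarrow> 'a) \<Rightarrow> ('a \<Rightarrow> nat) \<Rightarrow> ('a \<Rightarrow> 'a \<Rightarrow> real) \<Rightarrow> bool" where
  "hom_dist gm w d \<longleftrightarrow>
     (\<forall>x y. d x y = 0 \<longleftrightarrow> x = y) \<and> (\<forall>x y. d x y = d y x) \<and>
     (\<forall>x y z. d x z \<le> d x y + d y z) \<and>
     continuous_on UNIV (\<lambda>p. d (fst p) (snd p)) \<and>
     (\<forall>x y z. d (gm z x) (gm z y) = d x y) \<and>
     (\<forall>r>0. \<forall>x y. d (dil w r x) (dil w r y) = r * d x y)"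

definition hball :: "('a \<Rightarrow> 'a \<Rightarrow> real) \<Rightarrow> 'a \<Rightarrow> real \<Rightarrow> 'a set" where
  "hball d x r = {y. d y x < r}"

text \<open>Left invariant field X_b applied to a function, horizontal gradient and divergence.
Horizontal sections are identified with their coefficient vectors in hlayer w 1.\<close>
definition Xf :: "('a::euclidean_space \<Rightarrow> 'a \<Rightarrow> 'a) \<Rightarrow> 'a \<Rightarrow> ('a \<Rightarrow> real) \<Rightarrow> 'a \<Rightarrow> real" where
  "Xf gm b f x = deriv (\<lambda>t. f (gm x (t *\<^sub>R b))) 0"

definition hgrad :: "('a::euclidean_space \<Rightarrow> 'a \<Rightarrow> 'a) \<Rightarrow> ('a \<Rightarrow> nat) \<Rightarrow> ('a \<Rightarrow> real) \<Rightarrow> 'a \<Rightarrow> 'a" where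
  "hgrad gm w f x = (\<Sum>b\<in>{b\<in>Basis. w b = 1}. Xf gm b f x *\<^sub>R b)"

definition hdiv :: "('a::euclidean_space \<Rightarrow> 'a \<Rightarrow> 'a) \<Rightarrow> ('a \<Rightarrow> nat) \<Rightarrow> ('a \<Rightarrow> 'a) \<Rightarrow> 'a \<Rightarrow> real" where
  "hdiv gm w \<phi> x = (\<Sum>b\<in>{b\<in>Basis. w b = 1}. Xf gm b (\<lambda>y. \<phi> y \<bullet> b) x)"

definition tsupport :: "('a::real_normed_vector \<Rightarrow> 'b::zero) \<Rightarrow> 'a set" where
  "tsupport f = closure {x. f x \<noteq> 0}"

definition esupport :: "('a::euclidean_space \<Rightarrow> real) \<Rightarrow> 'a set" where
  "esupport f = UNIV - \<Union>{V. open V \<and> (AE x in lebesgue. x \<in> V \<longrightarrow> f x = 0)}"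

definition cpt_in :: "'a::euclidean_space set \<Rightarrow> 'a set \<Rightarrow> bool" where
  "cpt_in A Om \<longleftrightarrow> compact (closure A) \<and> closure A \<subseteq> Om"

definition test_fun :: "'a::euclidean_space set \<Rightarrow> ('a \<Rightarrow> real) \<Rightarrow> bool" where
  "test_fun Om \<psi> \<longleftrightarrow> Cinf_on UNIV \<psi> \<and> compact (tsupport \<psi>) \<and> tsupport \<psi> \<subseteq> Om"

definition C1c_horiz :: "('a::euclidean_space \<Rightarrow> nat) \<Rightarrow> 'a set \<Rightarrow> ('a \<Rightarrow> 'a) \<Rightarrow> bool" where
  "C1c_horiz w Om \<phi> \<longleftrightarrow> (\<forall>x. \<phi> x \<in> hlayer w 1) \<and>
     (\<forall>b\<in>Basis. (\<lambda>x. \<phi> x \<bullet> b) differentiable_on UNIV \<and>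
        (\<forall>c\<in>Basis. continuous_on UNIV (\<lambda>x. frechet_derivative (\<lambda>y. \<phi> y \<bullet> b) (at x) c))) \<and>
     compact (tsupport \<phi>) \<and> tsupport \<phi> \<subseteq> Om"

text \<open>(nu, sigma) represent D_H chi_E in the open set Om: nu = |D_H chi_E| (locally finite
Radon measure on Om), sigma = sigma_{chi_E}, nu_E = - sigma.\<close>
definition perim_rep :: "('a::euclidean_space \<Rightarrow> 'a \<Rightarrow> 'a) \<Rightarrow> ('a \<Rightarrow> nat) \<Rightarrow> 'a set \<Rightarrow> 'a set
    \<Rightarrow> 'a measure \<Rightarrow> ('a \<Rightarrow> 'a) \<Rightarrow> bool" where
  "perim_rep gm w Om E \<nu> \<sigma> \<longleftrightarrow>
     sets \<nu> = sets borel \<and> emeasure \<nu> (UNIV - Om) = 0 \<and>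
     (\<forall>K. compact K \<and> K \<subseteq> Om \<longrightarrow> emeasure \<nu> K < \<infinity>) \<and>
     \<sigma> \<in> borel_measurable \<nu> \<and> (AE x in \<nu>. norm (\<sigma> x) = 1 \<and> \<sigma> x \<in> hlayer w 1) \<and>
     (\<forall>\<phi>. C1c_horiz w Om \<phi> \<longrightarrow>
        integrable \<nu> (\<lambda>x. \<phi> x \<bullet> \<sigma> x) \<and>
        (\<integral>x. indicator E x * hdiv gm w \<phi> x \<partial>lebesgue) = - (\<integral>x. \<phi> x \<bullet> \<sigma> x \<partial>\<nu>))"

definition red_bdry :: "('a::euclidean_space \<Rightarrow> 'a \<Rightarrow> real) \<Rightarrow> 'a set \<Rightarrow> 'a measure \<Rightarrow> ('a \<Rightarrow> 'a) \<Rightarrow> 'a set" where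
  "red_bdry d Om \<nu> \<sigma> = {x\<in>Om. (\<forall>r>0. emeasure \<nu> (hball d x r) > 0) \<and>
     (\<exists>v. ((\<lambda>r. (1 / measure \<nu> (hball d x r)) *\<^sub>R
               (\<integral>y. indicator (hball d x r) y *\<^sub>R (- \<sigma> y) \<partial>\<nu>)) \<longlongrightarrow> v) (at_right 0)
          \<and> norm v = 1)}"

text \<open>F in DM^infinity_loc(H Om) with div F = g dx (i.e. |div F| absolutely continuous
w.r.t. Haar measure, g its Radon-Nikodym density).\<close>
definition DM_loc_ac :: "('a::euclidean_space \<Rightarrow> 'a \<Rightarrow> 'a) \<Rightarrow> ('a \<Rightarrow> nat) \<Rightarrow> 'a set
    \<Rightarrow> ('a \<Rightarrow> 'a) \<Rightarrow> ('a \<Rightarrow> real) \<Rightarrow> bool" where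
  "DM_loc_ac gm w Om F g \<longleftrightarrow>
     F \<in> borel_measurable lebesgue \<and> (\<forall>x\<in>Om. F x \<in> hlayer w 1) \<and>
     (\<forall>W. open W \<and> cpt_in W Om \<longrightarrow> (\<exists>C. AE x in lebesgue. x \<in> W \<longrightarrow> norm (F x) \<le> C)) \<and>
     g \<in> borel_measurable lebesgue \<and>
     (\<forall>K. compact K \<and> K \<subseteq> Om \<longrightarrow> set_integrable lebesgue K g) \<and>
     (\<forall>\<psi>. test_fun Om \<psi> \<longrightarrow>
        - (\<integral>x. F x \<bullet> hgrad gm w \<psi> x \<partial>lebesgue) = (\<integral>x. \<psi> x * g x \<partial>lebesgue))"

text \<open>Interior/exterior normal traces of F on the reduced boundary of E in Om (with
div F = g dx), E1 = measure theoretic interior w.r.t. F.\<close>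
definition normal_traces :: "('a::euclidean_space \<Rightarrow> 'a \<Rightarrow> 'a) \<Rightarrow> ('a \<Rightarrow> nat) \<Rightarrow> ('a \<Rightarrow> 'a \<Rightarrow> real)
    \<Rightarrow> 'a set \<Rightarrow> ('a \<Rightarrow> 'a) \<Rightarrow> ('a \<Rightarrow> real) \<Rightarrow> 'a set \<Rightarrow> 'a measure \<Rightarrow> ('a \<Rightarrow> 'a)
    \<Rightarrow> 'a set \<Rightarrow> ('a \<Rightarrow> real) \<Rightarrow> ('a \<Rightarrow> real) \<Rightarrow> bool" where
  "normal_traces gm w d Om F g E \<nu> \<sigma> E1 Tri Tre \<longleftrightarrow>
     (let R = red_bdry d Om \<nu> \<sigma> in
       E1 \<subseteq> Om - R \<and>
       E1 \<in> sets (completion (density lebesgue (\<lambda>x. ennreal \<bar>g x\<bar>))) \<and>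
       Tri \<in> borel_measurable \<nu> \<and> Tre \<in> borel_measurable \<nu> \<and>
       (\<exists>C. AE x in \<nu>. x \<in> R \<longrightarrow> \<bar>Tri x\<bar> \<le> C \<and> \<bar>Tre x\<bar> \<le> C) \<and>
       (\<forall>\<psi>. test_fun Om \<psi> \<longrightarrow>
          - (\<integral>x. indicator E x * (F x \<bullet> hgrad gm w \<psi> x) \<partial>lebesgue)
            = (\<integral>x. indicator E1 x * \<psi> x * g x \<partial>lebesgue) - (\<integral>x. indicator R x * \<psi> x * Tri x \<partial>\<nu>)) \<and>
       (\<forall>\<psi>. test_fun Om \<psi> \<longrightarrow>
          - (\<integral>x. indicator E x * (F x \<bullet> hgrad gm w \<psi> x) \<partial>lebesgue)
            = (\<integral>x. indicator (E1 \<union> R) x * \<psi> x * g x \<partial>lebesgue) - (\<integral>x. indicator R x * \<psi> x * Tre x \<partial>\<nu>)))"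

end

theory Submission
  imports Defs
begin

text \<open>Functions are mollified with the kernel \<open>\<rho> (x y\<inverse>)\<close>, \<open>\<rho>\<close> a symmetric bump at 0: on it the left
  invariant field \<open>X\<^sub>b\<close> acting on \<open>x\<close> equals \<open>- X\<^sub>b\<close> acting on \<open>y\<close>, so mollification commutes exactly with
  horizontal weak derivatives.

  Mollifying the indicator of \<open>E\<close> and composing with \<open>3 t\<^sup>2 - 2 t\<^sup>3\<close> shows that the perimeter measure is
  singular with respect to Lebesgue measure; mollifying \<open>F\<close> shows that
  \<open>div (\<chi>\<^sub>E F) - \<chi>\<^sub>E div F\<close> is bounded by a multiple of the perimeter measure. As \<open>div F\<close> is
  absolutely continuous, comparing with the two trace identities forces \<open>E\<^sup>1\<close> and \<open>E\<close> to agree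
  \<open>|div F|\<close>-almost everywhere and the two traces to coincide. The formula then follows by testing the trace
  identity with mollifications of \<open>\<phi>\<close>, cut off near the support of \<open>\<phi> \<chi>\<^sub>E\<close>: the weak gradient of \<open>\<phi>\<close>
  vanishes almost everywhere on \<open>{\<phi> = 0}\<close>, and \<open>\<phi>\<close> vanishes on the part of the reduced boundary outside
  this support.\<close>

section \<open>Smooth functions\<close>

text \<open>The kernel averages left translates of a function, and left invariant fields commute
  with left translations; hence no commutator error has to be estimated. Invariance of Lebesgue
  measure under the group is not an axiom here: its infinitesimal form, that every
  \<open>X\<^sub>b\<close> is divergence free, comes from the dilations. The traces and
  \<open>E1\<close> are given only through two distributional identities. Each comparison ends in a
  measure that is both absolutely continuous and dominated by, or equal to, one carried by a
  Lebesgue null set, so it vanishes. Perimeter data occur twice, on \<open>\<Omega>\<close> and on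
  \<open>U\<close>; uniqueness of the polar decomposition identifies the second pair with the
  restriction of the first. Integrals of nonintegrable functions are 0 by convention, so
  measurability is part of the argument: Lebesgue measurable data are exchanged for Borel
  representatives, and the reduced boundary must be shown to be a Borel set. Since the perimeter
  measure lives on a Lebesgue null set, limits under it need convergence at every point, and this is
  what the continuity of \<open>\<phi>\<close> provides.\<close>

definition pd :: "'a::euclidean_space \<Rightarrow> ('a \<Rightarrow> real) \<Rightarrow> 'a \<Rightarrow> real" where
  "pd b f = (\<lambda>x. frechet_derivative f (at x) b)"

definition smooth :: "('a::euclidean_space \<Rightarrow> real) \<Rightarrow> bool" where
  "smooth f \<longleftrightarrow> (\<forall>bs. set bs \<subseteq> Basis \<longrightarrow> (\<forall>x. iter_pd bs f differentiable (at x)))"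

lemma Cinf_on_UNIV_iff: "Cinf_on UNIV f \<longleftrightarrow> (\<forall>c\<in>Basis. smooth (\<lambda>y. f y \<bullet> c))"
  by (auto simp: Cinf_on_def smooth_def)

lemma Cinf_on_UNIV_real_iff: "Cinf_on UNIV (f :: 'a::euclidean_space \<Rightarrow> real) \<longleftrightarrow> smooth f"
  by (auto simp: Cinf_on_UNIV_iff)

text \<open>\<open>iter_pd\<close> differentiates first in the direction of the last list entry.
  Peeling the list from the right therefore exposes the innermost derivative, which is what an
  unfolding of \<open>smooth\<close> needs.\<close>

lemma iter_pd_snoc: "iter_pd (bs @ [b]) f = iter_pd bs (pd b f)"
  by (induction bs) (auto simp: pd_def)

lemma smooth_unfold:
  "smooth f \<longleftrightarrow> (\<forall>x. f differentiable (at x)) \<and> (\<forall>b\<in>Basis. smooth (pd b f))"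
proof
  assume f: "smooth f"
  have "f differentiable (at x)" for x
    using f[unfolded smooth_def, rule_format, of "[]" x] by simp
  moreover have "smooth (pd b f)" if "b \<in> Basis" for b
    unfolding smooth_def
  proof (intro allI impI)
    fix bs :: "'a list" and x
    assume "set bs \<subseteq> Basis"
    with that have "set (bs @ [b]) \<subseteq> Basis" by simp
    from f[unfolded smooth_def, rule_format, OF this]
    show "iter_pd bs (pd b f) differentiable at x" by (simp only: iter_pd_snoc)
  qed
  ultimately show "(\<forall>x. f differentiable (at x)) \<and> (\<forall>b\<in>Basis. smooth (pd b f))" by blast
next
  assume f: "(\<forall>x. f differentiable (at x)) \<and> (\<forall>b\<in>Basis. smooth (pd b f))"
  show "smooth f"
    unfolding smooth_def
  proof (intro allI impI)
    fix bs :: "'a list" and x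
    assume bs: "set bs \<subseteq> Basis"
    show "iter_pd bs f differentiable at x"
    proof (cases bs rule: rev_cases)
      case Nil
      then show ?thesis using f by simp
    next
      case (snoc cs c)
      then have "smooth (pd c f)" "set cs \<subseteq> Basis" using bs f by auto
      then show ?thesis unfolding snoc iter_pd_snoc by (auto simp: smooth_def)
    qed
  qed
qed

lemma smooth_differentiable: "smooth f \<Longrightarrow> f differentiable (at x)"
  using smooth_unfold by blast

lemma smooth_pd: "smooth f \<Longrightarrow> b \<in> Basis \<Longrightarrow> smooth (pd b f)"
  using smooth_unfold by blast

text \<open>Smoothness is a greatest fixed point, so a class of differentiable functions that is
  closed under \<open>pd\<close> serves as an invariant, in place of an induction on the order of
  the derivative.\<close>

lemma smooth_coinduct:
  assumes "f \<in> S" "\<And>f x. f \<in> S \<Longrightarrow> f differentiable (at x)"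
    and "\<And>f b. f \<in> S \<Longrightarrow> b \<in> Basis \<Longrightarrow> pd b f \<in> S"
  shows "smooth f"
proof -
  have "set bs \<subseteq> Basis \<Longrightarrow> iter_pd bs f \<in> S" for bs
    using assms(1) assms(3)[unfolded pd_def] by (induction bs) auto
  with assms(2) show ?thesis by (auto simp: smooth_def)
qed

lemma pd_eqI: "(f has_derivative D) (at x) \<Longrightarrow> pd b f x = D b"
  unfolding pd_def by (simp add: frechet_derivative_at[symmetric])

lemma differentiable_pd_linear:
  assumes "f differentiable (at x)"
  shows "(f has_derivative (\<lambda>v. \<Sum>b\<in>Basis. (v \<bullet> b) * pd b f x)) (at x)"
proof -
  have D: "(f has_derivative frechet_derivative f (at x)) (at x)"
    using assms by (simp add: frechet_derivative_works)
  then have "linear (frechet_derivative f (at x))"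
    using has_derivative_linear by blast
  then have "frechet_derivative f (at x) = (\<lambda>v. \<Sum>b\<in>Basis. (v \<bullet> b) * pd b f x)"
    by (intro ext, subst euclidean_representation[symmetric])
       (simp only: linear_sum linear_cmul real_scaleR_def pd_def)
  then show ?thesis using D by simp
qed

lemmas smooth_has_derivative = differentiable_pd_linear[OF smooth_differentiable]

section \<open>Smoothness via algebras of functions closed under differentiation\<close>

inductive_set fun_alg :: "('a \<Rightarrow> real) set \<Rightarrow> ('a \<Rightarrow> real) set" for B where
  fun_alg_base: "f \<in> B \<Longrightarrow> f \<in> fun_alg B"
| fun_alg_const: "(\<lambda>x. c) \<in> fun_alg B"
| fun_alg_add: "f \<in> fun_alg B \<Longrightarrow> g \<in> fun_alg B \<Longrightarrow> (\<lambda>x. f x + g x) \<in> fun_alg B"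
| fun_alg_mult: "f \<in> fun_alg B \<Longrightarrow> g \<in> fun_alg B \<Longrightarrow> (\<lambda>x. f x * g x) \<in> fun_alg B"

lemma fun_alg_sum:
  "(\<And>i. i \<in> I \<Longrightarrow> f i \<in> fun_alg B) \<Longrightarrow> (\<lambda>x. \<Sum>i\<in>I. f i x) \<in> fun_alg B"
  by (induction I rule: infinite_finite_induct)
     (auto intro: fun_alg_const fun_alg_add)

text \<open>By the sum and product rules the generated algebra is closed under \<open>pd\<close> as
  soon as the partial derivatives of its generators lie in it. The algebra is then an invariant for
  \<open>smooth_coinduct\<close>, and a smoothness proof reduces to a choice of generators.\<close>

lemma smooth_fun_alg:
  fixes B :: "('a::euclidean_space \<Rightarrow> real) set"
  assumes diff: "\<And>f x. f \<in> B \<Longrightarrow> f differentiable (at x)"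
    and pd: "\<And>f b. f \<in> B \<Longrightarrow> b \<in> Basis \<Longrightarrow> pd b f \<in> fun_alg B"
    and f: "f \<in> fun_alg B"
  shows "smooth f"
proof (rule smooth_coinduct[OF f])
  fix f and x :: 'a assume "f \<in> fun_alg B"
  then show "f differentiable (at x)"
    by (induction) (auto intro: diff)
next
  fix f and b :: 'a assume f: "f \<in> fun_alg B" and b: "b \<in> Basis"
  have D: "(f has_derivative frechet_derivative f (at x)) (at x)" if "f \<in> fun_alg B" for f x
    using that by (induction) (auto intro: diff simp flip: frechet_derivative_works)
  from f show "pd b f \<in> fun_alg B"
  proof induction
    case (fun_alg_base f)
    then show ?case using pd b by blast
  next
    case (fun_alg_const c)
    have "pd b (\<lambda>x. c) = (\<lambda>x. 0)"
      by (rule ext, rule pd_eqI) simp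
    then show ?case using fun_alg.fun_alg_const[of 0 B] by simp
  next
    case (fun_alg_add f g)
    have "pd b (\<lambda>x. f x + g x) = (\<lambda>x. pd b f x + pd b g x)"
      by (rule ext, unfold pd_def[of b f] pd_def[of b g], rule pd_eqI)
        (rule has_derivative_add; rule D; rule fun_alg_add)
    then show ?case using fun_alg_add fun_alg.fun_alg_add by metis
  next
    case (fun_alg_mult f g)
    have "pd b (\<lambda>x. f x * g x) = (\<lambda>x. f x * pd b g x + pd b f x * g x)"
      by (rule ext, unfold pd_def[of b f] pd_def[of b g], rule pd_eqI)
        (rule has_derivative_mult; rule D; rule fun_alg_mult)
    then show ?case
      using fun_alg_mult by (auto intro!: fun_alg.fun_alg_add fun_alg.fun_alg_mult)
  qed
qed

lemma smooth_const [simp]: "smooth (\<lambda>x. c)"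
  by (rule smooth_fun_alg[of "{}"]) (auto intro: fun_alg_const)

lemma smooth_bounded_linear:
  assumes "bounded_linear f" shows "smooth f"
proof (rule smooth_fun_alg[of "{f}"])
  have D: "(f has_derivative f) (at x)" for x
    using assms by (rule bounded_linear_imp_has_derivative)
  then show "g differentiable at x" if "g \<in> {f}" for g x
    using that differentiableI by blast
  have "pd b f = (\<lambda>x. f b)" for b by (rule ext, rule pd_eqI[OF D])
  then show "pd b g \<in> fun_alg {f}" if "g \<in> {f}" for g b using that
    by (auto intro: fun_alg_const)
qed (auto intro: fun_alg_base)

lemma smooth_closure:
  assumes "f \<in> fun_alg (Collect smooth)" shows "smooth f"
  by (rule smooth_fun_alg[OF _ _ assms])
     (auto intro: smooth_differentiable fun_alg_base smooth_pd)

lemma smooth_add: "smooth f \<Longrightarrow> smooth g \<Longrightarrow> smooth (\<lambda>x. f x + g x)"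
  by (intro smooth_closure fun_alg_add fun_alg_base) auto

lemma smooth_mult: "smooth f \<Longrightarrow> smooth g \<Longrightarrow> smooth (\<lambda>x. f x * g x)"
  by (intro smooth_closure fun_alg_mult fun_alg_base) auto

lemma smooth_sum: "(\<And>i. i \<in> I \<Longrightarrow> smooth (f i)) \<Longrightarrow> smooth (\<lambda>x. \<Sum>i\<in>I. f i x)"
  by (intro smooth_closure fun_alg_sum fun_alg_base) auto

lemma smooth_minus: "smooth f \<Longrightarrow> smooth (\<lambda>x. - f x)"
  using smooth_mult[OF smooth_const[of "-1"]] by simp

lemma smooth_diff: "smooth f \<Longrightarrow> smooth g \<Longrightarrow> smooth (\<lambda>x. f x - g x)"
  using smooth_add[OF _ smooth_minus, of f g] by simp

lemma smooth_power: "smooth f \<Longrightarrow> smooth (\<lambda>x. f x ^ n)"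
  by (induction n) (auto intro: smooth_mult)

lemma smooth_inner: "smooth (\<lambda>x. x \<bullet> c)"
  by (intro smooth_bounded_linear bounded_linear_inner_left)

lemma smooth_compose:
  fixes f :: "'b::euclidean_space \<Rightarrow> real" and g :: "'a::euclidean_space \<Rightarrow> 'b"
  assumes f: "smooth f" and g: "\<And>c. c \<in> Basis \<Longrightarrow> smooth (\<lambda>x. g x \<bullet> c)"
  shows "smooth (\<lambda>x. f (g x))"
proof -
  let ?B = "{h. smooth h} \<union> {\<lambda>x. h (g x) | h. smooth h}"
  have Dg: "(g has_derivative (\<lambda>v. \<Sum>c\<in>Basis. (\<Sum>b\<in>Basis. (v \<bullet> b) * pd b (\<lambda>y. g y \<bullet> c) x) *\<^sub>R c)) (at x)"
    for x
    by (rule has_derivative_componentwise_within[THEN iffD2])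
       (use g in \<open>auto intro!: smooth_has_derivative simp: inner_sum_left_Basis\<close>)
  have D: "((\<lambda>x. h (g x)) has_derivative (\<lambda>v. \<Sum>c\<in>Basis.
      ((\<Sum>b\<in>Basis. (v \<bullet> b) * pd b (\<lambda>y. g y \<bullet> c) x)) * pd c h (g x))) (at x)"
    if "smooth h" for h x
    using has_derivative_compose[OF Dg[of x] smooth_has_derivative[OF that]]
    by (simp add: inner_sum_left_Basis)
  show ?thesis
  proof (rule smooth_fun_alg[of ?B])
    show "h differentiable at x" if "h \<in> ?B" for h x
      using that D differentiableI smooth_differentiable by blast
    show "pd b h \<in> fun_alg ?B" if h: "h \<in> ?B" and b: "b \<in> Basis" for h b
    proof -
      from h consider "smooth h" | k where "smooth k" "h = (\<lambda>x. k (g x))" by blast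
      then show ?thesis
      proof cases
        case 1
        then show ?thesis using smooth_pd b by (auto intro: fun_alg_base)
      next
        case 2
        have "pd b h = (\<lambda>x. \<Sum>c\<in>Basis. pd b (\<lambda>y. g y \<bullet> c) x * pd c k (g x))"
        proof
          fix x
          show "pd b h x = (\<Sum>c\<in>Basis. pd b (\<lambda>y. g y \<bullet> c) x * pd c k (g x))"
            unfolding 2 pd_eqI[OF D[OF \<open>smooth k\<close>]]
            using b by (simp add: inner_Basis if_distrib[of "\<lambda>t. t * _"] cong: if_cong)
        qed
        also have "\<dots> \<in> fun_alg ?B"
        proof (intro fun_alg_sum fun_alg_mult)
          fix c :: 'b assume c: "c \<in> Basis"
          show "pd b (\<lambda>y. g y \<bullet> c) \<in> fun_alg ?B"
            using smooth_pd g c b by (intro fun_alg_base) auto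
          have "smooth (pd c k)" using smooth_pd c 2 by blast
          then show "(\<lambda>x. pd c k (g x)) \<in> fun_alg ?B"
            by (intro fun_alg_base UnI2 CollectI exI[of _ "pd c k"]) simp
        qed
        finally show ?thesis .
      qed
    qed
    show "(\<lambda>x. f (g x)) \<in> fun_alg ?B" using f by (intro fun_alg_base) auto
  qed
qed

lemma smooth_compose_real:
  "smooth f \<Longrightarrow> smooth g \<Longrightarrow> smooth (\<lambda>x. f (g x))" for f :: "real \<Rightarrow> real"
  by (rule smooth_compose) auto

lemma smooth_continuous_on: "smooth f \<Longrightarrow> continuous_on S f"
  by (meson continuous_at_imp_continuous_on differentiable_imp_continuous_within smooth_differentiable)

lemma smooth_realI:
  fixes f :: "real \<Rightarrow> real"
  assumes "\<And>x. (f has_real_derivative f' x) (at x)" "smooth f'"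
  shows "smooth f"
proof -
  have D: "(f has_derivative (\<lambda>v. v * f' x)) (at x)" for x
    using assms(1)[of x] by (simp add: has_field_derivative_def mult_commute_abs)
  have "pd 1 f = f'" by (rule ext, simp add: pd_eqI[OF D])
  then show ?thesis using D assms(2) by (subst smooth_unfold) (auto intro: differentiableI)
qed

section \<open>Flat functions, bumps and a smooth step\<close>

definition flat_exp :: "nat \<Rightarrow> real \<Rightarrow> real" where
  "flat_exp n t = (if t \<le> 0 then 0 else (1 / t) ^ n * exp (- (1 / t)))"

lemma flat_exp_tendsto_0: "((\<lambda>t. flat_exp n t) \<longlongrightarrow> 0) (at 0)"
proof (rule filterlim_split_at)
  show "(flat_exp n \<longlongrightarrow> 0) (at_left 0)"
    by (rule tendsto_eventually)
       (auto simp: flat_exp_def eventually_at_left_field intro!: exI[of _ "-1"])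
  have "((\<lambda>t::real. t ^ n / exp t) \<longlongrightarrow> 0) at_top" by (rule tendsto_power_div_exp_0)
  then have "((\<lambda>t. inverse t ^ n / exp (inverse t)) \<longlongrightarrow> (0::real)) (at_right 0)"
    by (rule filterlim_compose[OF _ filterlim_inverse_at_top_right])
  then show "(flat_exp n \<longlongrightarrow> 0) (at_right 0)"
    by (rule Lim_transform_eventually)
       (auto simp: flat_exp_def exp_minus field_simps eventually_at_right_field intro!: exI[of _ 1])
qed

text \<open>The usual flat function is the case \<open>n = 0\<close>. The extra powers of
  \<open>1 / t\<close> make the family closed under differentiation up to linear combinations, so
  that it can serve as a set of generators in \<open>smooth_fun_alg\<close>.\<close>

lemma flat_exp_derivative:
  "(flat_exp n has_real_derivative (- real n * flat_exp (n+1) t + flat_exp (n+2) t)) (at t)"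
proof -
  consider "t < 0" | "t = 0" | "t > 0" by linarith
  then show ?thesis
  proof cases
    case 1
    have "((\<lambda>_. 0) has_real_derivative 0) (at t)" by simp
    then have "(flat_exp n has_real_derivative 0) (at t)"
      by (rule has_field_derivative_transform_within[where S = UNIV and d = "-t"])
        (use 1 in \<open>auto simp: flat_exp_def dist_real_def\<close>)
    then show ?thesis using 1 by (simp add: flat_exp_def)
  next
    case 2
    \<comment> \<open>At the origin the difference quotient of \<open>flat_exp n\<close> is
      \<open>flat_exp (n+1)\<close>, whose limit is already known.\<close>
    have "((\<lambda>h. flat_exp n h / h) \<longlongrightarrow> 0) (at 0)"
      by (rule Lim_transform_eventually[OF flat_exp_tendsto_0[of "n+1"]])
        (auto simp: flat_exp_def eventually_at_filter)
    then show ?thesis using 2 by (simp add: DERIV_def flat_exp_def)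
  next
    case 3
    have "((\<lambda>t. (1 / t) ^ n * exp (- (1 / t))) has_real_derivative
        (- real n * flat_exp (n+1) t + flat_exp (n+2) t)) (at t)"
    proof -
      have D1: "((\<lambda>t. 1 / t) has_real_derivative - ((1 / t)\<^sup>2)) (at t)"
        using 3 by (auto intro!: derivative_eq_intros simp: power2_eq_square)
      have "((\<lambda>t. (1 / t) ^ n * exp (- (1 / t))) has_real_derivative
        (1 / t) ^ n * (exp (- (1 / t)) * (1 / t)\<^sup>2) +
        real n * ((1 / t) ^ (n - 1) * - ((1 / t)\<^sup>2)) * exp (- (1 / t))) (at t)"
        by (rule derivative_eq_intros D1 refl)+ simp
      moreover have "flat_exp k t = (1 / t) ^ k * exp (- (1 / t))" for k
        using 3 by (simp add: flat_exp_def)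
      ultimately show ?thesis
        by (cases n) (simp_all add: algebra_simps power2_eq_square diff_divide_distrib add_divide_distrib del: power_one_over power_divide)
    qed
    then show ?thesis
      by (rule has_field_derivative_transform_within[where S = UNIV and d = t])
        (use 3 in \<open>auto simp: flat_exp_def dist_real_def\<close>)
  qed
qed

lemma smooth_flat_exp: "smooth (flat_exp n)"
proof (rule smooth_fun_alg[of "range flat_exp"])
  have D: "(flat_exp n has_derivative (\<lambda>v. v * (- real n * flat_exp (n+1) x + flat_exp (n+2) x))) (at x)" for n x
    using flat_exp_derivative[of n x] unfolding has_field_derivative_def
    by (subst mult.commute)
  show "f differentiable at x" if "f \<in> range flat_exp" for f x
    using D that differentiableI by blast
  show "pd b f \<in> fun_alg (range flat_exp)" if f: "f \<in> range flat_exp" and "b \<in> Basis" for f b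
  proof -
    from f obtain n where n: "f = flat_exp n" by blast
    have "pd b f = (\<lambda>x. (- real n) * flat_exp (n+1) x + flat_exp (n+2) x)"
      using \<open>b \<in> Basis\<close> by (intro ext) (simp add: n pd_eqI[OF D])
    also have "\<dots> \<in> fun_alg (range flat_exp)"
      by (intro fun_alg_add fun_alg_mult fun_alg_const fun_alg_base) auto
    finally show ?thesis .
  qed
qed (auto intro: fun_alg_base)

lemma flat_exp_pos: "t > 0 \<Longrightarrow> flat_exp 0 t > 0"
  by (simp add: flat_exp_def)

lemma flat_exp_nonneg: "flat_exp 0 t \<ge> 0"
  by (simp add: flat_exp_def)

lemma flat_exp_nonpos: "t \<le> 0 \<Longrightarrow> flat_exp n t = 0"
  by (simp add: flat_exp_def)

text \<open>The squared distance to \<open>a\<close> is a polynomial, so no singularity arises at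
  the centre.\<close>

definition bump :: "'a::euclidean_space \<Rightarrow> real \<Rightarrow> 'a \<Rightarrow> real" where
  "bump a r x = flat_exp 0 (r\<^sup>2 - (x - a) \<bullet> (x - a))"

lemma smooth_bump: "smooth (bump a r)"
proof -
  have "smooth (\<lambda>x. (x - a) \<bullet> (x - a))"
    by (subst euclidean_inner, unfold inner_diff_left)
       (intro smooth_sum smooth_mult smooth_diff smooth_inner smooth_const)
  then show ?thesis unfolding bump_def
    by (intro smooth_compose_real[OF smooth_flat_exp] smooth_diff smooth_const)
qed

lemma bump_nonneg: "bump a r x \<ge> 0"
  by (simp add: bump_def flat_exp_nonneg)

lemma bump_pos_iff: "r > 0 \<Longrightarrow> bump a r x > 0 \<longleftrightarrow> dist x a < r"
proof -
  assume "r > 0"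
  have "dist x a < r \<longleftrightarrow> (x - a) \<bullet> (x - a) < r\<^sup>2"
    using \<open>r > 0\<close> by (simp add: dist_norm norm_lt_square)
  then show ?thesis
    using flat_exp_pos[of "r\<^sup>2 - (x - a) \<bullet> (x - a)"] flat_exp_nonpos[of "r\<^sup>2 - (x - a) \<bullet> (x - a)" 0]
    unfolding bump_def by (cases "r\<^sup>2 - (x - a) \<bullet> (x - a) > 0") auto
qed

text \<open>The primitive of a nonnegative smooth function that is positive exactly on the open unit
  interval, divided by its value at 1. It is constant on both sides of the interval because the
  integrand vanishes there.\<close>

lemma smooth_step_exists:
  "\<exists>H::real \<Rightarrow> real. smooth H \<and> (\<forall>t\<le>0. H t = 0) \<and> (\<forall>t\<ge>1. H t = 1) \<and> (\<forall>t. 0 \<le> H t \<and> H t \<le> 1)"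
proof -
  define p where "p = (\<lambda>t. flat_exp 0 t * flat_exp 0 (1 - t))"
  have sp: "smooth p" unfolding p_def
    by (intro smooth_mult smooth_flat_exp smooth_compose_real[OF smooth_flat_exp] smooth_diff
        smooth_const smooth_bounded_linear[of "\<lambda>x::real. x"]) simp
  \<comment> \<open>The lower limit -1 leaves room on the left of 0, so that the derivative is two
    sided at every \<open>t \<ge> 0\<close>. The integrand is 0 on the added piece.\<close>
  define P where "P = (\<lambda>t. integral {-1..t} p)"
  have p0: "p t \<ge> 0" for t by (simp add: p_def flat_exp_nonneg)
  have pz: "p t = 0" if "t \<le> 0 \<or> t \<ge> 1" for t using that by (auto simp: p_def flat_exp_nonpos)
  have pint: "p integrable_on {a..b}" for a b
    by (intro integrable_continuous_interval smooth_continuous_on sp)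
  have P0: "P t = 0" if "t \<le> 0" for t
    unfolding P_def by (rule integral_unique, rule has_integral_is_0) (use that pz in auto)
  have DP: "(P has_real_derivative p t) (at t)" for t
  proof (cases "t < 0")
    case True
    have "(P has_real_derivative 0) (at t)"
      by (rule has_field_derivative_transform_within[where S = UNIV and d = "-t" and f = "\<lambda>_. 0"])
        (use True P0 in \<open>auto simp: dist_real_def\<close>)
    then show ?thesis using True pz by simp
  next
    case False
    have "(P has_real_derivative p t) (at t within {-1..t+1})"
      unfolding P_def
      by (rule integral_has_real_derivative) (use False sp in \<open>auto intro: smooth_continuous_on\<close>)
    then have "(P has_real_derivative p t) (at t within {-1<..<t+1})"
      by (rule DERIV_subset) auto
    moreover have "at t within {-1<..<t+1} = at t"
      using False by (intro at_within_open) auto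
    ultimately show ?thesis by simp
  qed
  have sP: "smooth P" by (rule smooth_realI[where f' = p]) (fact DP, fact sp)
  have mono: "P s \<le> P t" if "s \<le> t" for s t
    by (rule DERIV_nonneg_imp_nondecreasing[OF that]) (use DP p0 in blast)
  have P1: "P t = P 1" if "t \<ge> 1" for t
  proof -
    have "P t \<le> P 1"
    proof (rule DERIV_nonpos_imp_nonincreasing[OF that])
      show "\<exists>y. (P has_real_derivative y) (at x) \<and> y \<le> 0" if "1 \<le> x" "x \<le> t" for x
        using DP[of x] pz[of x] that by auto
    qed
    then show ?thesis using mono[OF that] by simp
  qed
  have "P 0 < P 1"
  proof (rule DERIV_pos_imp_increasing_open[of 0 1 P])
    show "\<exists>y. (P has_real_derivative y) (at x) \<and> 0 < y" if "0 < x" "x < 1" for x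
      using DP[of x] that flat_exp_pos[of x] flat_exp_pos[of "1-x"] unfolding p_def by auto
  qed (use sP smooth_continuous_on in auto)
  then have pos: "P 1 > 0" using P0 by simp
  define H where "H = (\<lambda>t. (1 / P 1) * P t)"
  have "smooth H" unfolding H_def by (intro smooth_mult sP smooth_const)
  moreover have "H t = 0" if "t \<le> 0" for t using P0[OF that] by (simp add: H_def)
  moreover have "H t = 1" if "t \<ge> 1" for t using P1[OF that] pos by (simp add: H_def)
  moreover have "0 \<le> H t \<and> H t \<le> 1" for t
  proof -
    have "0 \<le> P t" using mono[of 0 t] P0 by (cases "t \<le> 0") auto
    moreover have "P t \<le> P 1" using mono[of t 1] P1[of t] by (cases "t \<le> 1") auto
    ultimately show ?thesis using pos by (simp add: H_def)
  qed
  ultimately show ?thesis by blast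
qed

section \<open>Cutoff functions and measures tested on compact sets\<close>

lemma test_fun_iff:
  "test_fun V \<psi> \<longleftrightarrow> smooth \<psi> \<and> compact (tsupport \<psi>) \<and> tsupport \<psi> \<subseteq> V"
  by (simp add: test_fun_def Cinf_on_UNIV_real_iff)

lemma tsupport_nonzero: "f x \<noteq> 0 \<Longrightarrow> x \<in> tsupport f"
  using closure_subset[of "{x. f x \<noteq> 0}"] by (auto simp: tsupport_def)

lemma tsupport_zero: "x \<notin> tsupport f \<Longrightarrow> f x = 0"
  using tsupport_nonzero by metis

lemma tsupport_subsetI:
  assumes "\<And>x. f x \<noteq> 0 \<Longrightarrow> x \<in> K" "closed K" shows "tsupport f \<subseteq> K"
  unfolding tsupport_def by (rule closure_minimal) (use assms in auto)

lemma test_funI: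
  assumes "smooth \<psi>" "\<And>x. \<psi> x \<noteq> 0 \<Longrightarrow> x \<in> K" "compact K" "K \<subseteq> V"
  shows "test_fun V \<psi>"
proof -
  have "closed K" using assms(3) by (rule compact_imp_closed)
  then have sub: "tsupport \<psi> \<subseteq> K" using tsupport_subsetI assms(2) by blast
  have "compact (K \<inter> tsupport \<psi>)"
    by (rule compact_Int_closed[OF assms(3)]) (simp add: tsupport_def)
  with sub have "compact (tsupport \<psi>)" by (simp add: Int_absorb1)
  then show ?thesis unfolding test_fun_iff using assms(1,4) sub by blast
qed

lemma test_fun_mono: "test_fun V \<psi> \<Longrightarrow> V \<subseteq> W \<Longrightarrow> test_fun W \<psi>"
  by (auto simp: test_fun_iff)

text \<open>Written as a sum with a closed ball so that compactness is immediate;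
  \<open>cthick_iff\<close> gives the description by distances.\<close>

definition cthick :: "'a::euclidean_space set \<Rightarrow> real \<Rightarrow> 'a set" where
  "cthick K e = {x + y | x y. x \<in> K \<and> y \<in> cball 0 e}"

lemma compact_cthick: "compact K \<Longrightarrow> compact (cthick K e)"
  unfolding cthick_def by (intro compact_sums compact_cball)

lemma cthick_iff: "z \<in> cthick K e \<longleftrightarrow> (\<exists>x\<in>K. dist x z \<le> e)"
proof
  assume "\<exists>x\<in>K. dist x z \<le> e"
  then obtain x where "x \<in> K" "dist x z \<le> e" by blast
  then show "z \<in> cthick K e"
    unfolding cthick_def
    by (intro CollectI exI[of _ x] exI[of _ "z - x"]) (auto simp: dist_norm norm_minus_commute)
next
  assume "z \<in> cthick K e"
  then obtain x y where "z = x + y" "x \<in> K" "norm y \<le> e" by (auto simp: cthick_def)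
  then show "\<exists>x\<in>K. dist x z \<le> e" by (intro bexI[of _ x]) (auto simp: dist_norm)
qed

lemma subset_cthick: "e \<ge> 0 \<Longrightarrow> K \<subseteq> cthick K e"
proof
  fix x assume "e \<ge> 0" "x \<in> K"
  then show "x \<in> cthick K e" unfolding cthick_iff by (intro bexI[of _ x]) auto
qed

lemma ball_Union_subset_cthick: "(\<Union>a\<in>K. ball a e) \<subseteq> cthick K e"
proof
  fix x assume "x \<in> (\<Union>a\<in>K. ball a e)"
  then obtain a where "a \<in> K" "dist a x < e" by auto
  then show "x \<in> cthick K e" unfolding cthick_iff by (intro bexI[of _ a]) auto
qed

lemma compact_open_cthick:
  assumes "compact K" "open V" "K \<subseteq> V"
  obtains e where "e > 0" "cthick K e \<subseteq> V"
proof -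
  obtain e where e: "e > 0" "(\<Union>x\<in>K. cball x e) \<subseteq> V"
    using compact_subset_open_imp_cball_epsilon_subset[OF assms] by blast
  have "cthick K e \<subseteq> (\<Union>x\<in>K. cball x e)" by (auto simp: cthick_iff)
  with e(2) have "cthick K e \<subseteq> V" by (rule order_trans[rotated])
  with e(1) show ?thesis by (rule that)
qed

text \<open>Finitely many bumps centred in \<open>K\<close> cover \<open>K\<close>, so their sum has
  a positive minimum \<open>c\<close> on it. The smooth step applied to the sum divided by
  \<open>c\<close> is 1 on \<open>K\<close> and vanishes where every bump does, that is, off a
  thickening of \<open>K\<close>.\<close>

lemma smooth_cutoff_on:
  fixes K :: "'a::euclidean_space set"
  assumes K: "compact K" and V: "open V" "K \<subseteq> V"
  obtains \<psi> where "test_fun V \<psi>" "\<And>x. 0 \<le> \<psi> x \<and> \<psi> x \<le> 1" "\<And>x. x \<in> K \<Longrightarrow> \<psi> x = 1"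
proof (cases "K = {}")
  case True
  have "test_fun V (\<lambda>x. 0)" by (rule test_funI[of _ "{}"]) auto
  then show ?thesis using that[of "\<lambda>x. 0"] True by simp
next
  case False
  obtain e where e: "e > 0" "cthick K e \<subseteq> V" using compact_open_cthick[OF assms] .
  have cov: "K \<subseteq> (\<Union>c\<in>K. ball c e)" using e by auto
  obtain T where T: "T \<subseteq> K" "finite T" "K \<subseteq> (\<Union>a\<in>T. ball a e)"
    by (rule compactE_image[OF K open_ball cov])
  define f where "f = (\<lambda>x. \<Sum>a\<in>T. bump a e x)"
  have sf: "smooth f" unfolding f_def by (intro smooth_sum smooth_bump)
  have fpos: "f x > 0" if "x \<in> K" for x
  proof -
    obtain a where "a \<in> T" "dist a x < e" using T(3) \<open>x \<in> K\<close> by (auto simp: subset_iff)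
    then have "bump a e x > 0" using e by (simp add: bump_pos_iff dist_commute)
    then show ?thesis unfolding f_def using T(2) \<open>a \<in> T\<close>
      by (intro sum_pos2[of _ a]) (auto simp: bump_nonneg)
  qed
  obtain x0 where x0: "x0 \<in> K" "\<And>y. y \<in> K \<Longrightarrow> f x0 \<le> f y"
    using continuous_attains_inf[OF K False smooth_continuous_on[OF sf]] by (elim bexE) simp
  define c where "c = f x0"
  have c: "c > 0" using fpos x0 by (simp add: c_def)
  obtain H :: "real \<Rightarrow> real" where H0: "smooth H \<and> (\<forall>t\<le>0. H t = 0) \<and> (\<forall>t\<ge>1. H t = 1) \<and> (\<forall>t. 0 \<le> H t \<and> H t \<le> 1)"
    by (rule exE[OF smooth_step_exists])
  then have H: "smooth H" "\<And>t. t \<le> 0 \<Longrightarrow> H t = 0" "\<And>t. t \<ge> 1 \<Longrightarrow> H t = 1"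
      "\<And>t. 0 \<le> H t \<and> H t \<le> 1"
    by simp_all
  define \<psi> where "\<psi> = (\<lambda>x. H ((1 / c) * f x))"
  show ?thesis
  proof (rule that)
    show "test_fun V \<psi>"
    proof (rule test_funI)
      show "smooth \<psi>" unfolding \<psi>_def
        by (intro smooth_compose_real[OF H(1)] smooth_mult sf smooth_const)
      show "compact (cthick K e)" by (rule compact_cthick[OF K])
      show "x \<in> cthick K e" if "\<psi> x \<noteq> 0" for x
      proof -
        have "\<not> (\<forall>a\<in>T. bump a e x \<le> 0)"
        proof
          assume "\<forall>a\<in>T. bump a e x \<le> 0"
          then have "f x \<le> 0" unfolding f_def by (intro sum_nonpos) auto
          then have "\<psi> x = 0" unfolding \<psi>_def using c by (intro H(2)) (simp add: divide_nonpos_pos)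
          then show False using that by simp
        qed
        then obtain a where "a \<in> T" "bump a e x > 0" by (auto simp: not_le)
        then have "dist a x < e" "a \<in> K" using e T by (auto simp: bump_pos_iff dist_commute)
        then show ?thesis unfolding cthick_iff by (intro bexI[of _ a]) auto
      qed
    qed (use e in auto)
    show "\<psi> x = 1" if "x \<in> K" for x
    proof -
      have "c \<le> f x" using x0(2)[OF that] by (simp add: c_def)
      then show ?thesis unfolding \<psi>_def using c by (intro H(3)) simp
    qed
    show "0 \<le> \<psi> x \<and> \<psi> x \<le> 1" for x unfolding \<psi>_def by (rule H(4))
  qed
qed

text \<open>The value 1 on an open set, and not only on \<open>K\<close>, makes the derivatives of
  the cutoff vanish along \<open>K\<close>. It is obtained by applying the weaker statement to a
  thickening of \<open>K\<close>.\<close>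

lemma smooth_cutoff:
  fixes K :: "'a::euclidean_space set"
  assumes K: "compact K" and V: "open V" "K \<subseteq> V"
  obtains \<psi> W where "test_fun V \<psi>" "\<And>x. 0 \<le> \<psi> x \<and> \<psi> x \<le> 1" "open W" "K \<subseteq> W"
    "\<And>x. x \<in> W \<Longrightarrow> \<psi> x = 1"
proof -
  obtain e where e: "e > 0" "cthick K e \<subseteq> V" using compact_open_cthick[OF assms] .
  obtain \<psi> where \<psi>: "test_fun V \<psi>" "\<And>x. 0 \<le> \<psi> x \<and> \<psi> x \<le> 1" "\<And>x. x \<in> cthick K e \<Longrightarrow> \<psi> x = 1"
    using smooth_cutoff_on[OF compact_cthick[OF K] V(1) e(2)] by blast
  show ?thesis
  proof (rule that[of \<psi> "\<Union>a\<in>K. ball a e"])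
    show "\<psi> x = 1" if "x \<in> (\<Union>a\<in>K. ball a e)" for x
      using \<psi>(3) ball_Union_subset_cthick that by blast
  qed (use \<psi> e in auto)
qed

section \<open>Smooth approximation of compact indicators, and functions that vanish under
  testing\<close>

definition cutoff_seq :: "'a::euclidean_space set \<Rightarrow> 'a set \<Rightarrow> 'a set \<Rightarrow> (nat \<Rightarrow> 'a \<Rightarrow> real) \<Rightarrow> bool" where
  "cutoff_seq V K K1 \<psi> \<longleftrightarrow> compact K1 \<and> K \<subseteq> K1 \<and> K1 \<subseteq> V \<and>
     (\<forall>n. test_fun V (\<psi> n)) \<and> (\<forall>n x. 0 \<le> \<psi> n x \<and> \<psi> n x \<le> 1) \<and> (\<forall>n x. x \<notin> K1 \<longrightarrow> \<psi> n x = 0) \<and>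
     (\<forall>x. (\<lambda>n. \<psi> n x) \<longlonglongrightarrow> indicator K x)"

lemma cutoff_seq_exists:
  fixes K :: "'a::euclidean_space set"
  assumes K: "compact K" and V: "open V" "K \<subseteq> V"
  obtains K1 \<psi> where "cutoff_seq V K K1 \<psi>"
proof -
  obtain e where e: "e > 0" "cthick K e \<subseteq> V" using compact_open_cthick[OF assms] .
  define W where "W n = (\<Union>a\<in>K. ball a (e / real (Suc n)))" for n
  have WV: "W n \<subseteq> cthick K e" for n
  proof
    fix x assume "x \<in> W n"
    then obtain a where "a \<in> K" "dist a x < e / real (Suc n)" by (auto simp: W_def)
    moreover have "e / real (Suc n) \<le> e" using e by (simp add: field_simps)
    ultimately show "x \<in> cthick K e" by (auto simp: cthick_iff intro!: bexI[of _ a])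
  qed
  have "\<exists>\<psi>. test_fun (W n) \<psi> \<and> (\<forall>x. 0 \<le> \<psi> x \<and> \<psi> x \<le> 1) \<and> (\<forall>x\<in>K. \<psi> x = 1)" for n
  proof -
    have "open (W n)" by (auto simp: W_def)
    moreover have "K \<subseteq> W n"
    proof
      fix x assume "x \<in> K"
      moreover have "x \<in> ball x (e / real (Suc n))" using e by simp
      ultimately show "x \<in> W n" unfolding W_def by (rule UN_I)
    qed
    ultimately obtain \<psi> where "test_fun (W n) \<psi>" "\<And>x. 0 \<le> \<psi> x \<and> \<psi> x \<le> 1" "\<And>x. x \<in> K \<Longrightarrow> \<psi> x = 1"
      using smooth_cutoff_on[OF K] by metis
    then show ?thesis by (intro exI[of _ \<psi>]) simp
  qed
  then have "\<forall>n. \<exists>\<psi>. test_fun (W n) \<psi> \<and> (\<forall>x. 0 \<le> \<psi> x \<and> \<psi> x \<le> 1) \<and> (\<forall>x\<in>K. \<psi> x = 1)" ..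
  from choice[OF this] obtain \<psi> where \<psi>: "\<And>n. test_fun (W n) (\<psi> n)" "\<And>n x. 0 \<le> \<psi> n x \<and> \<psi> n x \<le> 1"
      "\<And>n x. x \<in> K \<Longrightarrow> \<psi> n x = 1"
    by blast
  have nz: "x \<in> W n" if "\<psi> n x \<noteq> 0" for n x
    using \<psi>(1)[of n] tsupport_nonzero[of "\<psi> n" x] that by (auto simp: test_fun_iff)
  have lim: "(\<lambda>n. \<psi> n x) \<longlonglongrightarrow> indicator K x" for x
  proof (cases "x \<in> K")
    case True
    then show ?thesis using \<psi>(3) by simp
  next
    case False
    then have "x \<in> - K" "open (- K)" using K compact_imp_closed by auto
    then obtain d where d: "d > 0" "ball x d \<subseteq> - K" using open_contains_ball by metis
    obtain N where N: "e / real (Suc N) < d"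
    proof -
      obtain N where "e / d < real N"
        using reals_Archimedean2[of "e/d"] by blast
      then have "e / real (Suc N) < d" using e d by (simp add: field_simps)
      then show ?thesis using that by blast
    qed
    have "\<psi> n x = 0" if "n \<ge> N" for n
    proof (rule ccontr)
      assume "\<psi> n x \<noteq> 0"
      then obtain a where a: "a \<in> K" "dist a x < e / real (Suc n)" using nz by (auto simp: W_def)
      moreover have "e / real (Suc n) \<le> e / real (Suc N)"
        using that e by (intro divide_left_mono) auto
      ultimately have "a \<in> ball x d" using N by (simp add: dist_commute)
      then show False using d a by auto
    qed
    then have "(\<lambda>n. \<psi> n x) \<longlonglongrightarrow> 0"
      by (intro tendsto_eventually) (auto simp: eventually_at_top_linorder)
    then show ?thesis using False by simp
  qed
  have "cutoff_seq V K (cthick K e) \<psi>"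
    unfolding cutoff_seq_def
  proof (intro conjI allI impI)
    fix n x
    show "test_fun V (\<psi> n)" by (rule test_fun_mono[OF \<psi>(1)]) (use WV e in blast)
    show "\<psi> n x = 0" if "x \<notin> cthick K e" using nz WV that by blast
  qed (use compact_cthick[OF K] subset_cthick[of e K] e \<psi>(2) lim in auto)
  then show ?thesis using that by blast
qed

text \<open>Dominated convergence. The common compact support \<open>K1\<close> supplies the
  dominating function, so local integrability of \<open>u\<close> on \<open>K1\<close> is enough
  even when \<open>M\<close> is infinite.\<close>

lemma cutoff_seq_integral_tendsto:
  fixes K :: "'a::euclidean_space set" and M :: "'a measure" and u :: "'a \<Rightarrow> real"
  assumes c: "cutoff_seq V K K1 \<psi>" and M: "sets borel \<subseteq> sets M" "space M = UNIV"
    and K: "compact K" and u: "set_integrable M K1 u"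
  shows "(\<lambda>n. \<integral>x. \<psi> n x * u x \<partial>M) \<longlonglongrightarrow> (\<integral>x. indicator K x * u x \<partial>M)"
proof -
  have idM: "borel_measurable borel \<subseteq> borel_measurable M"
    using M by (intro measurable_mono) (auto)
  have K1: "compact K1" "K \<subseteq> K1" using c by (auto simp: cutoff_seq_def)
  have m: "\<psi> n \<in> borel_measurable M" for n
  proof -
    have "smooth (\<psi> n)" using c by (auto simp: cutoff_seq_def test_fun_iff)
    then have "\<psi> n \<in> borel_measurable borel"
      by (intro borel_measurable_continuous_onI smooth_continuous_on)
    then show ?thesis using idM by blast
  qed
  have u1: "(\<lambda>x. indicator K1 x * u x) \<in> borel_measurable M"
    using u by (auto simp: set_integrable_def)
  have eq: "\<psi> n x * u x = \<psi> n x * (indicator K1 x * u x)" for n x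
    using c by (auto simp: cutoff_seq_def indicator_def)
  have eq': "indicator K x * u x = indicator K x * (indicator K1 x * u x)" for x
    using K1 by (auto simp: indicator_def)
  have KM: "K \<in> sets M" using K M by (meson compact_imp_closed borel_closed subsetD)
  show ?thesis
    unfolding eq eq'
  proof (rule integral_dominated_convergence[where w = "\<lambda>x. \<bar>indicator K1 x * u x\<bar>"])
    show "integrable M (\<lambda>x. \<bar>indicator K1 x * u x\<bar>)" using u by (simp add: set_integrable_def)
    show "AE x in M. (\<lambda>n. \<psi> n x * (indicator K1 x * u x)) \<longlonglongrightarrow> indicator K x * (indicator K1 x * u x)"
      using c by (auto intro!: tendsto_mult simp: cutoff_seq_def)
    show "AE x in M. norm (\<psi> n x * (indicator K1 x * u x)) \<le> \<bar>indicator K1 x * u x\<bar>" for n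
    proof (rule AE_I2)
      fix x
      have "0 \<le> \<psi> n x" "\<psi> n x \<le> 1" using c by (auto simp: cutoff_seq_def)
      then show "norm (\<psi> n x * (indicator K1 x * u x)) \<le> \<bar>indicator K1 x * u x\<bar>"
        by (simp add: abs_mult mult_left_le_one_le)
    qed
  qed (use m u1 KM in measurable)
qed

text \<open>Inner regularity is applied to the finite Borel measure \<open>D\<close> with density
  \<open>\<bar>u\<bar>\<close> on \<open>A\<close>, not to \<open>M\<close>. The set where
  \<open>u\<close> is positive is exhausted in \<open>D\<close>-measure by compact sets, on each of
  which the \<open>D\<close>-measure is the integral of \<open>u\<close> and hence 0. The same for
  \<open>- u\<close>.\<close>

lemma AE_zero_if_compact_integrals_zero:
  fixes M :: "'a::euclidean_space measure" and u :: "'a \<Rightarrow> real"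
  assumes M: "sets M = sets borel" and A: "A \<in> sets borel" and u: "set_integrable M A u"
    and z: "\<And>K. compact K \<Longrightarrow> K \<subseteq> A \<Longrightarrow> (\<integral>x. indicator K x * u x \<partial>M) = 0"
  shows "AE x in M. x \<in> A \<longrightarrow> u x = 0"
proof -
  have pos: "AE x in M. \<not> (x \<in> A \<and> v x > 0)"
    if v: "set_integrable M A v" and z: "\<And>K. compact K \<Longrightarrow> K \<subseteq> A \<Longrightarrow> (\<integral>x. indicator K x * v x \<partial>M) = 0"
    for v :: "'a \<Rightarrow> real"
  proof -
    let ?v = "\<lambda>x. indicator A x * v x"
    have iv: "integrable M ?v" using v by (simp add: set_integrable_def)
    then have mv: "?v \<in> borel_measurable M" by auto
    define P where "P = {x. ?v x > 0}"
    have "{x \<in> space M. ?v x > 0} \<in> sets M" using mv by measurable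
    then have PM: "P \<in> sets M" using sets_eq_imp_space_eq[OF M] by (simp add: P_def)
    define D where "D = density M (\<lambda>x. ennreal (\<bar>?v x\<bar>))"
    have D: "emeasure D B = (\<integral>\<^sup>+x. ennreal \<bar>?v x\<bar> * indicator B x \<partial>M)" if "B \<in> sets M" for B
      using that mv unfolding D_def by (subst emeasure_density) auto
    have "emeasure D (space D) \<noteq> \<infinity>"
    proof -
      have "emeasure D (space D) = (\<integral>\<^sup>+x. ennreal \<bar>?v x\<bar> \<partial>M)"
        using D[of "space M"] by (auto simp: D_def intro!: nn_integral_cong)
      then show ?thesis using iv by (simp add: integrable_iff_bounded less_top)
    qed
    then have "emeasure D P = (SUP K\<in>{K. K \<subseteq> P \<and> compact K}. emeasure D K)"
      by (intro inner_regular) (use M PM in \<open>auto simp: D_def\<close>)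
    also have "\<dots> = 0"
    proof -
      have "emeasure D K = 0" if K: "K \<subseteq> P" "compact K" for K
      proof -
        have KA: "K \<subseteq> A"
        proof
          fix x assume "x \<in> K"
          then have "x \<in> P" using K by blast
          then have "?v x > 0" by (simp add: P_def)
          then show "x \<in> A" by (cases "x \<in> A") auto
        qed
        have KM: "K \<in> sets M" using K M by (simp add: compact_imp_closed)
        have "emeasure D K = (\<integral>\<^sup>+x. ennreal (indicator K x * v x) \<partial>M)"
          unfolding D[OF KM]
          using K KA by (intro nn_integral_cong) (auto simp: P_def indicator_def split: if_splits)
        also have "\<dots> = ennreal (\<integral>x. indicator K x * v x \<partial>M)"
        proof (rule nn_integral_eq_integral)
          have "integrable M (\<lambda>x. indicator K x *\<^sub>R ?v x)"
            using iv KM by (rule integrable_mult_indicator[rotated])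
          also have "(\<lambda>x. indicator K x *\<^sub>R ?v x) = (\<lambda>x. indicator K x * v x)"
            using KA by (auto simp: indicator_def fun_eq_iff)
          finally show "integrable M (\<lambda>x. indicator K x * v x)" .
          show "AE x in M. 0 \<le> indicator K x * v x"
          proof (rule AE_I2)
            fix x
            show "0 \<le> indicator K x * v x"
            proof (cases "x \<in> K")
              case True
              then have "x \<in> P" "x \<in> A" using K KA by blast+
              then have "v x > 0" by (simp add: P_def)
              then show ?thesis by simp
            qed simp
          qed
        qed
        also have "\<dots> = 0" using z K KA by simp
        finally show ?thesis .
      qed
      then have "(SUP K\<in>{K. K \<subseteq> P \<and> compact K}. emeasure D K) = (SUP K\<in>{K. K \<subseteq> P \<and> compact K}. 0)"
        by (intro SUP_cong) auto
      then show ?thesis by (simp add: SUP_constant bot_ennreal)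
    qed
    finally have "(\<integral>\<^sup>+x. ennreal \<bar>?v x\<bar> * indicator P x \<partial>M) = 0" using D[OF PM] by simp
    then have "AE x in M. ennreal \<bar>?v x\<bar> * indicator P x = 0"
      using mv PM by (subst (asm) nn_integral_0_iff_AE) auto
    then show ?thesis by eventually_elim (auto simp: P_def indicator_def split: if_splits)
  qed
  have "AE x in M. \<not> (x \<in> A \<and> u x > 0)" using pos[OF u z] .
  moreover have "AE x in M. \<not> (x \<in> A \<and> - u x > 0)"
    by (rule pos) (use u z in \<open>auto simp: set_integrable_def\<close>)
  ultimately show ?thesis by eventually_elim auto
qed

lemma open_eq_Union_compact:
  fixes U :: "'a::euclidean_space set"
  assumes "open U"
  obtains C :: "nat \<Rightarrow> 'a set" where "\<And>n. compact (C n)" "\<And>n. C n \<subseteq> U" "(\<Union>n. C n) = U"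
proof (rule open_Union_compact_subsets[OF assms])
  fix C :: "nat \<Rightarrow> 'a set"
  assume "\<And>n. compact (C n)" "\<And>n. C n \<subseteq> U" "\<Union>(range C) = U"
  then show thesis by (rule that)
qed

lemma AE_zero_if_compact_integrals_zero_local:
  fixes M :: "'a::euclidean_space measure" and u :: "'a \<Rightarrow> real"
  assumes M: "sets M = sets borel" and U: "open U" and A: "A \<in> sets borel" "A \<subseteq> U"
    and u: "\<And>K. compact K \<Longrightarrow> K \<subseteq> U \<Longrightarrow> set_integrable M K u"
    and z: "\<And>K. compact K \<Longrightarrow> K \<subseteq> A \<Longrightarrow> (\<integral>x. indicator K x * u x \<partial>M) = 0"
  shows "AE x in M. x \<in> A \<longrightarrow> u x = 0"
proof -
  obtain C :: "nat \<Rightarrow> 'a set" where C: "\<And>n. compact (C n)" "\<And>n. C n \<subseteq> U" "(\<Union>n. C n) = U"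
    using open_eq_Union_compact[OF U] by blast
  have "AE x in M. x \<in> A \<inter> C n \<longrightarrow> u x = 0" for n
  proof (rule AE_zero_if_compact_integrals_zero[OF M])
    show AC: "A \<inter> C n \<in> sets borel" using A C(1) by (intro sets.Int) (auto intro: borel_compact)
    show "set_integrable M (A \<inter> C n) u"
      by (rule set_integrable_subset[OF u[OF C(1,2)]]) (use AC M in auto)
    show "(\<integral>x. indicator K x * u x \<partial>M) = 0" if "compact K" "K \<subseteq> A \<inter> C n" for K
      using that by (intro z) auto
  qed
  then have "AE x in M. \<forall>n. x \<in> A \<inter> C n \<longrightarrow> u x = 0" by (subst AE_all_countable) auto
  then show ?thesis by eventually_elim (use A C in blast)
qed

text \<open>The fundamental lemma of the calculus of variations, for an arbitrary Borel measure in
  place of Lebesgue measure: smooth cutoffs turn test integrals into integrals over compact sets. It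
  is applied both to \<open>lborel\<close> and to a measure dominating two perimeter
  measures.\<close>

lemma AE_zero_if_test_integrals_zero:
  fixes M :: "'a::euclidean_space measure" and u :: "'a \<Rightarrow> real"
  assumes M: "sets M = sets borel" and U: "open U"
    and u: "\<And>K. compact K \<Longrightarrow> K \<subseteq> U \<Longrightarrow> set_integrable M K u"
    and z: "\<And>\<psi>. test_fun U \<psi> \<Longrightarrow> (\<integral>x. \<psi> x * u x \<partial>M) = 0"
  shows "AE x in M. x \<in> U \<longrightarrow> u x = 0"
proof (rule AE_zero_if_compact_integrals_zero_local[OF M U])
  show "U \<in> sets borel" "U \<subseteq> U" using U by simp_all
  show "set_integrable M K u" if "compact K" "K \<subseteq> U" for K using that by (rule u)
  fix K assume K: "compact K" "K \<subseteq> U"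
  obtain K1 \<psi> where c: "cutoff_seq U K K1 \<psi>" using cutoff_seq_exists[OF K(1) U K(2)] .
  have "(\<lambda>n. \<integral>x. \<psi> n x * u x \<partial>M) \<longlonglongrightarrow> (\<integral>x. indicator K x * u x \<partial>M)"
  proof (rule cutoff_seq_integral_tendsto[OF c _ _ K(1)])
    show "set_integrable M K1 u" using c by (intro u) (auto simp: cutoff_seq_def)
  qed (use M sets_eq_imp_space_eq[OF M] in simp_all)
  moreover have "(\<integral>x. \<psi> n x * u x \<partial>M) = 0" for n
    by (rule z) (use c in \<open>simp add: cutoff_seq_def\<close>)
  ultimately show "(\<integral>x. indicator K x * u x \<partial>M) = 0" by (simp add: LIMSEQ_const_iff)
qed

section \<open>Left invariant vector fields\<close>

definition smoothv :: "('a::euclidean_space \<Rightarrow> 'b::euclidean_space) \<Rightarrow> bool" where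
  "smoothv u \<longleftrightarrow> (\<forall>c\<in>Basis. smooth (\<lambda>x. u x \<bullet> c))"

lemma smoothv_id: "smoothv (\<lambda>x. x)"
  by (simp add: smoothv_def smooth_inner)

lemma smoothv_const: "smoothv (\<lambda>x. c)"
  by (simp add: smoothv_def)

lemma smoothv_uminus: "smoothv u \<Longrightarrow> smoothv (\<lambda>x. - u x)"
  by (simp add: smoothv_def smooth_minus)

lemma smoothv_fst: "smoothv (fst :: 'a::euclidean_space \<times> 'b::euclidean_space \<Rightarrow> 'a)"
  unfolding smoothv_def
  by (intro ballI smooth_bounded_linear bounded_linear_compose[OF bounded_linear_inner_left bounded_linear_fst])

lemma smoothv_snd: "smoothv (snd :: 'a::euclidean_space \<times> 'b::euclidean_space \<Rightarrow> 'b)"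
  unfolding smoothv_def
  by (intro ballI smooth_bounded_linear bounded_linear_compose[OF bounded_linear_inner_left bounded_linear_snd])

lemma smoothv_Pair: "smoothv u \<Longrightarrow> smoothv v \<Longrightarrow> smoothv (\<lambda>x. (u x, v x))"
  by (auto simp: smoothv_def Basis_prod_def)

lemma smooth_smoothv: "smooth f \<Longrightarrow> smoothv g \<Longrightarrow> smooth (\<lambda>x. f (g x))"
  by (rule smooth_compose) (auto simp: smoothv_def)

lemma pd_mult:
  assumes "smooth f" "smooth g"
  shows "pd b (\<lambda>x. f x * g x) x = f x * pd b g x + pd b f x * g x"
  unfolding pd_def[of b f] pd_def[of b g]
  by (rule pd_eqI, rule has_derivative_mult)
    (use smooth_differentiable[OF assms(1), of x] smooth_differentiable[OF assms(2), of x]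
      in \<open>simp_all add: frechet_derivative_works\<close>)

lemma pd_DERIV:
  assumes "smooth f" "b \<in> Basis"
  shows "((\<lambda>t. f (x + t *\<^sub>R b)) has_real_derivative pd b f (x + t *\<^sub>R b)) (at t)"
proof -
  have 1: "((\<lambda>t. x + t *\<^sub>R b) has_derivative (\<lambda>h. h *\<^sub>R b)) (at t)"
    by (auto intro!: derivative_eq_intros)
  have "((\<lambda>t. f (x + t *\<^sub>R b)) has_derivative
      (\<lambda>h. \<Sum>c\<in>Basis. ((h *\<^sub>R b) \<bullet> c) * pd c f (x + t *\<^sub>R b))) (at t)"
    by (rule has_derivative_compose[OF 1 smooth_has_derivative[OF assms(1)]])
  moreover have "(\<Sum>c\<in>Basis. ((h *\<^sub>R b) \<bullet> c) * pd c f (x + t *\<^sub>R b)) = pd b f (x + t *\<^sub>R b) * h" for h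
    using assms(2) by (simp add: inner_Basis if_distrib[of "\<lambda>t. t * _"] if_distrib[of "\<lambda>t. _ * t"] cong: if_cong)
  ultimately show ?thesis by (simp add: has_field_derivative_def)
qed

lemma pd_zero_outside:
  assumes "smooth f" "closed K" "\<And>x. x \<notin> K \<Longrightarrow> f x = 0" "x \<notin> K"
  shows "pd b f x = 0"
proof -
  have "((\<lambda>_. 0) has_derivative (\<lambda>_. 0)) (at x)" by simp
  then have "(f has_derivative (\<lambda>_. 0)) (at x)"
    by (rule has_derivative_transform_within_open[of _ _ _ _ "- K"]) (use assms in auto)
  then show ?thesis by (rule pd_eqI)
qed

lemma integrable_continuous_compact_support:
  fixes f :: "'a::euclidean_space \<Rightarrow> real"
  assumes "continuous_on UNIV f" "compact K" "\<And>x. x \<notin> K \<Longrightarrow> f x = 0"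
  shows "integrable lborel f"
proof -
  have "integrable lborel (\<lambda>x. indicator K x *\<^sub>R f x)"
    by (rule borel_integrable_compact[OF assms(2)]) (rule continuous_on_subset[OF assms(1)], simp)
  also have "(\<lambda>x. indicator K x *\<^sub>R f x) = f" using assms(3) by (auto simp: indicator_def fun_eq_iff)
  finally show ?thesis .
qed

lemma continuous_compact_bounded:
  fixes f :: "'a::euclidean_space \<Rightarrow> real"
  assumes "continuous_on K f" "compact K"
  obtains C where "C > 0" "\<And>x. x \<in> K \<Longrightarrow> \<bar>f x\<bar> \<le> C"
proof -
  have "bounded (f ` K)" using assms by (intro compact_imp_bounded compact_continuous_image)
  then obtain C where "C > 0" "\<forall>y\<in>f ` K. norm y \<le> C" unfolding bounded_pos by blast
  then show ?thesis by (intro that[of C]) auto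
qed

lemma continuous_compact_support_bounded:
  fixes f :: "'a::euclidean_space \<Rightarrow> real"
  assumes "continuous_on UNIV f" "compact K" "\<And>x. x \<notin> K \<Longrightarrow> f x = 0"
  obtains C where "C > 0" "\<And>x. \<bar>f x\<bar> \<le> C"
proof -
  obtain C where C: "C > 0" "\<And>x. x \<in> K \<Longrightarrow> \<bar>f x\<bar> \<le> C"
    using continuous_compact_bounded[OF continuous_on_subset[OF assms(1)] assms(2)] by blast
  have "\<bar>f x\<bar> \<le> C" for x using C assms(3)[of x] by (cases "x \<in> K") auto
  with C(1) show ?thesis by (rule that)
qed

text \<open>Translation invariance of \<open>lborel\<close> makes every difference quotient
  integrate to 0. By the mean value theorem the quotients are bounded, and since the steps are at
  most 1 they vanish off \<open>cthick K 1\<close>, so dominated convergence applies.\<close>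

lemma integral_pd_eq_0:
  fixes v :: "'a::euclidean_space \<Rightarrow> real"
  assumes v: "smooth v" and K: "compact K" and z: "\<And>x. x \<notin> K \<Longrightarrow> v x = 0" and b: "b \<in> Basis"
  shows "(\<integral>x. pd b v x \<partial>lborel) = 0"
proof -
  have cl: "closed K" using K by (rule compact_imp_closed)
  have zp: "pd b v x = 0" if "x \<notin> K" for x using pd_zero_outside[OF v cl z that] .
  obtain C where C: "C > 0" "\<And>x. \<bar>pd b v x\<bar> \<le> C"
    using continuous_compact_support_bounded[OF smooth_continuous_on[OF smooth_pd[OF v b]] K zp] by blast
  define h where "h n = 1 / real (Suc n)" for n
  have h: "0 < h n" "h n \<le> 1" for n by (auto simp: h_def)
  have h0: "h \<longlonglongrightarrow> 0" unfolding h_def using LIMSEQ_inverse_real_of_nat by (simp add: inverse_eq_divide)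
  define q where "q n x = (v (x + h n *\<^sub>R b) - v x) / h n" for n x
  have cv: "continuous_on UNIV v" by (rule smooth_continuous_on[OF v])
  have cvs: "continuous_on UNIV (\<lambda>x. v (x + h n *\<^sub>R b))" for n
    by (rule continuous_on_compose2[OF cv]) (auto intro!: continuous_intros)
  have int_v: "integrable lborel v" by (rule integrable_continuous_compact_support[OF cv K z])
  have int_vs: "integrable lborel (\<lambda>x. v (x + a))" "(\<integral>x. v (x + a) \<partial>lborel) = (\<integral>x. v x \<partial>lborel)" for a
  proof -
    have "integrable (distr lborel borel ((+) a)) v" using int_v by (simp add: lborel_distr_plus)
    then show "integrable lborel (\<lambda>x. v (x + a))"
      by (subst (asm) integrable_distr_eq)
        (auto intro: borel_measurable_continuous_onI[OF cv] simp: add.commute)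
    have "(\<integral>x. v x \<partial>lborel) = (\<integral>x. v x \<partial>distr lborel borel ((+) a))" by (simp add: lborel_distr_plus)
    also have "\<dots> = (\<integral>x. v (x + a) \<partial>lborel)"
      by (subst integral_distr) (auto intro: borel_measurable_continuous_onI[OF cv] simp: add.commute)
    finally show "(\<integral>x. v (x + a) \<partial>lborel) = (\<integral>x. v x \<partial>lborel)" ..
  qed
  have q_bound: "\<bar>q n x\<bar> \<le> C * indicator (cthick K 1) x" for n x
  proof (cases "x \<in> cthick K 1")
    case True
    obtain \<xi> where "v (x + h n *\<^sub>R b) - v (x + 0 *\<^sub>R b) = (h n - 0) * pd b v (x + \<xi> *\<^sub>R b)"
      using MVT2[OF h(1)[of n], of "\<lambda>t. v (x + t *\<^sub>R b)" "\<lambda>t. pd b v (x + t *\<^sub>R b)"]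
        pd_DERIV[OF v b] by blast
    then have "q n x = pd b v (x + \<xi> *\<^sub>R b)" using h(1)[of n] by (simp add: q_def)
    then show ?thesis using C True by simp
  next
    case False
    have "x \<notin> K" using False subset_cthick[of 1 K] by auto
    moreover have "x + h n *\<^sub>R b \<notin> K"
    proof
      assume "x + h n *\<^sub>R b \<in> K"
      moreover have "dist (x + h n *\<^sub>R b) x \<le> 1" using h[of n] b by (simp add: dist_norm)
      ultimately show False using False unfolding cthick_iff by blast
    qed
    ultimately show ?thesis using z C(1) by (simp add: q_def indicator_def)
  qed
  have "(\<lambda>n. \<integral>x. q n x \<partial>lborel) \<longlonglongrightarrow> (\<integral>x. pd b v x \<partial>lborel)"
  proof (rule integral_dominated_convergence[where w = "\<lambda>x. C * indicator (cthick K 1) x"])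
    have "integrable lborel (\<lambda>x. indicator (cthick K 1) x *\<^sub>R (1::real))"
      by (rule borel_integrable_compact[OF compact_cthick[OF K]]) simp
    then show "integrable lborel (\<lambda>x. C * indicator (cthick K 1) x)" by simp
    show "pd b v \<in> borel_measurable lborel"
      using borel_measurable_continuous_onI[OF smooth_continuous_on[OF smooth_pd[OF v b]]] by simp
    show "q n \<in> borel_measurable lborel" for n
    proof -
      have "continuous_on UNIV (\<lambda>x. (v (x + h n *\<^sub>R b) - v x) / h n)"
        using h(1)[of n] by (intro continuous_intros cvs cv) auto
      then show ?thesis unfolding q_def using borel_measurable_continuous_onI by simp
    qed
    show "AE x in lborel. (\<lambda>n. q n x) \<longlonglongrightarrow> pd b v x"
    proof (rule AE_I2)
      fix x
      have "((\<lambda>t. v (x + t *\<^sub>R b)) has_real_derivative pd b v x) (at 0)"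
        using pd_DERIV[OF v b, of x 0] by simp
      then have "((\<lambda>t. (v (x + t *\<^sub>R b) - v x) / t) \<longlongrightarrow> pd b v x) (at 0)"
        by (simp add: DERIV_def)
      moreover have "filterlim h (at 0) sequentially"
        unfolding filterlim_at using h0 h(1) by (auto intro!: always_eventually simp: less_imp_neq[symmetric])
      ultimately show "(\<lambda>n. q n x) \<longlonglongrightarrow> pd b v x"
        unfolding q_def by (rule filterlim_compose)
    qed
    show "AE x in lborel. norm (q n x) \<le> C * indicator (cthick K 1) x" for n
      using q_bound by simp
  qed
  moreover have "(\<integral>x. q n x \<partial>lborel) = 0" for n
    unfolding q_def using int_v int_vs by simp
  ultimately show ?thesis by (simp add: LIMSEQ_const_iff)
qed

section \<open>Left invariant fields in graded coordinates\<close>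

locale stratified =
  fixes gm :: "'a::euclidean_space \<Rightarrow> 'a \<Rightarrow> 'a" and w :: "'a \<Rightarrow> nat"
  assumes grp: "stratified_group gm w"
begin

lemma gm_assoc: "gm (gm x y) z = gm x (gm y z)"
  using grp by (simp add: stratified_group_def)

lemma gm_0 [simp]: "gm 0 x = x" "gm x 0 = x"
  using grp by (simp_all add: stratified_group_def)

lemma gm_inv [simp]: "gm x (- x) = 0" "gm (- x) x = 0"
  using grp by (simp_all add: stratified_group_def)

lemma gm_scale: "gm (s *\<^sub>R x) (t *\<^sub>R x) = (s + t) *\<^sub>R x"
  using grp by (simp add: stratified_group_def)

lemma gm_cancel [simp]: "gm (- x) (gm x y) = y" "gm x (gm (- x) y) = y"
  by (simp_all add: gm_assoc[symmetric])

lemma minus_gm: "- gm x y = gm (- y) (- x)"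
proof -
  have "gm (gm x y) (gm (- y) (- x)) = 0" by (simp add: gm_assoc)
  then have "gm (- gm x y) (gm (gm x y) (gm (- y) (- x))) = gm (- gm x y) 0" by simp
  then show ?thesis by simp
qed

lemma w_pos: "b \<in> Basis \<Longrightarrow> w b \<ge> 1"
  using grp by (simp add: stratified_group_def)

lemma gm_dil: "r > 0 \<Longrightarrow> gm (dil w r x) (dil w r y) = dil w r (gm x y)"
  using grp by (simp add: stratified_group_def)

lemma dil_inner: "c \<in> Basis \<Longrightarrow> dil w r x \<bullet> c = r ^ w c * (x \<bullet> c)"
  by (simp add: dil_def inner_sum_left_Basis)

lemma dil_add_Basis:
  assumes "b \<in> Basis" shows "dil w r (x + t *\<^sub>R b) = dil w r x + (r ^ w b * t) *\<^sub>R b"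
proof (rule euclidean_eqI)
  fix c :: 'a assume "c \<in> Basis"
  then show "dil w r (x + t *\<^sub>R b) \<bullet> c = (dil w r x + (r ^ w b * t) *\<^sub>R b) \<bullet> c"
    using assms by (simp add: dil_inner inner_add_left inner_Basis algebra_simps)
qed

lemma dil_scale_Basis:
  assumes "b \<in> Basis" shows "dil w r (t *\<^sub>R b) = (r ^ w b * t) *\<^sub>R b"
  using dil_add_Basis[OF assms, of r 0 t] by (simp add: dil_def)

lemma smoothv_gm_pair: "smoothv (\<lambda>p. gm (fst p) (snd p))"
  using grp by (simp add: stratified_group_def Cinf_on_UNIV_iff smoothv_def)

lemma smoothv_gm:
  assumes "smoothv u" "smoothv v" shows "smoothv (\<lambda>x. gm (u x) (v x))"
  unfolding smoothv_def
proof
  fix c :: 'a assume "c \<in> Basis"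
  then have "smooth (\<lambda>p. gm (fst p) (snd p) \<bullet> c)" using smoothv_gm_pair by (simp add: smoothv_def)
  from smooth_smoothv[OF this smoothv_Pair[OF assms]]
  show "smooth (\<lambda>x. gm (u x) (v x) \<bullet> c)" by simp
qed

lemma smoothv_continuous_on: 
  fixes u :: "'b::euclidean_space \<Rightarrow> 'c::euclidean_space"
  assumes "smoothv u" shows "continuous_on S u"
  using assms by (subst continuous_on_componentwise) (auto simp: smoothv_def intro: smooth_continuous_on)

text \<open>The coordinates of the left invariant fields: \<open>X\<^sub>b\<close> is the sum over
  \<open>c\<close> of \<open>acoef b c\<close> times the partial derivative in direction
  \<open>c\<close>. They are read off from the derivative of the group law in its second argument at
  the identity.\<close>

definition acoef :: "'a \<Rightarrow> 'a \<Rightarrow> 'a \<Rightarrow> real" where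
  "acoef b c x = pd (0, b) (\<lambda>p. gm (fst p) (snd p) \<bullet> c) (x, 0)"

lemma smooth_acoef:
  assumes "b \<in> Basis" "c \<in> Basis" shows "smooth (acoef b c)"
proof -
  have "smooth (\<lambda>p. gm (fst p) (snd p) \<bullet> c)" using smoothv_gm_pair assms by (simp add: smoothv_def)
  then have "smooth (pd (0, b) (\<lambda>p. gm (fst p) (snd p) \<bullet> c))"
    using assms by (intro smooth_pd) (auto simp: Basis_prod_def)
  from smooth_smoothv[OF this smoothv_Pair[OF smoothv_id smoothv_const]]
  show ?thesis unfolding acoef_def[abs_def] by simp
qed

lemma gm_curve_derivative:
  assumes c: "c \<in> Basis"
  shows "((\<lambda>t. gm x (t *\<^sub>R v) \<bullet> c) has_derivative
    (\<lambda>h. h * (\<Sum>b\<in>Basis. (v \<bullet> b) * acoef b c x))) (at 0)"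
proof -
  let ?g = "\<lambda>p. gm (fst p) (snd p) \<bullet> c"
  have s: "smooth ?g" using smoothv_gm_pair c by (simp add: smoothv_def)
  have 1: "((\<lambda>t::real. (x, t *\<^sub>R v)) has_derivative (\<lambda>h. (0, h *\<^sub>R v))) (at 0)"
    by (auto intro!: derivative_eq_intros)
  have "((\<lambda>t. ?g (x, t *\<^sub>R v)) has_derivative
     (\<lambda>h. \<Sum>b\<in>Basis. ((0, h *\<^sub>R v) \<bullet> b) * pd b ?g (x, 0 *\<^sub>R v))) (at 0)"
    by (rule has_derivative_compose[OF 1 smooth_has_derivative[OF s]])
  moreover have "(\<Sum>b\<in>Basis. ((0, h *\<^sub>R v) \<bullet> b) * pd b ?g (x, 0 *\<^sub>R v)) =
     h * (\<Sum>b\<in>Basis. (v \<bullet> b) * acoef b c x)" for h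
    unfolding Basis_prod_def
    by (subst sum.union_disjoint)
      (auto simp: sum.reindex inj_on_def acoef_def sum_distrib_left mult_ac zero_prod_def intro!: sum.cong)
  ultimately show ?thesis by simp
qed

lemma Xf_has_derivative:
  assumes u: "u differentiable (at x)"
  shows "((\<lambda>t. u (gm x (t *\<^sub>R v))) has_real_derivative
    (\<Sum>c\<in>Basis. (\<Sum>b\<in>Basis. (v \<bullet> b) * acoef b c x) * pd c u x)) (at 0)"
proof -
  have 1: "((\<lambda>t. gm x (t *\<^sub>R v)) has_derivative
      (\<lambda>h. \<Sum>c\<in>Basis. (h * (\<Sum>b\<in>Basis. (v \<bullet> b) * acoef b c x)) *\<^sub>R c)) (at 0)"
    by (rule has_derivative_componentwise_within[THEN iffD2])
       (auto intro!: gm_curve_derivative simp: inner_sum_left_Basis)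
  have 2: "(u has_derivative (\<lambda>v. \<Sum>b\<in>Basis. (v \<bullet> b) * pd b u x)) (at (gm x (0 *\<^sub>R v)))"
    using differentiable_pd_linear[OF u] by simp
  have eq: "(\<lambda>h. \<Sum>d\<in>Basis. ((\<Sum>c\<in>Basis. (h * (\<Sum>b\<in>Basis. (v \<bullet> b) * acoef b c x)) *\<^sub>R c) \<bullet> d) * pd d u x) =
     (*) (\<Sum>c\<in>Basis. (\<Sum>b\<in>Basis. (v \<bullet> b) * acoef b c x) * pd c u x)"
    by (rule ext) (simp add: inner_sum_left_Basis sum_distrib_left mult_ac)
  show ?thesis
    using has_derivative_compose[OF 1 2] unfolding has_field_derivative_def eq .
qed

lemma Xf_eq:
  assumes "u differentiable (at x)"
  shows "Xf gm v u x = (\<Sum>c\<in>Basis. (\<Sum>b\<in>Basis. (v \<bullet> b) * acoef b c x) * pd c u x)"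
  unfolding Xf_def by (rule DERIV_imp_deriv[OF Xf_has_derivative[OF assms]])

lemma Xf_Basis:
  assumes "u differentiable (at x)" "b \<in> Basis"
  shows "Xf gm b u x = (\<Sum>c\<in>Basis. acoef b c x * pd c u x)"
  unfolding Xf_eq[OF assms(1)]
  using assms(2) by (simp add: inner_Basis if_distrib[of "\<lambda>t. t * _"] cong: if_cong)

text \<open>The line through \<open>v\<close> is a one-parameter subgroup in exponential
  coordinates, so the derivative at parameter \<open>t\<close> is the derivative at 0 based at the
  translated point.\<close>

lemma Xf_DERIV:
  assumes "smooth u"
  shows "((\<lambda>t. u (gm x (t *\<^sub>R v))) has_real_derivative Xf gm v u (gm x (t *\<^sub>R v))) (at t)"
proof -
  have "((\<lambda>h. u (gm (gm x (t *\<^sub>R v)) (h *\<^sub>R v))) has_real_derivative Xf gm v u (gm x (t *\<^sub>R v))) (at 0)"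
    unfolding Xf_eq[OF smooth_differentiable[OF assms]]
    by (rule Xf_has_derivative[OF smooth_differentiable[OF assms]])
  then have "((\<lambda>h. u (gm x ((t + h) *\<^sub>R v))) has_real_derivative Xf gm v u (gm x (t *\<^sub>R v))) (at 0)"
    by (simp add: gm_assoc gm_scale)
  then show ?thesis
    using DERIV_shift[of "\<lambda>t. u (gm x (t *\<^sub>R v))" _ 0 t] by (simp add: add.commute)
qed

lemma acoef_DERIV:
  assumes "b \<in> Basis" "c \<in> Basis"
  shows "((\<lambda>t. gm x (t *\<^sub>R b) \<bullet> c) has_real_derivative acoef b c x) (at 0)"
  using gm_curve_derivative[OF assms(2), of x b] assms(1)
  by (simp add: has_field_derivative_def inner_Basis if_distrib[of "\<lambda>t. t * _"] mult_commute_abs cong: if_cong)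

text \<open>Dilations are automorphisms: both sides are the derivative at 0 of component
  \<open>c\<close> of the dilated curve \<open>gm x (t *\<^sub>R b)\<close>, computed before and
  after the dilation is moved inside the product.\<close>

lemma acoef_dil:
  assumes r: "r > 0" and b: "b \<in> Basis" and c: "c \<in> Basis"
  shows "r ^ w c * acoef b c x = r ^ w b * acoef b c (dil w r x)"
proof -
  have 1: "((\<lambda>t. r ^ w c * (gm x (t *\<^sub>R b) \<bullet> c)) has_real_derivative r ^ w c * acoef b c x) (at 0)"
    by (rule DERIV_cmult[OF acoef_DERIV[OF b c]])
  have 0: "((\<lambda>s. gm (dil w r x) (s *\<^sub>R b) \<bullet> c) has_real_derivative acoef b c (dil w r x)) (at (r ^ w b * 0))"
    using acoef_DERIV[OF b c] by simp
  have "((\<lambda>t. r ^ w b * t) has_real_derivative r ^ w b) (at 0)"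
    by (auto intro!: derivative_eq_intros)
  from DERIV_chain2[OF 0 this]
  have 2: "((\<lambda>t. gm (dil w r x) ((r ^ w b * t) *\<^sub>R b) \<bullet> c) has_real_derivative
      acoef b c (dil w r x) * r ^ w b) (at 0)" .
  have "(\<lambda>t. gm (dil w r x) ((r ^ w b * t) *\<^sub>R b) \<bullet> c) = (\<lambda>t. r ^ w c * (gm x (t *\<^sub>R b) \<bullet> c))"
    using gm_dil[OF r] dil_inner[OF c] by (simp add: dil_scale_Basis[OF b, symmetric])
  with DERIV_unique[OF 1] 2 show ?thesis by (simp add: mult.commute)
qed

text \<open>By homogeneity, \<open>r ^ w b * pd c (acoef b c) (dil w r x)\<close> does not depend on \<open>r > 0\<close>; let \<open>r\<close> tend to 0.\<close>

lemma pd_acoef_eq_0: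
  assumes b: "b \<in> Basis" and c: "c \<in> Basis"
  shows "pd c (acoef b c) x = 0"
proof -
  have sa: "smooth (acoef b c)" using smooth_acoef b c .
  have eq: "pd c (acoef b c) x = r ^ w b * pd c (acoef b c) (dil w r x)" if r: "r > 0" for r
  proof -
    have 1: "((\<lambda>t. r ^ w c * acoef b c (x + t *\<^sub>R c)) has_real_derivative r ^ w c * pd c (acoef b c) x) (at 0)"
      using DERIV_cmult[OF pd_DERIV[OF sa c, of x 0], of "r ^ w c"] by simp
    have 0: "((\<lambda>s. acoef b c (dil w r x + s *\<^sub>R c)) has_real_derivative pd c (acoef b c) (dil w r x)) (at (r ^ w c * 0))"
      using pd_DERIV[OF sa c, of "dil w r x" 0] by simp
    have "((\<lambda>t. r ^ w c * t) has_real_derivative r ^ w c) (at 0)"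
      by (auto intro!: derivative_eq_intros)
    from DERIV_cmult[OF DERIV_chain2[OF 0 this], of "r ^ w b"]
    have 2: "((\<lambda>t. r ^ w b * acoef b c (dil w r x + (r ^ w c * t) *\<^sub>R c)) has_real_derivative
        r ^ w b * (pd c (acoef b c) (dil w r x) * r ^ w c)) (at 0)" .
    have "(\<lambda>t. r ^ w b * acoef b c (dil w r x + (r ^ w c * t) *\<^sub>R c)) = (\<lambda>t. r ^ w c * acoef b c (x + t *\<^sub>R c))"
      using acoef_dil[OF r b c] by (simp add: dil_add_Basis[OF c, symmetric])
    with DERIV_unique[OF 1] 2
    have "r ^ w c * pd c (acoef b c) x = r ^ w b * (pd c (acoef b c) (dil w r x) * r ^ w c)" by simp
    then show ?thesis using r by simp
  qed
  have "((\<lambda>r. r ^ w b * pd c (acoef b c) (dil w r x)) \<longlongrightarrow> 0 ^ w b * pd c (acoef b c) (dil w 0 x)) (at_right 0)"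
  proof (intro tendsto_mult tendsto_power tendsto_ident_at)
    have "isCont (pd c (acoef b c)) (dil w 0 x)"
      using smooth_continuous_on[OF smooth_pd[OF sa c], of UNIV]
      by (simp add: continuous_on_eq_continuous_at)
    moreover have "((\<lambda>r. dil w r x) \<longlongrightarrow> dil w 0 x) (at_right 0)"
      unfolding dil_def by (intro tendsto_intros)
    ultimately show "((\<lambda>r. pd c (acoef b c) (dil w r x)) \<longlongrightarrow> pd c (acoef b c) (dil w 0 x)) (at_right 0)"
      by (rule isCont_tendsto_compose)
  qed
  moreover have "((\<lambda>r. r ^ w b * pd c (acoef b c) (dil w r x)) \<longlongrightarrow> pd c (acoef b c) x) (at_right 0)"
  proof (rule tendsto_eventually)
    show "\<forall>\<^sub>F r in at_right 0. r ^ w b * pd c (acoef b c) (dil w r x) = pd c (acoef b c) x"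
      using eventually_at_right_less[of "0::real"] by eventually_elim (simp flip: eq)
  qed
  ultimately have "pd c (acoef b c) x = 0 ^ w b * pd c (acoef b c) (dil w 0 x)"
    by (intro tendsto_unique[OF trivial_limit_at_right_real])
  then show ?thesis using w_pos[OF b] by (simp add: power_0_left)
qed

lemma smooth_Xf:
  assumes "smooth u" shows "smooth (Xf gm v u)"
proof -
  have "Xf gm v u = (\<lambda>x. \<Sum>c\<in>Basis. (\<Sum>b\<in>Basis. (v \<bullet> b) * acoef b c x) * pd c u x)"
    by (rule ext) (rule Xf_eq[OF smooth_differentiable[OF assms]])
  then show ?thesis
    by (simp only:) (intro smooth_sum smooth_mult smooth_const smooth_acoef smooth_pd assms)
qed

lemma Xf_lincomb:
  assumes "u differentiable (at x)"
  shows "Xf gm v u x = (\<Sum>b\<in>Basis. (v \<bullet> b) * Xf gm b u x)"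
proof -
  have "(\<Sum>b\<in>Basis. (v \<bullet> b) * Xf gm b u x) = (\<Sum>b\<in>Basis. (v \<bullet> b) * (\<Sum>c\<in>Basis. acoef b c x * pd c u x))"
    by (intro sum.cong refl) (simp add: Xf_Basis[OF assms])
  also have "\<dots> = (\<Sum>c\<in>Basis. (\<Sum>b\<in>Basis. (v \<bullet> b) * acoef b c x) * pd c u x)"
    unfolding sum_distrib_left sum_distrib_right by (subst sum.swap) (simp only: mult.assoc)
  finally show ?thesis by (simp only: Xf_eq[OF assms])
qed

lemma Xf_mult:
  assumes "smooth f" "smooth g"
  shows "Xf gm v (\<lambda>x. f x * g x) x = f x * Xf gm v g x + Xf gm v f x * g x"
  unfolding Xf_eq[OF smooth_differentiable[OF assms(1)]] Xf_eq[OF smooth_differentiable[OF assms(2)]]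
    Xf_eq[OF smooth_differentiable[OF smooth_mult[OF assms]]] pd_mult[OF assms]
  by (simp add: sum_distrib_left sum_distrib_right sum.distrib algebra_simps)

lemma Xf_zero_outside:
  assumes "smooth f" "closed K" "\<And>x. x \<notin> K \<Longrightarrow> f x = 0" "x \<notin> K"
  shows "Xf gm v f x = 0"
  unfolding Xf_eq[OF smooth_differentiable[OF assms(1)]]
  using pd_zero_outside[OF assms] by simp

text \<open>Each coefficient \<open>acoef b c\<close> is constant in the direction \<open>c\<close>,
  so \<open>X\<^sub>b\<close> is divergence free and its action on \<open>u\<close> is a sum of
  partial derivatives of the compactly supported functions \<open>acoef b c * u\<close>. This is the
  infinitesimal form of the invariance of Lebesgue measure.\<close>

lemma integral_Xf_eq_0:
  assumes u: "smooth u" and K: "compact K" and z: "\<And>x. x \<notin> K \<Longrightarrow> u x = 0"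
  shows "(\<integral>x. Xf gm v u x \<partial>lborel) = 0"
proof -
  let ?a = "\<lambda>b c x. acoef b c x * u x"
  have eq: "Xf gm v u x = (\<Sum>b\<in>Basis. \<Sum>c\<in>Basis. (v \<bullet> b) * pd c (?a b c) x)" for x
  proof -
    have "Xf gm v u x = (\<Sum>b\<in>Basis. (v \<bullet> b) * (\<Sum>c\<in>Basis. acoef b c x * pd c u x))"
      by (subst Xf_lincomb[OF smooth_differentiable[OF u]])
        (intro sum.cong refl, simp add: Xf_Basis[OF smooth_differentiable[OF u]])
    also have "\<dots> = (\<Sum>b\<in>Basis. (v \<bullet> b) * (\<Sum>c\<in>Basis. pd c (?a b c) x))"
      by (intro sum.cong refl arg_cong2[where f = "(*)"]) (simp add: pd_mult[OF smooth_acoef u] pd_acoef_eq_0)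
    finally show ?thesis by (simp add: sum_distrib_left)
  qed
  have sa: "smooth (?a b c)" if "b \<in> Basis" "c \<in> Basis" for b c
    using that by (intro smooth_mult smooth_acoef u)
  have I: "(\<integral>x. pd c (?a b c) x \<partial>lborel) = 0" if "b \<in> Basis" "c \<in> Basis" for b c
    by (rule integral_pd_eq_0[OF sa[OF that] K _ that(2)]) (simp add: z)
  have int: "integrable lborel (pd c (?a b c))" if "b \<in> Basis" "c \<in> Basis" for b c
  proof (rule integrable_continuous_compact_support[OF _ K])
    show "continuous_on UNIV (pd c (?a b c))"
      by (intro smooth_continuous_on smooth_pd sa that)
    show "pd c (?a b c) x = 0" if "x \<notin> K" for x
      by (rule pd_zero_outside[OF sa compact_imp_closed[OF K] _ that])
         (use \<open>b \<in> Basis\<close> \<open>c \<in> Basis\<close> z in auto)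
  qed
  show ?thesis unfolding eq by (simp add: I int)
qed

end

section \<open>Mollification\<close>

lemma integrable_mult_continuous:
  fixes f :: "'a::euclidean_space \<Rightarrow> real"
  assumes M: "sets M = sets borel" and f: "integrable M f" and B: "compact B" "\<And>y. y \<notin> B \<Longrightarrow> f y = 0"
    and g: "continuous_on UNIV g"
  shows "integrable M (\<lambda>y. g y * f y)"
proof -
  obtain C where C: "C > 0" "\<And>y. y \<in> B \<Longrightarrow> \<bar>g y\<bar> \<le> C"
    using continuous_compact_bounded[OF continuous_on_subset[OF g subset_UNIV] B(1)] by blast
  have [measurable]: "g \<in> borel_measurable M" "f \<in> borel_measurable M"
    using borel_measurable_continuous_onI[OF g] f M by (auto cong: measurable_cong_sets)
  show ?thesis
  proof (rule Bochner_Integration.integrable_bound)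
    show "integrable M (\<lambda>y. C * f y)" using f by simp
    show "AE y in M. norm (g y * f y) \<le> norm (C * f y)"
    proof (rule AE_I2)
      fix y
      show "norm (g y * f y) \<le> norm (C * f y)"
        using C B(2)[of y] by (cases "y \<in> B") (auto simp: abs_mult intro!: mult_right_mono)
    qed
  qed measurable
qed

text \<open>The kernel is an arbitrary function on the product space. A derivative in the first
  variable is then an instance of the same construction with another kernel, which provides the
  invariant class for \<open>smooth_coinduct\<close>.\<close>

definition kconv :: "'b::euclidean_space measure \<Rightarrow> ('a::euclidean_space \<times> 'b \<Rightarrow> real) \<Rightarrow> ('b \<Rightarrow> real) \<Rightarrow> 'a \<Rightarrow> real" where
  "kconv M k f x = (\<integral>y. k (x, y) * f y \<partial>M)"

context
  fixes M :: "'b::euclidean_space measure" and f :: "'b \<Rightarrow> real" and B :: "'b set"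
  assumes M: "sets M = sets borel" and f: "integrable M f" and B: "compact B" "\<And>y. y \<notin> B \<Longrightarrow> f y = 0"
begin

lemma kconv_integrable:
  fixes k :: "'a::euclidean_space \<times> 'b \<Rightarrow> real"
  assumes "smooth k" shows "integrable M (\<lambda>y. k (x, y) * f y)"
proof (rule integrable_mult_continuous[OF M f B])
  show "continuous_on UNIV (\<lambda>y. k (x, y))"
    by (rule continuous_on_compose2[OF smooth_continuous_on[OF assms, of UNIV]]) (auto intro!: continuous_intros)
qed

text \<open>Differentiation under the integral. The partial derivatives of \<open>k\<close> are
  uniformly continuous on \<open>cball x 1 \<times> B\<close>, so the first order Taylor error of
  \<open>k\<close> in its first variable is small uniformly for \<open>y\<close> in
  \<open>B\<close>; integrating against \<open>f\<close> keeps it small.\<close>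

lemma kconv_has_derivative:
  fixes k :: "'a::euclidean_space \<times> 'b \<Rightarrow> real"
  assumes k: "smooth k"
  shows "(kconv M k f has_derivative (\<lambda>v. \<Sum>b\<in>Basis. (v \<bullet> b) * kconv M (pd (b, 0) k) f x)) (at x)"
  unfolding has_derivative_at_alt
proof (intro conjI allI impI)
  show "bounded_linear (\<lambda>v. \<Sum>b\<in>Basis. v \<bullet> b * kconv M (pd (b, 0) k) f x)"
    by (intro bounded_linear_sum bounded_linear_mult_left[THEN bounded_linear_compose] bounded_linear_inner_left)
  have bB: "(b, 0) \<in> Basis" if "b \<in> Basis" for b :: 'a using that by (auto simp: Basis_prod_def)
  fix e :: real assume e: "e > 0"
  define I where "I = (\<integral>y. \<bar>f y\<bar> \<partial>M)"
  have I0: "I \<ge> 0" by (simp add: I_def)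
  \<comment> \<open>Chosen so that summing over \<open>DIM('a)\<close> directions and integrating
    against \<open>f\<close> costs at most \<open>e\<close>; the added 1 covers the case
    \<open>I = 0\<close>.\<close>
  define e' where "e' = e / ((I + 1) * DIM('a))"
  have e': "e' > 0" using e I0 by (simp add: e'_def)
  have "\<exists>d>0. \<forall>b\<in>(Basis::'a set). \<forall>x'\<in>cball x 1. \<forall>y\<in>B. dist x' x < d \<longrightarrow>
      \<bar>pd (b, 0) k (x', y) - pd (b, 0) k (x, y)\<bar> < e'"
  proof -
    have "\<exists>d>0. \<forall>x'\<in>cball x 1. \<forall>y\<in>B. dist x' x < d \<longrightarrow>
      \<bar>pd (b, 0) k (x', y) - pd (b, 0) k (x, y)\<bar> < e'" if b: "b \<in> Basis" for b :: 'a
    proof -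
      have "compact (cball x 1 \<times> B)" by (intro compact_Times compact_cball B)
      then have "uniformly_continuous_on (cball x 1 \<times> B) (pd (b, 0) k)"
        by (intro compact_uniformly_continuous smooth_continuous_on smooth_pd k bB b)
      then obtain d where d: "d > 0" "\<And>p p'. p \<in> cball x 1 \<times> B \<Longrightarrow> p' \<in> cball x 1 \<times> B \<Longrightarrow>
          dist p' p < d \<Longrightarrow> dist (pd (b, 0) k p') (pd (b, 0) k p) < e'"
        unfolding uniformly_continuous_on_def using e' by metis
      show ?thesis
      proof (intro exI conjI ballI impI)
        fix x' y assume "x' \<in> cball x 1" "y \<in> B" "dist x' x < d"
        then show "\<bar>pd (b, 0) k (x', y) - pd (b, 0) k (x, y)\<bar> < e'"
          using d(2)[of "(x, y)" "(x', y)"] by (simp add: dist_Pair_Pair dist_real_def)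
      qed (rule d(1))
    qed
    then have "\<forall>b\<in>Basis. \<exists>d>0. \<forall>x'\<in>cball x 1. \<forall>y\<in>B. dist x' x < d \<longrightarrow>
      \<bar>pd (b, 0) k (x', y) - pd (b, 0) k (x, y)\<bar> < e'" by blast
    from bchoice[OF this] obtain d where d: "\<And>b. b \<in> Basis \<Longrightarrow> d b > 0"
      "\<And>b x' y. b \<in> Basis \<Longrightarrow> x' \<in> cball x 1 \<Longrightarrow> y \<in> B \<Longrightarrow> dist x' x < d b \<Longrightarrow>
        \<bar>pd (b, 0) k (x', y) - pd (b, 0) k (x, y)\<bar> < e'"
      by blast
    show ?thesis
      by (rule exI[of _ "Min (d ` Basis)"]) (auto intro!: d)
  qed
  then obtain d where d: "d > 0" "\<And>b x' y. b \<in> (Basis::'a set) \<Longrightarrow> x' \<in> cball x 1 \<Longrightarrow> y \<in> B \<Longrightarrow> dist x' x < d \<Longrightarrow>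
      \<bar>pd (b, 0) k (x', y) - pd (b, 0) k (x, y)\<bar> < e'"
    by blast
  show "\<exists>d>0. \<forall>y. norm (y - x) < d \<longrightarrow> norm (kconv M k f y - kconv M k f x -
     (\<Sum>b\<in>Basis. (y - x) \<bullet> b * kconv M (pd (b, 0) k) f x)) \<le> e * norm (y - x)"
  proof (intro exI[of _ "min d 1"] conjI allI impI)
    fix x' assume x': "norm (x' - x) < min d 1"
    let ?E = "\<lambda>y. k (x', y) - k (x, y) - (\<Sum>b\<in>Basis. (x' - x) \<bullet> b * pd (b, 0) k (x, y))"
    have pw: "\<bar>?E y\<bar> \<le> norm (x' - x) * (DIM('a) * e')" if y: "y \<in> B" for y
    proof -
      have D: "((\<lambda>x. k (x, y)) has_derivative (\<lambda>v. \<Sum>b\<in>Basis. v \<bullet> b * pd (b, 0) k (z, y))) (at z)" for z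
      proof -
        have 1: "((\<lambda>x. (x, y)) has_derivative (\<lambda>v. (v, 0))) (at z)"
          by (auto intro!: derivative_eq_intros)
        have "(\<Sum>b\<in>Basis. ((v, 0) \<bullet> b) * pd b k (z, y)) = (\<Sum>b\<in>Basis. v \<bullet> b * pd (b, 0) k (z, y))" for v :: 'a
          unfolding Basis_prod_def
          by (subst sum.union_disjoint) (auto simp: sum.reindex inj_on_def)
        with has_derivative_compose[OF 1 smooth_has_derivative[OF k]] show ?thesis by simp
      qed
      have "norm (k (x', y) - k (x, y) - (\<lambda>v. \<Sum>b\<in>Basis. v \<bullet> b * pd (b, 0) k (x, y)) (x' - x))
          \<le> norm (x' - x) * (DIM('a) * e')"
      proof (rule differentiable_bound_linearization[where S = "ball x (min d 1)" and f' = "\<lambda>z v. \<Sum>b\<in>Basis. v \<bullet> b * pd (b, 0) k (z, y)"])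
        show "((\<lambda>x. k (x, y)) has_derivative (\<lambda>v. \<Sum>b\<in>Basis. v \<bullet> b * pd (b, 0) k (z, y))) (at z within ball x (min d 1))" for z
          by (rule has_derivative_at_withinI[OF D])
        show "x \<in> ball x (min d 1)" using d by simp
        show "x + t *\<^sub>R (x' - x) \<in> ball x (min d 1)" if "t \<in> {0..1}" for t
        proof -
          have "norm (t *\<^sub>R (x' - x)) \<le> norm (x' - x)" using that by (simp add: mult_left_le_one_le)
          then show ?thesis using x' by (simp add: dist_norm)
        qed
        show "onorm ((\<lambda>v. \<Sum>b\<in>Basis. v \<bullet> b * pd (b, 0) k (z, y)) - (\<lambda>v. \<Sum>b\<in>Basis. v \<bullet> b * pd (b, 0) k (x, y))) \<le> DIM('a) * e'"
          if z: "z \<in> ball x (min d 1)" for z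
        proof (rule onorm_le)
          fix v :: 'a
          have "norm (((\<lambda>v. \<Sum>b\<in>Basis. v \<bullet> b * pd (b, 0) k (z, y)) - (\<lambda>v. \<Sum>b\<in>Basis. v \<bullet> b * pd (b, 0) k (x, y))) v)
             = \<bar>\<Sum>b\<in>Basis. v \<bullet> b * (pd (b, 0) k (z, y) - pd (b, 0) k (x, y))\<bar>"
            by (simp add: sum_subtractf right_diff_distrib)
          also have "\<dots> \<le> (\<Sum>b\<in>(Basis::'a set). norm v * e')"
          proof (rule order_trans[OF sum_abs sum_mono])
            fix b :: 'a assume b: "b \<in> Basis"
            have "\<bar>pd (b, 0) k (z, y) - pd (b, 0) k (x, y)\<bar> \<le> e'"
              using d(2)[OF b _ y, of z] z by (simp add: dist_commute)
            then show "\<bar>v \<bullet> b * (pd (b, 0) k (z, y) - pd (b, 0) k (x, y))\<bar> \<le> norm v * e'"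
              using Basis_le_norm[OF b, of v] unfolding abs_mult by (intro mult_mono) auto
          qed
          also have "\<dots> = DIM('a) * e' * norm v" by simp
          finally show "norm (((\<lambda>v. \<Sum>b\<in>Basis. v \<bullet> b * pd (b, 0) k (z, y)) - (\<lambda>v. \<Sum>b\<in>Basis. v \<bullet> b * pd (b, 0) k (x, y))) v)
              \<le> DIM('a) * e' * norm v" .
        qed
      qed
      then show ?thesis by simp
    qed
    have i1: "integrable M (\<lambda>y. k (z, y) * f y)" for z by (rule kconv_integrable[OF k])
    have i2: "integrable M (\<lambda>y. pd (b, 0) k (z, y) * f y)" if "b \<in> Basis" for b z
      by (rule kconv_integrable[OF smooth_pd[OF k bB[OF that]]])
    have eq: "?E y * f y = k (x', y) * f y - k (x, y) * f y - (\<Sum>b\<in>Basis. (x' - x) \<bullet> b * (pd (b, 0) k (x, y) * f y))" for y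
      by (simp add: algebra_simps sum_distrib_left)
    have iE: "integrable M (\<lambda>y. ?E y * f y)"
      unfolding eq using i1 i2 by (intro Bochner_Integration.integrable_diff Bochner_Integration.integrable_sum integrable_mult_right) auto
    have "kconv M k f x' - kconv M k f x - (\<Sum>b\<in>Basis. (x' - x) \<bullet> b * kconv M (pd (b, 0) k) f x)
      = (\<integral>y. ?E y * f y \<partial>M)"
      unfolding eq kconv_def using i1 i2 by (simp add: Bochner_Integration.integral_diff)
    also have "\<bar>\<dots>\<bar> \<le> (\<integral>y. norm (x' - x) * (DIM('a) * e') * \<bar>f y\<bar> \<partial>M)"
    proof (rule order_trans[OF integral_abs_bound integral_mono])
      show "integrable M (\<lambda>y. \<bar>?E y * f y\<bar>)" using iE by (rule integrable_abs)
      show "integrable M (\<lambda>y. norm (x' - x) * (DIM('a) * e') * \<bar>f y\<bar>)" using f by simp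
      show "\<bar>?E y * f y\<bar> \<le> norm (x' - x) * (DIM('a) * e') * \<bar>f y\<bar>" for y
        using pw[of y] B(2)[of y] by (cases "y \<in> B") (auto simp: abs_mult intro!: mult_right_mono)
    qed
    also have "\<dots> = norm (x' - x) * (DIM('a) * e' * I)" by (simp add: I_def)
    also have "\<dots> \<le> norm (x' - x) * e"
    proof (rule mult_left_mono)
      have "DIM('a) * e' * I = e * (I / (I + 1))" using I0 by (simp add: e'_def)
      also have "\<dots> \<le> e * 1" using e I0 by (intro mult_left_mono) (auto simp: field_simps)
      finally show "DIM('a) * e' * I \<le> e" by simp
    qed simp
    finally show "norm (kconv M k f x' - kconv M k f x - (\<Sum>b\<in>Basis. (x' - x) \<bullet> b * kconv M (pd (b, 0) k) f x))
        \<le> e * norm (x' - x)" by (simp add: mult.commute)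
  qed (use d in simp)
qed

lemma pd_kconv:
  fixes k :: "'a::euclidean_space \<times> 'b \<Rightarrow> real"
  assumes "smooth k" "b \<in> Basis" shows "pd b (kconv M k f) = kconv M (pd (b, 0) k) f"
  by (rule ext, subst pd_eqI[OF kconv_has_derivative[OF assms(1)]])
    (use assms(2) in \<open>simp add: inner_Basis if_distrib[of "\<lambda>t. t * _"] cong: if_cong\<close>)

lemma smooth_kconv:
  fixes k :: "'a::euclidean_space \<times> 'b \<Rightarrow> real"
  assumes "smooth k" shows "smooth (kconv M k f)"
proof (rule smooth_coinduct[of _ "{kconv M k f | k :: 'a \<times> 'b \<Rightarrow> real. smooth k}"])
  show "kconv M k f \<in> {kconv M k f |k. smooth k}" using assms by blast
next
  fix h :: "'a \<Rightarrow> real" and x :: 'a assume "h \<in> {kconv M k f |k. smooth k}"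
  then obtain k :: "'a \<times> 'b \<Rightarrow> real" where k: "smooth k" "h = kconv M k f" by blast
  show "h differentiable at x" unfolding k(2) by (rule differentiableI[OF kconv_has_derivative[OF k(1)]])
next
  fix h :: "'a \<Rightarrow> real" and b :: 'a assume "h \<in> {kconv M k f |k. smooth k}" and b: "b \<in> Basis"
  then obtain k :: "'a \<times> 'b \<Rightarrow> real" where k: "smooth k" "h = kconv M k f" by blast
  have "smooth (pd (b, 0) k)" using b by (intro smooth_pd k) (auto simp: Basis_prod_def)
  then show "pd b h \<in> {kconv M k f |k. smooth k}" unfolding k(2) pd_kconv[OF k(1) b] by blast
qed

end

text \<open>Since inversion is negation, the kernel is \<open>\<rho> (x y\<inverse>)\<close>. The
  measure is a parameter because densities with respect to the perimeter measure are mollified as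
  well as functions.\<close>

definition mol :: "('a::euclidean_space \<Rightarrow> 'a \<Rightarrow> 'a) \<Rightarrow> 'a measure \<Rightarrow> ('a \<Rightarrow> real) \<Rightarrow> ('a \<Rightarrow> real) \<Rightarrow> 'a \<Rightarrow> real" where
  "mol gm M \<rho> f x = (\<integral>y. \<rho> (gm x (- y)) * f y \<partial>M)"

section \<open>Mollification adapted to the group\<close>

context stratified
begin

lemma smooth_kernel: "smooth \<rho> \<Longrightarrow> smooth (\<lambda>p. \<rho> (gm (fst p) (- snd p)))"
  by (rule smooth_smoothv[of \<rho>], assumption) (intro smoothv_gm smoothv_fst smoothv_uminus smoothv_snd)

lemma smooth_kernel_snd: "smooth \<rho> \<Longrightarrow> smooth (\<lambda>y. \<rho> (gm x (- y)))"
  by (rule smooth_smoothv[of \<rho>], assumption) (intro smoothv_gm smoothv_const smoothv_uminus smoothv_id)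

lemma smooth_kernel_fst: "smooth \<rho> \<Longrightarrow> smooth (\<lambda>x. \<rho> (gm x (- y)))"
  by (rule smooth_smoothv[of \<rho>], assumption) (intro smoothv_gm smoothv_const smoothv_id)

lemma mol_kconv: "mol gm M \<rho> f = kconv M (\<lambda>p. \<rho> (gm (fst p) (- snd p))) f"
  by (rule ext) (simp add: mol_def kconv_def)

text \<open>Multiplying \<open>x\<close> on the right by \<open>t *\<^sub>R v\<close> has the same
  effect on \<open>gm x (- y)\<close> as multiplying \<open>y\<close> on the right by its inverse,
  since both insert the same factor in the middle of the product.\<close>

lemma Xf_kernel:
  assumes "smooth \<rho>"
  shows "Xf gm v (\<lambda>x. \<rho> (gm x (- y))) x = - Xf gm v (\<lambda>y. \<rho> (gm x (- y))) y"
proof -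
  let ?u = "\<lambda>t. \<rho> (gm (gm x (t *\<^sub>R v)) (- y))"
  have "(?u has_real_derivative Xf gm v (\<lambda>x. \<rho> (gm x (- y))) x) (at 0)"
    using Xf_DERIV[OF smooth_kernel_fst[OF assms, of y], of x v 0] by simp
  then have "((\<lambda>t. ?u (- t)) has_real_derivative - Xf gm v (\<lambda>x. \<rho> (gm x (- y))) x) (at 0)"
    using DERIV_mirror[of ?u _ 0] by simp
  moreover have "?u (- t) = \<rho> (gm x (- gm y (t *\<^sub>R v)))" for t
    by (simp add: minus_gm gm_assoc)
  ultimately have "((\<lambda>t. \<rho> (gm x (- gm y (t *\<^sub>R v)))) has_real_derivative - Xf gm v (\<lambda>x. \<rho> (gm x (- y))) x) (at 0)"
    by simp
  from DERIV_imp_deriv[OF this] show ?thesis by (simp add: Xf_def[of gm v "\<lambda>y. \<rho> (gm x (- y))"])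
qed

lemma smooth_mol:
  assumes "sets M = sets borel" "integrable M f" "compact B" "\<And>y. y \<notin> B \<Longrightarrow> f y = 0" "smooth \<rho>"
  shows "smooth (mol gm M \<rho> f)"
  unfolding mol_kconv by (rule smooth_kconv[OF assms(1-4) smooth_kernel[OF assms(5)]])

lemma mol_integrable:
  assumes "sets M = sets borel" "integrable M f" "compact B" "\<And>y. y \<notin> B \<Longrightarrow> f y = 0" "smooth \<rho>"
  shows "integrable M (\<lambda>y. \<rho> (gm x (- y)) * f y)"
  using kconv_integrable[OF assms(1-4) smooth_kernel[OF assms(5)]] by simp

text \<open>After differentiation under the integral, \<open>Xf_kernel\<close> moves the field to
  the variable \<open>y\<close>. The result is an integral of \<open>f\<close> against the field
  applied to the kernel, which is the form in which weak derivatives and perimeters are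
  defined.\<close>

lemma Xf_mol:
  assumes M: "sets M = sets borel" and f: "integrable M f" "compact B" "\<And>y. y \<notin> B \<Longrightarrow> f y = 0" and \<rho>: "smooth \<rho>"
  shows "Xf gm v (mol gm M \<rho> f) x = - (\<integral>y. Xf gm v (\<lambda>y. \<rho> (gm x (- y))) y * f y \<partial>M)"
proof -
  let ?k = "\<lambda>p. \<rho> (gm (fst p) (- snd p))"
  have sk: "smooth ?k" by (rule smooth_kernel[OF \<rho>])
  have bB: "(b, 0) \<in> Basis" if "b \<in> Basis" for b :: 'a using that by (auto simp: Basis_prod_def)
  have pdk: "pd b (\<lambda>x. \<rho> (gm x (- y))) x = pd (b, 0) ?k (x, y)" if b: "b \<in> Basis" for b x y
  proof -
    have "((\<lambda>t. ?k ((x, y) + t *\<^sub>R (b, 0))) has_real_derivative pd (b, 0) ?k (x, y)) (at 0)"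
      using pd_DERIV[OF sk bB[OF b], of "(x, y)" 0] by (simp add: zero_prod_def[symmetric])
    moreover have "((\<lambda>t. \<rho> (gm (x + t *\<^sub>R b) (- y))) has_real_derivative pd b (\<lambda>x. \<rho> (gm x (- y))) x) (at 0)"
      using pd_DERIV[OF smooth_kernel_fst[OF \<rho>, of y] b, of x 0] by simp
    ultimately show ?thesis by (simp add: DERIV_unique)
  qed
  let ?A = "\<lambda>c. \<Sum>b\<in>Basis. (v \<bullet> b) * acoef b c x"
  have i: "integrable M (\<lambda>y. pd (c, 0) ?k (x, y) * f y)" if "c \<in> Basis" for c
    by (rule kconv_integrable[OF M f smooth_pd[OF sk bB[OF that]]])
  have "smooth (mol gm M \<rho> f)" by (rule smooth_mol[OF M f \<rho>])
  then have "Xf gm v (mol gm M \<rho> f) x = (\<Sum>c\<in>Basis. ?A c * pd c (mol gm M \<rho> f) x)"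
    by (intro Xf_eq smooth_differentiable)
  also have "\<dots> = (\<Sum>c\<in>Basis. ?A c * (\<integral>y. pd (c, 0) ?k (x, y) * f y \<partial>M))"
    unfolding mol_kconv by (intro sum.cong refl) (simp add: pd_kconv[OF M f sk] kconv_def)
  also have "\<dots> = (\<integral>y. (\<Sum>c\<in>Basis. ?A c * (pd (c, 0) ?k (x, y) * f y)) \<partial>M)"
    using i by simp
  also have "\<dots> = (\<integral>y. Xf gm v (\<lambda>x. \<rho> (gm x (- y))) x * f y \<partial>M)"
    unfolding Xf_eq[OF smooth_differentiable[OF smooth_kernel_fst[OF \<rho>]]]
    by (intro Bochner_Integration.integral_cong refl) (simp add: pdk sum_distrib_right mult.assoc)
  finally show ?thesis by (simp add: Xf_kernel[OF \<rho>])
qed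

lemma continuous_gm: "continuous_on S (\<lambda>p. gm (fst p) (snd p))"
  by (rule smoothv_continuous_on[OF smoothv_gm_pair])

lemma continuous_on_gm [continuous_intros]:
  "continuous_on S u \<Longrightarrow> continuous_on S v \<Longrightarrow> continuous_on S (\<lambda>x. gm (u x) (v x))"
  using continuous_on_compose2[OF continuous_gm[of UNIV] continuous_on_Pair] by fastforce

text \<open>The support of the kernel is controlled by the size of the product
  \<open>gm x (- y)\<close>, not by the Euclidean distance. With \<open>z\<close> this product,
  \<open>y\<close> equals \<open>gm (- z) x\<close>, which depends uniformly continuously on
  \<open>z\<close> near 0 and \<open>x\<close> in \<open>K\<close>, and equals \<open>x\<close> for
  \<open>z = 0\<close>.\<close>

lemma kernel_near_diagonal:
  assumes K: "compact K" and \<delta>: "\<delta> > 0"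
  obtains \<epsilon> where "\<epsilon> > 0" "\<And>x y. x \<in> K \<Longrightarrow> norm (gm x (- y)) < \<epsilon> \<Longrightarrow> dist x y < \<delta>"
proof -
  let ?f = "\<lambda>p::'a \<times> 'a. gm (- fst p) (snd p)"
  have "uniformly_continuous_on (cball 0 1 \<times> K) ?f"
    by (intro compact_uniformly_continuous continuous_intros compact_Times compact_cball K)
  then obtain d where d: "d > 0" "\<And>p p'. p \<in> cball 0 1 \<times> K \<Longrightarrow> p' \<in> cball 0 1 \<times> K \<Longrightarrow>
     dist p' p < d \<Longrightarrow> dist (?f p') (?f p) < \<delta>"
    unfolding uniformly_continuous_on_def using \<delta> by metis
  show ?thesis
  proof (rule that[of "min d 1"])
    fix x y assume x: "x \<in> K" and n: "norm (gm x (- y)) < min d 1"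
    have "gm (- gm x (- y)) x = y" by (simp add: minus_gm gm_assoc)
    then show "dist x y < \<delta>"
      using d(2)[of "(0, x)" "(gm x (- y), x)"] x n by (simp add: dist_Pair_Pair dist_commute)
  qed (use d in simp)
qed

lemma norm_gm_commute: "norm (gm x (- y)) = norm (gm y (- x))"
  by (metis minus_gm minus_minus norm_minus_cancel)

text \<open>The group analogue of \<open>cthick\<close>: all left multiples of points of
  \<open>K\<close> by elements of norm at most \<open>r\<close>. It contains every point that the
  kernel reaches from \<open>K\<close>.\<close>

definition gthick :: "'a set \<Rightarrow> real \<Rightarrow> 'a set" where
  "gthick K r = (\<lambda>p. gm (fst p) (snd p)) ` (cball 0 r \<times> K)"

lemma compact_gthick: "compact K \<Longrightarrow> compact (gthick K r)"
  unfolding gthick_def by (intro compact_continuous_image continuous_gm compact_Times compact_cball)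

lemma gthickI: "x \<in> K \<Longrightarrow> norm (gm x (- y)) \<le> r \<Longrightarrow> y \<in> gthick K r"
  unfolding gthick_def
  by (intro image_eqI[of _ _ "(gm y (- x), x)"]) (auto simp: gm_assoc norm_gm_commute[of y x] gm_cancel(1)[of x, simplified])

text \<open>Unit mass is demanded of the kernel at every \<open>x\<close>, because invariance of
  Lebesgue measure under the group is not part of \<open>stratified_group\<close>. Symmetry of
  \<rho> makes the kernel symmetric in its two variables, which \<open>mol_duality\<close>
  needs.\<close>

definition mollifier :: "real \<Rightarrow> ('a \<Rightarrow> real) \<Rightarrow> bool" where
  "mollifier \<epsilon> \<rho> \<longleftrightarrow> smooth \<rho> \<and> (\<forall>z. \<rho> z \<ge> 0) \<and> (\<forall>z. \<rho> (- z) = \<rho> z) \<and>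
     (\<forall>z. \<rho> z \<noteq> 0 \<longrightarrow> norm z < \<epsilon>) \<and> (\<forall>x. (\<integral>y. \<rho> (gm x (- y)) \<partial>lborel) = 1)"

text \<open>Since \<open>X\<^sub>v\<close> in \<open>x\<close> is \<open>- X\<^sub>v\<close> in \<open>y\<close> on the kernel, the integral is constant along the curves
  \<open>t *\<^sub>R x\<close>; this replaces the invariance of Lebesgue measure under the group law.\<close>

lemma kernel_integral_constant:
  assumes \<rho>: "smooth \<rho>" and s: "\<And>z. \<rho> z \<noteq> 0 \<Longrightarrow> norm z < \<epsilon>"
  shows "(\<integral>y. \<rho> (gm x (- y)) \<partial>lborel) = (\<integral>y. \<rho> (- y) \<partial>lborel)"
proof -
  \<comment> \<open>\<open>B\<close> contains the support of the kernel at every point of norm at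
    most \<open>norm x\<close>. Its indicator therefore stands in for the constant function 1, which
    is not integrable.\<close>
  define B where "B = gthick (cball 0 (norm x)) \<epsilon>"
  have B: "compact B" unfolding B_def by (intro compact_gthick compact_cball)
  define f :: "'a \<Rightarrow> real" where "f = (\<lambda>y. indicator B y)"
  have zB: "\<rho> (gm z (- y)) = 0" if "norm z \<le> norm x" "y \<notin> B" for z y
  proof (rule ccontr)
    assume "\<rho> (gm z (- y)) \<noteq> 0"
    then have "norm (gm z (- y)) \<le> \<epsilon>" using s less_imp_le by blast
    then have "y \<in> B" unfolding B_def using that by (intro gthickI[of z]) auto
    then show False using that by simp
  qed
  have f: "integrable lborel f" "\<And>y. y \<notin> B \<Longrightarrow> f y = 0"
    using borel_integrable_compact[OF B continuous_on_const[of B "1::real"]] by (auto simp: f_def)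
  let ?N = "mol gm lborel \<rho> f"
  have sN: "smooth ?N" using smooth_mol[OF _ f(1) B f(2) \<rho>] by simp
  have N: "?N z = (\<integral>y. \<rho> (gm z (- y)) \<partial>lborel)" if "norm z \<le> norm x" for z
    unfolding mol_def by (intro Bochner_Integration.integral_cong) (use zB[OF that] in \<open>auto simp: f_def indicator_def\<close>)
  have "Xf gm x ?N z = 0" if z: "norm z \<le> norm x" for z
  proof -
    have z0: "Xf gm x (\<lambda>y. \<rho> (gm z (- y))) y = 0" if "y \<notin> B" for y
      by (rule Xf_zero_outside[OF smooth_kernel_snd[OF \<rho>] compact_imp_closed[OF B] zB[OF z] that])
    have "Xf gm x ?N z = - (\<integral>y. Xf gm x (\<lambda>y. \<rho> (gm z (- y))) y * f y \<partial>lborel)"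
      using Xf_mol[OF _ f(1) B f(2) \<rho>] by simp
    also have "(\<integral>y. Xf gm x (\<lambda>y. \<rho> (gm z (- y))) y * f y \<partial>lborel) = (\<integral>y. Xf gm x (\<lambda>y. \<rho> (gm z (- y))) y \<partial>lborel)"
      by (intro Bochner_Integration.integral_cong) (use z0 in \<open>auto simp: f_def indicator_def\<close>)
    also have "\<dots> = 0"
      by (rule integral_Xf_eq_0[OF smooth_kernel_snd[OF \<rho>] B zB[OF z]])
    finally show ?thesis by simp
  qed
  then have D: "((\<lambda>t. ?N (gm 0 (t *\<^sub>R x))) has_real_derivative 0) (at t)" if "0 < t" "t < 1" for t
    using Xf_DERIV[OF sN, of 0 x t] that by (simp add: mult_left_le_one_le)
  have "?N (gm 0 (1 *\<^sub>R x)) = ?N (gm 0 (0 *\<^sub>R x))"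
  proof (rule DERIV_isconst_end[of 0 1 "\<lambda>t. ?N (gm 0 (t *\<^sub>R x))"])
    show "continuous_on {0..1} (\<lambda>t. ?N (gm 0 (t *\<^sub>R x)))"
      using continuous_on_compose2[OF smooth_continuous_on[OF sN, of UNIV], of "{0..1}" "\<lambda>t. t *\<^sub>R x"]
      by (simp add: continuous_intros)
  qed (use D in auto)
  then show ?thesis using N[of x] N[of 0] by simp
qed

lemma mollifier_exists:
  assumes "\<epsilon> > 0" shows "\<exists>\<rho>. mollifier \<epsilon> \<rho>"
proof -
  let ?b = "bump (0::'a) \<epsilon>"
  define c where "c = (\<integral>y. ?b (- y) \<partial>lborel)"
  have sym: "?b (- z) = ?b z" for z by (simp add: bump_def)
  have nz: "norm z < \<epsilon>" if "?b z \<noteq> 0" for z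
    using bump_pos_iff[OF assms, where a = 0 and x = z] bump_nonneg[of 0 \<epsilon> z] that by auto
  have int: "integrable lborel ?b"
    by (rule integrable_continuous_compact_support[OF smooth_continuous_on[OF smooth_bump] compact_cball[of 0 \<epsilon>]])
      (use nz in force)
  have "c \<ge> 0" unfolding c_def by (intro integral_nonneg_AE AE_I2 bump_nonneg)
  moreover have "c \<noteq> 0"
  proof
    assume "c = 0"
    then have "(\<integral>y. ?b y \<partial>lborel) = 0" unfolding c_def by (simp add: sym)
    then have "AE y in lborel. ?b y = 0"
      using integral_nonneg_eq_0_iff_AE[OF int] bump_nonneg by auto
    then have "AE y in lborel. y \<notin> ball (0::'a) \<epsilon>"
      by eventually_elim (use bump_pos_iff[OF assms, where a = "0::'a"] in \<open>force simp: dist_commute\<close>)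
    then have "ball (0::'a) \<epsilon> \<in> null_sets lborel"
      by (subst (asm) AE_iff_null_sets[symmetric]) auto
    then have "negligible (ball (0::'a) \<epsilon>)"
      by (simp add: negligible_iff_null_sets null_sets_completionI)
    then show False using open_not_negligible[of "ball (0::'a) \<epsilon>"] assms by simp
  qed
  ultimately have c: "c > 0" by simp
  have "mollifier \<epsilon> (\<lambda>z. (1 / c) * ?b z)"
    unfolding mollifier_def
  proof (intro conjI allI impI)
    show "smooth (\<lambda>z. 1 / c * ?b z)" by (intro smooth_mult smooth_const smooth_bump)
    show "(\<integral>y. 1 / c * ?b (gm x (- y)) \<partial>lborel) = 1" for x
    proof -
      have "(\<integral>y. ?b (gm x (- y)) \<partial>lborel) = c" unfolding c_def
        by (rule kernel_integral_constant[OF smooth_bump nz])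
      then show ?thesis using c by simp
    qed
  qed (use c nz bump_nonneg[of "0::'a" \<epsilon>] sym in \<open>auto simp: divide_nonneg_pos\<close>)
  then show ?thesis by blast
qed

end

text \<open>By induction on integrable functions. An indicator is first replaced by that of a
  compact subset, through inner regularity, and this one by a smooth cutoff; sums and dominated
  limits are routine.\<close>

lemma L1_dense_continuous_compact_support:
  fixes f :: "'a::euclidean_space \<Rightarrow> real"
  assumes "integrable lborel f" "e > 0"
  shows "\<exists>c K. continuous_on UNIV c \<and> compact K \<and> (\<forall>x. x \<notin> K \<longrightarrow> c x = 0) \<and> (\<integral>x. \<bar>f x - c x\<bar> \<partial>lborel) < e"
  using assms
proof (induction f arbitrary: e rule: integrable_induct)
  case (base A c)
  \<comment> \<open>Inner regularity is stated for finite measures, so \<open>lborel\<close> is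
    restricted to the set \<open>A\<close> of finite measure.\<close>
  define D where "D = density lborel (indicator A :: 'a \<Rightarrow> ennreal)"
  have A: "A \<in> sets borel" using base by simp
  have eD: "emeasure D B = emeasure lborel (A \<inter> B)" if "B \<in> sets borel" for B
    using that A unfolding D_def by (subst emeasure_density) (auto simp: indicator_inter_arith[symmetric])
  have finA: "emeasure lborel A < \<infinity>" using base by simp
  have DA: "emeasure D A = (SUP K\<in>{K. K \<subseteq> A \<and> compact K}. emeasure D K)"
    by (rule inner_regular) (use A eD[of UNIV] finA in \<open>auto simp: D_def\<close>)
  \<comment> \<open>Half of \<open>e\<close> is reserved for the loss from \<open>A\<close> to
    \<open>K\<close>, the other half for the smoothing of \<open>K\<close>; the added 1 covers
    \<open>c = 0\<close>.\<close>
  define e' where "e' = e / (2 * (\<bar>c\<bar> + 1))"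
  have e': "e' > 0" "\<bar>c\<bar> * e' \<le> e / 2" using base by (auto simp: e'_def field_simps)
  have "\<exists>K. compact K \<and> K \<subseteq> A \<and> measure lborel A - measure lborel K < e'"
  proof (cases "measure lborel A < e'")
    case True
    then show ?thesis by (intro exI[of _ "{}"]) auto
  next
    case False
    have "ennreal (measure lborel A - e') < emeasure D A"
      using finA e' False by (simp add: eD[OF A] emeasure_eq_ennreal_measure ennreal_less_iff)
    then obtain K where K: "K \<subseteq> A" "compact K" "ennreal (measure lborel A - e') < emeasure D K"
      unfolding DA less_SUP_iff by blast
    have "emeasure D K = emeasure lborel K"
      using K by (subst eD) (auto simp: compact_imp_closed Int_absorb1)
    moreover have "emeasure lborel K = ennreal (measure lborel K)"
      by (rule emeasure_eq_ennreal_measure) (use emeasure_lborel_cbox_finite emeasure_compact_finite[OF K(2)] in auto)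
    ultimately have "measure lborel A - e' < measure lborel K"
      using K(3) False by (simp add: ennreal_less_iff)
    then show ?thesis using K by (intro exI[of _ K]) auto
  qed
  then obtain K where K: "compact K" "K \<subseteq> A" "measure lborel A - measure lborel K < e'" by blast
  obtain K1 \<psi> where \<psi>: "cutoff_seq UNIV K K1 \<psi>"
    using cutoff_seq_exists[OF K(1) open_UNIV subset_UNIV] .
  have K1: "compact K1" "K \<subseteq> K1" using \<psi> by (auto simp: cutoff_seq_def)
  have c\<psi>: "continuous_on UNIV (\<psi> n)" for n
    using \<psi> by (auto simp: cutoff_seq_def test_fun_iff intro: smooth_continuous_on)
  have [measurable]: "\<psi> n \<in> borel_measurable borel" for n
    by (rule borel_measurable_continuous_onI[OF c\<psi>])
  have [measurable]: "K \<in> sets borel" "K1 \<in> sets borel" using K K1 by (auto simp: compact_imp_closed)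
  have iK1: "integrable lborel (indicator K1 :: 'a \<Rightarrow> real)"
    using borel_integrable_compact[OF K1(1) continuous_on_const[of K1 "1::real"]] by simp
  have iK: "integrable lborel (indicator K :: 'a \<Rightarrow> real)"
    using borel_integrable_compact[OF K(1) continuous_on_const[of K "1::real"]] by simp
  have iA: "integrable lborel (indicator A :: 'a \<Rightarrow> real)"
    using A finA by (auto intro!: integrable_real_indicator)
  have "(\<lambda>n. \<integral>x. \<bar>\<psi> n x - indicator K x\<bar> \<partial>lborel) \<longlonglongrightarrow> (\<integral>x. \<bar>indicator K x - indicator K x\<bar> \<partial>(lborel :: 'a measure))"
  proof (rule integral_dominated_convergence[where w = "indicator K1"])
    show "AE x in lborel. norm \<bar>\<psi> n x - indicator K x\<bar> \<le> indicator K1 x" for n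
    proof (rule AE_I2)
      fix x
      have "0 \<le> \<psi> n x" "\<psi> n x \<le> 1" "x \<notin> K1 \<Longrightarrow> \<psi> n x = 0" using \<psi> by (auto simp: cutoff_seq_def)
      then show "norm \<bar>\<psi> n x - indicator K x\<bar> \<le> indicator K1 x" using K1 by (auto simp: indicator_def)
    qed
    show "AE x in lborel. (\<lambda>n. \<bar>\<psi> n x - indicator K x\<bar>) \<longlonglongrightarrow> \<bar>indicator K x - indicator K x\<bar>"
      using \<psi> unfolding cutoff_seq_def by (intro AE_I2 tendsto_rabs tendsto_diff tendsto_const) simp
  qed (use iK1 in measurable)
  then have "(\<lambda>n. \<integral>x. \<bar>\<psi> n x - indicator K x\<bar> \<partial>lborel) \<longlonglongrightarrow> 0" by simp
  then have "(\<lambda>n. \<bar>c\<bar> * (\<integral>x. \<bar>\<psi> n x - indicator K x\<bar> \<partial>lborel)) \<longlonglongrightarrow> 0"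
    using tendsto_mult_right_zero by blast
  moreover have "e / 2 > 0" using base by simp
  ultimately have "\<forall>\<^sub>F n in sequentially. \<bar>c\<bar> * (\<integral>x. \<bar>\<psi> n x - indicator K x\<bar> \<partial>lborel) < e / 2"
    by (rule order_tendstoD)
  then obtain n where n: "\<bar>c\<bar> * (\<integral>x. \<bar>\<psi> n x - indicator K x\<bar> \<partial>lborel) < e / 2"
    using eventually_happens sequentially_bot by blast
  have i\<psi>: "integrable lborel (\<psi> n)"
    by (rule integrable_continuous_compact_support[OF c\<psi> K1(1)]) (use \<psi> in \<open>auto simp: cutoff_seq_def\<close>)
  have "(\<integral>x. \<bar>indicator A x *\<^sub>R c - \<psi> n x * c\<bar> \<partial>lborel) \<le>
    (\<integral>x. \<bar>c\<bar> * (indicator A x - indicator K x) + \<bar>c\<bar> * \<bar>\<psi> n x - indicator K x\<bar> \<partial>lborel)"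
  proof (rule integral_mono)
    show "integrable lborel (\<lambda>x. \<bar>indicator A x *\<^sub>R c - \<psi> n x * c\<bar>)" using iA i\<psi> by auto
    show "integrable lborel (\<lambda>x. \<bar>c\<bar> * (indicator A x - indicator K x) + \<bar>c\<bar> * \<bar>\<psi> n x - indicator K x\<bar>)"
      using iA i\<psi> iK by auto
    fix x
    have "\<bar>indicator A x *\<^sub>R c - \<psi> n x * c\<bar> = \<bar>c\<bar> * \<bar>(indicator A x - indicator K x) - (\<psi> n x - indicator K x)\<bar>"
      by (simp add: abs_mult[symmetric] algebra_simps)
    also have "\<dots> \<le> \<bar>c\<bar> * (\<bar>indicator A x - indicator K x\<bar> + \<bar>\<psi> n x - indicator K x\<bar>)"
      by (intro mult_left_mono abs_triangle_ineq4) auto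
    also have "\<bar>indicator A x - indicator K x\<bar> = (indicator A x - indicator K x :: real)"
      using K(2) by (auto simp: indicator_def)
    finally show "\<bar>indicator A x *\<^sub>R c - \<psi> n x * c\<bar> \<le> \<bar>c\<bar> * (indicator A x - indicator K x) + \<bar>c\<bar> * \<bar>\<psi> n x - indicator K x\<bar>"
      by (simp add: distrib_left)
  qed
  also have "\<dots> = \<bar>c\<bar> * (measure lborel A - measure lborel K) + \<bar>c\<bar> * (\<integral>x. \<bar>\<psi> n x - indicator K x\<bar> \<partial>lborel)"
    using iA i\<psi> iK by simp
  also have "\<dots> < e / 2 + e / 2"
    using n e' K(3) mult_left_mono[of "measure lborel A - measure lborel K" e' "\<bar>c\<bar>"] by linarith
  finally have "(\<integral>x. \<bar>indicator A x *\<^sub>R c - \<psi> n x * c\<bar> \<partial>lborel) < e" by simp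
  then show ?case
    using c\<psi> K1 \<psi> by (intro exI[of _ "\<lambda>x. \<psi> n x * c"] exI[of _ K1]) (auto simp: cutoff_seq_def intro!: continuous_intros)
next
  case (add f g)
  from add.IH(1)[of "e/2"] add.prems obtain c1 K1 where 1: "continuous_on UNIV c1" "compact K1" "\<forall>x. x \<notin> K1 \<longrightarrow> c1 x = 0"
    "(\<integral>x. \<bar>f x - c1 x\<bar> \<partial>lborel) < e / 2" by auto
  from add.IH(2)[of "e/2"] add.prems obtain c2 K2 where 2: "continuous_on UNIV c2" "compact K2" "\<forall>x. x \<notin> K2 \<longrightarrow> c2 x = 0"
    "(\<integral>x. \<bar>g x - c2 x\<bar> \<partial>lborel) < e / 2" by auto
  have i: "integrable lborel c1" "integrable lborel c2"
    using integrable_continuous_compact_support[OF 1(1,2)] integrable_continuous_compact_support[OF 2(1,2)] 1(3) 2(3)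
    by blast+
  have "(\<integral>x. \<bar>f x + g x - (c1 x + c2 x)\<bar> \<partial>lborel) \<le> (\<integral>x. \<bar>f x - c1 x\<bar> + \<bar>g x - c2 x\<bar> \<partial>lborel)"
    using i add.hyps by (intro integral_mono) auto
  also have "\<dots> = (\<integral>x. \<bar>f x - c1 x\<bar> \<partial>lborel) + (\<integral>x. \<bar>g x - c2 x\<bar> \<partial>lborel)"
    using i add.hyps by simp
  also have "\<dots> < e" using 1 2 by simp
  finally show ?case
  proof (intro exI conjI)
    show "continuous_on UNIV (\<lambda>x. c1 x + c2 x)" using 1 2 by (intro continuous_on_add)
    show "compact (K1 \<union> K2)" using 1 2 by (intro compact_Un)
    show "\<forall>x. x \<notin> K1 \<union> K2 \<longrightarrow> c1 x + c2 x = 0" using 1(3) 2(3) by simp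
  qed
next
  case (lim f s)
  \<comment> \<open>The approximants are bounded by twice the limit function, hence the factor 3 in
    the dominating function.\<close>
  have "(\<lambda>i. \<integral>x. \<bar>f x - s i x\<bar> \<partial>lborel) \<longlonglongrightarrow> (\<integral>x. \<bar>f x - f x\<bar> \<partial>lborel)"
  proof (rule integral_dominated_convergence[where w = "\<lambda>x. 3 * \<bar>f x\<bar>"])
    show "AE x in lborel. (\<lambda>i. \<bar>f x - s i x\<bar>) \<longlonglongrightarrow> \<bar>f x - f x\<bar>"
    proof (rule AE_I2)
      fix x
      have "(\<lambda>i. s i x) \<longlonglongrightarrow> f x" by (rule lim.hyps) simp
      then show "(\<lambda>i. \<bar>f x - s i x\<bar>) \<longlonglongrightarrow> \<bar>f x - f x\<bar>"
        by (intro tendsto_rabs tendsto_diff tendsto_const)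
    qed
    show "AE x in lborel. norm \<bar>f x - s i x\<bar> \<le> 3 * \<bar>f x\<bar>" for i
    proof (rule AE_I2)
      fix x
      have "\<bar>s i x\<bar> \<le> 2 * \<bar>f x\<bar>" using lim.hyps(3)[of x i] by simp
      then show "norm \<bar>f x - s i x\<bar> \<le> 3 * \<bar>f x\<bar>" by simp
    qed
  qed (use lim in auto)
  then have "(\<lambda>i. \<integral>x. \<bar>f x - s i x\<bar> \<partial>lborel) \<longlonglongrightarrow> 0" by simp
  moreover have "e / 2 > 0" using lim.prems by simp
  ultimately have "\<forall>\<^sub>F i in sequentially. (\<integral>x. \<bar>f x - s i x\<bar> \<partial>lborel) < e / 2"
    by (rule order_tendstoD)
  then obtain i where i: "(\<integral>x. \<bar>f x - s i x\<bar> \<partial>lborel) < e / 2"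
    using eventually_happens sequentially_bot by blast
  from lim.IH[of "e/2" i] lim.prems obtain c K where c: "continuous_on UNIV c" "compact K" "\<forall>x. x \<notin> K \<longrightarrow> c x = 0"
    "(\<integral>x. \<bar>s i x - c x\<bar> \<partial>lborel) < e / 2" by auto
  have ic: "integrable lborel c" using c by (auto intro!: integrable_continuous_compact_support)
  have "(\<integral>x. \<bar>f x - c x\<bar> \<partial>lborel) \<le> (\<integral>x. \<bar>f x - s i x\<bar> + \<bar>s i x - c x\<bar> \<partial>lborel)"
    using ic lim by (intro integral_mono) auto
  also have "\<dots> = (\<integral>x. \<bar>f x - s i x\<bar> \<partial>lborel) + (\<integral>x. \<bar>s i x - c x\<bar> \<partial>lborel)"
    using ic lim by simp
  also have "\<dots> < e" using i c by simp
  finally show ?case using c by blast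
qed

section \<open>The mollifying sequence and its convergence\<close>

context stratified
begin

definition rho :: "nat \<Rightarrow> 'a \<Rightarrow> real" where
  "rho n = (SOME \<rho>. mollifier (inverse (real (Suc n))) \<rho>)"

lemma mollifier_rho: "mollifier (inverse (real (Suc n))) (rho n)"
  unfolding rho_def by (rule someI_ex[OF mollifier_exists]) simp

lemma smooth_rho: "smooth (rho n)"
  and rho_nonneg: "rho n z \<ge> 0"
  and rho_sym: "rho n (- z) = rho n z"
  and rho_support: "rho n z \<noteq> 0 \<Longrightarrow> norm z < inverse (real (Suc n))"
  and rho_integral: "(\<integral>y. rho n (gm x (- y)) \<partial>lborel) = 1"
  using mollifier_rho[of n] by (simp_all add: mollifier_def)

lemma rho_support_1: "rho n z \<noteq> 0 \<Longrightarrow> norm z \<le> 1"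
proof -
  assume "rho n z \<noteq> 0"
  then have "norm z < inverse (real (Suc n))" by (rule rho_support)
  also have "\<dots> \<le> 1" by (simp add: inverse_le_1_iff)
  finally show ?thesis by simp
qed

lemma kernel_sym: "rho n (gm x (- y)) = rho n (gm y (- x))"
  using rho_sym[of n "gm x (- y)"] by (simp add: minus_gm)

lemma kernel_support: "rho n (gm x (- y)) \<noteq> 0 \<Longrightarrow> x \<in> K \<Longrightarrow> y \<in> gthick K 1"
  by (rule gthickI) (auto intro: rho_support_1)

lemma kernel_integrable: "integrable lborel (\<lambda>y. rho n (gm x (- y)))"
proof (rule integrable_continuous_compact_support)
  show "continuous_on UNIV (\<lambda>y. rho n (gm x (- y)))"
    by (rule smooth_continuous_on[OF smooth_kernel_snd[OF smooth_rho]])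
  show "compact (gthick {x} 1)" by (intro compact_gthick) simp
  show "rho n (gm x (- y)) = 0" if "y \<notin> gthick {x} 1" for y
    using kernel_support[of n x y "{x}"] that by auto
qed

lemma kernel_measurable: "(\<lambda>y. rho n (gm x (- y))) \<in> borel_measurable borel"
  by (rule borel_measurable_continuous_onI[OF smooth_continuous_on[OF smooth_kernel_snd[OF smooth_rho]]])

lemma rho_near:
  assumes "compact K" "\<delta> > 0"
  shows "\<forall>\<^sub>F n in sequentially. \<forall>x\<in>K. \<forall>y. rho n (gm x (- y)) \<noteq> 0 \<longrightarrow> dist x y < \<delta>"
proof -
  obtain \<epsilon> where \<epsilon>: "\<epsilon> > 0" "\<And>x y. x \<in> K \<Longrightarrow> norm (gm x (- y)) < \<epsilon> \<Longrightarrow> dist x y < \<delta>"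
    using kernel_near_diagonal[OF assms] by blast
  have "\<forall>\<^sub>F n in sequentially. inverse (real (Suc n)) < \<epsilon>"
    by (rule order_tendstoD(2)[OF LIMSEQ_inverse_real_of_nat \<epsilon>(1)])
  then show ?thesis
  proof eventually_elim
    case (elim n)
    then show ?case using \<epsilon>(2) rho_support less_trans by blast
  qed
qed

lemma mol_bound:
  assumes f: "f \<in> borel_measurable borel" "AE y in lborel. \<bar>f y\<bar> \<le> C"
  shows "\<bar>mol gm lborel (rho n) f x\<bar> \<le> C"
proof -
  have [measurable]: "(\<lambda>y. rho n (gm x (- y))) \<in> borel_measurable borel" by (rule kernel_measurable)
  note f(1)[measurable]
  have b: "AE y in lborel. \<bar>rho n (gm x (- y)) * f y\<bar> \<le> C * rho n (gm x (- y))"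
    using f(2)
  proof eventually_elim
    case (elim y)
    then show ?case using mult_left_mono[OF elim rho_nonneg[of n "gm x (- y)"]] rho_nonneg[of n "gm x (- y)"]
      by (simp add: abs_mult mult.commute)
  qed
  have i: "integrable lborel (\<lambda>y. C * rho n (gm x (- y)))" using kernel_integrable by simp
  have i2: "integrable lborel (\<lambda>y. rho n (gm x (- y)) * f y)"
    by (rule Bochner_Integration.integrable_bound[OF i]) (use b in \<open>auto elim!: eventually_mono\<close>)
  have "\<bar>mol gm lborel (rho n) f x\<bar> \<le> (\<integral>y. \<bar>rho n (gm x (- y)) * f y\<bar> \<partial>lborel)"
    unfolding mol_def by (rule integral_abs_bound)
  also have "\<dots> \<le> (\<integral>y. C * rho n (gm x (- y)) \<partial>lborel)"
    by (rule integral_mono_AE[OF _ i b]) (use i2 in simp)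
  also have "\<dots> = C" by (simp add: rho_integral)
  finally show ?thesis .
qed

lemma mol_tendsto_at:
  assumes f: "integrable lborel f" "compact B" "\<And>y. y \<notin> B \<Longrightarrow> f y = 0" and c: "isCont f x"
  shows "(\<lambda>n. mol gm lborel (rho n) f x) \<longlonglongrightarrow> f x"
proof (rule tendstoI)
  fix e :: real assume e: "e > 0"
  then have "e / 2 > 0" by simp
  then obtain \<delta> where \<delta>: "\<delta> > 0" "\<And>y. dist y x < \<delta> \<Longrightarrow> dist (f y) (f x) < e / 2"
    using c unfolding continuous_at_eps_delta by (metis dist_commute)
  have "\<forall>\<^sub>F n in sequentially. \<forall>z\<in>{x}. \<forall>y. rho n (gm z (- y)) \<noteq> 0 \<longrightarrow> dist z y < \<delta>"
    by (rule rho_near) (use \<delta> in auto)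
  then show "\<forall>\<^sub>F n in sequentially. dist (mol gm lborel (rho n) f x) (f x) < e"
  proof eventually_elim
    case (elim n)
    have i1: "integrable lborel (\<lambda>y. rho n (gm x (- y)) * f y)"
      by (rule mol_integrable[OF _ f smooth_rho]) simp
    have i2: "integrable lborel (\<lambda>y. rho n (gm x (- y)) * (f y - f x))"
      using i1 kernel_integrable[of n x] by (simp add: right_diff_distrib)
    have "mol gm lborel (rho n) f x - f x = (\<integral>y. rho n (gm x (- y)) * (f y - f x) \<partial>lborel)"
      unfolding mol_def right_diff_distrib using i1 kernel_integrable[of n x] rho_integral[of n x] by simp
    also have "\<bar>\<dots>\<bar> \<le> (\<integral>y. \<bar>rho n (gm x (- y)) * (f y - f x)\<bar> \<partial>lborel)" by (rule integral_abs_bound)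
    also have "\<dots> \<le> (\<integral>y. rho n (gm x (- y)) * (e / 2) \<partial>lborel)"
    proof (rule integral_mono)
      fix y
      show "\<bar>rho n (gm x (- y)) * (f y - f x)\<bar> \<le> rho n (gm x (- y)) * (e / 2)"
      proof (cases "rho n (gm x (- y)) = 0")
        case False
        then have "\<bar>f y - f x\<bar> \<le> e / 2" using elim \<delta>(2)[of y] by (auto simp: dist_commute[of x y] dist_real_def)
        then show ?thesis using rho_nonneg[of n "gm x (- y)"] unfolding abs_mult by (simp only: abs_of_nonneg) (intro mult_left_mono)
      qed simp
    qed (use i2 kernel_integrable[of n x] in auto)
    also have "\<dots> = e / 2" by (simp add: rho_integral)
    finally show ?case using e by (simp add: dist_real_def)
  qed
qed

lemma mol_zero_outside:
  assumes "\<And>y. y \<notin> B \<Longrightarrow> f y = 0" "x \<notin> gthick B 1"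
  shows "mol gm M (rho n) f x = 0"
proof -
  have z: "rho n (gm x (- y)) * f y = 0" for y
  proof (cases "y \<in> B")
    case True
    then have "rho n (gm y (- x)) = 0" using kernel_support[of n y x B] assms(2) by auto
    then show ?thesis by (simp add: kernel_sym[of n x y])
  qed (use assms in simp)
  show ?thesis unfolding mol_def z by simp
qed

text \<open>Fubini together with the symmetry of the kernel. The mollification of a density with
  respect to \<open>M\<close>, which is a smooth function, is traded for the mollification of the
  test function, which is then integrated against \<open>M\<close> itself.\<close>

lemma mol_duality:
  assumes M: "sets M = sets borel" "sigma_finite_measure M"
    and f: "integrable M f" "compact B" "\<And>y. y \<notin> B \<Longrightarrow> f y = 0"
    and \<psi>: "continuous_on UNIV \<psi>" "compact K" "\<And>x. x \<notin> K \<Longrightarrow> \<psi> x = 0"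
  shows "(\<integral>x. \<psi> x * mol gm M (rho n) f x \<partial>lborel) = (\<integral>y. f y * mol gm lborel (rho n) \<psi> y \<partial>M)"
proof -
  interpret M: sigma_finite_measure M by (rule M(2))
  interpret P: pair_sigma_finite lborel M ..
  have "rho n z = 0" if "z \<notin> cball 0 1" for z using rho_support_1[of n z] that by auto
  then obtain C where C: "C > 0" "\<And>z. \<bar>rho n z\<bar> \<le> C"
    using continuous_compact_support_bounded[OF smooth_continuous_on[OF smooth_rho] compact_cball[of 0 1]] by blast
  have spM: "space M = UNIV" using sets_eq_imp_space_eq[OF M(1)] by simp
  have [measurable]: "f \<in> borel_measurable M" using f by simp
  have [measurable]: "\<psi> \<in> borel_measurable borel" by (rule borel_measurable_continuous_onI[OF \<psi>(1)])
  have [measurable]: "(\<lambda>p. rho n (gm (fst p) (- snd p))) \<in> borel_measurable (lborel \<Otimes>\<^sub>M M)"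
  proof -
    have "(\<lambda>p. rho n (gm (fst p) (- snd p))) \<in> borel_measurable borel"
      by (rule borel_measurable_continuous_onI[OF smooth_continuous_on[OF smooth_kernel[OF smooth_rho]]])
    moreover have "sets (lborel \<Otimes>\<^sub>M M) = sets (borel :: ('a \<times> 'a) measure)"
      using M(1) by (simp add: borel_prod[symmetric] cong: sets_pair_measure_cong)
    ultimately show ?thesis by (simp cong: measurable_cong_sets)
  qed
  let ?h = "\<lambda>x y. \<psi> x * (rho n (gm x (- y)) * f y)"
  have i\<psi>: "integrable lborel \<psi>" by (rule integrable_continuous_compact_support[OF \<psi>])
  have mh: "case_prod ?h \<in> borel_measurable (lborel \<Otimes>\<^sub>M M)"
    unfolding case_prod_beta' by measurable
  have im: "integrable M (\<lambda>y. rho n (gm x (- y)) * f y)" for x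
    by (rule mol_integrable[OF M(1) f smooth_rho])
  have int: "integrable (lborel \<Otimes>\<^sub>M M) (case_prod ?h)"
  proof (rule P.Fubini_integrable[OF mh])
    show "AE x in lborel. integrable M (\<lambda>y. case_prod ?h (x, y))" using im by simp
    show "integrable lborel (\<lambda>x. \<integral>y. norm (case_prod ?h (x, y)) \<partial>M)"
    proof (rule Bochner_Integration.integrable_bound)
      show "integrable lborel (\<lambda>x. \<psi> x * (C * (\<integral>y. \<bar>f y\<bar> \<partial>M)))" using i\<psi> by simp
      show "(\<lambda>x. \<integral>y. norm (case_prod ?h (x, y)) \<partial>M) \<in> borel_measurable lborel"
        using mh by (intro M.borel_measurable_lebesgue_integral) (simp add: case_prod_beta')
      show "AE x in lborel. norm (\<integral>y. norm (case_prod ?h (x, y)) \<partial>M) \<le> norm (\<psi> x * (C * (\<integral>y. \<bar>f y\<bar> \<partial>M)))"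
      proof (rule AE_I2)
        fix x
        have "(\<integral>y. \<bar>rho n (gm x (- y)) * f y\<bar> \<partial>M) \<le> (\<integral>y. C * \<bar>f y\<bar> \<partial>M)"
          proof (rule integral_mono)
            show "\<bar>rho n (gm x (- y)) * f y\<bar> \<le> C * \<bar>f y\<bar>" for y
              unfolding abs_mult using C by (intro mult_right_mono) auto
          qed (use im[of x] f(1) in \<open>auto simp del: abs_mult\<close>)
        then have "\<bar>\<psi> x\<bar> * (\<integral>y. \<bar>rho n (gm x (- y)) * f y\<bar> \<partial>M) \<le> \<bar>\<psi> x\<bar> * (C * (\<integral>y. \<bar>f y\<bar> \<partial>M))"
          by (intro mult_left_mono) auto
        moreover have "(\<integral>y. norm (case_prod ?h (x, y)) \<partial>M) = \<bar>\<psi> x\<bar> * (\<integral>y. \<bar>rho n (gm x (- y)) * f y\<bar> \<partial>M)"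
          by (simp add: abs_mult[of "\<psi> x"])
        ultimately show "norm (\<integral>y. norm (case_prod ?h (x, y)) \<partial>M) \<le> norm (\<psi> x * (C * (\<integral>y. \<bar>f y\<bar> \<partial>M)))"
          using C by (simp add: abs_mult)
      qed
    qed
  qed
  have "(\<integral>x. \<psi> x * mol gm M (rho n) f x \<partial>lborel) = (\<integral>x. (\<integral>y. ?h x y \<partial>M) \<partial>lborel)"
    by (simp add: mol_def)
  also have "\<dots> = (\<integral>y. (\<integral>x. ?h x y \<partial>lborel) \<partial>M)"
    by (rule P.Fubini_integral[OF int, symmetric])
  also have "\<dots> = (\<integral>y. f y * mol gm lborel (rho n) \<psi> y \<partial>M)"
  proof (intro Bochner_Integration.integral_cong refl)
    fix y
    have "(\<integral>x. ?h x y \<partial>lborel) = (\<integral>x. f y * (rho n (gm y (- x)) * \<psi> x) \<partial>lborel)"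
      by (intro Bochner_Integration.integral_cong refl) (simp add: kernel_sym[of n y] mult_ac)
    then show "(\<integral>x. ?h x y \<partial>lborel) = f y * mol gm lborel (rho n) \<psi> y" by (simp add: mol_def)
  qed
  finally show ?thesis .
qed

context
  fixes f :: "'a \<Rightarrow> real" and B
  assumes f: "integrable lborel f" "compact B" "\<And>y. y \<notin> B \<Longrightarrow> f y = 0"
begin

lemma smooth_mol_rho: "smooth (mol gm lborel (rho n) f)"
  by (rule smooth_mol[OF _ f smooth_rho]) simp

lemma integrable_mol: "integrable lborel (mol gm lborel (rho n) f)"
  by (rule integrable_continuous_compact_support[OF smooth_continuous_on[OF smooth_mol_rho] compact_gthick[OF f(2)]])
    (rule mol_zero_outside[OF f(3)])

text \<open>The mollification of \<open>f\<close> is dominated by that of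
  \<open>\<bar>f\<bar>\<close>, whose integral is computed by duality with the constant 1. As
  duality asks for compact support, the constant is replaced by a cutoff that equals 1 where the
  mollification lives; its own mollification is at most 1.\<close>

lemma mol_L1_contraction:
  "(\<integral>x. \<bar>mol gm lborel (rho n) f x\<bar> \<partial>lborel) \<le> (\<integral>x. \<bar>f x\<bar> \<partial>lborel)"
proof -
  let ?a = "\<lambda>x. \<bar>f x\<bar>" and ?K = "gthick B 1"
  have a: "integrable lborel ?a" "\<And>y. y \<notin> B \<Longrightarrow> ?a y = 0" using f by auto
  have K: "compact ?K" by (rule compact_gthick[OF f(2)])
  obtain \<psi> where \<psi>: "test_fun UNIV \<psi>" "\<And>x. 0 \<le> \<psi> x \<and> \<psi> x \<le> 1" "\<And>x. x \<in> ?K \<Longrightarrow> \<psi> x = 1"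
    using smooth_cutoff_on[OF K open_UNIV subset_UNIV] by blast
  have sm: "smooth (mol gm lborel (rho n) ?a)" by (rule smooth_mol[OF _ a(1) f(2) a(2) smooth_rho]) simp
  have ia: "integrable lborel (mol gm lborel (rho n) ?a)"
    by (rule integrable_continuous_compact_support[OF smooth_continuous_on[OF sm] K])
      (rule mol_zero_outside[OF a(2)])
  have \<psi>c: "continuous_on UNIV \<psi>" "compact (tsupport \<psi>)"
    using \<psi> by (auto simp: test_fun_iff intro: smooth_continuous_on)
  have "(\<integral>x. \<bar>mol gm lborel (rho n) f x\<bar> \<partial>lborel) \<le> (\<integral>x. mol gm lborel (rho n) ?a x \<partial>lborel)"
  proof (rule integral_mono)
    show "\<bar>mol gm lborel (rho n) f x\<bar> \<le> mol gm lborel (rho n) ?a x" for x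
    proof -
      have "\<bar>mol gm lborel (rho n) f x\<bar> \<le> (\<integral>y. \<bar>rho n (gm x (- y)) * f y\<bar> \<partial>lborel)"
        unfolding mol_def by (rule integral_abs_bound)
      also have "\<dots> = mol gm lborel (rho n) ?a x" by (simp add: mol_def abs_mult rho_nonneg)
      finally show ?thesis .
    qed
  qed (use integrable_mol ia in auto)
  also have "\<dots> = (\<integral>x. \<psi> x * mol gm lborel (rho n) ?a x \<partial>lborel)"
  proof (intro Bochner_Integration.integral_cong refl)
    fix x show "mol gm lborel (rho n) ?a x = \<psi> x * mol gm lborel (rho n) ?a x"
      using \<psi>(3)[of x] mol_zero_outside[OF a(2), where x = x] by (cases "x \<in> ?K") auto
  qed
  also have "\<dots> = (\<integral>y. \<bar>f y\<bar> * mol gm lborel (rho n) \<psi> y \<partial>lborel)"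
    by (rule mol_duality[OF _ _ a(1) f(2) a(2) \<psi>c]) (auto simp: lborel.sigma_finite_measure_axioms tsupport_zero)
  also have "\<dots> \<le> (\<integral>y. \<bar>f y\<bar> \<partial>lborel)"
  proof -
    have b: "\<bar>mol gm lborel (rho n) \<psi> y\<bar> \<le> 1" for y
      by (rule mol_bound) (use \<psi> in \<open>auto intro!: borel_measurable_continuous_onI[OF \<psi>c(1)] AE_I2\<close>)
    have i\<psi>: "integrable lborel \<psi>"
      by (rule integrable_continuous_compact_support[OF \<psi>c]) (auto simp: tsupport_zero)
    have s\<psi>: "smooth (mol gm lborel (rho n) \<psi>)"
      by (rule smooth_mol[OF _ i\<psi> \<psi>c(2) _ smooth_rho]) (auto simp: tsupport_zero)
    have [measurable]: "mol gm lborel (rho n) \<psi> \<in> borel_measurable borel"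
      by (rule borel_measurable_continuous_onI[OF smooth_continuous_on[OF s\<psi>]])
    have bb: "\<bar>f y\<bar> * mol gm lborel (rho n) \<psi> y \<le> \<bar>f y\<bar>" "\<bar>f y\<bar> * \<bar>mol gm lborel (rho n) \<psi> y\<bar> \<le> \<bar>f y\<bar>" for y
      using b[of y] mult_left_le[of "mol gm lborel (rho n) \<psi> y" "\<bar>f y\<bar>"]
        mult_left_le[of "\<bar>mol gm lborel (rho n) \<psi> y\<bar>" "\<bar>f y\<bar>"] by auto
    show ?thesis
    proof (rule integral_mono[OF _ a(1)])
      show "integrable lborel (\<lambda>y. \<bar>f y\<bar> * mol gm lborel (rho n) \<psi> y)"
        by (rule Bochner_Integration.integrable_bound[OF a(1)]) (use f bb in \<open>auto simp: abs_mult\<close>)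
    qed (rule bb(1))
  qed
  finally show ?thesis .
qed

end

lemma mol_diff:
  assumes "integrable lborel f" "compact B" "\<And>y. y \<notin> B \<Longrightarrow> f y = 0"
    and "integrable lborel g" "compact B'" "\<And>y. y \<notin> B' \<Longrightarrow> g y = 0"
  shows "mol gm lborel (rho n) (\<lambda>y. f y - g y) x = mol gm lborel (rho n) f x - mol gm lborel (rho n) g x"
  unfolding mol_def right_diff_distrib
  using mol_integrable[OF _ assms(1-3) smooth_rho] mol_integrable[OF _ assms(4-6) smooth_rho]
  by (intro Bochner_Integration.integral_diff) simp_all

lemma mol_L1_tendsto_continuous:
  assumes c: "continuous_on UNIV c" "compact K" "\<And>x. x \<notin> K \<Longrightarrow> c x = 0"
  shows "(\<lambda>n. \<integral>x. \<bar>mol gm lborel (rho n) c x - c x\<bar> \<partial>lborel) \<longlonglongrightarrow> 0"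
proof -
  have ic: "integrable lborel c" by (rule integrable_continuous_compact_support[OF c])
  obtain C where C: "C > 0" "\<And>x. \<bar>c x\<bar> \<le> C" using continuous_compact_support_bounded[OF c] by blast
  let ?B = "gthick K 1 \<union> K"
  have B: "compact ?B" using compact_gthick c(2) by blast
  have m: "mol gm lborel (rho n) c \<in> borel_measurable borel" for n
    by (rule borel_measurable_continuous_onI[OF smooth_continuous_on[OF smooth_mol_rho[OF ic c(2,3)]]])
  have "(\<lambda>n. \<integral>x. \<bar>mol gm lborel (rho n) c x - c x\<bar> \<partial>lborel) \<longlonglongrightarrow> (\<integral>x. \<bar>c x - c x\<bar> \<partial>lborel)"
  proof (rule integral_dominated_convergence[where w = "\<lambda>x. 2 * C * indicator ?B x"])
    show "integrable lborel (\<lambda>x. 2 * C * indicator ?B x)"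
      using borel_integrable_compact[OF B continuous_on_const[of ?B "1::real"]] by simp
    show "AE x in lborel. (\<lambda>n. \<bar>mol gm lborel (rho n) c x - c x\<bar>) \<longlonglongrightarrow> \<bar>c x - c x\<bar>"
      using c(1) mol_tendsto_at[OF ic c(2,3)]
      by (intro AE_I2 tendsto_rabs tendsto_diff tendsto_const) (auto simp: continuous_on_eq_continuous_at)
    show "AE x in lborel. norm \<bar>mol gm lborel (rho n) c x - c x\<bar> \<le> 2 * C * indicator ?B x" for n
    proof (rule AE_I2)
      fix x
      have "\<bar>mol gm lborel (rho n) c x\<bar> \<le> C"
        by (rule mol_bound) (use C in \<open>auto intro!: borel_measurable_continuous_onI[OF c(1)] AE_I2\<close>)
      then have "\<bar>mol gm lborel (rho n) c x - c x\<bar> \<le> 2 * C" using C(2)[of x] by linarith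
      moreover have "mol gm lborel (rho n) c x - c x = 0" if "x \<notin> ?B"
        using that mol_zero_outside[OF c(3), where x = x] c(3)[of x] by auto
      ultimately show "norm \<bar>mol gm lborel (rho n) c x - c x\<bar> \<le> 2 * C * indicator ?B x"
        by (cases "x \<in> ?B") auto
    qed
  qed (use m borel_measurable_continuous_onI[OF c(1)] in auto)
  then show ?thesis by simp
qed

text \<open>A three-term estimate: approximate \<open>f\<close> by a continuous function, for which
  convergence is dominated and pointwise, and control the mollified error by the L1
  contraction.\<close>

lemma mol_L1_tendsto:
  assumes f: "integrable lborel f" "compact B" "\<And>y. y \<notin> B \<Longrightarrow> f y = 0"
  shows "(\<lambda>n. \<integral>x. \<bar>mol gm lborel (rho n) f x - f x\<bar> \<partial>lborel) \<longlonglongrightarrow> 0"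
proof (rule tendstoI)
  fix e :: real assume e: "e > 0"
  then have "e / 3 > 0" by simp
  from L1_dense_continuous_compact_support[OF f(1) this]
  obtain c K where c: "continuous_on UNIV c" "compact K" "\<And>x. x \<notin> K \<Longrightarrow> c x = 0"
      "(\<integral>x. \<bar>f x - c x\<bar> \<partial>lborel) < e / 3"
    by blast
  have ic: "integrable lborel c" by (rule integrable_continuous_compact_support[OF c(1-3)])
  have fc: "integrable lborel (\<lambda>x. f x - c x)" "compact (B \<union> K)" "\<And>x. x \<notin> B \<union> K \<Longrightarrow> f x - c x = 0"
    using f ic c by auto
  have "\<forall>\<^sub>F n in sequentially. (\<integral>x. \<bar>mol gm lborel (rho n) c x - c x\<bar> \<partial>lborel) < e / 3"
    by (rule order_tendstoD(2)[OF mol_L1_tendsto_continuous[OF c(1-3)] \<open>e / 3 > 0\<close>])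
  then show "\<forall>\<^sub>F n in sequentially. dist (\<integral>x. \<bar>mol gm lborel (rho n) f x - f x\<bar> \<partial>lborel) 0 < e"
  proof eventually_elim
    case (elim n)
    have i: "integrable lborel (mol gm lborel (rho n) f)" "integrable lborel (mol gm lborel (rho n) c)"
      "integrable lborel (mol gm lborel (rho n) (\<lambda>x. f x - c x))"
      using integrable_mol[OF f] integrable_mol[OF ic c(2,3)] integrable_mol[OF fc] by simp_all
    have "(\<integral>x. \<bar>mol gm lborel (rho n) f x - f x\<bar> \<partial>lborel) \<le>
      (\<integral>x. \<bar>mol gm lborel (rho n) (\<lambda>x. f x - c x) x\<bar> + (\<bar>mol gm lborel (rho n) c x - c x\<bar> + \<bar>f x - c x\<bar>) \<partial>lborel)"
    proof (rule integral_mono)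
      show "\<bar>mol gm lborel (rho n) f x - f x\<bar> \<le>
        \<bar>mol gm lborel (rho n) (\<lambda>x. f x - c x) x\<bar> + (\<bar>mol gm lborel (rho n) c x - c x\<bar> + \<bar>f x - c x\<bar>)" for x
        using mol_diff[OF f ic c(2,3), of n x] by linarith
    qed (use i f(1) ic in auto)
    also have "\<dots> = (\<integral>x. \<bar>mol gm lborel (rho n) (\<lambda>x. f x - c x) x\<bar> \<partial>lborel) +
      ((\<integral>x. \<bar>mol gm lborel (rho n) c x - c x\<bar> \<partial>lborel) + (\<integral>x. \<bar>f x - c x\<bar> \<partial>lborel))"
      using i f(1) ic by simp
    also have "\<dots> < e"
      using mol_L1_contraction[OF fc, of n] elim c(4) by linarith
    finally show ?case by (simp add: dist_real_def)
  qed
qed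

text \<open>The factors \<open>c n\<close> may change with \<open>n\<close> because the chain rule
  produces coefficients that depend on the mollified function itself. L1 convergence of the
  mollifications absorbs the error, and only almost everywhere convergence of bounded factors is
  left.\<close>

lemma mol_varying_weak_tendsto:
  assumes f: "integrable lborel f" "compact B" "\<And>y. y \<notin> B \<Longrightarrow> f y = 0"
    and c: "\<And>n. c n \<in> borel_measurable borel" "c0 \<in> borel_measurable borel" "\<And>n. AE x in lborel. \<bar>c n x\<bar> \<le> D"
    and lim: "AE x in lborel. (\<lambda>n. c n x) \<longlonglongrightarrow> c0 x"
  shows "(\<lambda>n. \<integral>x. c n x * mol gm lborel (rho n) f x \<partial>lborel) \<longlonglongrightarrow> (\<integral>x. c0 x * f x \<partial>lborel)"
proof -
  note c(1,2) [measurable]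
  have ih: "integrable lborel (\<lambda>x. c n x * u x)" if u: "integrable lborel u" for u :: "'a \<Rightarrow> real" and n
  proof (rule Bochner_Integration.integrable_bound)
    show "integrable lborel (\<lambda>x. D * u x)" using u by simp
    show "AE x in lborel. norm (c n x * u x) \<le> norm (D * u x)"
      using c(3)[of n] by eventually_elim (auto simp: abs_mult intro!: mult_right_mono)
  qed (use u in auto)
  have i: "integrable lborel (mol gm lborel (rho n) f)" for n by (rule integrable_mol[OF f])
  have 1: "(\<lambda>n. \<integral>x. c n x * f x \<partial>lborel) \<longlonglongrightarrow> (\<integral>x. c0 x * f x \<partial>lborel)"
  proof (rule integral_dominated_convergence[where w = "\<lambda>x. \<bar>D\<bar> * \<bar>f x\<bar>"])
    show "AE x in lborel. (\<lambda>n. c n x * f x) \<longlonglongrightarrow> c0 x * f x"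
      using lim by eventually_elim (intro tendsto_mult tendsto_const)
    show "AE x in lborel. norm (c n x * f x) \<le> \<bar>D\<bar> * \<bar>f x\<bar>" for n
      using c(3)[of n] by eventually_elim (auto simp: abs_mult intro!: mult_right_mono)
  qed (use f(1) in auto)
  have 2: "(\<lambda>n. \<integral>x. c n x * (mol gm lborel (rho n) f x - f x) \<partial>lborel) \<longlonglongrightarrow> 0"
  proof (rule tendsto_0_le[OF mol_L1_tendsto[OF f], of _ "\<bar>D\<bar>"])
    show "\<forall>\<^sub>F n in sequentially. norm (\<integral>x. c n x * (mol gm lborel (rho n) f x - f x) \<partial>lborel)
       \<le> norm (\<integral>x. \<bar>mol gm lborel (rho n) f x - f x\<bar> \<partial>lborel) * \<bar>D\<bar>"
    proof (rule always_eventually, rule allI)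
      fix n
      have "\<bar>\<integral>x. c n x * (mol gm lborel (rho n) f x - f x) \<partial>lborel\<bar> \<le> (\<integral>x. \<bar>c n x * (mol gm lborel (rho n) f x - f x)\<bar> \<partial>lborel)"
        by (rule integral_abs_bound)
      also have "\<dots> \<le> (\<integral>x. \<bar>D\<bar> * \<bar>mol gm lborel (rho n) f x - f x\<bar> \<partial>lborel)"
      proof (rule integral_mono_AE)
        show "AE x in lborel. \<bar>c n x * (mol gm lborel (rho n) f x - f x)\<bar> \<le> \<bar>D\<bar> * \<bar>mol gm lborel (rho n) f x - f x\<bar>"
          using c(3)[of n] by eventually_elim (auto simp: abs_mult intro!: mult_right_mono)
      qed (use ih[OF Bochner_Integration.integrable_diff[OF i f(1)]] i f(1) in auto)
      finally show "norm (\<integral>x. c n x * (mol gm lborel (rho n) f x - f x) \<partial>lborel)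
       \<le> norm (\<integral>x. \<bar>mol gm lborel (rho n) f x - f x\<bar> \<partial>lborel) * \<bar>D\<bar>"
        by (simp add: mult.commute)
    qed
  qed
  have "(\<integral>x. c n x * f x \<partial>lborel) + (\<integral>x. c n x * (mol gm lborel (rho n) f x - f x) \<partial>lborel)
     = (\<integral>x. c n x * mol gm lborel (rho n) f x \<partial>lborel)" for n
    unfolding right_diff_distrib using ih[OF i] ih[OF f(1)] by simp
  with tendsto_add[OF 1 2] show ?thesis by simp
qed

lemma mol_weak_tendsto:
  assumes f: "integrable lborel f" "compact B" "\<And>y. y \<notin> B \<Longrightarrow> f y = 0"
    and h: "h \<in> borel_measurable borel" "AE x in lborel. \<bar>h x\<bar> \<le> C"
  shows "(\<lambda>n. \<integral>x. h x * mol gm lborel (rho n) f x \<partial>lborel) \<longlonglongrightarrow> (\<integral>x. h x * f x \<partial>lborel)"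
  by (rule mol_varying_weak_tendsto[OF f h(1) h(1) h(2) AE_I2[OF tendsto_const]])

end

section \<open>Perimeter measures\<close>

lemma hlayer_inner_eq_0:
  assumes "v \<in> hlayer w j" "b \<in> Basis" "w b \<noteq> j" shows "v \<bullet> b = 0"
  using assms(1) unfolding hlayer_def
proof (induction rule: span_induct)
  case base
  then show ?case unfolding subspace_def by (simp add: inner_add_left)
next
  case (step x)
  then show ?case using assms by (auto simp: inner_Basis)
qed

text \<open>The sum of the two measures dominates both, so both have densities with respect to it.
  This makes a Lebesgue decomposition explicit: the part of \<open>M2\<close> singular to
  \<open>M1\<close> is carried by the zero set of \<open>p\<close>, and elsewhere \<open>M2\<close>
  has density \<open>q / p\<close> with respect to \<open>M1\<close>.\<close>

lemma common_densities:
  fixes M1 M2 :: "'a::euclidean_space measure"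
  assumes M1: "sets M1 = sets borel" and M2: "sets M2 = sets borel"
    and A: "countable \<A>" "\<A> \<subseteq> sets borel" "\<Union>\<A> = UNIV"
    and fin: "\<And>A. A \<in> \<A> \<Longrightarrow> emeasure M1 A < \<infinity> \<and> emeasure M2 A < \<infinity>"
  obtains m p q where "sets m = sets borel" "sigma_finite_measure m"
    "\<And>B. B \<in> sets borel \<Longrightarrow> emeasure m B = emeasure M1 B + emeasure M2 B"
    "p \<in> borel_measurable borel" "q \<in> borel_measurable borel" "\<And>x. p x \<ge> 0" "\<And>x. q x \<ge> (0::real)"
    "M1 = density m (\<lambda>x. ennreal (p x))" "M2 = density m (\<lambda>x. ennreal (q x))"
proof -
  define m where "m = measure_of UNIV (sets borel) (\<lambda>B. emeasure M1 B + emeasure M2 B)"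
  have sm: "sets m = sets borel" unfolding m_def
    using sets.sigma_sets_eq[of "borel :: 'a measure"] by simp
  have em: "emeasure m B = emeasure M1 B + emeasure M2 B" if "B \<in> sets borel" for B
    unfolding m_def
  proof (rule emeasure_measure_of_sigma)
    show "sigma_algebra UNIV (sets (borel :: 'a measure))"
      using sets.sigma_algebra_axioms[of "borel :: 'a measure"] by simp
    show "positive (sets borel) (\<lambda>B. emeasure M1 B + emeasure M2 B)" by (simp add: positive_def)
    show "countably_additive (sets borel) (\<lambda>B. emeasure M1 B + emeasure M2 B)"
    proof (rule countably_additiveI)
      fix X :: "nat \<Rightarrow> 'a set" assume X: "range X \<subseteq> sets borel" "disjoint_family X"
      have "(\<Sum>i. emeasure M1 (X i) + emeasure M2 (X i)) = (\<Sum>i. emeasure M1 (X i)) + (\<Sum>i. emeasure M2 (X i))"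
        by (intro suminf_add[symmetric]) auto
      also have "\<dots> = emeasure M1 (\<Union>i. X i) + emeasure M2 (\<Union>i. X i)"
        using X M1 M2 by (simp add: suminf_emeasure)
      finally show "(\<Sum>i. emeasure M1 (X i) + emeasure M2 (X i)) = emeasure M1 (\<Union>i. X i) + emeasure M2 (\<Union>i. X i)" .
    qed
  qed (rule that)
  have sp: "space m = UNIV" using sets_eq_imp_space_eq[OF sm] by simp
  have sfm: "sigma_finite_measure m"
  proof
    show "\<exists>A. countable A \<and> A \<subseteq> sets m \<and> \<Union> A = space m \<and> (\<forall>a\<in>A. emeasure m a \<noteq> \<infinity>)"
      using A fin em by (intro exI[of _ \<A>]) (auto simp: sm sp subset_iff less_top)
  qed
  interpret m: sigma_finite_measure m by (rule sfm)
  have RN: "\<exists>p\<in>borel_measurable borel. (\<forall>x. p x \<ge> (0::real)) \<and> M = density m (\<lambda>x. ennreal (p x))"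
    if M: "sets M = sets borel" "\<And>A. A \<in> \<A> \<Longrightarrow> emeasure M A < \<infinity>" "\<And>B. B \<in> sets borel \<Longrightarrow> emeasure M B \<le> emeasure m B" for M
  proof -
    have spM: "space M = UNIV" using sets_eq_imp_space_eq[OF M(1)] by simp
    have sf: "sigma_finite_measure M"
    proof
      show "\<exists>A. countable A \<and> A \<subseteq> sets M \<and> \<Union> A = space M \<and> (\<forall>a\<in>A. emeasure M a \<noteq> \<infinity>)"
        using A M by (intro exI[of _ \<A>]) (auto simp: spM subset_iff less_top)
    qed
    have ac: "absolutely_continuous m M"
      unfolding absolutely_continuous_def
    proof
      fix B assume "B \<in> null_sets m"
      then have "B \<in> sets borel" "emeasure m B = 0" using sm by auto
      moreover have "emeasure M B \<le> emeasure m B" using M(3) \<open>B \<in> sets borel\<close> .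
      ultimately show "B \<in> null_sets M" using M(1) by (auto simp: null_sets_def)
    qed
    have s: "sets M = sets m" using M sm by simp
    let ?R = "RN_deriv m M"
    have R: "density m ?R = M" by (rule m.density_RN_deriv[OF ac s])
    have Rf: "AE x in m. ?R x \<noteq> \<infinity>" by (rule m.RN_deriv_finite[OF sf ac s])
    have [measurable]: "?R \<in> borel_measurable m" by simp
    show ?thesis
    proof (intro bexI conjI allI)
      show "(\<lambda>x. enn2real (?R x)) \<in> borel_measurable borel"
        using sm by (auto cong: measurable_cong_sets)
      have "M = density m ?R" using R by simp
      also have "\<dots> = density m (\<lambda>x. ennreal (enn2real (?R x)))"
        by (rule density_cong) (use Rf in \<open>auto elim!: eventually_mono simp: less_top\<close>)
      finally show "M = density m (\<lambda>x. ennreal (enn2real (?R x)))" .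
    qed simp
  qed
  obtain p where p: "p \<in> borel_measurable borel" "\<And>x. p x \<ge> (0::real)" "M1 = density m (\<lambda>x. ennreal (p x))"
    using RN[OF M1] fin em by auto
  obtain q where q: "q \<in> borel_measurable borel" "\<And>x. q x \<ge> (0::real)" "M2 = density m (\<lambda>x. ennreal (q x))"
    using RN[OF M2] fin em by auto
  show ?thesis by (rule that[OF sm sfm em p(1) q(1) p(2) q(2) p(3) q(3)])
qed

text \<open>Pieces for \<sigma>-finiteness on the whole space: a perimeter measure on
  \<open>U\<close> is finite on compact subsets of \<open>U\<close> and null on sets that miss
  \<open>U\<close>, while boundedness makes Lebesgue measure finite on both kinds.\<close>

lemma open_finite_cover:
  fixes U :: "'a::euclidean_space set"
  assumes "open U"
  obtains \<A> where "countable \<A>" "\<A> \<subseteq> sets borel" "\<Union>\<A> = UNIV"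
    "\<And>A. A \<in> \<A> \<Longrightarrow> bounded A \<and> ((compact A \<and> A \<subseteq> U) \<or> A \<subseteq> - U)"
proof -
  obtain C :: "nat \<Rightarrow> 'a set" where C: "\<And>n. compact (C n)" "\<And>n. C n \<subseteq> U" "(\<Union>n. C n) = U"
    using open_eq_Union_compact[OF assms] by blast
  let ?D = "\<lambda>n::nat. - U \<inter> cball 0 (real n)"
  show ?thesis
  proof (rule that[of "range C \<union> range ?D"])
    show "\<Union> (range C \<union> range ?D) = UNIV"
    proof (intro set_eqI iffI UNIV_I)
      fix x :: 'a
      obtain n :: nat where "norm x \<le> real n" using real_arch_simple by blast
      then show "x \<in> \<Union> (range C \<union> range ?D)" using C(3) by (cases "x \<in> U") auto
    qed
    show "range C \<union> range ?D \<subseteq> sets borel"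
      using C(1) assms by (auto simp: compact_imp_closed intro!: borel_closed closed_Int)
    fix A assume "A \<in> range C \<union> range ?D"
    then show "bounded A \<and> ((compact A \<and> A \<subseteq> U) \<or> A \<subseteq> - U)"
      using C by (auto intro: compact_imp_bounded bounded_subset[OF bounded_cball])
  qed simp
qed

section \<open>Perimeter measures in scalar form\<close>

context stratified
begin

text \<open>A working form of \<open>perim_rep\<close>: Borel data, \<open>lborel\<close>, and test
  fields with a single component along one horizontal basis vector. The indicator is replaced by a
  function \<open>h\<close>, so that null-set modifications and restrictions to smaller open sets
  keep the same shape.\<close>

definition perim_s :: "'a set \<Rightarrow> ('a \<Rightarrow> real) \<Rightarrow> 'a measure \<Rightarrow> ('a \<Rightarrow> 'a) \<Rightarrow> bool" where
  "perim_s Om h \<nu> \<sigma> \<longleftrightarrow> sets \<nu> = sets borel \<and> emeasure \<nu> (UNIV - Om) = 0 \<and>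
     (\<forall>K. compact K \<and> K \<subseteq> Om \<longrightarrow> emeasure \<nu> K < \<infinity>) \<and>
     \<sigma> \<in> borel_measurable borel \<and> (AE x in \<nu>. norm (\<sigma> x) = 1 \<and> \<sigma> x \<in> hlayer w 1) \<and>
     (\<forall>\<psi> b. test_fun Om \<psi> \<longrightarrow> b \<in> Basis \<longrightarrow> w b = 1 \<longrightarrow>
        (\<integral>x. h x * Xf gm b \<psi> x \<partial>lborel) = - (\<integral>x. \<psi> x * (\<sigma> x \<bullet> b) \<partial>\<nu>))"

context
  fixes Om h \<nu> \<sigma>
  assumes Om: "open Om" and P: "perim_s Om h \<nu> \<sigma>"
begin

lemma perim_sets: "sets \<nu> = sets borel" and perim_space: "space \<nu> = UNIV"
  and perim_fin: "compact K \<Longrightarrow> K \<subseteq> Om \<Longrightarrow> emeasure \<nu> K < \<infinity>"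
  and perim_sigma_measurable: "\<sigma> \<in> borel_measurable borel"
  and perim_AE: "AE x in \<nu>. norm (\<sigma> x) = 1 \<and> \<sigma> x \<in> hlayer w 1"
  and perim_ibp: "test_fun Om \<psi> \<Longrightarrow> b \<in> Basis \<Longrightarrow> w b = 1 \<Longrightarrow>
        (\<integral>x. h x * Xf gm b \<psi> x \<partial>lborel) = - (\<integral>x. \<psi> x * (\<sigma> x \<bullet> b) \<partial>\<nu>)"
  using P sets_eq_imp_space_eq[of \<nu> borel] by (auto simp: perim_s_def)

lemma perim_AE_Om: "AE x in \<nu>. x \<in> Om"
proof (rule AE_I'[of "UNIV - Om"])
  show "UNIV - Om \<in> null_sets \<nu>" using P Om by (auto simp: perim_s_def null_sets_def)
qed auto

lemma perim_AE_inner: "b \<in> Basis \<Longrightarrow> AE x in \<nu>. \<bar>\<sigma> x \<bullet> b\<bar> \<le> 1"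
  using perim_AE by eventually_elim (metis Basis_le_norm)

lemma perim_cover_finite:
  assumes "(compact A \<and> A \<subseteq> Om) \<or> A \<subseteq> - Om" shows "emeasure \<nu> A < \<infinity>"
proof (cases "compact A \<and> A \<subseteq> Om")
  case False
  then have "emeasure \<nu> A \<le> emeasure \<nu> (UNIV - Om)"
    using assms Om by (intro emeasure_mono) (auto simp: perim_sets)
  then show ?thesis using P by (simp add: perim_s_def)
qed (use perim_fin in blast)

lemma perim_sigma_finite: "sigma_finite_measure \<nu>"
proof
  obtain \<A> where A: "countable \<A>" "\<A> \<subseteq> sets borel" "\<Union>\<A> = UNIV"
    "\<And>A. A \<in> \<A> \<Longrightarrow> bounded A \<and> ((compact A \<and> A \<subseteq> Om) \<or> A \<subseteq> - Om)"
    using open_finite_cover[OF Om] by metis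
  show "\<exists>A. countable A \<and> A \<subseteq> sets \<nu> \<and> \<Union> A = space \<nu> \<and> (\<forall>a\<in>A. emeasure \<nu> a \<noteq> \<infinity>)"
    using A perim_cover_finite by (intro exI[of _ \<A>]) (auto simp: perim_sets perim_space less_top)
qed

lemma perim_integrable_indicator:
  assumes "A \<in> sets borel" "A \<subseteq> K" "compact K" "K \<subseteq> Om"
  shows "integrable \<nu> (indicator A :: 'a \<Rightarrow> real)"
proof (rule integrable_real_indicator)
  show "A \<in> sets \<nu>" using assms by (simp add: perim_sets)
  have "emeasure \<nu> A \<le> emeasure \<nu> K" using assms by (intro emeasure_mono) (auto simp: perim_sets compact_imp_closed)
  then show "emeasure \<nu> A < \<infinity>" using perim_fin[OF assms(3,4)] by (rule le_less_trans)
qed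

lemma perim_integrable_sigma:
  assumes "A \<in> sets borel" "A \<subseteq> K" "compact K" "K \<subseteq> Om" "b \<in> Basis"
  shows "integrable \<nu> (\<lambda>x. indicator A x * (\<sigma> x \<bullet> b))"
proof (rule Bochner_Integration.integrable_bound[OF perim_integrable_indicator[OF assms(1-4)]])
  have [measurable]: "\<sigma> \<in> borel_measurable \<nu>" "A \<in> sets \<nu>"
    using perim_sigma_measurable assms perim_sets by (auto cong: measurable_cong_sets)
  show "(\<lambda>x. indicator A x * (\<sigma> x \<bullet> b)) \<in> borel_measurable \<nu>" by measurable
  show "AE x in \<nu>. norm (indicator A x * (\<sigma> x \<bullet> b)) \<le> norm (indicator A x :: real)"
    using perim_AE_inner[OF assms(5)] by eventually_elim (auto simp: indicator_def)
qed

text \<open>When the kernel at \<open>x\<close> is supported in \<open>K1\<close> it is itself an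
  admissible test function. Inserting it in the perimeter identity shows that the derivative of the
  mollified function is the mollified derivative measure.\<close>

lemma perim_Xf_mol:
  assumes h: "h \<in> borel_measurable borel" "\<And>x. \<bar>h x\<bar> \<le> 1" and K1: "compact K1" "K1 \<subseteq> Om"
    and b: "b \<in> Basis" "w b = 1"
    and x: "\<And>y. rho n (gm x (- y)) \<noteq> 0 \<Longrightarrow> y \<in> K1"
  shows "Xf gm b (mol gm lborel (rho n) (\<lambda>y. indicator K1 y * h y)) x
    = mol gm \<nu> (rho n) (\<lambda>y. indicator K1 y * (\<sigma> y \<bullet> b)) x"
proof -
  let ?k = "\<lambda>y. rho n (gm x (- y))"
  have sk: "smooth ?k" by (rule smooth_kernel_snd[OF smooth_rho])
  have tk: "test_fun Om ?k" by (rule test_funI[OF sk x K1])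
  have int: "integrable lborel (\<lambda>y. indicator K1 y * h y)"
  proof (rule Bochner_Integration.integrable_bound)
    show "integrable lborel (indicator K1 :: 'a \<Rightarrow> real)"
      using borel_integrable_compact[OF K1(1) continuous_on_const[of K1 "1::real"]] by simp
    show "(\<lambda>y. indicator K1 y * h y) \<in> borel_measurable lborel"
      using h(1) K1(1) by (auto intro!: borel_measurable_times borel_measurable_indicator simp: compact_imp_closed)
    show "AE y in lborel. norm (indicator K1 y * h y) \<le> norm (indicator K1 y :: real)"
      using h(2) by (intro AE_I2) (auto simp: indicator_def)
  qed
  have z: "Xf gm b ?k y = 0" if "y \<notin> K1" for y
    by (rule Xf_zero_outside[OF sk compact_imp_closed[OF K1(1)] _ that]) (use x in blast)
  have "Xf gm b (mol gm lborel (rho n) (\<lambda>y. indicator K1 y * h y)) x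
    = - (\<integral>y. Xf gm b ?k y * (indicator K1 y * h y) \<partial>lborel)"
    by (rule Xf_mol[OF _ int K1(1) _ smooth_rho]) auto
  also have "(\<integral>y. Xf gm b ?k y * (indicator K1 y * h y) \<partial>lborel) = (\<integral>y. h y * Xf gm b ?k y \<partial>lborel)"
    by (intro Bochner_Integration.integral_cong refl) (use z in \<open>auto simp: indicator_def\<close>)
  also have "\<dots> = - (\<integral>y. ?k y * (\<sigma> y \<bullet> b) \<partial>\<nu>)" by (rule perim_ibp[OF tk b])
  also have "(\<integral>y. ?k y * (\<sigma> y \<bullet> b) \<partial>\<nu>) = mol gm \<nu> (rho n) (\<lambda>y. indicator K1 y * (\<sigma> y \<bullet> b)) x"
    unfolding mol_def by (intro Bochner_Integration.integral_cong refl) (use x in \<open>auto simp: indicator_def\<close>)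
  finally show ?thesis by simp
qed

end

section \<open>Singularity of the perimeter measure with respect to Lebesgue measure\<close>

lemma Xf_compose_real:
  assumes f: "smooth f" and g: "(g has_real_derivative g') (at (f x))"
  shows "Xf gm v (\<lambda>x. g (f x)) x = g' * Xf gm v f x"
proof -
  have 1: "((\<lambda>t. f (gm x (t *\<^sub>R v))) has_real_derivative Xf gm v f x) (at 0)"
    using Xf_DERIV[OF f, of x v 0] by simp
  have 2: "(g has_real_derivative g') (at (f (gm x (0 *\<^sub>R v))))" using g by simp
  show ?thesis unfolding Xf_def[of gm v "\<lambda>x. g (f x)"] using DERIV_imp_deriv[OF DERIV_chain2[OF 2 1]] .
qed

lemma Xf_ibp:
  assumes f: "smooth f" and \<psi>: "test_fun V \<psi>"
  shows "(\<integral>x. f x * Xf gm v \<psi> x \<partial>lborel) = - (\<integral>x. \<psi> x * Xf gm v f x \<partial>lborel)"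
proof -
  have s\<psi>: "smooth \<psi>" and K: "compact (tsupport \<psi>)" using \<psi> by (auto simp: test_fun_iff)
  have z: "\<psi> x = 0" if "x \<notin> tsupport \<psi>" for x using that by (rule tsupport_zero)
  have zX: "Xf gm v \<psi> x = 0" if "x \<notin> tsupport \<psi>" for x
    by (rule Xf_zero_outside[OF s\<psi> compact_imp_closed[OF K] z that])
  have i1: "integrable lborel (\<lambda>x. f x * Xf gm v \<psi> x)"
    by (rule integrable_continuous_compact_support[OF _ K])
      (use zX in \<open>auto intro!: smooth_continuous_on smooth_mult f smooth_Xf s\<psi>\<close>)
  have i2: "integrable lborel (\<lambda>x. \<psi> x * Xf gm v f x)"
    by (rule integrable_continuous_compact_support[OF _ K])
      (use z in \<open>auto intro!: smooth_continuous_on smooth_mult f smooth_Xf s\<psi>\<close>)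
  have "(\<integral>x. Xf gm v (\<lambda>x. f x * \<psi> x) x \<partial>lborel) = 0"
    by (rule integral_Xf_eq_0[OF smooth_mult[OF f s\<psi>] K]) (use z in auto)
  also have "(\<lambda>x. Xf gm v (\<lambda>x. f x * \<psi> x) x) = (\<lambda>x. f x * Xf gm v \<psi> x + \<psi> x * Xf gm v f x)"
    by (rule ext) (simp add: Xf_mult[OF f s\<psi>])
  finally show ?thesis using i1 i2 by simp
qed

lemma mol_nonneg: "(\<And>y. f y \<ge> 0) \<Longrightarrow> mol gm M (rho n) f x \<ge> 0"
  unfolding mol_def by (intro integral_nonneg_AE AE_I2 mult_nonneg_nonneg rho_nonneg)

lemma abs_mol_le: "\<bar>mol gm M (rho n) f x\<bar> \<le> mol gm M (rho n) (\<lambda>y. \<bar>f y\<bar>) x"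
proof -
  have "\<bar>mol gm M (rho n) f x\<bar> \<le> (\<integral>y. \<bar>rho n (gm x (- y)) * f y\<bar> \<partial>M)"
    unfolding mol_def by (rule integral_abs_bound)
  also have "\<dots> = mol gm M (rho n) (\<lambda>y. \<bar>f y\<bar>) x" by (simp add: mol_def abs_mult rho_nonneg)
  finally show ?thesis .
qed

text \<open>\<open>3 t\<^sup>2 - 2 t\<^sup>3\<close> fixes 0 and 1 and its derivative vanishes there: composing the mollified
  indicator with it leaves the limit unchanged but kills the absolutely continuous part of the derivative.\<close>

lemma perim_singular_bound:
  assumes Om: "open Om" and E: "E \<in> sets borel" and P: "perim_s Om (indicator E) \<nu> \<sigma>"
    and b: "b \<in> Basis" "w b = 1" and \<psi>: "test_fun Om \<psi>"
    and m: "sets m = sets borel" and pm: "p \<in> borel_measurable borel" and qm: "q \<in> borel_measurable borel"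
    and p0: "\<And>x. p x \<ge> 0" and q0: "\<And>x. q x \<ge> (0::real)"
    and Lp: "lborel = density m (\<lambda>x. ennreal (p x))" and nuq: "\<nu> = density m (\<lambda>x. ennreal (q x))"
  shows "\<bar>\<integral>x. \<psi> x * (\<sigma> x \<bullet> b) \<partial>\<nu>\<bar> \<le> 3/2 * (\<integral>x. indicator {x. p x = 0} x * \<bar>\<psi> x\<bar> \<partial>\<nu>)"
proof -
  let ?N = "{x. p x = 0}"
  note perim = Om P
  have snu: "sets \<nu> = sets borel" by (rule perim_sets[OF perim])
  have N: "?N \<in> sets borel" using pm by measurable
  have s\<psi>: "smooth \<psi>" and K: "compact (tsupport \<psi>)" "tsupport \<psi> \<subseteq> Om" using \<psi> by (auto simp: test_fun_iff)
  let ?K = "tsupport \<psi>"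
  have z\<psi>: "\<psi> x = 0" if "x \<notin> ?K" for x using that by (rule tsupport_zero)
  have zX: "Xf gm b \<psi> x = 0" if "x \<notin> ?K" for x
    by (rule Xf_zero_outside[OF s\<psi> compact_imp_closed[OF K(1)] z\<psi> that])
  obtain e where e: "e > 0" "cthick ?K e \<subseteq> Om" using compact_open_cthick[OF K(1) Om K(2)] .
  define K1 where "K1 = cthick ?K e"
  have K1: "compact K1" "K1 \<subseteq> Om" "?K \<subseteq> K1" using e compact_cthick[OF K(1)] subset_cthick[of e ?K] by (auto simp: K1_def)
  have K1b: "K1 \<in> sets borel" using K1 by (simp add: compact_imp_closed)
  \<comment> \<open>Localising by an indicator rather than by a smooth cutoff keeps \<open>u\<close>
    two-valued, so that the polynomial fixes it and the derivative of the polynomial vanishes on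
    it.\<close>
  define u where "u = (\<lambda>y. indicator K1 y * indicator E y :: real)"
  have u01: "u y = 0 \<or> u y = 1" for y by (auto simp: u_def indicator_def)
  have um [measurable]: "u \<in> borel_measurable borel" using E K1b unfolding u_def by measurable
  have iK1: "integrable lborel (indicator K1 :: 'a \<Rightarrow> real)"
    using borel_integrable_compact[OF K1(1) continuous_on_const[of K1 "1::real"]] by simp
  have u: "integrable lborel u" "compact K1" "\<And>y. y \<notin> K1 \<Longrightarrow> u y = 0"
  proof -
    show "integrable lborel u"
    proof (rule Bochner_Integration.integrable_bound[OF iK1])
      show "AE y in lborel. norm (u y) \<le> norm (indicator K1 y :: real)"
        by (intro AE_I2) (simp add: u_def indicator_def)
    qed simp
  qed (use K1 in \<open>auto simp: u_def\<close>)
  define f where "f n = mol gm lborel (rho n) u" for n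
  have sf: "smooth (f n)" for n unfolding f_def by (rule smooth_mol_rho[OF u])
  have fm [measurable]: "f n \<in> borel_measurable borel" for n
    by (rule borel_measurable_continuous_onI[OF smooth_continuous_on[OF sf]])
  have f01: "0 \<le> f n x" "f n x \<le> 1" for n x
  proof -
    have un: "u y \<ge> 0" "\<bar>u y\<bar> \<le> 1" for y using u01[of y] by auto
    show "0 \<le> f n x" unfolding f_def by (rule mol_nonneg) (rule un)
    have "\<bar>f n x\<bar> \<le> 1" unfolding f_def by (rule mol_bound[OF um]) (use un in auto)
    then show "f n x \<le> 1" by simp
  qed
  \<comment> \<open>Off \<open>?N\<close> the perimeter measure has density \<open>q / p\<close>
    with respect to Lebesgue measure. Thus \<open>a\<close> is the absolutely continuous part of the
    derivative in direction \<open>b\<close>, and \<open>s\<close> represents the part carried by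
    the Lebesgue null set \<open>?N\<close>.\<close>
  define a where "a = (\<lambda>y. indicator (K1 - ?N) y * ((\<sigma> y \<bullet> b) * (q y / p y)))"
  define s where "s = (\<lambda>y. indicator (K1 \<inter> ?N) y * (\<sigma> y \<bullet> b))"
  have \<sigma>m [measurable]: "\<sigma> \<in> borel_measurable borel" by (rule perim_sigma_measurable[OF perim])
  have bm [measurable]: "h \<in> borel_measurable m \<longleftrightarrow> h \<in> borel_measurable borel" for h :: "'a \<Rightarrow> real"
    using m by (auto cong: measurable_cong_sets)
  have pmm [measurable]: "p \<in> borel_measurable m" "q \<in> borel_measurable m" using pm qm bm by auto
  note pm [measurable] qm [measurable] N [measurable] K1b [measurable]
  have am: "a \<in> borel_measurable borel" unfolding a_def by measurable
  have is1: "integrable \<nu> (\<lambda>y. indicator A y * (\<sigma> y \<bullet> b))" if "A \<in> sets borel" "A \<subseteq> K1" for A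
    by (rule perim_integrable_sigma[OF perim that K1(1,2) b(1)])
  have pa: "p y * a y = q y * (indicator (K1 - ?N) y * (\<sigma> y \<bullet> b))" for y
    by (simp add: a_def indicator_def)
  have ia: "integrable lborel a"
  proof -
    have "integrable \<nu> (\<lambda>y. indicator (K1 - ?N) y * (\<sigma> y \<bullet> b))" by (rule is1) auto
    then have "integrable m (\<lambda>y. q y *\<^sub>R (indicator (K1 - ?N) y * (\<sigma> y \<bullet> b)))"
      unfolding nuq by (subst (asm) integrable_density) (use q0 bm in auto)
    then have "integrable m (\<lambda>y. p y *\<^sub>R a y)" by (simp add: pa)
    then show ?thesis unfolding Lp by (subst integrable_density) (use p0 am bm in auto)
  qed
  have a: "integrable lborel a" "compact K1" "\<And>y. y \<notin> K1 \<Longrightarrow> a y = 0"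
    using ia K1 by (auto simp: a_def)
  have is': "integrable \<nu> s" "compact K1" "\<And>y. y \<notin> K1 \<Longrightarrow> s y = 0"
    using is1[of "K1 \<inter> ?N"] K1 by (auto simp: s_def)
  have split: "mol gm \<nu> (rho n) (\<lambda>y. indicator K1 y * (\<sigma> y \<bullet> b)) x
     = mol gm lborel (rho n) a x + mol gm \<nu> (rho n) s x" for n x
  proof -
    let ?k = "\<lambda>y. rho n (gm x (- y))"
    have km [measurable]: "?k \<in> borel_measurable borel" by (rule kernel_measurable)
    let ?t = "\<lambda>y. indicator (K1 - ?N) y * (\<sigma> y \<bullet> b)"
    have it: "integrable \<nu> ?t" by (rule is1) auto
    have ikt: "integrable \<nu> (\<lambda>y. ?k y * ?t y)"
      by (rule mol_integrable[OF snu it K1(1) _ smooth_rho]) auto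
    have iks: "integrable \<nu> (\<lambda>y. ?k y * s y)"
      by (rule mol_integrable[OF snu is' smooth_rho])
    have "mol gm \<nu> (rho n) (\<lambda>y. indicator K1 y * (\<sigma> y \<bullet> b)) x = (\<integral>y. ?k y * ?t y + ?k y * s y \<partial>\<nu>)"
      unfolding mol_def by (intro Bochner_Integration.integral_cong refl) (auto simp: s_def indicator_def)
    also have "\<dots> = (\<integral>y. ?k y * ?t y \<partial>\<nu>) + mol gm \<nu> (rho n) s x"
      unfolding mol_def by (rule Bochner_Integration.integral_add[OF ikt iks])
    also have "(\<integral>y. ?k y * ?t y \<partial>\<nu>) = (\<integral>y. q y *\<^sub>R (?k y * ?t y) \<partial>m)"
      unfolding nuq by (rule integral_density) (use q0 bm in auto)
    also have "\<dots> = (\<integral>y. p y *\<^sub>R (?k y * a y) \<partial>m)"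
      using pa by (intro Bochner_Integration.integral_cong refl) (simp add: mult_ac)
    also have "\<dots> = (\<integral>y. ?k y * a y \<partial>lborel)"
      unfolding Lp by (rule integral_density[symmetric]) (use p0 am bm in auto)
    finally show ?thesis by (simp add: mol_def)
  qed
  define \<beta> where "\<beta> = (\<lambda>t::real. 3 * t\<^sup>2 - 2 * t ^ 3)"
  define \<beta>' where "\<beta>' = (\<lambda>t::real. 6 * t - 6 * t\<^sup>2)"
  have D\<beta>: "(\<beta> has_real_derivative \<beta>' t) (at t)" for t
    unfolding \<beta>_def \<beta>'_def by (auto intro!: derivative_eq_intros simp: power2_eq_square)
  have s\<beta>f: "smooth (\<lambda>x. \<beta> (f n x))" for n
    unfolding \<beta>_def by (intro smooth_diff smooth_mult smooth_const smooth_power sf)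
  \<comment> \<open>The factor 3/2 in the statement originates here: it is the maximum of
    \<open>\<beta>'\<close>, attained at 1/2.\<close>
  have \<beta>'b: "\<bar>\<beta>' t\<bar> \<le> 3/2" if "0 \<le> t" "t \<le> 1" for t
  proof -
    have "6 * t - 6 * t\<^sup>2 = 6 * t * (1 - t)" by (simp add: power2_eq_square algebra_simps)
    also have "\<dots> \<ge> 0" using that by simp
    finally have "0 \<le> \<beta>' t" by (simp add: \<beta>'_def)
    moreover have "3/2 - (6 * t - 6 * t\<^sup>2) = 6 * (t - 1/2)\<^sup>2" by (simp add: power2_eq_square algebra_simps)
    then have "\<beta>' t \<le> 3/2" unfolding \<beta>'_def using zero_le_power2[of "t - 1/2"] by linarith
    ultimately show ?thesis by simp
  qed
  have \<beta>b: "\<bar>\<beta> t\<bar> \<le> 1" if "0 \<le> t" "t \<le> 1" for t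
  proof -
    have "\<beta> t = t\<^sup>2 * (3 - 2 * t)" by (simp add: \<beta>_def power2_eq_square power3_eq_cube algebra_simps)
    moreover have "1 - \<beta> t = (1 - t)\<^sup>2 * (1 + 2 * t)" by (simp add: \<beta>_def power2_eq_square power3_eq_cube algebra_simps)
    moreover have "t\<^sup>2 * (3 - 2 * t) \<ge> 0" "(1 - t)\<^sup>2 * (1 + 2 * t) \<ge> 0" using that by auto
    ultimately show ?thesis by simp
  qed
  obtain C where C: "C > 0" "\<And>x. \<bar>\<psi> x\<bar> \<le> C"
    using continuous_compact_support_bounded[OF smooth_continuous_on[OF s\<psi>] K(1) z\<psi>] by blast
  have \<psi>m [measurable]: "\<psi> \<in> borel_measurable borel" "Xf gm b \<psi> \<in> borel_measurable borel"
    by (intro borel_measurable_continuous_onI smooth_continuous_on s\<psi> smooth_Xf)+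
  have iX: "integrable lborel (Xf gm b \<psi>)"
    by (rule integrable_continuous_compact_support[OF smooth_continuous_on[OF smooth_Xf[OF s\<psi>]] K(1) zX])
  let ?A = "\<lambda>n. \<integral>x. \<beta> (f n x) * Xf gm b \<psi> x \<partial>lborel"
  let ?a\<psi> = "\<lambda>x. \<bar>\<psi> x\<bar>" and ?as = "\<lambda>y. \<bar>s y\<bar>"
  \<comment> \<open>The three terms are the error of mollifying \<open>a\<close>, the contribution
    of \<open>a\<close> itself, and the contribution of \<open>s\<close>. The first tends to 0 in L1
    and the second because \<open>\<beta>' (u x) = 0\<close>; only the last survives.\<close>
  define T where "T n = 3/2 * C * (\<integral>x. \<bar>mol gm lborel (rho n) a x - a x\<bar> \<partial>lborel) + C * (\<integral>x. \<bar>\<beta>' (f n x) * a x\<bar> \<partial>lborel)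
     + 3/2 * (\<integral>y. \<bar>s y\<bar> * mol gm lborel (rho n) ?a\<psi> y \<partial>\<nu>)" for n
  have cas: "integrable \<nu> ?as" "compact K1" "\<And>y. y \<notin> K1 \<Longrightarrow> ?as y = 0" using is' by auto
  have ca\<psi>: "continuous_on UNIV ?a\<psi>" "compact ?K" "\<And>x. x \<notin> ?K \<Longrightarrow> ?a\<psi> x = 0"
    using z\<psi> K smooth_continuous_on[OF s\<psi>] by (auto intro!: continuous_intros)
  have ia\<psi>: "integrable lborel ?a\<psi>" by (rule integrable_continuous_compact_support[OF ca\<psi>])
  have mol_a_i: "integrable lborel (mol gm lborel (rho n) a)" for n by (rule integrable_mol[OF a])
  have smas: "smooth (mol gm \<nu> (rho n) ?as)" for n by (rule smooth_mol[OF snu cas smooth_rho])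
  have \<beta>a: "\<bar>\<beta>' (f n x) * a x\<bar> \<le> 3/2 * \<bar>a x\<bar>" for n x
    unfolding abs_mult by (intro mult_right_mono \<beta>'b f01 abs_ge_zero)
  have i\<beta>a: "integrable lborel (\<lambda>x. \<beta>' (f n x) * a x)" for n
  proof (rule Bochner_Integration.integrable_bound)
    show "integrable lborel (\<lambda>x. 3/2 * a x)" using a(1) by simp
    show "(\<lambda>x. \<beta>' (f n x) * a x) \<in> borel_measurable lborel" using am unfolding \<beta>'_def by measurable
    show "AE x in lborel. norm (\<beta>' (f n x) * a x) \<le> norm (3/2 * a x)"
    proof (rule AE_I2)
      fix x
      have "norm (3/2 * a x) = 3/2 * \<bar>a x\<bar>" by (simp add: abs_mult)
      then show "norm (\<beta>' (f n x) * a x) \<le> norm (3/2 * a x)" using \<beta>a[of n x] by (simp only: real_norm_def)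
    qed
  qed
  have bound: "\<forall>\<^sub>F n in sequentially. \<bar>?A n\<bar> \<le> T n"
    using rho_near[OF K(1) e(1)]
  proof eventually_elim
    case (elim n)
    have near: "y \<in> K1" if "x \<in> ?K" "rho n (gm x (- y)) \<noteq> 0" for x y
      unfolding K1_def cthick_iff using elim that less_imp_le by blast
    have Xf_f: "Xf gm b (f n) x = mol gm lborel (rho n) a x + mol gm \<nu> (rho n) s x" if "x \<in> ?K" for x
      unfolding split[symmetric] f_def u_def
      by (rule perim_Xf_mol[OF perim _ _ K1(1,2) b near[OF that]]) (use E in \<open>auto simp: indicator_def\<close>)
    have eqA: "?A n = - (\<integral>x. \<psi> x * (\<beta>' (f n x) * Xf gm b (f n) x) \<partial>lborel)"
      unfolding Xf_ibp[OF s\<beta>f \<psi>] Xf_compose_real[OF sf D\<beta>] ..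
    have i1: "integrable lborel (\<lambda>x. \<psi> x * (\<beta>' (f n x) * Xf gm b (f n) x))"
    proof (rule integrable_continuous_compact_support[OF _ K(1)])
      show "continuous_on UNIV (\<lambda>x. \<psi> x * (\<beta>' (f n x) * Xf gm b (f n) x))"
        unfolding \<beta>'_def
        by (intro smooth_continuous_on smooth_mult smooth_diff smooth_const smooth_power sf smooth_Xf s\<psi>)
    qed (use z\<psi> in auto)
    have i3: "integrable lborel (\<lambda>x. \<bar>\<psi> x\<bar> * mol gm \<nu> (rho n) ?as x)"
      by (rule integrable_continuous_compact_support[OF _ K(1)])
        (use z\<psi> ca\<psi>(1) smooth_continuous_on[OF smas] in \<open>auto intro!: continuous_on_mult\<close>)
    have "\<bar>?A n\<bar> \<le> (\<integral>x. \<bar>\<psi> x * (\<beta>' (f n x) * Xf gm b (f n) x)\<bar> \<partial>lborel)"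
      unfolding eqA abs_minus_cancel by (rule integral_abs_bound)
    also have "\<dots> \<le> (\<integral>x. 3/2 * C * \<bar>mol gm lborel (rho n) a x - a x\<bar> + C * \<bar>\<beta>' (f n x) * a x\<bar>
        + 3/2 * (\<bar>\<psi> x\<bar> * mol gm \<nu> (rho n) ?as x) \<partial>lborel)"
    proof (rule integral_mono)
      show "integrable lborel (\<lambda>x. \<bar>\<psi> x * (\<beta>' (f n x) * Xf gm b (f n) x)\<bar>)" by (rule integrable_abs[OF i1])
      show "integrable lborel (\<lambda>x. 3/2 * C * \<bar>mol gm lborel (rho n) a x - a x\<bar> + C * \<bar>\<beta>' (f n x) * a x\<bar>
        + 3/2 * (\<bar>\<psi> x\<bar> * mol gm \<nu> (rho n) ?as x))"
        using mol_a_i a(1) i\<beta>a i3 by (intro Bochner_Integration.integrable_add integrable_mult_right integrable_abs Bochner_Integration.integrable_diff)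
      fix x
      let ?ma = "mol gm lborel (rho n) a x" and ?ms = "mol gm \<nu> (rho n) s x" and ?mas = "mol gm \<nu> (rho n) ?as x"
      have ms: "\<bar>?ms\<bar> \<le> ?mas" by (rule abs_mol_le)
      show "\<bar>\<psi> x * (\<beta>' (f n x) * Xf gm b (f n) x)\<bar> \<le> 3/2 * C * \<bar>?ma - a x\<bar> + C * \<bar>\<beta>' (f n x) * a x\<bar> + 3/2 * (\<bar>\<psi> x\<bar> * ?mas)"
      proof (cases "x \<in> ?K")
        case True
        let ?B = "\<beta>' (f n x)"
        have B: "\<bar>?B\<bar> \<le> 3/2" by (rule \<beta>'b[OF f01])
        have "\<psi> x * (?B * Xf gm b (f n) x) = \<psi> x * ?B * (?ma - a x) + \<psi> x * (?B * a x) + ?B * \<psi> x * ?ms"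
          unfolding Xf_f[OF True] by (simp add: algebra_simps)
        then have "\<bar>\<psi> x * (?B * Xf gm b (f n) x)\<bar> \<le> \<bar>\<psi> x * ?B * (?ma - a x)\<bar> + \<bar>\<psi> x * (?B * a x)\<bar> + \<bar>?B * \<psi> x * ?ms\<bar>"
          by linarith
        also have "\<dots> = (\<bar>\<psi> x\<bar> * \<bar>?B\<bar>) * \<bar>?ma - a x\<bar> + \<bar>\<psi> x\<bar> * \<bar>?B * a x\<bar> + \<bar>?B\<bar> * (\<bar>\<psi> x\<bar> * \<bar>?ms\<bar>)"
          by (simp add: abs_mult)
        also have "\<dots> \<le> (C * (3/2)) * \<bar>?ma - a x\<bar> + C * \<bar>?B * a x\<bar> + 3/2 * (\<bar>\<psi> x\<bar> * ?mas)"
          using C B ms by (intro add_mono mult_mono mult_right_mono) auto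
        finally show ?thesis by (simp add: mult.commute)
      next
        case False
        have "?mas \<ge> 0" using ms by linarith
        then show ?thesis using False z\<psi> C by simp
      qed
    qed
    also have "\<dots> = 3/2 * C * (\<integral>x. \<bar>mol gm lborel (rho n) a x - a x\<bar> \<partial>lborel) + C * (\<integral>x. \<bar>\<beta>' (f n x) * a x\<bar> \<partial>lborel)
        + 3/2 * (\<integral>x. \<bar>\<psi> x\<bar> * mol gm \<nu> (rho n) ?as x \<partial>lborel)"
      using mol_a_i[of n] a(1) i\<beta>a[of n] i3 by simp
    also have "(\<integral>x. \<bar>\<psi> x\<bar> * mol gm \<nu> (rho n) ?as x \<partial>lborel) = (\<integral>y. \<bar>s y\<bar> * mol gm lborel (rho n) ?a\<psi> y \<partial>\<nu>)"
      by (rule mol_duality[OF snu perim_sigma_finite[OF perim] cas ca\<psi>])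
    finally show "\<bar>?A n\<bar> \<le> T n" by (simp add: T_def)
  qed
  have "(\<lambda>n. \<integral>x. norm (mol gm lborel (rho n) u x - u x) \<partial>lborel) \<longlonglongrightarrow> 0"
    using mol_L1_tendsto[OF u] by simp
  \<comment> \<open>L1 convergence gives pointwise convergence only along a subsequence, which
    suffices to identify the limits.\<close>
  then obtain r where r: "strict_mono r" "AE x in lborel. (\<lambda>n. f (r n) x - u x) \<longlonglongrightarrow> 0"
    using tendsto_L1_AE_subseq[of lborel "\<lambda>n x. mol gm lborel (rho n) u x - u x"] integrable_mol[OF u] u(1)
    unfolding f_def by blast
  have ftend: "AE x in lborel. (\<lambda>n. f (r n) x) \<longlonglongrightarrow> u x"
    using r(2) by eventually_elim (rule LIM_zero_cancel)
  have A_lim: "(\<lambda>n. ?A (r n)) \<longlonglongrightarrow> - (\<integral>x. \<psi> x * (\<sigma> x \<bullet> b) \<partial>\<nu>)"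
  proof -
    have "(\<lambda>n. ?A (r n)) \<longlonglongrightarrow> (\<integral>x. u x * Xf gm b \<psi> x \<partial>lborel)"
    proof (rule integral_dominated_convergence[where w = "\<lambda>x. \<bar>Xf gm b \<psi> x\<bar>"])
      show "AE x in lborel. (\<lambda>n. \<beta> (f (r n) x) * Xf gm b \<psi> x) \<longlonglongrightarrow> u x * Xf gm b \<psi> x"
        using ftend
      proof eventually_elim
        case (elim x)
        have "(\<lambda>n. \<beta> (f (r n) x)) \<longlonglongrightarrow> \<beta> (u x)"
          unfolding \<beta>_def by (intro tendsto_intros elim)
        moreover have "\<beta> (u x) = u x" using u01[of x] by (auto simp: \<beta>_def)
        ultimately show ?case by (intro tendsto_mult) auto
      qed
      show "AE x in lborel. norm (\<beta> (f (r n) x) * Xf gm b \<psi> x) \<le> \<bar>Xf gm b \<psi> x\<bar>" for n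
        using \<beta>b[OF f01] by (intro AE_I2) (auto simp: abs_mult intro!: mult_left_le_one_le)
      show "(\<lambda>x. \<beta> (f (r n) x) * Xf gm b \<psi> x) \<in> borel_measurable lborel" for n
        unfolding \<beta>_def by measurable
    qed (use iX in auto)
    also have "(\<integral>x. u x * Xf gm b \<psi> x \<partial>lborel) = (\<integral>x. indicator E x * Xf gm b \<psi> x \<partial>lborel)"
      using zX K1(3) by (intro Bochner_Integration.integral_cong refl) (auto simp: u_def indicator_def)
    also have "\<dots> = - (\<integral>x. \<psi> x * (\<sigma> x \<bullet> b) \<partial>\<nu>)"
      by (rule perim_ibp[OF perim \<psi> b])
    finally show ?thesis .
  qed
  have T_lim: "(\<lambda>n. T (r n)) \<longlonglongrightarrow> 3/2 * C * 0 + C * 0 + 3/2 * (\<integral>y. \<bar>s y\<bar> * \<bar>\<psi> y\<bar> \<partial>\<nu>)"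
    unfolding T_def
  proof (intro tendsto_add tendsto_mult tendsto_const)
    show "(\<lambda>n. \<integral>x. \<bar>mol gm lborel (rho (r n)) a x - a x\<bar> \<partial>lborel) \<longlonglongrightarrow> 0"
      using LIMSEQ_subseq_LIMSEQ[OF mol_L1_tendsto[OF a] r(1)] by (simp add: comp_def)
    have "(\<lambda>n. \<integral>x. \<bar>\<beta>' (f (r n) x) * a x\<bar> \<partial>lborel) \<longlonglongrightarrow> (\<integral>x. \<bar>0 * a x\<bar> \<partial>lborel)"
    proof (rule integral_dominated_convergence[where w = "\<lambda>x. 3/2 * \<bar>a x\<bar>"])
      show "AE x in lborel. (\<lambda>n. \<bar>\<beta>' (f (r n) x) * a x\<bar>) \<longlonglongrightarrow> \<bar>0 * a x\<bar>"
        using ftend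
      proof eventually_elim
        case (elim x)
        have "(\<lambda>n. \<beta>' (f (r n) x)) \<longlonglongrightarrow> \<beta>' (u x)"
          unfolding \<beta>'_def by (intro tendsto_intros elim)
        moreover have "\<beta>' (u x) = 0" using u01[of x] by (auto simp: \<beta>'_def)
        ultimately show ?case by (intro tendsto_mult tendsto_rabs tendsto_const) auto
      qed
      show "AE x in lborel. norm \<bar>\<beta>' (f (r n) x) * a x\<bar> \<le> 3/2 * \<bar>a x\<bar>" for n
        using \<beta>a by (intro AE_I2) (simp only: real_norm_def abs_idempotent)
      show "(\<lambda>x. \<bar>\<beta>' (f (r n) x) * a x\<bar>) \<in> borel_measurable lborel" for n
        using i\<beta>a[of "r n"] by auto
    qed (use a(1) in auto)
    then show "(\<lambda>n. \<integral>x. \<bar>\<beta>' (f (r n) x) * a x\<bar> \<partial>lborel) \<longlonglongrightarrow> 0" by simp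
    \<comment> \<open>Convergence is needed at every point, since the measure may charge Lebesgue
      null sets; it follows from the continuity of \<psi>.\<close>
    show "(\<lambda>n. \<integral>y. \<bar>s y\<bar> * mol gm lborel (rho (r n)) ?a\<psi> y \<partial>\<nu>) \<longlonglongrightarrow> (\<integral>y. \<bar>s y\<bar> * \<bar>\<psi> y\<bar> \<partial>\<nu>)"
    proof (rule integral_dominated_convergence[where w = "\<lambda>y. C * \<bar>s y\<bar>"])
      have mm: "mol gm lborel (rho n) ?a\<psi> \<in> borel_measurable borel" for n
        by (rule borel_measurable_continuous_onI[OF smooth_continuous_on[OF smooth_mol_rho[OF ia\<psi> ca\<psi>(2,3)]]])
      then have mm\<nu>: "mol gm lborel (rho n) ?a\<psi> \<in> borel_measurable \<nu>" for n
        using snu by (simp cong: measurable_cong_sets)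
      have \<psi>\<nu>: "\<psi> \<in> borel_measurable \<nu>" using snu \<psi>m(1) by (simp cong: measurable_cong_sets)
      show "(\<lambda>y. \<bar>s y\<bar> * mol gm lborel (rho (r n)) ?a\<psi> y) \<in> borel_measurable \<nu>" for n
        by (intro borel_measurable_times mm\<nu>) (use is' in auto)
      show "(\<lambda>y. \<bar>s y\<bar> * \<bar>\<psi> y\<bar>) \<in> borel_measurable \<nu>" using is'(1) \<psi>\<nu> by auto
      show "AE y in \<nu>. (\<lambda>n. \<bar>s y\<bar> * mol gm lborel (rho (r n)) ?a\<psi> y) \<longlonglongrightarrow> \<bar>s y\<bar> * \<bar>\<psi> y\<bar>"
      proof (rule AE_I2)
        fix y
        have "(\<lambda>n. mol gm lborel (rho n) ?a\<psi> y) \<longlonglongrightarrow> ?a\<psi> y"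
          by (rule mol_tendsto_at[OF ia\<psi> ca\<psi>(2,3)])
            (use ca\<psi>(1) in \<open>simp_all add: continuous_on_eq_continuous_at\<close>)
        from LIMSEQ_subseq_LIMSEQ[OF this r(1)]
        show "(\<lambda>n. \<bar>s y\<bar> * mol gm lborel (rho (r n)) ?a\<psi> y) \<longlonglongrightarrow> \<bar>s y\<bar> * \<bar>\<psi> y\<bar>"
          by (intro tendsto_mult tendsto_const) (simp add: comp_def)
      qed
      show "AE y in \<nu>. norm (\<bar>s y\<bar> * mol gm lborel (rho (r n)) ?a\<psi> y) \<le> C * \<bar>s y\<bar>" for n
      proof (rule AE_I2)
        fix y
        have "\<bar>mol gm lborel (rho (r n)) ?a\<psi> y\<bar> \<le> C" by (rule mol_bound) (use C in auto)
        then show "norm (\<bar>s y\<bar> * mol gm lborel (rho (r n)) ?a\<psi> y) \<le> C * \<bar>s y\<bar>"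
          by (simp add: abs_mult mult.commute[of C] mult_left_mono)
      qed
    qed (use is' in auto)
  qed
  have "\<bar>- (\<integral>x. \<psi> x * (\<sigma> x \<bullet> b) \<partial>\<nu>)\<bar> \<le> 3/2 * C * 0 + C * 0 + 3/2 * (\<integral>y. \<bar>s y\<bar> * \<bar>\<psi> y\<bar> \<partial>\<nu>)"
  proof (rule tendsto_le[OF sequentially_bot T_lim tendsto_rabs[OF A_lim]])
    show "\<forall>\<^sub>F n in sequentially. \<bar>?A (r n)\<bar> \<le> T (r n)"
      using eventually_subseq[OF r(1) bound] .
  qed
  moreover have "(\<integral>y. \<bar>s y\<bar> * \<bar>\<psi> y\<bar> \<partial>\<nu>) \<le> (\<integral>x. indicator ?N x * \<bar>\<psi> x\<bar> \<partial>\<nu>)"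
  proof (rule integral_mono_AE)
    have \<psi>\<nu>: "\<psi> \<in> borel_measurable \<nu>" using snu \<psi>m(1) by (simp cong: measurable_cong_sets)
    have i\<nu>: "integrable \<nu> (\<lambda>x. C * indicator K1 x)"
      using perim_integrable_indicator[OF perim K1b order_refl K1(1,2)] by simp
    show "AE y in \<nu>. \<bar>s y\<bar> * \<bar>\<psi> y\<bar> \<le> indicator ?N y * \<bar>\<psi> y\<bar>"
      using perim_AE_inner[OF perim b(1)] by eventually_elim (auto simp: s_def indicator_def intro!: mult_left_le_one_le)
    show "integrable \<nu> (\<lambda>y. \<bar>s y\<bar> * \<bar>\<psi> y\<bar>)"
      by (rule Bochner_Integration.integrable_bound[where f = "\<lambda>y. C * s y"])
        (use is'(1) \<psi>\<nu> C in \<open>auto simp: abs_mult mult.commute[of C] intro!: mult_left_mono AE_I2\<close>)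
    show "integrable \<nu> (\<lambda>y. indicator ?N y * \<bar>\<psi> y\<bar>)"
    proof (rule Bochner_Integration.integrable_bound[OF i\<nu>])
      show "(\<lambda>y. indicator ?N y * \<bar>\<psi> y\<bar>) \<in> borel_measurable \<nu>"
        using \<psi>\<nu> N snu by (intro borel_measurable_times borel_measurable_indicator) auto
      show "AE y in \<nu>. norm (indicator ?N y * \<bar>\<psi> y\<bar>) \<le> norm (C * indicator K1 y)"
      proof (rule AE_I2)
        fix y
        show "norm (indicator ?N y * \<bar>\<psi> y\<bar>) \<le> norm (C * indicator K1 y)"
        proof (cases "y \<in> ?K")
          case True
          then show ?thesis using C K1(3) by (auto simp: indicator_def)
        qed (simp add: z\<psi>)
      qed
    qed
  qed
  ultimately show ?thesis by simp
qed

text \<open>On a compact set disjoint from the null set \<open>N\<close> the bound above reads 0, so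
  every horizontal component of \<sigma> vanishes almost everywhere off \<open>N\<close>. As
  \<sigma> is a horizontal unit vector almost everywhere, the measure cannot charge the complement
  of \<open>N\<close>.\<close>

lemma perim_singular:
  assumes Om: "open Om" and E: "E \<in> sets borel" and P: "perim_s Om (indicator E) \<nu> \<sigma>"
  obtains N where "N \<in> sets borel" "emeasure lborel N = 0" "AE x in \<nu>. x \<in> N"
proof -
  note perim = Om P
  have snu: "sets \<nu> = sets borel" by (rule perim_sets[OF perim])
  obtain \<A> where A: "countable \<A>" "\<A> \<subseteq> sets borel" "\<Union>\<A> = (UNIV :: 'a set)"
    "\<And>A. A \<in> \<A> \<Longrightarrow> bounded A \<and> ((compact A \<and> A \<subseteq> Om) \<or> A \<subseteq> - Om)"
    using open_finite_cover[OF Om] by blast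
  have fin: "emeasure lborel A < \<infinity> \<and> emeasure \<nu> A < \<infinity>" if "A \<in> \<A>" for A
    using A(4)[OF that] emeasure_bounded_finite perim_cover_finite[OF perim] by blast
  obtain m p q where m: "sets m = sets borel" and pq: "p \<in> borel_measurable borel" "q \<in> borel_measurable borel"
    "\<And>x. p x \<ge> 0" "\<And>x. q x \<ge> (0::real)"
    and d: "lborel = density m (\<lambda>x. ennreal (p x))" "\<nu> = density m (\<lambda>x. ennreal (q x))"
    using common_densities[OF _ snu A(1-3) fin] sets_lborel by metis
  define N where "N = {x. p x = 0}"
  have N: "N \<in> sets borel" using pq(1) unfolding N_def by measurable
  have pmm: "(\<lambda>x. ennreal (p x)) \<in> borel_measurable m" using pq(1) m by (auto cong: measurable_cong_sets)
  have "emeasure lborel N = (\<integral>\<^sup>+x. ennreal (p x) * indicator N x \<partial>m)"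
    unfolding d(1) using pmm N m by (subst emeasure_density) auto
  also have "\<dots> = (\<integral>\<^sup>+x. 0 \<partial>m)" by (intro nn_integral_cong) (auto simp: N_def indicator_def)
  finally have N0: "emeasure lborel N = 0" by simp
  have \<sigma>0: "AE x in \<nu>. x \<in> Om - N \<longrightarrow> \<sigma> x \<bullet> b = 0" if b: "b \<in> Basis" "w b = 1" for b
  proof (rule AE_zero_if_compact_integrals_zero_local[OF snu Om])
    show "Om - N \<in> sets borel" "Om - N \<subseteq> Om" using Om N by auto
    show si: "set_integrable \<nu> K (\<lambda>x. \<sigma> x \<bullet> b)" if "compact K" "K \<subseteq> Om" for K
      using perim_integrable_sigma[OF perim _ order_refl that b(1)] that(1)
      by (simp add: set_integrable_def compact_imp_closed)
    fix K assume K: "compact K" "K \<subseteq> Om - N"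
    then have KO: "K \<subseteq> Om" by blast
    obtain K1 \<psi> where c: "cutoff_seq Om K K1 \<psi>" using cutoff_seq_exists[OF K(1) Om KO] .
    have K1: "compact K1" "K1 \<subseteq> Om" using c by (auto simp: cutoff_seq_def)
    have 1: "(\<lambda>j. \<integral>x. \<psi> j x * (\<sigma> x \<bullet> b) \<partial>\<nu>) \<longlonglongrightarrow> (\<integral>x. indicator K x * (\<sigma> x \<bullet> b) \<partial>\<nu>)"
      by (rule cutoff_seq_integral_tendsto[OF c _ _ K(1) si[OF K1]])
        (use snu perim_space[OF perim] in auto)
    have 2: "(\<lambda>j. \<integral>x. \<psi> j x * indicator N x \<partial>\<nu>) \<longlonglongrightarrow> (\<integral>x. indicator K x * indicator N x \<partial>\<nu>)"
    proof (rule cutoff_seq_integral_tendsto[OF c _ _ K(1)])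
      have "integrable \<nu> (indicator (K1 \<inter> N) :: 'a \<Rightarrow> real)"
        by (rule perim_integrable_indicator[OF perim _ _ K1]) (use K1 N in \<open>auto simp: compact_imp_closed\<close>)
      moreover have "(\<lambda>x. indicator K1 x *\<^sub>R indicator N x) = (indicator (K1 \<inter> N) :: 'a \<Rightarrow> real)"
        by (rule ext) (simp add: indicator_def)
      ultimately show "set_integrable \<nu> K1 (indicator N :: 'a \<Rightarrow> real)"
        by (simp only: set_integrable_def)
    qed (use snu perim_space[OF perim] in auto)
    have z: "indicator K x * indicator N x = (0::real)" for x using K(2) by (auto simp: indicator_def)
    have "\<bar>\<integral>x. indicator K x * (\<sigma> x \<bullet> b) \<partial>\<nu>\<bar> \<le> 3/2 * (\<integral>x. indicator K x * indicator N x \<partial>\<nu>)"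
    proof (rule LIMSEQ_le[OF tendsto_rabs[OF 1] tendsto_mult[OF tendsto_const 2]])
      have "\<bar>\<integral>x. \<psi> j x * (\<sigma> x \<bullet> b) \<partial>\<nu>\<bar> \<le> 3/2 * (\<integral>x. \<psi> j x * indicator N x \<partial>\<nu>)" for j
      proof -
        have t: "test_fun Om (\<psi> j)" using c by (simp add: cutoff_seq_def)
        have "\<bar>\<psi> j x\<bar> = \<psi> j x" for x using c by (simp add: cutoff_seq_def)
        then show ?thesis using perim_singular_bound[OF Om E P b t m pq d] by (simp add: N_def mult.commute)
      qed
      then show "\<exists>M. \<forall>j\<ge>M. \<bar>\<integral>x. \<psi> j x * (\<sigma> x \<bullet> b) \<partial>\<nu>\<bar> \<le> 3/2 * (\<integral>x. \<psi> j x * indicator N x \<partial>\<nu>)" by blast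
    qed
    then show "(\<integral>x. indicator K x * (\<sigma> x \<bullet> b) \<partial>\<nu>) = 0" by (simp add: z)
  qed
  have "AE x in \<nu>. \<forall>b\<in>{b\<in>Basis. w b = 1}. x \<in> Om - N \<longrightarrow> \<sigma> x \<bullet> b = 0"
    by (rule AE_finite_allI) (use \<sigma>0 in auto)
  then have "AE x in \<nu>. x \<in> N"
    using perim_AE[OF perim] perim_AE_Om[OF perim]
  proof eventually_elim
    case (elim x)
    show ?case
    proof (rule ccontr)
      assume "x \<notin> N"
      have \<sigma>x: "norm (\<sigma> x) = 1" "\<sigma> x \<in> hlayer w 1" using elim(2) by simp_all
      have "\<sigma> x \<bullet> b = 0" if "b \<in> Basis" for b
      proof (cases "w b = 1")
        case True
        then show ?thesis using elim(1)[rule_format, of b] elim(3) \<open>x \<notin> N\<close> that by simp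
      next
        case False
        then show ?thesis using hlayer_inner_eq_0[OF \<sigma>x(2) that] by simp
      qed
      then have "\<sigma> x = 0" by (intro euclidean_eqI[of "\<sigma> x" 0]) simp
      then show False using \<sigma>x(1) by simp
    qed
  qed
  then show ?thesis by (rule that[OF N N0])
qed

end

section \<open>Pairing with the perimeter measure\<close>

text \<open>On compact sets that miss \<open>N\<close> the dominating measure vanishes, so
  \<open>u\<close> is 0 almost everywhere off \<open>N\<close>; and \<open>N\<close> is itself
  Lebesgue null.\<close>

lemma AE_zero_if_dominated_singular:
  fixes \<nu> :: "'a::euclidean_space measure"
  assumes U: "open U" and snu: "sets \<nu> = sets borel" and fin: "\<And>K. compact K \<Longrightarrow> K \<subseteq> U \<Longrightarrow> emeasure \<nu> K < \<infinity>"
    and N: "N \<in> sets borel" "emeasure lborel N = 0" "AE x in \<nu>. x \<in> N"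
    and u: "\<And>K. compact K \<Longrightarrow> K \<subseteq> U \<Longrightarrow> set_integrable lborel K u"
    and le: "\<And>\<psi>. test_fun U \<psi> \<Longrightarrow> \<bar>\<integral>x. \<psi> x * u x \<partial>lborel\<bar> \<le> C * (\<integral>x. \<bar>\<psi> x\<bar> \<partial>\<nu>)"
  shows "AE x in lborel. x \<in> U \<longrightarrow> u x = 0"
proof -
  have sp: "space \<nu> = UNIV" using sets_eq_imp_space_eq[OF snu] by simp
  have "AE x in lborel. x \<in> U - N \<longrightarrow> u x = 0"
  proof (rule AE_zero_if_compact_integrals_zero_local[OF sets_lborel U])
    show "U - N \<in> sets borel" "U - N \<subseteq> U" using U N by auto
    show "set_integrable lborel K u" if "compact K" "K \<subseteq> U" for K using u that .
    fix K assume K: "compact K" "K \<subseteq> U - N"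
    then have KU: "K \<subseteq> U" by blast
    obtain K1 \<psi> where c: "cutoff_seq U K K1 \<psi>" using cutoff_seq_exists[OF K(1) U KU] .
    have K1: "compact K1" "K1 \<subseteq> U" using c by (auto simp: cutoff_seq_def)
    have 1: "(\<lambda>j. \<integral>x. \<psi> j x * u x \<partial>lborel) \<longlonglongrightarrow> (\<integral>x. indicator K x * u x \<partial>lborel)"
      by (rule cutoff_seq_integral_tendsto[OF c _ _ K(1) u[OF K1]]) auto
    have 2: "(\<lambda>j. \<integral>x. \<psi> j x * 1 \<partial>\<nu>) \<longlonglongrightarrow> (\<integral>x. indicator K x * 1 \<partial>\<nu>)"
    proof (rule cutoff_seq_integral_tendsto[OF c _ _ K(1)])
      show "set_integrable \<nu> K1 (\<lambda>x. 1::real)"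
        unfolding set_integrable_def using fin[OF K1] K1 snu
        by (auto intro!: integrable_real_indicator simp: compact_imp_closed)
    qed (use snu sp in auto)
    have "AE x in \<nu>. indicator K x = (0::real)"
      using N(3) by eventually_elim (use K in \<open>auto simp: indicator_def\<close>)
    then have z: "(\<integral>x. indicator K x * (1::real) \<partial>\<nu>) = 0"
      by (intro integral_eq_zero_AE) auto
    have "\<bar>\<integral>x. indicator K x * u x \<partial>lborel\<bar> \<le> C * (\<integral>x. indicator K x * 1 \<partial>\<nu>)"
    proof (rule LIMSEQ_le[OF tendsto_rabs[OF 1] tendsto_mult[OF tendsto_const 2]])
      have "\<bar>\<integral>x. \<psi> j x * u x \<partial>lborel\<bar> \<le> C * (\<integral>x. \<psi> j x * 1 \<partial>\<nu>)" for j
      proof -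
        have t: "test_fun U (\<psi> j)" using c by (simp add: cutoff_seq_def)
        have "\<bar>\<psi> j x\<bar> = \<psi> j x" for x using c by (simp add: cutoff_seq_def)
        then show ?thesis using le[OF t] by simp
      qed
      then show "\<exists>M. \<forall>j\<ge>M. \<bar>\<integral>x. \<psi> j x * u x \<partial>lborel\<bar> \<le> C * (\<integral>x. \<psi> j x * 1 \<partial>\<nu>)" by blast
    qed
    then show "(\<integral>x. indicator K x * u x \<partial>lborel) = 0" using z by simp
  qed
  moreover have "AE x in lborel. x \<notin> N"
    by (rule AE_not_in) (use N in \<open>auto simp: null_sets_def\<close>)
  ultimately show ?thesis by eventually_elim auto
qed

text \<open>The counterpart on the singular side: testing on compact subsets of \<open>N\<close>
  makes the Lebesgue integral vanish, while \<open>N\<close> carries all of \<nu>.\<close>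

lemma AE_zero_if_equal_singular:
  fixes \<nu> :: "'a::euclidean_space measure"
  assumes U: "open U" and snu: "sets \<nu> = sets borel"
    and N: "N \<in> sets borel" "emeasure lborel N = 0" "AE x in \<nu>. x \<in> N"
    and u: "\<And>K. compact K \<Longrightarrow> K \<subseteq> U \<Longrightarrow> set_integrable lborel K u"
    and v: "\<And>K. compact K \<Longrightarrow> K \<subseteq> U \<Longrightarrow> set_integrable \<nu> K v"
    and eq: "\<And>\<psi>. test_fun U \<psi> \<Longrightarrow> (\<integral>x. \<psi> x * u x \<partial>lborel) = (\<integral>x. \<psi> x * v x \<partial>\<nu>)"
  shows "AE x in \<nu>. x \<in> U \<longrightarrow> v x = 0"
proof -
  have sp: "space \<nu> = UNIV" using sets_eq_imp_space_eq[OF snu] by simp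
  have Nn: "AE x in lborel. x \<notin> N"
    by (rule AE_not_in) (use N in \<open>auto simp: null_sets_def\<close>)
  have "AE x in \<nu>. x \<in> U \<inter> N \<longrightarrow> v x = 0"
  proof (rule AE_zero_if_compact_integrals_zero_local[OF snu U])
    show "U \<inter> N \<in> sets borel" "U \<inter> N \<subseteq> U" using U N by auto
    show "set_integrable \<nu> K v" if "compact K" "K \<subseteq> U" for K using v that .
    fix K assume K: "compact K" "K \<subseteq> U \<inter> N"
    then have KU: "K \<subseteq> U" by blast
    obtain K1 \<psi> where c: "cutoff_seq U K K1 \<psi>" using cutoff_seq_exists[OF K(1) U KU] .
    have K1: "compact K1" "K1 \<subseteq> U" using c by (auto simp: cutoff_seq_def)
    have 1: "(\<lambda>j. \<integral>x. \<psi> j x * u x \<partial>lborel) \<longlonglongrightarrow> (\<integral>x. indicator K x * u x \<partial>lborel)"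
      by (rule cutoff_seq_integral_tendsto[OF c _ _ K(1) u[OF K1]]) auto
    have 2: "(\<lambda>j. \<integral>x. \<psi> j x * v x \<partial>\<nu>) \<longlonglongrightarrow> (\<integral>x. indicator K x * v x \<partial>\<nu>)"
      by (rule cutoff_seq_integral_tendsto[OF c _ _ K(1) v[OF K1]]) (use snu sp in auto)
    have "(\<integral>x. \<psi> j x * u x \<partial>lborel) = (\<integral>x. \<psi> j x * v x \<partial>\<nu>)" for j
      by (rule eq) (use c in \<open>simp add: cutoff_seq_def\<close>)
    with 1 2 have "(\<integral>x. indicator K x * v x \<partial>\<nu>) = (\<integral>x. indicator K x * u x \<partial>lborel)"
      by (simp add: LIMSEQ_unique)
    also have "\<dots> = 0"
      by (rule integral_eq_zero_AE) (use Nn in eventually_elim, use K in \<open>auto simp: indicator_def\<close>)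
    finally show "(\<integral>x. indicator K x * v x \<partial>\<nu>) = 0" .
  qed
  then show ?thesis using N(3) by eventually_elim auto
qed

section \<open>The bound for the pairing of \<open>F\<close> with the derivative of an
  indicator\<close>

context stratified
begin

text \<open>\<open>K1\<close> stays inside \<open>V\<close>, where the weak identities hold, and for
  large \<open>n\<close> contains every kernel centred at the support of \<psi>. Functions can thus
  be cut off to \<open>K1\<close>, which makes them integrable, without changing their
  mollifications on that support.\<close>

lemma test_fun_neighbourhood:
  assumes V: "open V" and \<psi>: "test_fun V \<psi>"
  obtains K1 where "compact K1" "K1 \<subseteq> V" "tsupport \<psi> \<subseteq> interior K1"
    "\<forall>\<^sub>F n in sequentially. \<forall>x\<in>tsupport \<psi>. \<forall>y. rho n (gm x (- y)) \<noteq> 0 \<longrightarrow> y \<in> K1"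
proof -
  let ?K = "tsupport \<psi>"
  have K: "compact ?K" "?K \<subseteq> V" using \<psi> by (auto simp: test_fun_iff)
  obtain e where e: "e > 0" "cthick ?K e \<subseteq> V" using compact_open_cthick[OF K(1) V K(2)] .
  show ?thesis
  proof (rule that[of "cthick ?K e"])
    show "compact (cthick ?K e)" by (rule compact_cthick[OF K(1)])
    have "(\<Union>a\<in>?K. ball a e) \<subseteq> interior (cthick ?K e)"
      by (rule interior_maximal[OF ball_Union_subset_cthick]) auto
    moreover have "x \<in> (\<Union>a\<in>?K. ball a e)" if "x \<in> ?K" for x
      by (rule UN_I[OF that]) (use e in simp)
    ultimately show "?K \<subseteq> interior (cthick ?K e)" by blast
    show "\<forall>\<^sub>F n in sequentially. \<forall>x\<in>?K. \<forall>y. rho n (gm x (- y)) \<noteq> 0 \<longrightarrow> y \<in> cthick ?K e"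
      using rho_near[OF K(1) e(1)] by eventually_elim (unfold cthick_iff, meson less_imp_le)
  qed (rule e(2))
qed

lemma integrable_indicator_compact_mult:
  fixes f :: "'a \<Rightarrow> real"
  assumes K: "compact K" and f: "f \<in> borel_measurable borel" "AE x in lborel. x \<in> K \<longrightarrow> \<bar>f x\<bar> \<le> C"
  shows "integrable lborel (\<lambda>x. indicator K x * f x)"
proof (rule Bochner_Integration.integrable_bound)
  show "integrable lborel (\<lambda>x. C * indicator K x)"
    using borel_integrable_compact[OF K continuous_on_const[of K "1::real"]] by simp
  show "(\<lambda>x. indicator K x * f x) \<in> borel_measurable lborel"
    using f(1) K by (intro borel_measurable_times borel_measurable_indicator) (auto simp: compact_imp_closed)
  show "AE x in lborel. norm (indicator K x * f x) \<le> norm (C * indicator K x)"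
    using f(2) by eventually_elim (auto simp: indicator_def)
qed

text \<open>As in \<open>perim_Xf_mol\<close>, the kernel is the test function. The commutation is
  exact at every \<open>x\<close> whose kernel lies in \<open>K1\<close>.\<close>

lemma Xf_mol_weak_derivative:
  assumes f: "integrable lborel (\<lambda>y. indicator K1 y * f y)" and K1: "compact K1" "K1 \<subseteq> V"
    and weak: "\<And>\<psi>. test_fun V \<psi> \<Longrightarrow> (\<integral>x. f x * Xf gm b \<psi> x \<partial>lborel) = - (\<integral>x. \<psi> x * h x \<partial>lborel)"
    and x: "\<And>y. rho n (gm x (- y)) \<noteq> 0 \<Longrightarrow> y \<in> K1"
  shows "Xf gm b (mol gm lborel (rho n) (\<lambda>y. indicator K1 y * f y)) x
    = mol gm lborel (rho n) (\<lambda>y. indicator K1 y * h y) x"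
proof -
  let ?k = "\<lambda>y. rho n (gm x (- y))"
  have sk: "smooth ?k" by (rule smooth_kernel_snd[OF smooth_rho])
  have tk: "test_fun V ?k" by (rule test_funI[OF sk x K1])
  have z: "Xf gm b ?k y = 0" if "y \<notin> K1" for y
    by (rule Xf_zero_outside[OF sk compact_imp_closed[OF K1(1)] _ that]) (use x in blast)
  have "Xf gm b (mol gm lborel (rho n) (\<lambda>y. indicator K1 y * f y)) x
    = - (\<integral>y. Xf gm b ?k y * (indicator K1 y * f y) \<partial>lborel)"
    by (rule Xf_mol[OF _ f K1(1) _ smooth_rho]) auto
  also have "(\<integral>y. Xf gm b ?k y * (indicator K1 y * f y) \<partial>lborel) = (\<integral>y. f y * Xf gm b ?k y \<partial>lborel)"
    by (intro Bochner_Integration.integral_cong refl) (use z in \<open>auto simp: indicator_def\<close>)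
  also have "\<dots> = - (\<integral>y. ?k y * h y \<partial>lborel)" by (rule weak[OF tk])
  also have "(\<integral>y. ?k y * h y \<partial>lborel) = mol gm lborel (rho n) (\<lambda>y. indicator K1 y * h y) x"
    unfolding mol_def by (intro Bochner_Integration.integral_cong refl) (use x in \<open>auto simp: indicator_def\<close>)
  finally show ?thesis by simp
qed

abbreviation hbasis :: "'a set" where "hbasis \<equiv> {b \<in> Basis. w b = 1}"

text \<open>Only the sum over \<open>b\<close> can be identified: the derivatives of single
  components of \<open>F\<close> are mere distributions, while their sum is the function
  \<open>g\<close>.\<close>

lemma sum_Xf_mol_divergence:
  assumes F: "\<And>b. b \<in> hbasis \<Longrightarrow> integrable lborel (\<lambda>y. indicator K1 y * (F y \<bullet> b))" and K1: "compact K1" "K1 \<subseteq> V"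
    and dv: "\<And>\<psi>. test_fun V \<psi> \<Longrightarrow> (\<integral>x. (\<Sum>b\<in>hbasis. (F x \<bullet> b) * Xf gm b \<psi> x) \<partial>lborel) = - (\<integral>x. \<psi> x * g x \<partial>lborel)"
    and x: "\<And>y. rho n (gm x (- y)) \<noteq> 0 \<Longrightarrow> y \<in> K1"
  shows "(\<Sum>b\<in>hbasis. Xf gm b (mol gm lborel (rho n) (\<lambda>y. indicator K1 y * (F y \<bullet> b))) x)
    = mol gm lborel (rho n) (\<lambda>y. indicator K1 y * g y) x"
proof -
  let ?k = "\<lambda>y. rho n (gm x (- y))"
  have sk: "smooth ?k" by (rule smooth_kernel_snd[OF smooth_rho])
  have tk: "test_fun V ?k" by (rule test_funI[OF sk x K1])
  have z: "Xf gm b ?k y = 0" if "y \<notin> K1" for y b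
    by (rule Xf_zero_outside[OF sk compact_imp_closed[OF K1(1)] _ that]) (use x in blast)
  have i: "integrable lborel (\<lambda>y. Xf gm b ?k y * (indicator K1 y * (F y \<bullet> b)))" if "b \<in> hbasis" for b
    by (rule integrable_mult_continuous[OF _ F[OF that] K1(1)])
      (auto intro: smooth_continuous_on smooth_Xf sk)
  have "(\<Sum>b\<in>hbasis. Xf gm b (mol gm lborel (rho n) (\<lambda>y. indicator K1 y * (F y \<bullet> b))) x)
    = (\<Sum>b\<in>hbasis. - (\<integral>y. Xf gm b ?k y * (indicator K1 y * (F y \<bullet> b)) \<partial>lborel))"
  proof (rule sum.cong[OF refl])
    fix b assume b: "b \<in> hbasis"
    show "Xf gm b (mol gm lborel (rho n) (\<lambda>y. indicator K1 y * (F y \<bullet> b))) x =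
      - (\<integral>y. Xf gm b ?k y * (indicator K1 y * (F y \<bullet> b)) \<partial>lborel)"
      by (rule Xf_mol[OF _ F[OF b] K1(1) _ smooth_rho]) auto
  qed
  also have "\<dots> = - (\<integral>y. (\<Sum>b\<in>hbasis. Xf gm b ?k y * (indicator K1 y * (F y \<bullet> b))) \<partial>lborel)"
    using i by (simp add: sum_negf)
  also have "(\<integral>y. (\<Sum>b\<in>hbasis. Xf gm b ?k y * (indicator K1 y * (F y \<bullet> b))) \<partial>lborel)
     = (\<integral>y. (\<Sum>b\<in>hbasis. (F y \<bullet> b) * Xf gm b ?k y) \<partial>lborel)"
    by (intro Bochner_Integration.integral_cong sum.cong refl) (use z in \<open>auto simp: indicator_def\<close>)
  also have "\<dots> = - (\<integral>y. ?k y * g y \<partial>lborel)" by (rule dv[OF tk])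
  also have "(\<integral>y. ?k y * g y \<partial>lborel) = mol gm lborel (rho n) (\<lambda>y. indicator K1 y * g y) x"
    unfolding mol_def by (intro Bochner_Integration.integral_cong refl) (use x in \<open>auto simp: indicator_def\<close>)
  finally show ?thesis by simp
qed

text \<open>For a smooth field the left side is the integral of the divergence of the field times
  \<psi> over \<open>E\<close>, hence an integral against the perimeter measure, where each of the
  \<open>card hbasis\<close> components contributes at most \<open>\<bar>C\<bar>\<close>. The
  bounded field \<open>F\<close> is reached by mollification, which preserves the bounds on the
  components and converges in L1, while all other factors stay bounded.\<close>

lemma pairing_bound:
  assumes U: "open U" and E: "E \<in> sets borel" and P: "perim_s U (indicator E) \<nu> \<sigma>"
    and F: "F \<in> borel_measurable borel" "\<And>b. b \<in> hbasis \<Longrightarrow> AE x in lborel. x \<in> U \<longrightarrow> \<bar>F x \<bullet> b\<bar> \<le> C"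
    and g: "g \<in> borel_measurable borel" "\<And>K. compact K \<Longrightarrow> K \<subseteq> U \<Longrightarrow> set_integrable lborel K g"
    and dv: "\<And>\<psi>. test_fun U \<psi> \<Longrightarrow> (\<integral>x. (\<Sum>b\<in>hbasis. (F x \<bullet> b) * Xf gm b \<psi> x) \<partial>lborel) = - (\<integral>x. \<psi> x * g x \<partial>lborel)"
    and \<psi>: "test_fun U \<psi>"
  shows "\<bar>(\<integral>x. indicator E x * (\<Sum>b\<in>hbasis. (F x \<bullet> b) * Xf gm b \<psi> x) \<partial>lborel) + (\<integral>x. indicator E x * \<psi> x * g x \<partial>lborel)\<bar>
    \<le> real (card hbasis) * \<bar>C\<bar> * (\<integral>x. \<bar>\<psi> x\<bar> \<partial>\<nu>)"
proof -
  note perim = U P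
  have snu: "sets \<nu> = sets borel" by (rule perim_sets[OF perim])
  have s\<psi>: "smooth \<psi>" and K: "compact (tsupport \<psi>)" "tsupport \<psi> \<subseteq> U" using \<psi> by (auto simp: test_fun_iff)
  let ?K = "tsupport \<psi>"
  have z\<psi>: "\<psi> x = 0" if "x \<notin> ?K" for x using that by (rule tsupport_zero)
  have zX: "Xf gm b \<psi> x = 0" if "x \<notin> ?K" for x b
    by (rule Xf_zero_outside[OF s\<psi> compact_imp_closed[OF K(1)] z\<psi> that])
  obtain K1 where K1: "compact K1" "K1 \<subseteq> U" "?K \<subseteq> interior K1"
    and near: "\<forall>\<^sub>F n in sequentially. \<forall>x\<in>?K. \<forall>y. rho n (gm x (- y)) \<noteq> 0 \<longrightarrow> y \<in> K1"
    using test_fun_neighbourhood[OF U \<psi>] by blast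
  have KK1: "?K \<subseteq> K1" using K1(3) interior_subset by blast
  have K1b [measurable]: "K1 \<in> sets borel" using K1 by (simp add: compact_imp_closed)
  note E [measurable] F(1) [measurable] g(1) [measurable]
  let ?F = "\<lambda>b y. indicator K1 y * (F y \<bullet> b)" and ?g = "\<lambda>y. indicator K1 y * g y"
  have F1: "integrable lborel (?F b)" if "b \<in> hbasis" for b
    by (rule integrable_indicator_compact_mult[OF K1(1), where C = "\<bar>C\<bar>"])
      (use F(2)[OF that] K1(2) in \<open>auto elim!: eventually_mono\<close>)
  have Fz: "\<And>y. y \<notin> K1 \<Longrightarrow> ?F b y = 0" for b by simp
  have g1: "integrable lborel ?g" using g(2)[OF K1(1,2)] by (simp add: set_integrable_def)
  have gz: "\<And>y. y \<notin> K1 \<Longrightarrow> ?g y = 0" by simp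
  define f where "f n b = mol gm lborel (rho n) (?F b)" for n b
  have sf: "smooth (f n b)" if "b \<in> hbasis" for n b
    unfolding f_def by (rule smooth_mol_rho[OF F1[OF that] K1(1) Fz])
  have fb: "\<bar>f n b x\<bar> \<le> \<bar>C\<bar>" if "b \<in> hbasis" for n b x
    unfolding f_def
    by (rule mol_bound) (use F(2)[OF that] K1(2) in \<open>auto elim!: eventually_mono simp: indicator_def\<close>)
  obtain C\<psi> where C\<psi>: "C\<psi> > 0" "\<And>x. \<bar>\<psi> x\<bar> \<le> C\<psi>"
    using continuous_compact_support_bounded[OF smooth_continuous_on[OF s\<psi>] K(1) z\<psi>] by blast
  have \<psi>m [measurable]: "\<psi> \<in> borel_measurable borel"
    by (rule borel_measurable_continuous_onI[OF smooth_continuous_on[OF s\<psi>]])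
  have Xm [measurable]: "Xf gm b \<psi> \<in> borel_measurable borel" for b
    by (rule borel_measurable_continuous_onI[OF smooth_continuous_on[OF smooth_Xf[OF s\<psi>]]])
  \<comment> \<open>For large \<open>n\<close> this is the integral over \<open>E\<close> of the
    divergence of \<psi> times the mollified field, expanded by the product rule so that each term
    has a limit.\<close>
  let ?A = "\<lambda>n. (\<integral>x. (indicator E x * \<psi> x) * mol gm lborel (rho n) ?g x \<partial>lborel) +
    (\<Sum>b\<in>hbasis. \<integral>x. (indicator E x * Xf gm b \<psi> x) * f n b x \<partial>lborel)"
  have A_lim: "?A \<longlonglongrightarrow> (\<integral>x. (indicator E x * \<psi> x) * ?g x \<partial>lborel) + (\<Sum>b\<in>hbasis. \<integral>x. (indicator E x * Xf gm b \<psi> x) * ?F b x \<partial>lborel)"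
  proof (intro tendsto_add tendsto_sum)
    show "(\<lambda>n. \<integral>x. (indicator E x * \<psi> x) * mol gm lborel (rho n) ?g x \<partial>lborel) \<longlonglongrightarrow> (\<integral>x. (indicator E x * \<psi> x) * ?g x \<partial>lborel)"
    proof (rule mol_weak_tendsto[OF g1 K1(1) gz])
      show "AE x in lborel. \<bar>indicator E x * \<psi> x\<bar> \<le> C\<psi>"
        using C\<psi> by (intro AE_I2) (auto simp: indicator_def intro: less_imp_le)
    qed simp_all
    fix b assume b: "b \<in> hbasis"
    obtain D where D: "D > 0" "\<And>x. \<bar>Xf gm b \<psi> x\<bar> \<le> D"
      using continuous_compact_support_bounded[OF smooth_continuous_on[OF smooth_Xf[OF s\<psi>]] K(1) zX] by blast
    show "(\<lambda>n. \<integral>x. (indicator E x * Xf gm b \<psi> x) * f n b x \<partial>lborel) \<longlonglongrightarrow> (\<integral>x. (indicator E x * Xf gm b \<psi> x) * ?F b x \<partial>lborel)"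
      unfolding f_def
    proof (rule mol_weak_tendsto[OF F1[OF b] K1(1) Fz])
      show "AE x in lborel. \<bar>indicator E x * Xf gm b \<psi> x\<bar> \<le> D"
        using D by (intro AE_I2) (auto simp: indicator_def intro: less_imp_le)
    qed simp_all
  qed
  have lim_eq: "(\<integral>x. (indicator E x * \<psi> x) * ?g x \<partial>lborel) + (\<Sum>b\<in>hbasis. \<integral>x. (indicator E x * Xf gm b \<psi> x) * ?F b x \<partial>lborel)
    = (\<integral>x. indicator E x * (\<Sum>b\<in>hbasis. (F x \<bullet> b) * Xf gm b \<psi> x) \<partial>lborel) + (\<integral>x. indicator E x * \<psi> x * g x \<partial>lborel)"
  proof -
    have "integrable lborel (\<lambda>x. (indicator E x * Xf gm b \<psi> x) * ?F b x)" if b: "b \<in> hbasis" for b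
    proof -
      have "integrable lborel (\<lambda>x. Xf gm b \<psi> x * ?F b x)"
        by (rule integrable_mult_continuous[OF _ F1[OF b] K1(1) Fz]) (auto intro: smooth_continuous_on smooth_Xf s\<psi>)
      then have "integrable lborel (\<lambda>x. indicator E x *\<^sub>R (Xf gm b \<psi> x * ?F b x))"
        by (rule integrable_mult_indicator[rotated]) (use E in simp)
      then show ?thesis by (simp add: mult.assoc)
    qed
    then have "(\<Sum>b\<in>hbasis. \<integral>x. (indicator E x * Xf gm b \<psi> x) * ?F b x \<partial>lborel)
      = (\<integral>x. (\<Sum>b\<in>hbasis. (indicator E x * Xf gm b \<psi> x) * ?F b x) \<partial>lborel)"
      by (subst Bochner_Integration.integral_sum) auto
    also have "\<dots> = (\<integral>x. indicator E x * (\<Sum>b\<in>hbasis. (F x \<bullet> b) * Xf gm b \<psi> x) \<partial>lborel)"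
    proof (intro Bochner_Integration.integral_cong refl)
      fix x
      have "Xf gm b \<psi> x * indicator K1 x = Xf gm b \<psi> x" for b
        using zX[of x b] KK1 by (cases "x \<in> ?K") auto
      then have "(indicator E x * Xf gm b \<psi> x) * ?F b x = indicator E x * ((F x \<bullet> b) * Xf gm b \<psi> x)" for b
        by (metis (no_types, lifting) mult.assoc mult.commute)
      then show "(\<Sum>b\<in>hbasis. (indicator E x * Xf gm b \<psi> x) * ?F b x) = indicator E x * (\<Sum>b\<in>hbasis. (F x \<bullet> b) * Xf gm b \<psi> x)"
        by (simp only: sum_distrib_left)
    qed
    moreover have "(\<integral>x. (indicator E x * \<psi> x) * ?g x \<partial>lborel) = (\<integral>x. indicator E x * \<psi> x * g x \<partial>lborel)"
      by (intro Bochner_Integration.integral_cong refl) (use z\<psi> KK1 in \<open>auto simp: indicator_def\<close>)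
    ultimately show ?thesis by simp
  qed
  have i\<psi>\<nu>: "integrable \<nu> (\<lambda>x. \<bar>\<psi> x\<bar>)"
  proof (rule Bochner_Integration.integrable_bound)
    show "integrable \<nu> (\<lambda>x. C\<psi> * indicator K1 x)"
      using perim_integrable_indicator[OF perim K1b order_refl K1(1,2)] by simp
    show "(\<lambda>x. \<bar>\<psi> x\<bar>) \<in> borel_measurable \<nu>" using \<psi>m snu by (simp cong: measurable_cong_sets)
    show "AE x in \<nu>. norm \<bar>\<psi> x\<bar> \<le> norm (C\<psi> * indicator K1 x)"
    proof (rule AE_I2)
      fix x show "norm \<bar>\<psi> x\<bar> \<le> norm (C\<psi> * indicator K1 x)"
        using C\<psi> z\<psi>[of x] KK1 by (cases "x \<in> ?K") (auto simp: indicator_def)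
    qed
  qed
  have bound: "\<forall>\<^sub>F n in sequentially. \<bar>?A n\<bar> \<le> real (card hbasis) * \<bar>C\<bar> * (\<integral>x. \<bar>\<psi> x\<bar> \<partial>\<nu>)"
    using near
  proof eventually_elim
    case (elim n)
    have t: "test_fun U (\<lambda>x. \<psi> x * f n b x)" if "b \<in> hbasis" for b
      by (rule test_funI[of _ ?K]) (use s\<psi> sf[OF that] z\<psi> K in \<open>auto intro: smooth_mult\<close>)
    have dsum: "(\<Sum>b\<in>hbasis. Xf gm b (f n b) x) = mol gm lborel (rho n) ?g x" if "x \<in> ?K" for x
      unfolding f_def by (rule sum_Xf_mol_divergence[OF F1 K1(1,2) dv]) (use elim that in blast)+
    have pw: "(indicator E x * \<psi> x) * mol gm lborel (rho n) ?g x + (\<Sum>b\<in>hbasis. (indicator E x * Xf gm b \<psi> x) * f n b x)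
      = (\<Sum>b\<in>hbasis. indicator E x * Xf gm b (\<lambda>x. \<psi> x * f n b x) x)" for x
    proof -
      have "\<psi> x * mol gm lborel (rho n) ?g x = (\<Sum>b\<in>hbasis. \<psi> x * Xf gm b (f n b) x)"
        using dsum[of x] z\<psi>[of x] by (cases "x \<in> ?K") (simp_all flip: sum_distrib_left)
      then have "(indicator E x * \<psi> x) * mol gm lborel (rho n) ?g x = (\<Sum>b\<in>hbasis. indicator E x * (\<psi> x * Xf gm b (f n b) x))"
        by (simp add: mult.assoc sum_distrib_left)
      moreover have "Xf gm b (\<lambda>x. \<psi> x * f n b x) x = \<psi> x * Xf gm b (f n b) x + Xf gm b \<psi> x * f n b x" if "b \<in> hbasis" for b
        by (rule Xf_mult[OF s\<psi> sf[OF that]])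
      ultimately show ?thesis by (simp add: sum.distrib distrib_left mult.assoc)
    qed
    have ic: "integrable lborel (\<lambda>x. indicator E x * h x)" if "continuous_on UNIV h" "\<And>x. x \<notin> ?K \<Longrightarrow> h x = 0" for h :: "'a \<Rightarrow> real"
    proof -
      have "integrable lborel h" by (rule integrable_continuous_compact_support[OF that(1) K(1) that(2)])
      then have "integrable lborel (\<lambda>x. indicator E x *\<^sub>R h x)"
        by (rule integrable_mult_indicator[rotated]) (use E in simp)
      then show ?thesis by simp
    qed
    have i1: "integrable lborel (\<lambda>x. (indicator E x * \<psi> x) * mol gm lborel (rho n) ?g x)"
      unfolding mult.assoc
      by (rule ic) (use z\<psi> in \<open>auto intro!: smooth_continuous_on smooth_mult s\<psi> smooth_mol_rho[OF g1 K1(1) gz]\<close>)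
    have i2: "integrable lborel (\<lambda>x. (indicator E x * Xf gm b \<psi> x) * f n b x)" if "b \<in> hbasis" for b
      unfolding mult.assoc
      by (rule ic) (use zX in \<open>auto intro!: smooth_continuous_on smooth_mult smooth_Xf s\<psi> sf[OF that]\<close>)
    have i3: "integrable lborel (\<lambda>x. indicator E x * Xf gm b (\<lambda>x. \<psi> x * f n b x) x)" if "b \<in> hbasis" for b
    proof (rule ic)
      show "continuous_on UNIV (Xf gm b (\<lambda>x. \<psi> x * f n b x))"
        by (intro smooth_continuous_on smooth_Xf smooth_mult s\<psi> sf[OF that])
      show "Xf gm b (\<lambda>x. \<psi> x * f n b x) x = 0" if "x \<notin> ?K" for x
        by (rule Xf_zero_outside[OF smooth_mult[OF s\<psi> sf[OF \<open>b \<in> hbasis\<close>]] compact_imp_closed[OF K(1)] _ that])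
          (simp add: z\<psi>)
    qed
    have "?A n = (\<integral>x. (indicator E x * \<psi> x) * mol gm lborel (rho n) ?g x + (\<Sum>b\<in>hbasis. (indicator E x * Xf gm b \<psi> x) * f n b x) \<partial>lborel)"
      using i1 i2 by (subst Bochner_Integration.integral_add) auto
    also have "\<dots> = (\<Sum>b\<in>hbasis. \<integral>x. indicator E x * Xf gm b (\<lambda>x. \<psi> x * f n b x) x \<partial>lborel)"
      unfolding pw using i3 by (subst Bochner_Integration.integral_sum) auto
    also have "\<dots> = (\<Sum>b\<in>hbasis. - (\<integral>x. (\<psi> x * f n b x) * (\<sigma> x \<bullet> b) \<partial>\<nu>))"
      by (intro sum.cong refl) (rule perim_ibp[OF perim t], auto)
    also have "\<bar>\<dots>\<bar> \<le> (\<Sum>b\<in>hbasis. \<bar>C\<bar> * (\<integral>x. \<bar>\<psi> x\<bar> \<partial>\<nu>))"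
    proof (rule order_trans[OF sum_abs sum_mono])
      fix b assume b: "b \<in> hbasis"
      have fm: "f n b \<in> borel_measurable borel"
        by (rule borel_measurable_continuous_onI[OF smooth_continuous_on[OF sf[OF b]]])
      have pwb: "AE x in \<nu>. \<bar>(\<psi> x * f n b x) * (\<sigma> x \<bullet> b)\<bar> \<le> \<bar>C\<bar> * \<bar>\<psi> x\<bar>"
        using perim_AE_inner[OF perim conjunct1[OF b[unfolded mem_Collect_eq]]]
      proof eventually_elim
        case (elim x)
        have "\<bar>\<psi> x\<bar> * \<bar>f n b x\<bar> * \<bar>\<sigma> x \<bullet> b\<bar> \<le> \<bar>\<psi> x\<bar> * \<bar>C\<bar> * 1"
          using elim fb[OF b, of n x] by (intro mult_mono mult_left_mono) auto
        then show ?case by (simp add: abs_mult mult.commute)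
      qed
      have iL: "integrable \<nu> (\<lambda>x. (\<psi> x * f n b x) * (\<sigma> x \<bullet> b))"
      proof (rule Bochner_Integration.integrable_bound)
        show "integrable \<nu> (\<lambda>x. \<bar>C\<bar> * \<bar>\<psi> x\<bar>)" using i\<psi>\<nu> by simp
        have [measurable]: "\<sigma> \<in> borel_measurable borel" by (rule perim_sigma_measurable[OF perim])
        have "(\<lambda>x. (\<psi> x * f n b x) * (\<sigma> x \<bullet> b)) \<in> borel_measurable borel" using fm by measurable
        then show "(\<lambda>x. (\<psi> x * f n b x) * (\<sigma> x \<bullet> b)) \<in> borel_measurable \<nu>" using snu by (simp cong: measurable_cong_sets)
        show "AE x in \<nu>. norm ((\<psi> x * f n b x) * (\<sigma> x \<bullet> b)) \<le> norm (\<bar>C\<bar> * \<bar>\<psi> x\<bar>)"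
          using pwb by eventually_elim (simp add: abs_mult)
      qed
      have "\<bar>- (\<integral>x. (\<psi> x * f n b x) * (\<sigma> x \<bullet> b) \<partial>\<nu>)\<bar> \<le> (\<integral>x. \<bar>(\<psi> x * f n b x) * (\<sigma> x \<bullet> b)\<bar> \<partial>\<nu>)"
        unfolding abs_minus_cancel by (rule integral_abs_bound)
      also have "\<dots> \<le> (\<integral>x. \<bar>C\<bar> * \<bar>\<psi> x\<bar> \<partial>\<nu>)"
        by (rule integral_mono_AE[OF integrable_abs[OF iL] _ pwb]) (use i\<psi>\<nu> in simp)
      finally show "\<bar>- (\<integral>x. (\<psi> x * f n b x) * (\<sigma> x \<bullet> b) \<partial>\<nu>)\<bar> \<le> \<bar>C\<bar> * (\<integral>x. \<bar>\<psi> x\<bar> \<partial>\<nu>)" by simp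
    qed
    finally show "\<bar>?A n\<bar> \<le> real (card hbasis) * \<bar>C\<bar> * (\<integral>x. \<bar>\<psi> x\<bar> \<partial>\<nu>)" by simp
  qed
  show ?thesis unfolding lim_eq[symmetric]
    by (rule tendsto_upperbound[OF tendsto_rabs[OF A_lim] bound sequentially_bot])
qed

end

section \<open>Weak horizontal derivatives\<close>

lemma smooth_exp: "smooth (exp :: real \<Rightarrow> real)"
proof (rule smooth_fun_alg[of "{exp}"])
  have D: "((exp :: real \<Rightarrow> real) has_derivative (\<lambda>h. h * exp x)) (at x)" for x
    using DERIV_exp[of x] by (simp add: has_field_derivative_def mult_commute_abs)
  show "f differentiable at x" if "f \<in> {exp}" for f :: "real \<Rightarrow> real" and x
    using that differentiableI[OF D] by auto
  show "pd b f \<in> fun_alg {exp}" if "f \<in> {exp}" "b \<in> Basis" for f :: "real \<Rightarrow> real" and b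
  proof -
    have "pd b f = exp" using that by (intro ext) (simp add: pd_eqI[OF D])
    then show ?thesis by (simp add: fun_alg_base)
  qed
qed (simp add: fun_alg_base)

text \<open>A smooth kind of truncation at height of order \<open>1 / sqrt N\<close>: the values
  tend to 0 as \<open>N\<close> grows, yet the slope at 0 remains 1.\<close>

definition soft_cut :: "nat \<Rightarrow> real \<Rightarrow> real" where
  "soft_cut N t = t * exp (- (real N * t\<^sup>2))"

definition soft_cut' :: "nat \<Rightarrow> real \<Rightarrow> real" where
  "soft_cut' N t = (1 - 2 * (real N * t\<^sup>2)) * exp (- (real N * t\<^sup>2))"

lemma smooth_soft_cut: "smooth f \<Longrightarrow> smooth (\<lambda>x. soft_cut N (f x))"
  unfolding soft_cut_def
  by (intro smooth_mult smooth_compose_real[OF smooth_exp] smooth_minus smooth_power smooth_const)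

lemma soft_cut_derivative: "(soft_cut N has_real_derivative soft_cut' N t) (at t)"
  unfolding soft_cut_def soft_cut'_def
  by (auto intro!: derivative_eq_intros simp: power2_eq_square algebra_simps)

lemma abs_soft_cut_le: "\<bar>soft_cut N t\<bar> \<le> \<bar>t\<bar>"
  unfolding soft_cut_def abs_mult by (intro mult_left_le) auto

text \<open>A bound independent of \<open>N\<close>, for dominated convergence. With
  \<open>s = N t\<^sup>2\<close> it amounts to \<open>1 + 2 * s \<le> 3 * exp s\<close>, which
  \<open>1 + s \<le> exp s\<close> gives with room to spare.\<close>

lemma abs_soft_cut'_le: "\<bar>soft_cut' N t\<bar> \<le> 3"
proof -
  define s where "s = real N * t\<^sup>2"
  have s: "s \<ge> 0" by (simp add: s_def)
  have "\<bar>soft_cut' N t\<bar> = \<bar>1 - 2 * s\<bar> * exp (- s)" by (simp add: soft_cut'_def s_def abs_mult)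
  also have "\<dots> \<le> (1 + 2 * s) * exp (- s)" using s by (intro mult_right_mono) auto
  also have "\<dots> = (1 + 2 * s) / exp s" by (simp add: exp_minus divide_inverse)
  also have "\<dots> \<le> 3"
  proof -
    have "1 + s \<le> exp s" by (rule exp_ge_add_one_self)
    then have "1 + 2 * s \<le> 3 * exp s" using s by linarith
    then show ?thesis by (simp add: pos_divide_le_eq)
  qed
  finally show ?thesis .
qed

lemma exp_tendsto_0_nat: "t \<noteq> 0 \<Longrightarrow> (\<lambda>N. exp (- (real N * t\<^sup>2))) \<longlonglongrightarrow> 0"
proof -
  assume "t \<noteq> 0"
  then have "filterlim (\<lambda>N. real N * t\<^sup>2) at_top sequentially"
    by (intro filterlim_at_top_mult_tendsto_pos[of _ "t\<^sup>2"]
        filterlim_real_sequentially tendsto_const filterlim_tendsto_pos_mult_at_top) auto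
  then have "filterlim (\<lambda>N. - (real N * t\<^sup>2)) at_bot sequentially"
    by (simp add: filterlim_uminus_at_top)
  then show ?thesis by (rule filterlim_compose[OF exp_at_bot])
qed

lemma soft_cut_tendsto: "(\<lambda>N. soft_cut N t) \<longlonglongrightarrow> 0"
proof (cases "t = 0")
  case False
  then show ?thesis unfolding soft_cut_def
    using tendsto_mult_right_zero[OF exp_tendsto_0_nat] by blast
qed (simp add: soft_cut_def)

lemma soft_cut'_tendsto: "(\<lambda>N. soft_cut' N t) \<longlonglongrightarrow> indicator {0} t"
proof (cases "t = 0")
  case False
  define a where "a = t\<^sup>2"
  have a: "a > 0" using False by (simp add: a_def)
  have top: "filterlim (\<lambda>N. real N * a) at_top sequentially"
    using a by (intro filterlim_at_top_mult_tendsto_pos[of _ a] filterlim_real_sequentially tendsto_const) auto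
  have "(\<lambda>N. (real N * a) ^ 1 / exp (real N * a)) \<longlonglongrightarrow> 0"
    by (rule filterlim_compose[OF tendsto_power_div_exp_0 top])
  moreover have "(\<lambda>N. (real N * a) ^ 0 / exp (real N * a)) \<longlonglongrightarrow> 0"
    by (rule filterlim_compose[OF tendsto_power_div_exp_0 top])
  ultimately have "(\<lambda>N. (real N * a) ^ 0 / exp (real N * a) - 2 * ((real N * a) ^ 1 / exp (real N * a))) \<longlonglongrightarrow> 0 - 2 * 0"
    by (intro tendsto_intros)
  then show ?thesis using False unfolding soft_cut'_def a_def
    by (simp add: exp_minus field_simps)
qed (simp add: soft_cut'_def)

context stratified
begin

text \<open>The cutoff function may jump on the frontier of \<open>K1\<close>, so pointwise
  convergence is asserted in the interior only, where it agrees with \<open>f\<close> near each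
  point.\<close>

lemma mol_cutoff_tendsto:
  assumes K1: "compact K1" and f: "f \<in> borel_measurable borel" "\<And>x. x \<in> K1 \<Longrightarrow> isCont f x"
  obtains M where "integrable lborel (\<lambda>y. indicator K1 y * f y)" "\<And>x. x \<in> K1 \<Longrightarrow> \<bar>f x\<bar> \<le> M"
    "\<And>n x. \<bar>mol gm lborel (rho n) (\<lambda>y. indicator K1 y * f y) x\<bar> \<le> M"
    "\<And>x. x \<in> interior K1 \<Longrightarrow> (\<lambda>n. mol gm lborel (rho n) (\<lambda>y. indicator K1 y * f y) x) \<longlonglongrightarrow> f x"
proof -
  have "continuous_on K1 f" using f(2) by (simp add: continuous_at_imp_continuous_on)
  then obtain M where M: "M > 0" "\<And>x. x \<in> K1 \<Longrightarrow> \<bar>f x\<bar> \<le> M"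
    using continuous_compact_bounded[OF _ K1] by blast
  have int: "integrable lborel (\<lambda>y. indicator K1 y * f y)"
    by (rule integrable_indicator_compact_mult[OF K1 f(1), of M]) (use M in auto)
  have [measurable]: "f \<in> borel_measurable borel" "K1 \<in> sets borel"
    using f(1) K1 by (auto simp: compact_imp_closed)
  have b: "\<bar>mol gm lborel (rho n) (\<lambda>y. indicator K1 y * f y) x\<bar> \<le> M" for n x
    by (rule mol_bound) (use M in \<open>auto simp: indicator_def intro!: AE_I2\<close>)
  have t: "(\<lambda>n. mol gm lborel (rho n) (\<lambda>y. indicator K1 y * f y) x) \<longlonglongrightarrow> f x" if x: "x \<in> interior K1" for x
  proof -
    have xK: "x \<in> K1" using x interior_subset by blast
    have "\<forall>\<^sub>F y in nhds x. indicator K1 y * f y = f y"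
      using eventually_nhds_in_open[OF open_interior x]
    proof eventually_elim
      case (elim y)
      then have "y \<in> K1" using interior_subset by blast
      then show ?case by simp
    qed
    from isCont_cong[OF this] f(2)[OF xK] have "isCont (\<lambda>y. indicator K1 y * f y) x" by simp
    from mol_tendsto_at[OF int K1 _ this] show ?thesis using xK by simp
  qed
  show ?thesis by (rule that[OF int M(2) b t])
qed

text \<open>Apply the chain rule to \<open>t * exp (- N t\<^sup>2)\<close>, whose derivative tends to the indicator of \<open>{0}\<close>.\<close>

lemma weak_derivative_zero_on_zero_set:
  assumes V: "open V" and f: "f \<in> borel_measurable borel" "\<And>x. x \<in> V \<Longrightarrow> isCont f x"
    and h: "h \<in> borel_measurable borel" "\<And>K. compact K \<Longrightarrow> K \<subseteq> V \<Longrightarrow> set_integrable lborel K h"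
    and weak: "\<And>\<psi>. test_fun V \<psi> \<Longrightarrow> (\<integral>x. f x * Xf gm b \<psi> x \<partial>lborel) = - (\<integral>x. \<psi> x * h x \<partial>lborel)"
  shows "AE x in lborel. x \<in> V \<longrightarrow> f x = 0 \<longrightarrow> h x = 0"
proof -
  note f(1) [measurable] h(1) [measurable]
  have Zm [measurable]: "{x. f x = 0} \<in> sets borel" by measurable
  have "AE x in lborel. x \<in> V \<longrightarrow> indicator {x. f x = 0} x * h x = 0"
  proof (rule AE_zero_if_test_integrals_zero[OF sets_lborel V])
    show "set_integrable lborel K (\<lambda>x. indicator {x. f x = 0} x * h x)" if K: "compact K" "K \<subseteq> V" for K
    proof -
      have "integrable lborel (\<lambda>x. indicator {x. f x = 0} x *\<^sub>R (indicator K x *\<^sub>R h x))"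
        by (rule integrable_mult_indicator) (use h(2)[OF K] in \<open>auto simp: set_integrable_def\<close>)
      then show ?thesis unfolding set_integrable_def by (simp add: mult.left_commute)
    qed
    fix \<psi> assume \<psi>: "test_fun V \<psi>"
    have s\<psi>: "smooth \<psi>" and K: "compact (tsupport \<psi>)" "tsupport \<psi> \<subseteq> V" using \<psi> by (auto simp: test_fun_iff)
    let ?K = "tsupport \<psi>"
    have z\<psi>: "\<psi> x = 0" if "x \<notin> ?K" for x using that by (rule tsupport_zero)
    have zX: "Xf gm b \<psi> x = 0" if "x \<notin> ?K" for x
      by (rule Xf_zero_outside[OF s\<psi> compact_imp_closed[OF K(1)] z\<psi> that])
    obtain K1 where K1: "compact K1" "K1 \<subseteq> V" "?K \<subseteq> interior K1"
      and near: "\<forall>\<^sub>F n in sequentially. \<forall>x\<in>?K. \<forall>y. rho n (gm x (- y)) \<noteq> 0 \<longrightarrow> y \<in> K1"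
      using test_fun_neighbourhood[OF V \<psi>] by blast
    have KK1: "?K \<subseteq> K1" using K1(3) interior_subset by blast
    let ?f = "\<lambda>y. indicator K1 y * f y" and ?h = "\<lambda>y. indicator K1 y * h y"
    have fK1: "isCont f x" if "x \<in> K1" for x using f(2) K1(2) that by blast
    obtain M where fi: "integrable lborel ?f" and M: "\<And>x. x \<in> K1 \<Longrightarrow> \<bar>f x\<bar> \<le> M"
      and fM: "\<And>n x. \<bar>mol gm lborel (rho n) ?f x\<bar> \<le> M"
      and ft: "\<And>x. x \<in> interior K1 \<Longrightarrow> (\<lambda>n. mol gm lborel (rho n) ?f x) \<longlonglongrightarrow> f x"
      using mol_cutoff_tendsto[OF K1(1) f(1) fK1] by blast
    have hi: "integrable lborel ?h" "\<And>y. y \<notin> K1 \<Longrightarrow> ?h y = 0" using h(2)[OF K1(1,2)] by (simp_all add: set_integrable_def)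
    define fn where "fn n = mol gm lborel (rho n) ?f" for n
    have sf: "smooth (fn n)" for n unfolding fn_def by (rule smooth_mol_rho[OF fi K1(1)]) simp
    have fnm [measurable]: "fn n \<in> borel_measurable borel" for n
      by (rule borel_measurable_continuous_onI[OF smooth_continuous_on[OF sf]])
    have \<psi>m [measurable]: "\<psi> \<in> borel_measurable borel" "Xf gm b \<psi> \<in> borel_measurable borel"
      by (intro borel_measurable_continuous_onI smooth_continuous_on s\<psi> smooth_Xf)+
    have scm [measurable]: "soft_cut N \<in> borel_measurable borel" "soft_cut' N \<in> borel_measurable borel" for N
      unfolding soft_cut_def soft_cut'_def by measurable
    obtain C where C: "C > 0" "\<And>x. \<bar>\<psi> x\<bar> \<le> C"
      using continuous_compact_support_bounded[OF smooth_continuous_on[OF s\<psi>] K(1) z\<psi>] by blast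
    have iX: "integrable lborel (Xf gm b \<psi>)"
      by (rule integrable_continuous_compact_support[OF smooth_continuous_on[OF smooth_Xf[OF s\<psi>]] K(1) zX])
    have scb: "\<bar>soft_cut N (fn n x)\<bar> \<le> M" for N n x
      using abs_soft_cut_le[of N "fn n x"] fM[of n x] unfolding fn_def by linarith
    have contsc: "isCont (soft_cut N) t" "isCont (soft_cut' N) t" for N t
      unfolding soft_cut_def soft_cut'_def by (intro continuous_intros)+
    \<comment> \<open>The chain rule for \<open>soft_cut N\<close> in weak form, obtained with
      \<open>N\<close> fixed as the mollification index tends to infinity. Only afterwards is
      \<open>N\<close> sent to infinity: the left side then tends to 0 and the right side retains
      the part of \<open>h\<close> on the zero set.\<close>
    have step: "(\<integral>x. soft_cut N (f x) * Xf gm b \<psi> x \<partial>lborel) = - (\<integral>x. (\<psi> x * soft_cut' N (f x)) * ?h x \<partial>lborel)" for N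
    proof (rule LIMSEQ_unique)
      show "(\<lambda>n. \<integral>x. soft_cut N (fn n x) * Xf gm b \<psi> x \<partial>lborel) \<longlonglongrightarrow> (\<integral>x. soft_cut N (f x) * Xf gm b \<psi> x \<partial>lborel)"
      proof (rule integral_dominated_convergence[where w = "\<lambda>x. M * \<bar>Xf gm b \<psi> x\<bar>"])
        show "AE x in lborel. (\<lambda>n. soft_cut N (fn n x) * Xf gm b \<psi> x) \<longlonglongrightarrow> soft_cut N (f x) * Xf gm b \<psi> x"
        proof (rule AE_I2)
          fix x show "(\<lambda>n. soft_cut N (fn n x) * Xf gm b \<psi> x) \<longlonglongrightarrow> soft_cut N (f x) * Xf gm b \<psi> x"
          proof (cases "x \<in> ?K")
            case True
            then have "(\<lambda>n. fn n x) \<longlonglongrightarrow> f x" unfolding fn_def using K1(3) ft by blast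
            then show ?thesis by (intro tendsto_mult tendsto_const isCont_tendsto_compose[OF contsc(1)])
          qed (simp add: zX)
        qed
        show "AE x in lborel. norm (soft_cut N (fn n x) * Xf gm b \<psi> x) \<le> M * \<bar>Xf gm b \<psi> x\<bar>" for n
          using scb by (intro AE_I2) (auto simp: abs_mult intro!: mult_right_mono)
      qed (use iX in auto)
      have lim: "(\<lambda>n. \<integral>x. (\<psi> x * soft_cut' N (fn n x)) * mol gm lborel (rho n) ?h x \<partial>lborel)
        \<longlonglongrightarrow> (\<integral>x. (\<psi> x * soft_cut' N (f x)) * ?h x \<partial>lborel)"
      proof (rule mol_varying_weak_tendsto[OF hi(1) K1(1) hi(2)])
        show "AE x in lborel. \<bar>\<psi> x * soft_cut' N (fn n x)\<bar> \<le> C * 3" for n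
          unfolding abs_mult using C abs_soft_cut'_le by (intro AE_I2 mult_mono) auto
        show "AE x in lborel. (\<lambda>n. \<psi> x * soft_cut' N (fn n x)) \<longlonglongrightarrow> \<psi> x * soft_cut' N (f x)"
        proof (rule AE_I2)
          fix x show "(\<lambda>n. \<psi> x * soft_cut' N (fn n x)) \<longlonglongrightarrow> \<psi> x * soft_cut' N (f x)"
          proof (cases "x \<in> ?K")
            case True
            then have "(\<lambda>n. fn n x) \<longlonglongrightarrow> f x" unfolding fn_def using K1(3) ft by blast
            then show ?thesis by (intro tendsto_mult tendsto_const isCont_tendsto_compose[OF contsc(2)])
          qed (simp add: z\<psi>)
        qed
      qed simp_all
      have ev: "\<forall>\<^sub>F n in sequentially. - (\<integral>x. (\<psi> x * soft_cut' N (fn n x)) * mol gm lborel (rho n) ?h x \<partial>lborel)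
        = (\<integral>x. soft_cut N (fn n x) * Xf gm b \<psi> x \<partial>lborel)"
        using near
      proof eventually_elim
        case (elim n)
        have "(\<integral>x. soft_cut N (fn n x) * Xf gm b \<psi> x \<partial>lborel) = - (\<integral>x. \<psi> x * (soft_cut' N (fn n x) * Xf gm b (fn n) x) \<partial>lborel)"
          unfolding Xf_ibp[OF smooth_soft_cut[OF sf] \<psi>] Xf_compose_real[OF sf soft_cut_derivative] ..
        also have "(\<integral>x. \<psi> x * (soft_cut' N (fn n x) * Xf gm b (fn n) x) \<partial>lborel)
          = (\<integral>x. (\<psi> x * soft_cut' N (fn n x)) * mol gm lborel (rho n) ?h x \<partial>lborel)"
        proof (intro Bochner_Integration.integral_cong refl)
          fix x
          show "\<psi> x * (soft_cut' N (fn n x) * Xf gm b (fn n) x) = (\<psi> x * soft_cut' N (fn n x)) * mol gm lborel (rho n) ?h x"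
          proof (cases "x \<in> ?K")
            case True
            have "Xf gm b (fn n) x = mol gm lborel (rho n) ?h x"
              unfolding fn_def by (rule Xf_mol_weak_derivative[OF fi K1(1,2) weak]) (use elim True in blast)+
            then show ?thesis by (simp add: mult.assoc)
          qed (simp add: z\<psi>)
        qed
        finally show ?case by simp
      qed
      show "(\<lambda>n. \<integral>x. soft_cut N (fn n x) * Xf gm b \<psi> x \<partial>lborel) \<longlonglongrightarrow> - (\<integral>x. (\<psi> x * soft_cut' N (f x)) * ?h x \<partial>lborel)"
        by (rule Lim_transform_eventually[OF tendsto_minus[OF lim] ev])
    qed
    have L: "(\<lambda>N. \<integral>x. soft_cut N (f x) * Xf gm b \<psi> x \<partial>lborel) \<longlonglongrightarrow> (\<integral>x. 0 * Xf gm b \<psi> x \<partial>lborel)"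
    proof (rule integral_dominated_convergence[where w = "\<lambda>x. M * \<bar>Xf gm b \<psi> x\<bar>"])
      show "AE x in lborel. (\<lambda>N. soft_cut N (f x) * Xf gm b \<psi> x) \<longlonglongrightarrow> 0 * Xf gm b \<psi> x"
        by (intro AE_I2 tendsto_mult tendsto_const soft_cut_tendsto)
      show "AE x in lborel. norm (soft_cut N (f x) * Xf gm b \<psi> x) \<le> M * \<bar>Xf gm b \<psi> x\<bar>" for N
      proof (rule AE_I2)
        fix x show "norm (soft_cut N (f x) * Xf gm b \<psi> x) \<le> M * \<bar>Xf gm b \<psi> x\<bar>"
        proof (cases "x \<in> ?K")
          case True
          then have "\<bar>soft_cut N (f x)\<bar> \<le> M" using abs_soft_cut_le[of N "f x"] M[of x] KK1 by force
          then show ?thesis by (auto simp: abs_mult intro!: mult_right_mono)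
        qed (simp add: zX)
      qed
    qed (use iX in auto)
    have R: "(\<lambda>N. - (\<integral>x. (\<psi> x * soft_cut' N (f x)) * ?h x \<partial>lborel)) \<longlonglongrightarrow> - (\<integral>x. (\<psi> x * indicator {0} (f x)) * ?h x \<partial>lborel)"
    proof (rule tendsto_minus, rule integral_dominated_convergence[where w = "\<lambda>x. C * 3 * \<bar>?h x\<bar>"])
      show "(\<lambda>x. (\<psi> x * indicator {0} (f x)) * ?h x) \<in> borel_measurable lborel"
      proof -
        have "(\<lambda>x. indicator {0} (f x) :: real) = indicator {x. f x = 0}" by (auto simp: indicator_def fun_eq_iff)
        then show ?thesis using hi(1) by auto
      qed
      show "(\<lambda>x. (\<psi> x * soft_cut' N (f x)) * ?h x) \<in> borel_measurable lborel" for N using hi(1) by auto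
      show "AE x in lborel. (\<lambda>N. (\<psi> x * soft_cut' N (f x)) * ?h x) \<longlonglongrightarrow> (\<psi> x * indicator {0} (f x)) * ?h x"
        by (intro AE_I2 tendsto_mult tendsto_const soft_cut'_tendsto)
      show "AE x in lborel. norm ((\<psi> x * soft_cut' N (f x)) * ?h x) \<le> C * 3 * \<bar>?h x\<bar>" for N
      proof (rule AE_I2)
        fix x
        have "\<bar>\<psi> x\<bar> * \<bar>soft_cut' N (f x)\<bar> \<le> C * 3" using C abs_soft_cut'_le by (intro mult_mono) auto
        then have "\<bar>\<psi> x\<bar> * \<bar>soft_cut' N (f x)\<bar> * \<bar>?h x\<bar> \<le> C * 3 * \<bar>?h x\<bar>" by (rule mult_right_mono) simp
        then show "norm ((\<psi> x * soft_cut' N (f x)) * ?h x) \<le> C * 3 * \<bar>?h x\<bar>" by (simp only: real_norm_def abs_mult)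
      qed
    qed (use hi(1) in auto)
    have "(\<integral>x. (\<psi> x * indicator {0} (f x)) * ?h x \<partial>lborel) = 0"
      using LIMSEQ_unique[OF L[unfolded step] R] by simp
    also have "(\<integral>x. (\<psi> x * indicator {0} (f x)) * ?h x \<partial>lborel) = (\<integral>x. \<psi> x * (indicator {x. f x = 0} x * h x) \<partial>lborel)"
      by (intro Bochner_Integration.integral_cong refl) (use z\<psi> KK1 in \<open>auto simp: indicator_def\<close>)
    finally show "(\<integral>x. \<psi> x * (indicator {x. f x = 0} x * h x) \<partial>lborel) = 0" .
  qed
  then show ?thesis by eventually_elim (auto simp: indicator_def)
qed

text \<open>The identity \<open>tr\<close> is applied to \<eta> times the mollification of
  \<open>f\<close>. The gradient terms converge because the weak derivatives are mollified in L1
  against bounded factors. The boundary term converges because continuity of \<open>f\<close> gives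
  bounded convergence at every point of the support of \<eta>; convergence almost everywhere in the
  Lebesgue sense would say nothing under \<nu>.\<close>

lemma trace_identity_weak:
  assumes U: "open U" and E: "E \<in> sets borel"
    and F: "F \<in> borel_measurable borel" "\<And>b. b \<in> hbasis \<Longrightarrow> AE x in lborel. x \<in> U \<longrightarrow> \<bar>F x \<bullet> b\<bar> \<le> C"
    and g: "g \<in> borel_measurable borel" "\<And>K. compact K \<Longrightarrow> K \<subseteq> U \<Longrightarrow> set_integrable lborel K g"
    and snu: "sets \<nu> = sets borel" and v: "v \<in> borel_measurable borel" "\<And>K. compact K \<Longrightarrow> K \<subseteq> U \<Longrightarrow> set_integrable \<nu> K v"
    and tr: "\<And>\<psi>. test_fun U \<psi> \<Longrightarrow> - (\<integral>x. indicator E x * (\<Sum>b\<in>hbasis. (F x \<bullet> b) * Xf gm b \<psi> x) \<partial>lborel)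
       = (\<integral>x. \<psi> x * g x \<partial>lborel) - (\<integral>x. \<psi> x * v x \<partial>\<nu>)"
    and f: "f \<in> borel_measurable borel" "\<And>x. x \<in> U \<Longrightarrow> isCont f x"
    and h: "h \<in> borel_measurable borel" "\<And>b K. b \<in> hbasis \<Longrightarrow> compact K \<Longrightarrow> K \<subseteq> U \<Longrightarrow> set_integrable lborel K (\<lambda>x. h x \<bullet> b)"
    and weak: "\<And>b \<psi>. b \<in> hbasis \<Longrightarrow> test_fun U \<psi> \<Longrightarrow>
       (\<integral>x. f x * Xf gm b \<psi> x \<partial>lborel) = - (\<integral>x. \<psi> x * (h x \<bullet> b) \<partial>lborel)"
    and \<eta>: "test_fun U \<eta>"
  shows "- (\<integral>x. indicator E x * (\<Sum>b\<in>hbasis. (F x \<bullet> b) * (\<eta> x * (h x \<bullet> b) + f x * Xf gm b \<eta> x)) \<partial>lborel)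
       = (\<integral>x. \<eta> x * f x * g x \<partial>lborel) - (\<integral>x. \<eta> x * f x * v x \<partial>\<nu>)"
proof -
  have s\<eta>: "smooth \<eta>" and K: "compact (tsupport \<eta>)" "tsupport \<eta> \<subseteq> U" using \<eta> by (auto simp: test_fun_iff)
  let ?K = "tsupport \<eta>"
  have z\<eta>: "\<eta> x = 0" if "x \<notin> ?K" for x using that by (rule tsupport_zero)
  have zX: "Xf gm b \<eta> x = 0" if "x \<notin> ?K" for x b
    by (rule Xf_zero_outside[OF s\<eta> compact_imp_closed[OF K(1)] z\<eta> that])
  obtain K1 where K1: "compact K1" "K1 \<subseteq> U" "?K \<subseteq> interior K1"
    and near: "\<forall>\<^sub>F n in sequentially. \<forall>x\<in>?K. \<forall>y. rho n (gm x (- y)) \<noteq> 0 \<longrightarrow> y \<in> K1"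
    using test_fun_neighbourhood[OF U \<eta>] by blast
  have KK1: "?K \<subseteq> K1" using K1(3) interior_subset by blast
  have K1b [measurable]: "K1 \<in> sets borel" using K1 by (simp add: compact_imp_closed)
  note E [measurable] F(1) [measurable] g(1) [measurable] v(1) [measurable] f(1) [measurable] h(1) [measurable]
  let ?f = "\<lambda>y. indicator K1 y * f y" and ?h = "\<lambda>b y. indicator K1 y * (h y \<bullet> b)"
  have fK1: "isCont f x" if "x \<in> K1" for x using f(2) K1(2) that by blast
  obtain M where fi: "integrable lborel ?f" and M: "\<And>x. x \<in> K1 \<Longrightarrow> \<bar>f x\<bar> \<le> M"
    and fM: "\<And>n x. \<bar>mol gm lborel (rho n) ?f x\<bar> \<le> M"
    and ft: "\<And>x. x \<in> interior K1 \<Longrightarrow> (\<lambda>n. mol gm lborel (rho n) ?f x) \<longlonglongrightarrow> f x"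
    using mol_cutoff_tendsto[OF K1(1) f(1) fK1] by blast
  have M0: "M \<ge> 0" using fM[of 0 0] by linarith
  have hi: "integrable lborel (?h b)" if "b \<in> hbasis" for b
    using h(2)[OF that K1(1,2)] by (simp add: set_integrable_def)
  have hz: "\<And>y. y \<notin> K1 \<Longrightarrow> ?h b y = 0" for b by simp
  define fn where "fn n = mol gm lborel (rho n) ?f" for n
  have sf: "smooth (fn n)" for n unfolding fn_def by (rule smooth_mol_rho[OF fi K1(1)]) simp
  have fnm [measurable]: "fn n \<in> borel_measurable borel" for n
    by (rule borel_measurable_continuous_onI[OF smooth_continuous_on[OF sf]])
  have \<eta>m [measurable]: "\<eta> \<in> borel_measurable borel" "Xf gm b \<eta> \<in> borel_measurable borel" for b
    by (intro borel_measurable_continuous_onI smooth_continuous_on s\<eta> smooth_Xf)+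
  have nuM: "u \<in> borel_measurable borel \<Longrightarrow> u \<in> borel_measurable \<nu>" for u :: "'a \<Rightarrow> real"
    using snu by (simp cong: measurable_cong_sets)
  have fb: "\<bar>fn n x\<bar> \<le> M" for n x using fM unfolding fn_def .
  have ftK: "(\<lambda>n. fn n x) \<longlonglongrightarrow> f x" if "x \<in> ?K" for x unfolding fn_def using K1(3) ft that by blast
  obtain C\<eta> where C\<eta>: "C\<eta> > 0" "\<And>x. \<bar>\<eta> x\<bar> \<le> C\<eta>"
    using continuous_compact_support_bounded[OF smooth_continuous_on[OF s\<eta>] K(1) z\<eta>] by blast
  have gi: "integrable lborel (\<lambda>x. indicator K1 x * g x)" using g(2)[OF K1(1,2)] by (simp add: set_integrable_def)
  have vi: "integrable \<nu> (\<lambda>x. indicator K1 x * v x)" using v(2)[OF K1(1,2)] by (simp add: set_integrable_def)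
  have bd: "\<bar>\<eta> x * fn n x * u\<bar> \<le> C\<eta> * M * \<bar>indicator K1 x * u\<bar>" for x n and u :: real
  proof (cases "x \<in> ?K")
    case True
    have "\<bar>\<eta> x\<bar> * \<bar>fn n x\<bar> \<le> C\<eta> * M" using C\<eta> fb by (intro mult_mono) auto
    then have "\<bar>\<eta> x\<bar> * \<bar>fn n x\<bar> * \<bar>u\<bar> \<le> C\<eta> * M * \<bar>u\<bar>" by (rule mult_right_mono) simp
    moreover have "x \<in> K1" using True KK1 by blast
    ultimately show ?thesis by (simp add: abs_mult)
  qed (use C\<eta> M0 in \<open>simp add: z\<eta>\<close>)
  have pt: "(\<lambda>n. \<eta> x * fn n x * u) \<longlonglongrightarrow> \<eta> x * f x * u" for x and u :: real
    by (cases "x \<in> ?K") (auto simp: z\<eta> intro!: tendsto_intros ftK)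
  have L1: "(\<lambda>n. \<integral>x. \<eta> x * fn n x * g x \<partial>lborel) \<longlonglongrightarrow> (\<integral>x. \<eta> x * f x * g x \<partial>lborel)"
    by (rule integral_dominated_convergence[where w = "\<lambda>x. C\<eta> * M * \<bar>indicator K1 x * g x\<bar>"])
      (use gi bd pt in auto)
  have L2: "(\<lambda>n. \<integral>x. \<eta> x * fn n x * v x \<partial>\<nu>) \<longlonglongrightarrow> (\<integral>x. \<eta> x * f x * v x \<partial>\<nu>)"
    by (rule integral_dominated_convergence[where w = "\<lambda>x. C\<eta> * M * \<bar>indicator K1 x * v x\<bar>"])
      (use vi bd pt in \<open>auto intro!: nuM\<close>)
  have cb: "AE x in lborel. \<bar>indicator E x * (F x \<bullet> b) * \<eta> x\<bar> \<le> \<bar>C\<bar> * C\<eta>" if "b \<in> hbasis" for b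
    using F(2)[OF that]
  proof eventually_elim
    case (elim x)
    show ?case
    proof (cases "x \<in> U")
      case True
      have "\<bar>indicator E x * (F x \<bullet> b)\<bar> \<le> \<bar>C\<bar>" using elim True by (auto simp: indicator_def)
      then show ?thesis unfolding abs_mult[of _ "\<eta> x"] using C\<eta>(2) by (intro mult_mono) auto
    next
      case False
      then have "\<eta> x = 0" using z\<eta> K(2) by blast
      then show ?thesis using C\<eta> by simp
    qed
  qed
  have L3: "(\<lambda>n. \<integral>x. (indicator E x * (F x \<bullet> b) * \<eta> x) * mol gm lborel (rho n) (?h b) x \<partial>lborel)
     \<longlonglongrightarrow> (\<integral>x. (indicator E x * (F x \<bullet> b) * \<eta> x) * ?h b x \<partial>lborel)" if b: "b \<in> hbasis" for b
    by (rule mol_weak_tendsto[OF hi[OF b] K1(1) hz _ cb[OF b]]) measurable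
  have db: "AE x in lborel. norm ((indicator E x * (F x \<bullet> b) * Xf gm b \<eta> x) * u x) \<le> \<bar>C\<bar> * M * \<bar>Xf gm b \<eta> x\<bar>"
    if b: "b \<in> hbasis" and u: "\<And>x. x \<in> ?K \<Longrightarrow> \<bar>u x\<bar> \<le> M" for b and u :: "'a \<Rightarrow> real"
    using F(2)[OF b]
  proof eventually_elim
    case (elim x)
    show ?case
    proof (cases "x \<in> ?K")
      case True
      have "\<bar>indicator E x * (F x \<bullet> b)\<bar> \<le> \<bar>C\<bar>" using elim True K(2) by (auto simp: indicator_def)
      then have "\<bar>indicator E x * (F x \<bullet> b)\<bar> * \<bar>u x\<bar> \<le> \<bar>C\<bar> * M" using u[OF True] by (intro mult_mono) auto
      then have "\<bar>indicator E x * (F x \<bullet> b)\<bar> * \<bar>u x\<bar> * \<bar>Xf gm b \<eta> x\<bar> \<le> \<bar>C\<bar> * M * \<bar>Xf gm b \<eta> x\<bar>"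
        by (rule mult_right_mono) simp
      then show ?thesis by (simp add: abs_mult mult_ac)
    qed (simp add: zX)
  qed
  have iX: "integrable lborel (Xf gm b \<eta>)" for b
    by (rule integrable_continuous_compact_support[OF smooth_continuous_on[OF smooth_Xf[OF s\<eta>]] K(1) zX])
  have L4: "(\<lambda>n. \<integral>x. (indicator E x * (F x \<bullet> b) * Xf gm b \<eta> x) * fn n x \<partial>lborel)
     \<longlonglongrightarrow> (\<integral>x. (indicator E x * (F x \<bullet> b) * Xf gm b \<eta> x) * f x \<partial>lborel)" if b: "b \<in> hbasis" for b
  proof (rule integral_dominated_convergence[where w = "\<lambda>x. \<bar>C\<bar> * M * \<bar>Xf gm b \<eta> x\<bar>"])
    show "AE x in lborel. (\<lambda>n. (indicator E x * (F x \<bullet> b) * Xf gm b \<eta> x) * fn n x) \<longlonglongrightarrow> (indicator E x * (F x \<bullet> b) * Xf gm b \<eta> x) * f x"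
    proof (rule AE_I2)
      fix x show "(\<lambda>n. (indicator E x * (F x \<bullet> b) * Xf gm b \<eta> x) * fn n x) \<longlonglongrightarrow> (indicator E x * (F x \<bullet> b) * Xf gm b \<eta> x) * f x"
        by (cases "x \<in> ?K") (auto simp: zX intro!: tendsto_mult tendsto_const ftK)
    qed
    show "AE x in lborel. norm ((indicator E x * (F x \<bullet> b) * Xf gm b \<eta> x) * fn n x) \<le> \<bar>C\<bar> * M * \<bar>Xf gm b \<eta> x\<bar>" for n
      by (rule db[OF b fb])
  qed (use iX in auto)
  have i3: "integrable lborel (\<lambda>x. (indicator E x * (F x \<bullet> b) * \<eta> x) * u x)" if b: "b \<in> hbasis" and u: "integrable lborel u" for b and u :: "'a \<Rightarrow> real"
  proof (rule Bochner_Integration.integrable_bound)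
    show "integrable lborel (\<lambda>x. \<bar>C\<bar> * C\<eta> * u x)" using u by simp
    show "AE x in lborel. norm ((indicator E x * (F x \<bullet> b) * \<eta> x) * u x) \<le> norm (\<bar>C\<bar> * C\<eta> * u x)"
      using cb[OF b]
    proof eventually_elim
      case (elim x)
      then have "\<bar>indicator E x * (F x \<bullet> b) * \<eta> x\<bar> * \<bar>u x\<bar> \<le> \<bar>C\<bar> * C\<eta> * \<bar>u x\<bar>" by (rule mult_right_mono) simp
      then show ?case using C\<eta>(1) by (simp only: real_norm_def abs_mult[of _ "u x"] abs_mult[of "\<bar>C\<bar>"] abs_idempotent abs_of_pos)
    qed
  qed (use u in measurable)
  have i4: "integrable lborel (\<lambda>x. (indicator E x * (F x \<bullet> b) * Xf gm b \<eta> x) * u x)"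
    if b: "b \<in> hbasis" and u: "\<And>x. x \<in> ?K \<Longrightarrow> \<bar>u x\<bar> \<le> M" "u \<in> borel_measurable borel" for b and u :: "'a \<Rightarrow> real"
  proof (rule Bochner_Integration.integrable_bound)
    show "integrable lborel (\<lambda>x. \<bar>C\<bar> * M * \<bar>Xf gm b \<eta> x\<bar>)" using iX by simp
    show "AE x in lborel. norm ((indicator E x * (F x \<bullet> b) * Xf gm b \<eta> x) * u x) \<le> norm (\<bar>C\<bar> * M * \<bar>Xf gm b \<eta> x\<bar>)"
    proof -
      have "AE x in lborel. norm ((indicator E x * (F x \<bullet> b) * Xf gm b \<eta> x) * u x) \<le> \<bar>C\<bar> * M * \<bar>Xf gm b \<eta> x\<bar>"
        by (rule db[OF b u(1)])
      then show ?thesis by eventually_elim (auto intro: order_trans)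
    qed
    note u(2) [measurable]
    show "(\<lambda>x. (indicator E x * (F x \<bullet> b) * Xf gm b \<eta> x) * u x) \<in> borel_measurable lborel" by measurable
  qed
  let ?A = "\<lambda>n. \<Sum>b\<in>hbasis. (\<integral>x. (indicator E x * (F x \<bullet> b) * \<eta> x) * mol gm lborel (rho n) (?h b) x \<partial>lborel)
      + (\<integral>x. (indicator E x * (F x \<bullet> b) * Xf gm b \<eta> x) * fn n x \<partial>lborel)"
  have A_lim: "?A \<longlonglongrightarrow> (\<Sum>b\<in>hbasis. (\<integral>x. (indicator E x * (F x \<bullet> b) * \<eta> x) * ?h b x \<partial>lborel)
      + (\<integral>x. (indicator E x * (F x \<bullet> b) * Xf gm b \<eta> x) * f x \<partial>lborel))"
    by (intro tendsto_sum tendsto_add L3 L4)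
  have fKM: "\<bar>f x\<bar> \<le> M" if "x \<in> ?K" for x using M KK1 that by blast
  have A_eq: "(\<Sum>b\<in>hbasis. (\<integral>x. (indicator E x * (F x \<bullet> b) * \<eta> x) * ?h b x \<partial>lborel)
      + (\<integral>x. (indicator E x * (F x \<bullet> b) * Xf gm b \<eta> x) * f x \<partial>lborel))
    = (\<integral>x. indicator E x * (\<Sum>b\<in>hbasis. (F x \<bullet> b) * (\<eta> x * (h x \<bullet> b) + f x * Xf gm b \<eta> x)) \<partial>lborel)"
  proof -
    have "(\<Sum>b\<in>hbasis. (\<integral>x. (indicator E x * (F x \<bullet> b) * \<eta> x) * ?h b x \<partial>lborel)
      + (\<integral>x. (indicator E x * (F x \<bullet> b) * Xf gm b \<eta> x) * f x \<partial>lborel))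
     = (\<Sum>b\<in>hbasis. \<integral>x. (indicator E x * (F x \<bullet> b) * \<eta> x) * ?h b x + (indicator E x * (F x \<bullet> b) * Xf gm b \<eta> x) * f x \<partial>lborel)"
      by (intro sum.cong refl Bochner_Integration.integral_add[symmetric] i3 i4 hi fKM f(1))
    also have "\<dots> = (\<integral>x. (\<Sum>b\<in>hbasis. (indicator E x * (F x \<bullet> b) * \<eta> x) * ?h b x + (indicator E x * (F x \<bullet> b) * Xf gm b \<eta> x) * f x) \<partial>lborel)"
      by (intro Bochner_Integration.integral_sum[symmetric] Bochner_Integration.integrable_add i3 i4 hi fKM f(1))
    also have "\<dots> = (\<integral>x. indicator E x * (\<Sum>b\<in>hbasis. (F x \<bullet> b) * (\<eta> x * (h x \<bullet> b) + f x * Xf gm b \<eta> x)) \<partial>lborel)"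
    proof (intro Bochner_Integration.integral_cong refl)
      fix x
      have "\<eta> x * indicator K1 x = \<eta> x" using z\<eta>[of x] KK1 by (cases "x \<in> ?K") auto
      then have "(indicator E x * (F x \<bullet> b) * \<eta> x) * ?h b x = indicator E x * (F x \<bullet> b) * \<eta> x * (h x \<bullet> b)" for b
        by (simp only: mult.assoc mult.left_commute[of _ "indicator K1 x"]) (metis mult.assoc mult.commute)
      then show "(\<Sum>b\<in>hbasis. (indicator E x * (F x \<bullet> b) * \<eta> x) * ?h b x + (indicator E x * (F x \<bullet> b) * Xf gm b \<eta> x) * f x)
        = indicator E x * (\<Sum>b\<in>hbasis. (F x \<bullet> b) * (\<eta> x * (h x \<bullet> b) + f x * Xf gm b \<eta> x))"
        unfolding sum_distrib_left by (intro sum.cong refl) (simp only: distrib_left mult_ac)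
    qed
    finally show ?thesis .
  qed
  have ev: "\<forall>\<^sub>F n in sequentially. (\<integral>x. \<eta> x * fn n x * g x \<partial>lborel) - (\<integral>x. \<eta> x * fn n x * v x \<partial>\<nu>) = - ?A n"
    using near
  proof eventually_elim
    case (elim n)
    have t: "test_fun U (\<lambda>x. \<eta> x * fn n x)"
      by (rule test_funI[of _ ?K]) (use s\<eta> sf z\<eta> K in \<open>auto intro: smooth_mult\<close>)
    have pw: "indicator E x * (\<Sum>b\<in>hbasis. (F x \<bullet> b) * Xf gm b (\<lambda>x. \<eta> x * fn n x) x)
      = (\<Sum>b\<in>hbasis. (indicator E x * (F x \<bullet> b) * \<eta> x) * mol gm lborel (rho n) (?h b) x + (indicator E x * (F x \<bullet> b) * Xf gm b \<eta> x) * fn n x)" for x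
      unfolding sum_distrib_left
    proof (intro sum.cong refl)
      fix b assume b: "b \<in> hbasis"
      have "\<eta> x * Xf gm b (fn n) x = \<eta> x * mol gm lborel (rho n) (?h b) x"
      proof (cases "x \<in> ?K")
        case True
        have "Xf gm b (fn n) x = mol gm lborel (rho n) (?h b) x"
          unfolding fn_def by (rule Xf_mol_weak_derivative[OF fi K1(1,2) weak[OF b]]) (use elim True in blast)+
        then show ?thesis by simp
      qed (simp add: z\<eta>)
      then have "Xf gm b (\<lambda>x. \<eta> x * fn n x) x = \<eta> x * mol gm lborel (rho n) (?h b) x + Xf gm b \<eta> x * fn n x"
        using Xf_mult[OF s\<eta> sf, of b n x] by simp
      then show "indicator E x * ((F x \<bullet> b) * Xf gm b (\<lambda>x. \<eta> x * fn n x) x)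
        = (indicator E x * (F x \<bullet> b) * \<eta> x) * mol gm lborel (rho n) (?h b) x + (indicator E x * (F x \<bullet> b) * Xf gm b \<eta> x) * fn n x"
        by (simp only: distrib_left mult.assoc)
    qed
    have mi: "integrable lborel (mol gm lborel (rho n) (?h b))" if "b \<in> hbasis" for b
      by (rule integrable_mol[OF hi[OF that] K1(1) hz])
    have "?A n = (\<Sum>b\<in>hbasis. \<integral>x. (indicator E x * (F x \<bullet> b) * \<eta> x) * mol gm lborel (rho n) (?h b) x
        + (indicator E x * (F x \<bullet> b) * Xf gm b \<eta> x) * fn n x \<partial>lborel)"
      by (intro sum.cong refl Bochner_Integration.integral_add[symmetric] i3 i4 mi fb fnm)
    also have "\<dots> = (\<integral>x. (\<Sum>b\<in>hbasis. (indicator E x * (F x \<bullet> b) * \<eta> x) * mol gm lborel (rho n) (?h b) x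
        + (indicator E x * (F x \<bullet> b) * Xf gm b \<eta> x) * fn n x) \<partial>lborel)"
      by (intro Bochner_Integration.integral_sum[symmetric] Bochner_Integration.integrable_add i3 i4 mi fb fnm)
    also have "\<dots> = (\<integral>x. indicator E x * (\<Sum>b\<in>hbasis. (F x \<bullet> b) * Xf gm b (\<lambda>x. \<eta> x * fn n x) x) \<partial>lborel)"
      by (simp only: pw)
    finally show ?case using tr[OF t] by simp
  qed
  have "(\<lambda>n. - ?A n) \<longlonglongrightarrow> (\<integral>x. \<eta> x * f x * g x \<partial>lborel) - (\<integral>x. \<eta> x * f x * v x \<partial>\<nu>)"
    by (rule Lim_transform_eventually[OF tendsto_diff[OF L1 L2] ev])
  then show ?thesis using LIMSEQ_unique tendsto_minus[OF A_lim[unfolded A_eq]] by blast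
qed

end

section \<open>The reduced boundary\<close>

lemma emeasure_density_indicator:
  assumes "A \<in> sets M" "B \<in> sets M"
  shows "emeasure (density M (indicator A)) B = emeasure M (A \<inter> B)"
  using assms by (subst emeasure_density) (simp_all flip: indicator_inter_arith)

section \<open>Locality and uniqueness of perimeter measures\<close>

context stratified
begin

text \<open>Test functions supported in \<open>U\<close>, together with their derivatives, vanish
  elsewhere, so neither the part of \<nu> outside \<open>U\<close> nor the values of
  \<open>h'\<close> there are seen.\<close>

lemma perim_s_restrict:
  assumes Om: "open Om" and U: "open U" "U \<subseteq> Om" and P: "perim_s Om h \<nu> \<sigma>"
    and h: "\<And>x. x \<in> U \<Longrightarrow> h' x = h x"
  shows "perim_s U h' (density \<nu> (indicator U)) \<sigma>"
  unfolding perim_s_def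
proof (intro conjI allI impI)
  note perim = Om P
  have snu: "sets \<nu> = sets borel" by (rule perim_sets[OF perim])
  have Um: "U \<in> sets \<nu>" using U snu by simp
  then have im: "(indicator U :: 'a \<Rightarrow> ennreal) \<in> borel_measurable \<nu>" by simp
  show "sets (density \<nu> (indicator U)) = sets borel" using snu by simp
  show "emeasure (density \<nu> (indicator U)) (UNIV - U) = 0"
  proof -
    have "(\<lambda>x. indicator U x * indicator (UNIV - U) x :: ennreal) = (\<lambda>x. 0)" by (auto simp: indicator_def)
    then show ?thesis using U snu im by (subst emeasure_density) auto
  qed
  show "\<sigma> \<in> borel_measurable borel" by (rule perim_sigma_measurable[OF perim])
  show "emeasure (density \<nu> (indicator U)) K < \<infinity>" if "compact K \<and> K \<subseteq> U" for K
  proof -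
    have "emeasure (density \<nu> (indicator U)) K = emeasure \<nu> (U \<inter> K)"
      by (rule emeasure_density_indicator) (use that Um snu in \<open>auto simp: compact_imp_closed\<close>)
    also have "\<dots> \<le> emeasure \<nu> K"
      using that snu by (intro emeasure_mono) (auto simp: compact_imp_closed)
    also have "\<dots> < \<infinity>" using that U by (intro perim_fin[OF perim]) auto
    finally show ?thesis .
  qed
  show "AE x in density \<nu> (indicator U). norm (\<sigma> x) = 1 \<and> \<sigma> x \<in> hlayer w 1"
    unfolding AE_density[OF im] using perim_AE[OF perim] by eventually_elim simp
  fix \<psi> b assume \<psi>: "test_fun U \<psi>" and b: "b \<in> Basis" "w b = 1"
  have s\<psi>: "smooth \<psi>" and K: "compact (tsupport \<psi>)" "tsupport \<psi> \<subseteq> U" using \<psi> by (auto simp: test_fun_iff)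
  have z: "\<psi> x = 0" if "x \<notin> U" for x using that tsupport_zero K(2) by blast
  have zX: "Xf gm b \<psi> x = 0" if "x \<notin> U" for x
  proof (rule Xf_zero_outside[OF s\<psi> compact_imp_closed[OF K(1)]])
    show "x \<notin> tsupport \<psi>" using that K(2) by blast
  qed (rule tsupport_zero)
  have "(\<integral>x. h' x * Xf gm b \<psi> x \<partial>lborel) = (\<integral>x. h x * Xf gm b \<psi> x \<partial>lborel)"
    by (intro Bochner_Integration.integral_cong refl) (metis h zX mult_zero_right)
  also have "\<dots> = - (\<integral>x. \<psi> x * (\<sigma> x \<bullet> b) \<partial>\<nu>)"
    by (rule perim_ibp[OF perim test_fun_mono[OF \<psi> U(2)] b])
  also have "(\<integral>x. \<psi> x * (\<sigma> x \<bullet> b) \<partial>\<nu>) = (\<integral>x. indicator U x *\<^sub>R (\<psi> x * (\<sigma> x \<bullet> b)) \<partial>\<nu>)"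
    by (intro Bochner_Integration.integral_cong refl) (use z in \<open>auto simp: indicator_def\<close>)
  also have "\<dots> = (\<integral>x. \<psi> x * (\<sigma> x \<bullet> b) \<partial>density \<nu> (\<lambda>x. ennreal (indicator U x)))"
  proof (rule integral_density[symmetric])
    have [measurable]: "\<psi> \<in> borel_measurable borel" "\<sigma> \<in> borel_measurable borel"
      using perim_sigma_measurable[OF perim] s\<psi> by (auto intro!: borel_measurable_continuous_onI smooth_continuous_on)
    have "(\<lambda>x. \<psi> x * (\<sigma> x \<bullet> b)) \<in> borel_measurable borel" by measurable
    then show "(\<lambda>x. \<psi> x * (\<sigma> x \<bullet> b)) \<in> borel_measurable \<nu>" using snu by (simp cong: measurable_cong_sets)
  qed (use Um in auto)
  finally show "(\<integral>x. h' x * Xf gm b \<psi> x \<partial>lborel) = - (\<integral>x. \<psi> x * (\<sigma> x \<bullet> b) \<partial>density \<nu> (indicator U))"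
    by (simp add: ennreal_indicator)
qed

text \<open>Uniqueness of the polar decomposition. With densities \<open>p\<close> and
  \<open>q\<close> relative to a common measure, the vector densities \<open>p \<sigma>1\<close> and
  \<open>q \<sigma>2\<close> agree against all test functions, hence almost everywhere. Taking norms
  of unit vectors gives \<open>p = q\<close>, and then the directions agree where the density is
  positive.\<close>

lemma perim_s_unique:
  assumes U: "open U" and P1: "perim_s U h \<nu>1 \<sigma>1" and P2: "perim_s U h \<nu>2 \<sigma>2"
  shows "\<nu>1 = \<nu>2" "AE x in \<nu>2. \<sigma>1 x = \<sigma>2 x"
proof -
  note s1 = perim_sets[OF U P1] and s2 = perim_sets[OF U P2]
  obtain \<A> where A: "countable \<A>" "\<A> \<subseteq> sets borel" "\<Union>\<A> = (UNIV :: 'a set)"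
    "\<And>A. A \<in> \<A> \<Longrightarrow> bounded A \<and> ((compact A \<and> A \<subseteq> U) \<or> A \<subseteq> - U)"
    using open_finite_cover[OF U] by blast
  have fin: "emeasure \<nu>1 A < \<infinity> \<and> emeasure \<nu>2 A < \<infinity>" if "A \<in> \<A>" for A
    using A(4)[OF that] perim_cover_finite[OF U P1] perim_cover_finite[OF U P2] by blast
  obtain m p q where m: "sets m = sets borel" and pq: "p \<in> borel_measurable borel" "q \<in> borel_measurable borel"
    "\<And>x. p x \<ge> 0" "\<And>x. q x \<ge> (0::real)"
    and d1: "\<nu>1 = density m (\<lambda>x. ennreal (p x))" and d2: "\<nu>2 = density m (\<lambda>x. ennreal (q x))"
    using common_densities[OF s1 s2 A(1-3) fin] by metis
  have mm: "u \<in> borel_measurable m \<longleftrightarrow> u \<in> borel_measurable borel" for u :: "'a \<Rightarrow> real"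
    using m by (auto cong: measurable_cong_sets)
  have pm: "(\<lambda>x. ennreal (p x)) \<in> borel_measurable m" "(\<lambda>x. ennreal (q x)) \<in> borel_measurable m"
    using pq m by (auto cong: measurable_cong_sets)
  note [measurable] = pq(1,2) perim_sigma_measurable[OF U P1] perim_sigma_measurable[OF U P2]
  have eqb: "AE x in m. x \<in> U \<longrightarrow> p x * (\<sigma>1 x \<bullet> b) - q x * (\<sigma>2 x \<bullet> b) = 0" if b: "b \<in> Basis" "w b = 1" for b
  proof (rule AE_zero_if_test_integrals_zero[OF m U])
    have si: "integrable m (\<lambda>x. r x * (k x * (s x \<bullet> b)))"
      if "integrable \<nu> (\<lambda>x. k x * (s x \<bullet> b))" "\<nu> = density m (\<lambda>x. ennreal (r x))" "\<And>x. r x \<ge> 0"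
        "r \<in> borel_measurable borel" "k \<in> borel_measurable borel" "s \<in> borel_measurable borel"
      for \<nu> r k and s :: "'a \<Rightarrow> 'a"
    proof -
      note that(4-6)[measurable]
      show ?thesis using that(1) unfolding that(2) by (subst (asm) integrable_density) (use that(3) in \<open>auto simp: mm\<close>)
    qed
    show "set_integrable m K (\<lambda>x. p x * (\<sigma>1 x \<bullet> b) - q x * (\<sigma>2 x \<bullet> b))" if K: "compact K" "K \<subseteq> U" for K
    proof -
      have Kb [measurable]: "K \<in> sets borel" using K by (simp add: compact_imp_closed)
      have "integrable m (\<lambda>x. p x * (indicator K x * (\<sigma>1 x \<bullet> b)))"
        by (rule si[OF perim_integrable_sigma[OF U P1 Kb order_refl K b(1)] d1 pq(3)]) measurable
      moreover have "integrable m (\<lambda>x. q x * (indicator K x * (\<sigma>2 x \<bullet> b)))"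
        by (rule si[OF perim_integrable_sigma[OF U P2 Kb order_refl K b(1)] d2 pq(4)]) measurable
      ultimately have "integrable m (\<lambda>x. p x * (indicator K x * (\<sigma>1 x \<bullet> b)) - q x * (indicator K x * (\<sigma>2 x \<bullet> b)))"
        by (rule Bochner_Integration.integrable_diff)
      then show ?thesis unfolding set_integrable_def by (simp add: right_diff_distrib mult.left_commute)
    qed
    fix \<psi> assume \<psi>: "test_fun U \<psi>"
    have s\<psi>: "smooth \<psi>" and K: "compact (tsupport \<psi>)" "tsupport \<psi> \<subseteq> U" using \<psi> by (auto simp: test_fun_iff)
    let ?K = "tsupport \<psi>"
    have [measurable]: "\<psi> \<in> borel_measurable borel"
      using s\<psi> by (auto intro!: borel_measurable_continuous_onI smooth_continuous_on)
    have Kb: "?K \<in> sets borel" using K by (simp add: compact_imp_closed)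
    have i\<psi>: "integrable \<nu> (\<lambda>x. \<psi> x * (s x \<bullet> b))" if P: "perim_s U h \<nu> s" for \<nu> s
    proof -
      have "integrable \<nu> (\<lambda>x. \<psi> x * (indicator ?K x * (s x \<bullet> b)))"
        by (rule integrable_mult_continuous[OF perim_sets[OF U P] perim_integrable_sigma[OF U P Kb order_refl K b(1)] K(1)])
          (auto intro: smooth_continuous_on s\<psi>)
      moreover have "\<psi> x * (indicator ?K x * (s x \<bullet> b)) = \<psi> x * (s x \<bullet> b)" for x
        using tsupport_zero[of x \<psi>] by (cases "x \<in> ?K") auto
      ultimately show ?thesis by simp
    qed
    have e1: "(\<integral>x. p x * (\<psi> x * (\<sigma>1 x \<bullet> b)) \<partial>m) = (\<integral>x. \<psi> x * (\<sigma>1 x \<bullet> b) \<partial>\<nu>1)"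
      unfolding d1 by (subst integral_density) (use pq in \<open>auto simp: mm\<close>)
    have e2: "(\<integral>x. q x * (\<psi> x * (\<sigma>2 x \<bullet> b)) \<partial>m) = (\<integral>x. \<psi> x * (\<sigma>2 x \<bullet> b) \<partial>\<nu>2)"
      unfolding d2 by (subst integral_density) (use pq in \<open>auto simp: mm\<close>)
    have i1: "integrable m (\<lambda>x. p x * (\<psi> x * (\<sigma>1 x \<bullet> b)))"
      by (rule si[OF i\<psi>[OF P1] d1 pq(3)]) measurable
    have i2: "integrable m (\<lambda>x. q x * (\<psi> x * (\<sigma>2 x \<bullet> b)))"
      by (rule si[OF i\<psi>[OF P2] d2 pq(4)]) measurable
    have "(\<integral>x. \<psi> x * (p x * (\<sigma>1 x \<bullet> b) - q x * (\<sigma>2 x \<bullet> b)) \<partial>m)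
      = (\<integral>x. p x * (\<psi> x * (\<sigma>1 x \<bullet> b)) - q x * (\<psi> x * (\<sigma>2 x \<bullet> b)) \<partial>m)"
      by (intro Bochner_Integration.integral_cong refl) (simp add: algebra_simps)
    also have "\<dots> = (\<integral>x. \<psi> x * (\<sigma>1 x \<bullet> b) \<partial>\<nu>1) - (\<integral>x. \<psi> x * (\<sigma>2 x \<bullet> b) \<partial>\<nu>2)"
      using i1 i2 by (simp add: e1 e2)
    also have "\<dots> = 0" using perim_ibp[OF U P1 \<psi> b] perim_ibp[OF U P2 \<psi> b] by simp
    finally show "(\<integral>x. \<psi> x * (p x * (\<sigma>1 x \<bullet> b) - q x * (\<sigma>2 x \<bullet> b)) \<partial>m) = 0" .
  qed
  have "AE x in m. \<forall>b\<in>hbasis. x \<in> U \<longrightarrow> p x * (\<sigma>1 x \<bullet> b) - q x * (\<sigma>2 x \<bullet> b) = 0"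
    by (rule AE_finite_allI) (use eqb in auto)
  moreover have "AE x in m. p x > 0 \<longrightarrow> x \<in> U \<and> norm (\<sigma>1 x) = 1 \<and> \<sigma>1 x \<in> hlayer w 1"
  proof -
    have "AE x in \<nu>1. x \<in> U \<and> norm (\<sigma>1 x) = 1 \<and> \<sigma>1 x \<in> hlayer w 1"
      using perim_AE[OF U P1] perim_AE_Om[OF U P1] by eventually_elim simp
    then show ?thesis unfolding d1 by (subst (asm) AE_density[OF pm(1)]) simp
  qed
  moreover have "AE x in m. q x > 0 \<longrightarrow> x \<in> U \<and> norm (\<sigma>2 x) = 1 \<and> \<sigma>2 x \<in> hlayer w 1"
  proof -
    have "AE x in \<nu>2. x \<in> U \<and> norm (\<sigma>2 x) = 1 \<and> \<sigma>2 x \<in> hlayer w 1"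
      using perim_AE[OF U P2] perim_AE_Om[OF U P2] by eventually_elim simp
    then show ?thesis unfolding d2 by (subst (asm) AE_density[OF pm(2)]) simp
  qed
  ultimately have main: "AE x in m. p x = q x \<and> (q x > 0 \<longrightarrow> \<sigma>1 x = \<sigma>2 x)"
  proof eventually_elim
    case (elim x)
    have n1: "p x = norm (p x *\<^sub>R \<sigma>1 x)" using elim(2) pq(3)[of x] by (cases "p x = 0") auto
    have n2: "q x = norm (q x *\<^sub>R \<sigma>2 x)" using elim(3) pq(4)[of x] by (cases "q x = 0") auto
    have "p x *\<^sub>R \<sigma>1 x = q x *\<^sub>R \<sigma>2 x"
    proof (cases "x \<in> U")
      case True
      show ?thesis
      proof (rule euclidean_eqI)
        fix b :: 'a assume b: "b \<in> Basis"
        show "p x *\<^sub>R \<sigma>1 x \<bullet> b = q x *\<^sub>R \<sigma>2 x \<bullet> b"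
        proof (cases "w b = 1")
          case True
          then show ?thesis using elim(1)[rule_format, of b] b \<open>x \<in> U\<close> by simp
        next
          case False
          have "p x * (\<sigma>1 x \<bullet> b) = 0"
            using elim(2) pq(3)[of x] hlayer_inner_eq_0[where v = "\<sigma>1 x" and w = w and j = 1, OF _ b False] by (cases "p x = 0") auto
          moreover have "q x * (\<sigma>2 x \<bullet> b) = 0"
            using elim(3) pq(4)[of x] hlayer_inner_eq_0[where v = "\<sigma>2 x" and w = w and j = 1, OF _ b False] by (cases "q x = 0") auto
          ultimately show ?thesis by (simp only: inner_scaleR_left)
        qed
      qed
    next
      case False
      then have "p x = 0" "q x = 0" using elim(2,3) pq(3,4)[of x] by (auto simp: less_le)
      then show ?thesis by simp
    qed
    moreover from this n1 n2 have "p x = q x" by simp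
    ultimately show ?case by auto
  qed
  then have pqeq: "AE x in m. p x = q x" by eventually_elim simp
  show "\<nu>1 = \<nu>2" unfolding d1 d2
    by (rule density_cong[OF pm]) (use pqeq in \<open>auto elim!: eventually_mono\<close>)
  show "AE x in \<nu>2. \<sigma>1 x = \<sigma>2 x"
    unfolding d2 by (subst AE_density[OF pm(2)]) (use main in \<open>auto elim!: eventually_mono\<close>)
qed

end

section \<open>The homogeneous distance and the Euclidean topology\<close>

locale stratified_metric = stratified +
  fixes d :: "'a \<Rightarrow> 'a \<Rightarrow> real"
  assumes dist: "hom_dist gm w d"
begin

lemma d_zero_iff: "d x y = 0 \<longleftrightarrow> x = y" and d_sym: "d x y = d y x"
  and d_triangle: "d x z \<le> d x y + d y z" and d_left: "d (gm z x) (gm z y) = d x y"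
  and d_dil: "r > 0 \<Longrightarrow> d (dil w r x) (dil w r y) = r * d x y"
  and d_continuous: "continuous_on UNIV (\<lambda>p. d (fst p) (snd p))"
  using dist unfolding hom_dist_def by blast+

lemma d_nonneg: "d x y \<ge> 0"
proof -
  have "d x x \<le> d x y + d y x" by (rule d_triangle)
  moreover have "d x x = 0" by (simp add: d_zero_iff)
  moreover have "d y x = d x y" by (rule d_sym)
  ultimately show ?thesis by linarith
qed

lemma dil_0_right: "dil w r 0 = 0"
  by (simp add: dil_def)

lemma open_hball: "open (hball d x r)"
proof -
  have "continuous_on UNIV (\<lambda>y. d y x)"
    using continuous_on_compose2[OF d_continuous, of UNIV "\<lambda>y. (y, x)"] by (simp add: continuous_intros)
  then show ?thesis unfolding hball_def by (intro open_Collect_less) (auto intro: continuous_intros)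
qed

lemma hball_mono: "r \<le> s \<Longrightarrow> hball d x r \<subseteq> hball d x s"
  by (auto simp: hball_def)

text \<open>On the Euclidean sphere of radius \<open>e\<close> the distance to 0 has a positive
  minimum. A point of norm at least \<open>e\<close> is shrunk onto this sphere by some dilation
  with factor at most 1, which does not increase its distance to 0, so this distance is at least
  that minimum.\<close>

lemma d_small_imp_norm_small:
  assumes e: "e > 0"
  obtains c where "c > 0" "\<And>z. d 0 z < c \<Longrightarrow> norm z < e"
proof (cases "sphere (0::'a) e = {}")
  case True
  then show ?thesis using e by simp
next
  case False
  have "continuous_on (sphere 0 e) (\<lambda>z. d 0 z)"
    using continuous_on_compose2[OF d_continuous, of _ "\<lambda>z. (0, z)"] by (simp add: continuous_intros)
  then obtain z0 where z0: "z0 \<in> sphere 0 e" "\<And>z. z \<in> sphere 0 e \<Longrightarrow> d 0 z0 \<le> d 0 z"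
    using continuous_attains_inf[OF compact_sphere False] by blast
  have "d 0 z0 \<noteq> 0" using z0(1) e d_zero_iff[of 0 z0] by auto
  then have c: "d 0 z0 > 0" using d_nonneg[of 0 z0] by simp
  have "norm z < e" if z: "d 0 z < d 0 z0" for z
  proof (rule ccontr)
    assume "\<not> norm z < e"
    then have ge: "e \<le> norm (dil w 1 z)" by (simp add: dil_def euclidean_representation)
    have "dil w 0 z = 0"
    proof (rule euclidean_eqI)
      fix b :: 'a assume "b \<in> Basis"
      then show "dil w 0 z \<bullet> b = 0 \<bullet> b" using w_pos[of b] by (simp add: dil_inner power_0_left)
    qed
    then have le: "norm (dil w 0 z) \<le> e" using e by simp
    have "continuous_on {0..1} (\<lambda>r. norm (dil w r z))" unfolding dil_def by (intro continuous_intros)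
    then have "\<exists>r\<ge>0. r \<le> 1 \<and> norm (dil w r z) = e"
      by (intro IVT'[where f = "\<lambda>r. norm (dil w r z)" and a = 0 and b = 1] le ge) auto
    then obtain r where r: "0 \<le> r" "r \<le> 1" "norm (dil w r z) = e" by blast
    have "r \<noteq> 0" using r(3) \<open>dil w 0 z = 0\<close> e by auto
    then have r0: "r > 0" using r by simp
    have "d 0 z0 \<le> d 0 (dil w r z)" by (rule z0(2)) (use r in simp)
    also have "\<dots> = r * d 0 z" using d_dil[OF r0, of 0 z] by (simp add: dil_0_right)
    also have "\<dots> \<le> d 0 z" using r d_nonneg[of 0 z] by (simp add: mult_left_le_one_le)
    finally show False using z by simp
  qed
  then show ?thesis using that[OF c] by blast
qed

text \<open>Left invariance moves the question to the identity, where the comparison of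
  \<open>d\<close> with the norm and the continuity of left translation settle it.\<close>

lemma hball_subset_open:
  assumes "open U" "x \<in> U"
  obtains r where "r > 0" "hball d x r \<subseteq> U"
proof -
  have "isCont (\<lambda>z. gm x z) 0"
    using continuous_on_compose2[OF continuous_gm[of UNIV], of UNIV "\<lambda>z. (x, z)"]
    by (simp add: continuous_intros continuous_on_eq_continuous_at[OF open_UNIV])
  then have "((\<lambda>z. gm x z) \<longlongrightarrow> gm x 0) (at 0)" by (simp add: isCont_def)
  then have "((\<lambda>z. gm x z) \<longlongrightarrow> gm x 0) (nhds 0)" by (rule tendsto_at_iff_tendsto_nhds[THEN iffD1])
  then have "\<forall>\<^sub>F z in nhds 0. gm x z \<in> U" using assms by (intro topological_tendstoD) auto
  then obtain e where e: "e > 0" "\<And>z. dist z 0 < e \<Longrightarrow> gm x z \<in> U"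
    unfolding eventually_nhds_metric by blast
  obtain c where c: "c > 0" "\<And>z. d 0 z < c \<Longrightarrow> norm z < e" using d_small_imp_norm_small[OF e(1)] by blast
  have "hball d x c \<subseteq> U"
  proof
    fix y assume "y \<in> hball d x c"
    then have "d x y < c" using d_sym[of x y] by (simp add: hball_def)
    moreover have "d x y = d 0 (gm (- x) y)" using d_left[of "- x" x y] by simp
    ultimately have "norm (gm (- x) y) < e" using c(2) by simp
    then have "gm x (gm (- x) y) \<in> U" by (intro e(2)) simp
    then show "y \<in> U" by simp
  qed
  with c(1) show ?thesis by (rule that)
qed

definition avg_normal :: "'a measure \<Rightarrow> ('a \<Rightarrow> 'a) \<Rightarrow> real \<Rightarrow> 'a \<Rightarrow> 'a" where
  "avg_normal \<nu> \<sigma> r x = (1 / measure \<nu> (hball d x r)) *\<^sub>R (\<integral>y. indicator (hball d x r) y *\<^sub>R (- \<sigma> y) \<partial>\<nu>)"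

lemma red_bdry_alt:
  "red_bdry d U \<nu> \<sigma> = {x \<in> U. (\<forall>r>0. emeasure \<nu> (hball d x r) > 0) \<and>
     (\<exists>v. ((\<lambda>r. avg_normal \<nu> \<sigma> r x) \<longlongrightarrow> v) (at_right 0) \<and> norm v = 1)}"
  by (simp add: red_bdry_def avg_normal_def)

text \<open>The limit of the averages depends only on balls of small radius, which lie in
  \<open>U\<close>; positivity for all radii follows from that for small ones. The normals need to
  agree only almost everywhere because they enter through averages.\<close>

lemma red_bdry_restrict:
  assumes snu: "sets \<nu> = sets borel" and U: "open U" "U \<subseteq> Om"
    and \<sigma>: "\<sigma> \<in> borel_measurable borel" "\<sigma>U \<in> borel_measurable borel" "AE x in density \<nu> (indicator U). \<sigma> x = \<sigma>U x"
  shows "red_bdry d U (density \<nu> (indicator U)) \<sigma>U = red_bdry d Om \<nu> \<sigma> \<inter> U"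
proof -
  let ?\<nu>U = "density \<nu> (indicator U)"
  have Um: "U \<in> sets \<nu>" using U snu by simp
  then have im: "(indicator U :: 'a \<Rightarrow> ennreal) \<in> borel_measurable \<nu>" by simp
  have \<sigma>m: "\<sigma> \<in> borel_measurable \<nu>" "\<sigma>U \<in> borel_measurable \<nu>" using \<sigma> snu by (auto cong: measurable_cong_sets)
  have AE': "AE x in \<nu>. x \<in> U \<longrightarrow> \<sigma> x = \<sigma>U x"
    using \<sigma>(3) by (subst (asm) AE_density[OF im]) (auto elim!: eventually_mono simp: indicator_def)
  have em: "emeasure ?\<nu>U B = emeasure \<nu> B" if "B \<in> sets borel" "B \<subseteq> U" for B
    using emeasure_density_indicator[of U \<nu> B] that Um snu by (simp add: Int_absorb1)
  have hb: "hball d x r \<in> sets borel" for x r using open_hball by simp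
  have avg: "avg_normal ?\<nu>U \<sigma>U r x = avg_normal \<nu> \<sigma> r x" if sub: "hball d x r \<subseteq> U" for x r
  proof -
    let ?B = "hball d x r"
    have Bm: "(\<lambda>y. indicator ?B y *\<^sub>R (- \<sigma>U y)) \<in> borel_measurable \<nu>"
      using \<sigma>m hb snu by (intro borel_measurable_scaleR borel_measurable_indicator borel_measurable_uminus) auto
    have Bm': "(\<lambda>y. indicator ?B y *\<^sub>R (- \<sigma> y)) \<in> borel_measurable \<nu>"
      using \<sigma>m hb snu by (intro borel_measurable_scaleR borel_measurable_indicator borel_measurable_uminus) auto
    have "(\<integral>y. indicator ?B y *\<^sub>R (- \<sigma>U y) \<partial>?\<nu>U) = (\<integral>y. indicator ?B y *\<^sub>R (- \<sigma>U y) \<partial>density \<nu> (\<lambda>y. ennreal (indicator U y)))"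
      by (simp add: ennreal_indicator)
    also have "\<dots> = (\<integral>y. indicator U y *\<^sub>R (indicator ?B y *\<^sub>R (- \<sigma>U y)) \<partial>\<nu>)"
      by (rule integral_density[OF Bm]) (use Um in auto)
    also have "\<dots> = (\<integral>y. indicator ?B y *\<^sub>R (- \<sigma> y) \<partial>\<nu>)"
    proof (rule integral_cong_AE[OF _ Bm'])
      show "(\<lambda>y. indicator U y *\<^sub>R (indicator ?B y *\<^sub>R (- \<sigma>U y))) \<in> borel_measurable \<nu>"
        by (rule borel_measurable_scaleR[OF borel_measurable_indicator[OF Um] Bm])
      show "AE y in \<nu>. indicator U y *\<^sub>R (indicator ?B y *\<^sub>R (- \<sigma>U y)) = indicator ?B y *\<^sub>R (- \<sigma> y)"
        using AE' by eventually_elim (use sub in \<open>auto simp: indicator_def\<close>)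
    qed
    finally show ?thesis unfolding avg_normal_def measure_def em[OF hb sub] by simp
  qed
  have "x \<in> red_bdry d U ?\<nu>U \<sigma>U \<longleftrightarrow> x \<in> red_bdry d Om \<nu> \<sigma>" if x: "x \<in> U" for x
  proof -
    obtain r0 where r0: "r0 > 0" "hball d x r0 \<subseteq> U" using hball_subset_open[OF U(1) x] by blast
    have "(\<forall>r>0. emeasure ?\<nu>U (hball d x r) > 0) \<longleftrightarrow> (\<forall>r>0. emeasure \<nu> (hball d x r) > 0)"
    proof (intro iffI allI impI)
      fix r :: real assume a: "\<forall>r>0. emeasure ?\<nu>U (hball d x r) > 0" and "r > 0"
      then have "0 < emeasure ?\<nu>U (hball d x (min r r0))" using r0 by simp
      also have "\<dots> = emeasure \<nu> (hball d x (min r r0))"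
        using r0 hball_mono[of "min r r0" r0 x] by (intro em hb) auto
      also have "\<dots> \<le> emeasure \<nu> (hball d x r)" using hb snu by (intro emeasure_mono hball_mono) auto
      finally show "0 < emeasure \<nu> (hball d x r)" .
    next
      fix r :: real assume a: "\<forall>r>0. emeasure \<nu> (hball d x r) > 0" and "r > 0"
      then have "0 < emeasure \<nu> (hball d x (min r r0))" using r0 by simp
      also have "\<dots> = emeasure ?\<nu>U (hball d x (min r r0))"
        using r0 hball_mono[of "min r r0" r0 x] by (intro em[symmetric] hb) auto
      also have "\<dots> \<le> emeasure ?\<nu>U (hball d x r)" using hb snu by (intro emeasure_mono hball_mono) auto
      finally show "0 < emeasure ?\<nu>U (hball d x r)" .
    qed
    moreover have "((\<lambda>r. avg_normal ?\<nu>U \<sigma>U r x) \<longlongrightarrow> v) (at_right 0) \<longleftrightarrow> ((\<lambda>r. avg_normal \<nu> \<sigma> r x) \<longlongrightarrow> v) (at_right 0)" for v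
    proof (rule filterlim_cong[OF refl refl])
      show "\<forall>\<^sub>F r in at_right 0. avg_normal ?\<nu>U \<sigma>U r x = avg_normal \<nu> \<sigma> r x"
        unfolding eventually_at_right_field
      proof (intro exI[of _ r0] conjI allI impI r0(1))
        fix r assume "0 < r" "r < r0"
        then have "hball d x r \<subseteq> hball d x r0" by (intro hball_mono) simp
        then show "avg_normal ?\<nu>U \<sigma>U r x = avg_normal \<nu> \<sigma> r x" using r0(2) by (intro avg) simp
      qed
    qed
    ultimately show ?thesis unfolding red_bdry_alt using x U by auto
  qed
  moreover have "red_bdry d U ?\<nu>U \<sigma>U \<subseteq> U" by (auto simp: red_bdry_alt)
  ultimately show ?thesis by blast
qed

end

section \<open>Borel measurability of the reduced boundary\<close>

context stratified_metric
begin

lemma hball_pair_measurable: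
  assumes "sets \<nu> = sets borel"
  shows "{p. d (snd p) (fst p) < r} \<in> sets (borel \<Otimes>\<^sub>M \<nu>)"
proof -
  have "continuous_on UNIV (\<lambda>p. d (snd p) (fst p))"
    using continuous_on_compose2[OF d_continuous, of UNIV "\<lambda>p. (snd p, fst p)"] by (simp add: continuous_intros)
  then have "open {p. d (snd p) (fst p) < r}" by (intro open_Collect_less) (auto intro: continuous_intros)
  then have "{p. d (snd p) (fst p) < r} \<in> sets (borel :: ('a \<times> 'a) measure)" by simp
  moreover have "sets (borel \<Otimes>\<^sub>M \<nu>) = sets (borel :: ('a \<times> 'a) measure)"
    using assms by (simp add: borel_prod[symmetric] cong: sets_pair_measure_cong)
  ultimately show ?thesis by simp
qed

context
  fixes \<nu> :: "'a measure" and \<sigma> :: "'a \<Rightarrow> 'a"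
  assumes snu: "sets \<nu> = sets borel" and fin: "finite_measure \<nu>" and int: "integrable \<nu> \<sigma>"
begin

lemma emeasure_hball_measurable: "(\<lambda>x. emeasure \<nu> (hball d x r)) \<in> borel_measurable borel"
proof -
  interpret finite_measure \<nu> by (rule fin)
  have "(\<lambda>x. emeasure \<nu> (Pair x -` {p. d (snd p) (fst p) < r})) \<in> borel_measurable borel"
    by (rule measurable_emeasure_Pair[OF hball_pair_measurable[OF snu]])
  then show ?thesis by (simp add: hball_def vimage_def)
qed

lemma avg_normal_measurable: "avg_normal \<nu> \<sigma> r \<in> borel_measurable borel"
proof -
  interpret finite_measure \<nu> by (rule fin)
  have 1: "(\<lambda>x. measure \<nu> (hball d x r)) \<in> borel_measurable borel"
    unfolding measure_def using emeasure_hball_measurable by measurable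
  have \<sigma>m: "\<sigma> \<in> borel_measurable \<nu>" using int by simp
  have "(\<lambda>(x, y). indicator {p. d (snd p) (fst p) < r} (x, y) *\<^sub>R (- \<sigma> y)) \<in> borel_measurable (borel \<Otimes>\<^sub>M \<nu>)"
    using hball_pair_measurable[OF snu, of r] \<sigma>m by measurable
  then have "(\<lambda>x. \<integral>y. indicator {p. d (snd p) (fst p) < r} (x, y) *\<^sub>R (- \<sigma> y) \<partial>\<nu>) \<in> borel_measurable borel"
    by (rule borel_measurable_lebesgue_integral)
  moreover have "indicator {p. d (snd p) (fst p) < r} (x, y) = (indicator (hball d x r) y :: real)" for x y
    by (simp add: indicator_def hball_def)
  ultimately show ?thesis unfolding avg_normal_def[abs_def] using 1 by (intro borel_measurable_scaleR) auto
qed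

text \<open>Open balls of increasing radii exhaust the open ball of the limiting radius, so both
  numerator and denominator converge from the left. From the right a charged sphere could cause a
  jump.\<close>

lemma avg_normal_left_continuous:
  assumes pos: "emeasure \<nu> (hball d x r) > 0" and s: "\<And>k. s k < r" "s \<longlonglongrightarrow> r"
  shows "(\<lambda>k. avg_normal \<nu> \<sigma> (s k) x) \<longlonglongrightarrow> avg_normal \<nu> \<sigma> r x"
proof -
  interpret finite_measure \<nu> by (rule fin)
  let ?B = "\<lambda>k. hball d x (s k)" and ?C = "hball d x r"
  have Bm: "hball d x s \<in> sets \<nu>" for s using open_hball snu by simp
  have lim_ind: "(\<lambda>k. indicator (?B k) y :: real) \<longlonglongrightarrow> indicator ?C y" for y
  proof (cases "y \<in> ?C")
    case True
    then have "\<forall>\<^sub>F k in sequentially. d y x < s k"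
      using s(2) by (intro order_tendstoD(1)) (simp_all add: hball_def)
    then have "\<forall>\<^sub>F k in sequentially. indicator (?B k) y = (1::real)"
      by eventually_elim (simp add: hball_def)
    then show ?thesis using True by (simp add: tendsto_eventually)
  next
    case False
    have "y \<notin> ?B k" for k using False s(1)[of k] by (simp add: hball_def)
    then show ?thesis using False by simp
  qed
  have i1: "integrable \<nu> (\<lambda>y. 1::real)" by simp
  have "(\<lambda>k. \<integral>y. indicator (?B k) y \<partial>\<nu>) \<longlonglongrightarrow> (\<integral>y. indicator ?C y \<partial>\<nu> :: real)"
    by (rule integral_dominated_convergence[where w = "\<lambda>y. 1"])
      (use lim_ind Bm i1 in \<open>auto simp: indicator_def\<close>)
  then have m: "(\<lambda>k. measure \<nu> (?B k)) \<longlonglongrightarrow> measure \<nu> ?C" using Bm by simp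
  have "measure \<nu> ?C \<noteq> 0" using pos by (simp add: emeasure_eq_measure)
  with m have m': "(\<lambda>k. 1 / measure \<nu> (?B k)) \<longlonglongrightarrow> 1 / measure \<nu> ?C" by (intro tendsto_divide tendsto_const)
  have "(\<lambda>k. \<integral>y. indicator (?B k) y *\<^sub>R (- \<sigma> y) \<partial>\<nu>) \<longlonglongrightarrow> (\<integral>y. indicator ?C y *\<^sub>R (- \<sigma> y) \<partial>\<nu>)"
  proof (rule integral_dominated_convergence[where w = "\<lambda>y. norm (\<sigma> y)"])
    have \<sigma>m: "\<sigma> \<in> borel_measurable \<nu>" using int by simp
    show "(\<lambda>y. indicator ?C y *\<^sub>R (- \<sigma> y)) \<in> borel_measurable \<nu>" "\<And>k. (\<lambda>y. indicator (?B k) y *\<^sub>R (- \<sigma> y)) \<in> borel_measurable \<nu>"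
      using Bm \<sigma>m by measurable
    show "integrable \<nu> (\<lambda>y. norm (\<sigma> y))" using int by simp
    show "AE y in \<nu>. (\<lambda>k. indicator (?B k) y *\<^sub>R (- \<sigma> y)) \<longlonglongrightarrow> indicator ?C y *\<^sub>R (- \<sigma> y)"
      by (intro AE_I2 tendsto_scaleR tendsto_const lim_ind)
    show "AE y in \<nu>. norm (indicator (?B k) y *\<^sub>R (- \<sigma> y)) \<le> norm (\<sigma> y)" for k
      by (intro AE_I2) (simp add: indicator_def)
  qed
  with m' show ?thesis unfolding avg_normal_def by (intro tendsto_scaleR)
qed

lemma avg_normal_rational_approx:
  assumes pos: "emeasure \<nu> (hball d x r) > 0" and r: "r > 0" and e: "e > 0"
  obtains q where "q \<in> \<rat>" "0 < q" "q < r" "dist (avg_normal \<nu> \<sigma> q x) (avg_normal \<nu> \<sigma> r x) < e"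
proof -
  have "\<exists>q\<in>\<rat>. max 0 (r - inverse (real (Suc k))) < q \<and> q < r" for k
    by (rule Rats_dense_in_real) (use r in simp)
  then obtain s where s: "\<And>k. s k \<in> \<rat>" "\<And>k. max 0 (r - inverse (real (Suc k))) < s k" "\<And>k. s k < r"
    by metis
  have "(\<lambda>k. r - inverse (real (Suc k))) \<longlonglongrightarrow> r - 0"
    by (intro tendsto_diff tendsto_const LIMSEQ_inverse_real_of_nat)
  then have "s \<longlonglongrightarrow> r"
    by (intro tendsto_sandwich[of "\<lambda>k. r - inverse (real (Suc k))" s sequentially "\<lambda>k. r"] always_eventually allI)
      (use s(2,3) in \<open>auto simp: less_imp_le\<close>)
  from avg_normal_left_continuous[OF pos s(3) this]
  have "\<forall>\<^sub>F k in sequentially. dist (avg_normal \<nu> \<sigma> (s k) x) (avg_normal \<nu> \<sigma> r x) < e"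
    using e by (rule tendstoD)
  then obtain k where k: "dist (avg_normal \<nu> \<sigma> (s k) x) (avg_normal \<nu> \<sigma> r x) < e"
    using eventually_happens sequentially_bot by blast
  have "0 < s k" using s(2)[of k] by simp
  from that[OF s(1) this s(3) k] show ?thesis .
qed

text \<open>Left continuity in the radius reduces the existence of the limit to a Cauchy condition
  over rational radii, which is a countable one.\<close>

lemma red_bdry_eq:
  "red_bdry d U \<nu> \<sigma> = {x \<in> U. (\<forall>k. emeasure \<nu> (hball d x (inverse (real (Suc k)))) > 0) \<and>
     (\<forall>n. \<exists>k. \<forall>q\<in>\<rat> \<inter> {0<..<inverse (real (Suc k))}. \<forall>q'\<in>\<rat> \<inter> {0<..<inverse (real (Suc k))}.
        dist (avg_normal \<nu> \<sigma> q x) (avg_normal \<nu> \<sigma> q' x) < inverse (real (Suc n))) \<and>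
     norm (lim (\<lambda>k. avg_normal \<nu> \<sigma> (inverse (real (Suc k))) x)) = 1}"
  (is "_ = {x \<in> U. ?pos x \<and> ?cau x \<and> ?nor x}")
proof -
  have pos_iff: "(\<forall>r>0. emeasure \<nu> (hball d x r) > 0) \<longleftrightarrow> ?pos x" for x
  proof (intro iffI allI impI)
    fix r :: real assume a: "?pos x" and r: "r > 0"
    obtain k where k: "inverse (real (Suc k)) < r" using reals_Archimedean[OF r] by blast
    have "0 < emeasure \<nu> (hball d x (inverse (real (Suc k))))" using a by blast
    also have "\<dots> \<le> emeasure \<nu> (hball d x r)"
      using k open_hball snu by (intro emeasure_mono hball_mono) auto
    finally show "0 < emeasure \<nu> (hball d x r)" .
  qed simp
  have inv_right: "filterlim (\<lambda>k. inverse (real (Suc k))) (at_right 0) sequentially"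
    unfolding filterlim_at using LIMSEQ_inverse_real_of_nat by (auto intro!: always_eventually)
  have "(\<exists>v. ((\<lambda>r. avg_normal \<nu> \<sigma> r x) \<longlongrightarrow> v) (at_right 0) \<and> norm v = 1) \<longleftrightarrow> ?cau x \<and> ?nor x"
    if pos: "\<forall>r>0. emeasure \<nu> (hball d x r) > 0" for x
  proof
    let ?f = "\<lambda>r. avg_normal \<nu> \<sigma> r x"
    assume "\<exists>v. (?f \<longlongrightarrow> v) (at_right 0) \<and> norm v = 1"
    then obtain v where v: "(?f \<longlongrightarrow> v) (at_right 0)" "norm v = 1" by blast
    have "(\<lambda>k. ?f (inverse (real (Suc k)))) \<longlonglongrightarrow> v" by (rule filterlim_compose[OF v(1) inv_right])
    then have nor: "?nor x" using v(2) limI by metis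
    have "\<exists>k. \<forall>q\<in>\<rat> \<inter> {0<..<inverse (real (Suc k))}. \<forall>q'\<in>\<rat> \<inter> {0<..<inverse (real (Suc k))}.
        dist (?f q) (?f q') < inverse (real (Suc n))" for n
    proof -
      have "inverse (real (Suc n)) / 2 > 0" by simp
      from tendstoD[OF v(1) this] obtain b where b: "b > 0" "\<And>r. 0 < r \<Longrightarrow> r < b \<Longrightarrow> dist (?f r) v < inverse (real (Suc n)) / 2"
        unfolding eventually_at_right_field by blast
      obtain k where k: "inverse (real (Suc k)) < b" using reals_Archimedean[OF b(1)] by blast
      show ?thesis
      proof (intro exI[of _ k] ballI)
        fix q q' assume "q \<in> \<rat> \<inter> {0<..<inverse (real (Suc k))}" "q' \<in> \<rat> \<inter> {0<..<inverse (real (Suc k))}"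
        then have "dist (?f q) v < inverse (real (Suc n)) / 2" "dist (?f q') v < inverse (real (Suc n)) / 2"
          using b(2)[of q] b(2)[of q'] k by auto
        then show "dist (?f q) (?f q') < inverse (real (Suc n))" by (rule dist_triangle_half_l)
      qed
    qed
    with nor show "?cau x \<and> ?nor x" by blast
  next
    let ?f = "\<lambda>r. avg_normal \<nu> \<sigma> r x"
    assume cn: "?cau x \<and> ?nor x"
    \<comment> \<open>Each radius is exchanged for a smaller rational one at the cost of
      \<open>e / 3\<close>; the remaining third is the Cauchy condition between the rational
      radii.\<close>
    have cau: "\<exists>\<delta>>0. \<forall>r r'. 0 < r \<longrightarrow> r < \<delta> \<longrightarrow> 0 < r' \<longrightarrow> r' < \<delta> \<longrightarrow> dist (?f r) (?f r') < e" if e: "e > 0" for e :: real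
    proof -
      have e3: "e / 3 > 0" using e by simp
      obtain n where n: "inverse (real (Suc n)) < e / 3" using reals_Archimedean[OF e3] by blast
      obtain k where k: "\<And>q q'. q \<in> \<rat> \<inter> {0<..<inverse (real (Suc k))} \<Longrightarrow> q' \<in> \<rat> \<inter> {0<..<inverse (real (Suc k))} \<Longrightarrow>
        dist (?f q) (?f q') < inverse (real (Suc n))" using cn by metis
      show ?thesis
      proof (intro exI[of _ "inverse (real (Suc k))"] conjI allI impI)
        fix r r' assume r: "0 < r" "r < inverse (real (Suc k))" and r': "0 < r'" "r' < inverse (real (Suc k))"
        obtain q where q: "q \<in> \<rat>" "0 < q" "q < r" "dist (?f q) (?f r) < e / 3"
          using avg_normal_rational_approx[OF pos[rule_format, OF r(1)] r(1) e3] by metis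
        obtain q' where q': "q' \<in> \<rat>" "0 < q'" "q' < r'" "dist (?f q') (?f r') < e / 3"
          using avg_normal_rational_approx[OF pos[rule_format, OF r'(1)] r'(1) e3] by metis
        have "dist (?f q) (?f q') < e / 3" using k[of q q'] q q' r r' n by auto
        moreover have "dist (?f r) (?f r') \<le> dist (?f q) (?f r) + dist (?f q) (?f q') + dist (?f q') (?f r')"
          using dist_triangle[of "?f r" "?f r'" "?f q"] dist_triangle[of "?f q" "?f r'" "?f q'"] dist_commute[of "?f r" "?f q"] by linarith
        ultimately show "dist (?f r) (?f r') < e" using q(4) q'(4) by linarith
      qed simp
    qed
    have "Cauchy (\<lambda>k. ?f (inverse (real (Suc k))))"
    proof (rule metric_CauchyI)
      fix e :: real assume "e > 0"
      from cau[OF this] obtain \<delta> where \<delta>: "\<delta> > 0" "\<And>r r'. 0 < r \<Longrightarrow> r < \<delta> \<Longrightarrow> 0 < r' \<Longrightarrow> r' < \<delta> \<Longrightarrow> dist (?f r) (?f r') < e" by blast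
      obtain M where "inverse (real (Suc M)) < \<delta>" using reals_Archimedean[OF \<delta>(1)] by blast
      moreover have "inverse (real (Suc m)) \<le> inverse (real (Suc M))" if "m \<ge> M" for m
        using that by (intro le_imp_inverse_le) auto
      ultimately have "inverse (real (Suc m)) < \<delta>" if "m \<ge> M" for m using that by (meson le_less_trans)
      then show "\<exists>M. \<forall>m\<ge>M. \<forall>n\<ge>M. dist (?f (inverse (real (Suc m)))) (?f (inverse (real (Suc n)))) < e"
        by (intro exI[of _ M] allI impI \<delta>(2)) auto
    qed
    then obtain v where v: "(\<lambda>k. ?f (inverse (real (Suc k)))) \<longlonglongrightarrow> v"
      using Cauchy_convergent_iff convergent_def by blast
    have "norm v = 1" using cn limI[OF v] by simp
    \<comment> \<open>The Cauchy condition over all radii extends the limit along the radii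
      \<open>1 / (k + 1)\<close> to a limit from the right at 0.\<close>
    moreover have "(?f \<longlongrightarrow> v) (at_right 0)"
    proof (rule tendstoI)
      fix e :: real assume "e > 0"
      then have e2: "e / 2 > 0" by simp
      from cau[OF e2] obtain \<delta> where \<delta>: "\<delta> > 0" "\<And>r r'. 0 < r \<Longrightarrow> r < \<delta> \<Longrightarrow> 0 < r' \<Longrightarrow> r' < \<delta> \<Longrightarrow> dist (?f r) (?f r') < e / 2" by blast
      have "\<forall>\<^sub>F k in sequentially. dist (?f (inverse (real (Suc k)))) v < e / 2" by (rule tendstoD[OF v e2])
      moreover have "\<forall>\<^sub>F k in sequentially. inverse (real (Suc k)) < \<delta>"
        by (rule order_tendstoD(2)[OF LIMSEQ_inverse_real_of_nat \<delta>(1)])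
      ultimately have "\<forall>\<^sub>F k in sequentially. dist (?f (inverse (real (Suc k)))) v < e / 2 \<and> inverse (real (Suc k)) < \<delta>"
        by (rule eventually_conj)
      then obtain k where k: "dist (?f (inverse (real (Suc k)))) v < e / 2" "inverse (real (Suc k)) < \<delta>"
        using eventually_happens sequentially_bot by blast
      show "\<forall>\<^sub>F r in at_right 0. dist (?f r) v < e"
        unfolding eventually_at_right_field
      proof (intro exI[of _ \<delta>] conjI allI impI \<delta>(1))
        fix r assume "0 < r" "r < \<delta>"
        then have "dist (?f r) (?f (inverse (real (Suc k)))) < e / 2" using k by (intro \<delta>(2)) auto
        then show "dist (?f r) v < e" using k(1) dist_triangle[of "?f r" v "?f (inverse (real (Suc k)))"] by linarith
      qed
    qed
    ultimately show "\<exists>v. (?f \<longlongrightarrow> v) (at_right 0) \<and> norm v = 1" by blast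
  qed
  then show ?thesis unfolding red_bdry_alt pos_iff by blast
qed

text \<open>Without measurability the integrals over the reduced boundary in \<open>normal_traces\<close> could be
  the junk value 0 and would not determine the traces.\<close>

lemma red_bdry_measurable:
  assumes "U \<in> sets borel" shows "red_bdry d U \<nu> \<sigma> \<in> sets borel"
proof -
  have cR: "countable (\<rat> \<inter> {0<..<inverse (real (Suc k))})" for k
    by (rule countable_subset[OF _ countable_rat]) auto
  have [measurable]: "avg_normal \<nu> \<sigma> r \<in> borel_measurable borel" "(\<lambda>x. emeasure \<nu> (hball d x r)) \<in> borel_measurable borel" for r
    by (rule avg_normal_measurable, rule emeasure_hball_measurable)
  have 1: "{x. \<forall>k. emeasure \<nu> (hball d x (inverse (real (Suc k)))) > 0} \<in> sets borel" by measurable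
  have 2: "{x. \<forall>n. \<exists>k. \<forall>q\<in>\<rat> \<inter> {0<..<inverse (real (Suc k))}. \<forall>q'\<in>\<rat> \<inter> {0<..<inverse (real (Suc k))}.
        dist (avg_normal \<nu> \<sigma> q x) (avg_normal \<nu> \<sigma> q' x) < inverse (real (Suc n))} \<in> sets borel"
  proof -
    have "{x. dist (avg_normal \<nu> \<sigma> q x) (avg_normal \<nu> \<sigma> q' x) < inverse (real (Suc n))} \<in> sets borel" for q q' n
      by measurable
    then have "(\<Inter>n. \<Union>k. \<Inter>q\<in>\<rat> \<inter> {0<..<inverse (real (Suc k))}. \<Inter>q'\<in>\<rat> \<inter> {0<..<inverse (real (Suc k))}.
      {x. dist (avg_normal \<nu> \<sigma> q x) (avg_normal \<nu> \<sigma> q' x) < inverse (real (Suc n))}) \<in> sets borel"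
      by (intro sets.countable_INT'' sets.countable_UN sets.countable_INT'[OF cR] image_subsetI) (use cR in auto)
    also have "(\<Inter>n. \<Union>k. \<Inter>q\<in>\<rat> \<inter> {0<..<inverse (real (Suc k))}. \<Inter>q'\<in>\<rat> \<inter> {0<..<inverse (real (Suc k))}.
      {x. dist (avg_normal \<nu> \<sigma> q x) (avg_normal \<nu> \<sigma> q' x) < inverse (real (Suc n))}) =
      {x. \<forall>n. \<exists>k. \<forall>q\<in>\<rat> \<inter> {0<..<inverse (real (Suc k))}. \<forall>q'\<in>\<rat> \<inter> {0<..<inverse (real (Suc k))}.
        dist (avg_normal \<nu> \<sigma> q x) (avg_normal \<nu> \<sigma> q' x) < inverse (real (Suc n))}" by auto
    finally show ?thesis .
  qed
  have [measurable]: "(\<lambda>x. lim (\<lambda>k. avg_normal \<nu> \<sigma> (inverse (real (Suc k))) x)) \<in> borel_measurable borel"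
    by (rule borel_measurable_lim_metric) measurable
  have 3: "{x. norm (lim (\<lambda>k. avg_normal \<nu> \<sigma> (inverse (real (Suc k))) x)) = 1} \<in> sets borel" by measurable
  show ?thesis unfolding red_bdry_eq
    using sets.Int[OF assms sets.Int[OF 1 sets.Int[OF 2 3]]] by (simp only: Collect_conj_eq Collect_mem_eq)
qed

end

end

section \<open>The Gauss--Green formula\<close>

lemma lebesgue_real_representative:
  fixes f :: "'a::euclidean_space \<Rightarrow> real"
  assumes "f \<in> borel_measurable lebesgue"
  obtains f' where "f' \<in> borel_measurable borel" "AE x in lborel. f' x = f x"
  using completion_ex_borel_measurable_real[OF assms] by (auto simp: eq_commute)

lemma lebesgue_vector_representative:
  fixes f :: "'a::euclidean_space \<Rightarrow> 'b::euclidean_space"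
  assumes f: "f \<in> borel_measurable lebesgue"
  obtains f' where "f' \<in> borel_measurable borel" "AE x in lborel. f' x = f x"
proof -
  have "\<exists>h. h \<in> borel_measurable borel \<and> (AE x in lborel. h x = f x \<bullet> b)" for b
    by (rule lebesgue_real_representative[of "\<lambda>x. f x \<bullet> b"]) (use f in auto)
  then obtain h where h: "\<And>b. h b \<in> borel_measurable borel" "\<And>b. AE x in lborel. h b x = f x \<bullet> b"
    by metis
  have "AE x in lborel. \<forall>b\<in>Basis. h b x = f x \<bullet> b"
    by (rule AE_finite_allI) (use h in auto)
  then have "AE x in lborel. (\<Sum>b\<in>Basis. h b x *\<^sub>R b) = f x"
    by eventually_elim (simp add: euclidean_representation)
  moreover have "(\<lambda>x. \<Sum>b\<in>Basis. h b x *\<^sub>R b) \<in> borel_measurable borel"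
    using h(1) by (intro borel_measurable_sum borel_measurable_scaleR) auto
  ultimately show ?thesis by (rule that[rotated])
qed

text \<open>Completeness of \<open>lebesgue\<close> makes \<open>f\<close> measurable because it
  agrees almost everywhere with a Borel function; so no measurability of \<open>f\<close> has to be
  checked at each use.\<close>

lemma lebesgue_integral_eq_lborel:
  fixes f :: "'a::euclidean_space \<Rightarrow> real"
  assumes f': "f' \<in> borel_measurable borel" and ae: "AE x in lborel. f' x = f x"
  shows "(\<integral>x. f x \<partial>lebesgue) = (\<integral>x. f' x \<partial>lborel)"
proof -
  have m: "f' \<in> borel_measurable lborel" using f' by simp
  then have mL: "f' \<in> borel_measurable lebesgue" by (rule measurable_completion)
  have aeL: "AE x in lebesgue. f' x = f x" using ae by (simp add: AE_completion_iff)
  have "f \<in> borel_measurable lebesgue" using borel_measurable_AE[OF mL aeL] .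
  then have "(\<integral>x. f x \<partial>lebesgue) = (\<integral>x. f' x \<partial>lebesgue)"
    using mL aeL by (intro integral_cong_AE) (auto elim!: eventually_mono)
  also have "\<dots> = (\<integral>x. f' x \<partial>lborel)" by (rule integral_completion[OF m])
  finally show ?thesis .
qed

lemma set_integrable_lborel_representative:
  fixes f :: "'a::euclidean_space \<Rightarrow> real"
  assumes f: "set_integrable lebesgue K f" and f': "f' \<in> borel_measurable borel" and ae: "AE x in lborel. f' x = f x"
    and K: "K \<in> sets borel"
  shows "set_integrable lborel K f'"
proof -
  have m: "(\<lambda>x. indicator K x *\<^sub>R f' x) \<in> borel_measurable lborel" using f' K by measurable
  have aeL: "AE x in lebesgue. f' x = f x" using ae by (simp add: AE_completion_iff)
  have "integrable lebesgue (\<lambda>x. indicator K x *\<^sub>R f' x)"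
  proof (rule integrable_cong_AE_imp[OF f[unfolded set_integrable_def] measurable_completion[OF m]])
    show "AE x in lebesgue. indicator K x *\<^sub>R f x = indicator K x *\<^sub>R f' x"
      using aeL by eventually_elim simp
  qed
  then show ?thesis unfolding set_integrable_def using integrable_completion[OF m] by simp
qed

text \<open>The complement of the essential support is an arbitrary union of open sets on each of
  which \<open>f\<close> vanishes almost everywhere. The Lindelof property reduces it to a countable
  union, for which the exceptional null sets add up to a null set.\<close>

lemma AE_zero_off_esupport:
  fixes f :: "'a::euclidean_space \<Rightarrow> real"
  shows "AE x in lborel. x \<notin> esupport f \<longrightarrow> f x = 0"
proof -
  let ?\<V> = "{V. open V \<and> (AE x in lebesgue. x \<in> V \<longrightarrow> f x = 0)}"
  obtain \<F> where F: "\<F> \<subseteq> ?\<V>" "countable \<F>" "\<Union>\<F> = \<Union>?\<V>"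
    using Lindelof[of ?\<V>] by blast
  have "AE x in lborel. \<forall>V\<in>\<F>. x \<in> V \<longrightarrow> f x = 0"
    unfolding AE_ball_countable[OF F(2)] using F(1) by (auto simp: AE_completion_iff)
  then show ?thesis
  proof eventually_elim
    case (elim x)
    show ?case
    proof
      assume "x \<notin> esupport f"
      then have "x \<in> \<Union>?\<V>" unfolding esupport_def by blast
      then show "f x = 0" using elim F(3) by blast
    qed
  qed
qed

lemma not_in_esupportE:
  assumes "x \<notin> esupport f"
  obtains V where "open V" "x \<in> V" "AE x in lborel. x \<in> V \<longrightarrow> f x = 0"
proof -
  have "x \<in> \<Union>{V. open V \<and> (AE x in lebesgue. x \<in> V \<longrightarrow> f x = 0)}" using assms unfolding esupport_def by blast
  then obtain V where "open V" "x \<in> V" "AE x in lebesgue. x \<in> V \<longrightarrow> f x = 0" by blast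
  then show ?thesis using that by (simp add: AE_completion_iff)
qed

lemma closed_esupport: "closed (esupport f)"
proof -
  have "open (\<Union>{V. open V \<and> (AE x in lebesgue. x \<in> V \<longrightarrow> f x = 0)})" by (rule open_Union) auto
  then show ?thesis unfolding esupport_def Compl_eq_Diff_UNIV[symmetric] by (rule closed_Compl)
qed

section \<open>From the perimeter hypotheses to their scalar form\<close>

context stratified
begin

lemma Xf_const: "Xf gm b (\<lambda>y. c) x = 0"
  by (simp add: Xf_def)

lemma Xf_zero_outside_test:
  assumes "test_fun V \<psi>" "x \<notin> V" shows "Xf gm b \<psi> x = 0"
proof -
  have s: "smooth \<psi>" and K: "compact (tsupport \<psi>)" "tsupport \<psi> \<subseteq> V" using assms by (auto simp: test_fun_iff)
  show ?thesis
  proof (rule Xf_zero_outside[OF s compact_imp_closed[OF K(1)]])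
    show "x \<notin> tsupport \<psi>" using K(2) assms(2) by blast
  qed (rule tsupport_zero)
qed

lemma Xf_locally_constant:
  assumes "smooth \<eta>" "open W" "\<And>y. y \<in> W \<Longrightarrow> \<eta> y = c" "x \<in> W"
  shows "Xf gm b \<eta> x = 0"
proof -
  have "smooth (\<lambda>y. \<eta> y - c)" by (intro smooth_diff assms(1) smooth_const)
  then have "Xf gm b (\<lambda>y. \<eta> y - c) x = 0"
    by (rule Xf_zero_outside[of _ "- W"]) (use assms in auto)
  then have "((\<lambda>t. \<eta> (gm x (t *\<^sub>R b)) - c) has_real_derivative 0) (at 0)"
    using Xf_DERIV[OF \<open>smooth (\<lambda>y. \<eta> y - c)\<close>, of x b 0] by simp
  from DERIV_add[OF this DERIV_const[of c]] have "((\<lambda>t. \<eta> (gm x (t *\<^sub>R b))) has_real_derivative 0) (at 0)" by simp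
  then show ?thesis unfolding Xf_def by (rule DERIV_imp_deriv)
qed

lemma hgrad_inner: "v \<bullet> hgrad gm w \<psi> x = (\<Sum>b\<in>hbasis. (v \<bullet> b) * Xf gm b \<psi> x)"
  by (simp add: hgrad_def inner_sum_right mult.commute)

lemma hlayer_inner_eq_sum:
  assumes "u \<in> hlayer w 1" shows "u \<bullet> v = (\<Sum>b\<in>hbasis. (u \<bullet> b) * (v \<bullet> b))"
proof -
  have "u \<bullet> v = (\<Sum>b\<in>Basis. (u \<bullet> b) * (v \<bullet> b))" by (rule euclidean_inner)
  also have "\<dots> = (\<Sum>b\<in>hbasis. (u \<bullet> b) * (v \<bullet> b))"
    by (rule sum.mono_neutral_right) (use hlayer_inner_eq_0[OF assms] in auto)
  finally show ?thesis .
qed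

lemma C1c_horiz_scaleR:
  assumes \<psi>: "test_fun Om \<psi>" and b: "b \<in> hbasis"
  shows "C1c_horiz w Om (\<lambda>x. \<psi> x *\<^sub>R b)" "hdiv gm w (\<lambda>x. \<psi> x *\<^sub>R b) x = Xf gm b \<psi> x"
proof -
  have s: "smooth \<psi>" and K: "compact (tsupport \<psi>)" "tsupport \<psi> \<subseteq> Om" using \<psi> by (auto simp: test_fun_iff)
  have b0: "b \<noteq> 0" using b by (auto simp: nonzero_Basis)
  have ts: "tsupport (\<lambda>x. \<psi> x *\<^sub>R b) = tsupport \<psi>" using b0 by (simp add: tsupport_def)
  have sc: "smooth (\<lambda>x. \<psi> x *\<^sub>R b \<bullet> c)" for c
  proof -
    have "smooth (\<lambda>x. \<psi> x * (b \<bullet> c))" by (intro smooth_mult s smooth_const)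
    then show ?thesis by simp
  qed
  show "C1c_horiz w Om (\<lambda>x. \<psi> x *\<^sub>R b)"
    unfolding C1c_horiz_def ts
  proof (intro conjI allI ballI K)
    show "\<psi> x *\<^sub>R b \<in> hlayer w 1" for x
      unfolding hlayer_def using b by (intro span_mul span_base) auto
    show "(\<lambda>x. \<psi> x *\<^sub>R b \<bullet> c) differentiable_on UNIV" for c
      unfolding differentiable_on_def using smooth_differentiable[OF sc] by auto
    show "continuous_on UNIV (\<lambda>x. frechet_derivative (\<lambda>y. \<psi> y *\<^sub>R b \<bullet> c) (at x) e)" if "e \<in> Basis" for c e
      using smooth_continuous_on[OF smooth_pd[OF sc that]] unfolding pd_def .
  qed
  have "Xf gm c (\<lambda>y. \<psi> y *\<^sub>R b \<bullet> c) x = (if c = b then Xf gm b \<psi> x else 0)" if "c \<in> hbasis" for c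
    using b that by (cases "c = b") (auto simp: inner_Basis Xf_const)
  then have "hdiv gm w (\<lambda>x. \<psi> x *\<^sub>R b) x = (\<Sum>c\<in>hbasis. if c = b then Xf gm b \<psi> x else 0)"
    unfolding hdiv_def by (intro sum.cong) auto
  then show "hdiv gm w (\<lambda>x. \<psi> x *\<^sub>R b) x = Xf gm b \<psi> x" using b by simp
qed

lemma borel_measurable_Xf: "smooth \<psi> \<Longrightarrow> Xf gm b \<psi> \<in> borel_measurable borel"
  by (intro borel_measurable_continuous_onI smooth_continuous_on smooth_Xf)

lemma borel_measurable_smooth: "smooth \<psi> \<Longrightarrow> \<psi> \<in> borel_measurable borel"
  by (intro borel_measurable_continuous_onI smooth_continuous_on)

text \<open>A scalar test function times a horizontal basis vector is an admissible field, with
  divergence \<open>Xf gm b \<psi>\<close>. The Lebesgue measurable set enters only through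
  integrals over Lebesgue measure, so a Borel set that agrees with it almost everywhere on
  \<open>Om\<close> may take its place.\<close>

lemma perim_rep_imp_perim_s:
  assumes P: "perim_rep gm w Om E \<nu> \<sigma>" and E': "E' \<in> sets borel" "AE x in lborel. x \<in> Om \<longrightarrow> (x \<in> E' \<longleftrightarrow> x \<in> E)"
  shows "perim_s Om (indicator E') \<nu> \<sigma>"
  unfolding perim_s_def
proof (intro conjI allI impI)
  have snu: "sets \<nu> = sets borel" using P by (simp add: perim_rep_def)
  show "\<sigma> \<in> borel_measurable borel" using P snu by (simp add: perim_rep_def cong: measurable_cong_sets)
  fix \<psi> b assume \<psi>: "test_fun Om \<psi>" and "b \<in> Basis" "w b = 1"
  then have b: "b \<in> hbasis" by simp
  have s: "smooth \<psi>" using \<psi> by (simp add: test_fun_iff)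
  note c = C1c_horiz_scaleR[OF \<psi> b]
  note borel_measurable_Xf[OF s, measurable] E'(1)[measurable]
  have "(\<integral>x. indicator E' x * Xf gm b \<psi> x \<partial>lborel) = (\<integral>x. indicator E x * hdiv gm w (\<lambda>x. \<psi> x *\<^sub>R b) x \<partial>lebesgue)"
  proof (rule lebesgue_integral_eq_lborel[symmetric])
    show "AE x in lborel. indicator E' x * Xf gm b \<psi> x = indicator E x * hdiv gm w (\<lambda>x. \<psi> x *\<^sub>R b) x"
      using E'(2)
    proof eventually_elim
      case (elim x)
      then show ?case using Xf_zero_outside_test[OF \<psi>, of x b] unfolding c(2) by (cases "x \<in> Om") (auto simp: indicator_def)
    qed
  qed measurable
  also have "\<dots> = - (\<integral>x. (\<psi> x *\<^sub>R b) \<bullet> \<sigma> x \<partial>\<nu>)" using P c(1) by (simp add: perim_rep_def)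
  finally show "(\<integral>x. indicator E' x * Xf gm b \<psi> x \<partial>lborel) = - (\<integral>x. \<psi> x * (\<sigma> x \<bullet> b) \<partial>\<nu>)"
    by (simp add: inner_commute)
qed (use P in \<open>auto simp: perim_rep_def\<close>)

text \<open>The zero measure also represents the derivative of a function that vanishes almost
  everywhere, and representations are unique.\<close>

lemma perim_null_if_AE_empty:
  assumes V: "open V" and P: "perim_s V h \<nu> \<sigma>" and h: "AE x in lborel. x \<in> V \<longrightarrow> h x = 0"
  shows "emeasure \<nu> UNIV = 0"
proof -
  have "perim_s V h (null_measure borel) \<sigma>"
    unfolding perim_s_def
  proof (intro conjI allI impI)
    fix \<psi> b assume \<psi>: "test_fun V \<psi>"
    have "(\<integral>x. h x * Xf gm b \<psi> x \<partial>lborel) = 0"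
    proof (rule integral_eq_zero_AE)
      show "AE x in lborel. h x * Xf gm b \<psi> x = 0"
        using h
      proof eventually_elim
        case (elim x)
        then show ?case using Xf_zero_outside_test[OF \<psi>, of x b] by (cases "x \<in> V") auto
      qed
    qed
    then show "(\<integral>x. h x * Xf gm b \<psi> x \<partial>lborel) = - (\<integral>x. \<psi> x * (\<sigma> x \<bullet> b) \<partial>null_measure borel)"
      by (simp add: integral_null_measure)
  next
    show "AE x in null_measure borel. norm (\<sigma> x) = 1 \<and> \<sigma> x \<in> hlayer w 1"
      by (auto simp: eventually_ae_filter null_sets_def intro!: exI[of _ UNIV])
  qed (use P in \<open>auto simp: perim_s_def\<close>)
  from perim_s_unique(1)[OF V P this] show ?thesis by simp
qed

end

section \<open>Equality of the traces and integration by parts\<close>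

theorem theorem1p5:
  fixes gm :: "'a::euclidean_space \<Rightarrow> 'a \<Rightarrow> 'a" and w :: "'a \<Rightarrow> nat"
    and d :: "'a \<Rightarrow> 'a \<Rightarrow> real" and \<Omega> U E E1 :: "'a set"
    and F G :: "'a \<Rightarrow> 'a" and g \<phi> Tri Tre :: "'a \<Rightarrow> real"
    and \<nu> \<nu>U :: "'a measure" and \<sigma> \<sigma>U :: "'a \<Rightarrow> 'a"
  assumes grp: "stratified_group gm w"
    and dist: "hom_dist gm w d"
    and \<Omega>: "open \<Omega>"
    and F: "DM_loc_ac gm w \<Omega> F g"
    and E: "E \<subseteq> \<Omega>" "E \<in> sets lebesgue"
    and perE: "perim_rep gm w \<Omega> E \<nu> \<sigma>"
    and \<phi>cont: "continuous_on \<Omega> \<phi>"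
    and G: "G \<in> borel_measurable lebesgue" "\<forall>x\<in>\<Omega>. G x \<in> hlayer w 1"
      "\<forall>K. compact K \<and> K \<subseteq> \<Omega> \<longrightarrow> set_integrable lebesgue K (\<lambda>x. norm (G x))"
      "\<forall>\<psi>. test_fun \<Omega> \<psi> \<longrightarrow> (\<forall>b\<in>{b\<in>Basis. w b = 1}.
          (\<integral>x. \<phi> x * Xf gm b \<psi> x \<partial>lebesgue) = - (\<integral>x. (G x \<bullet> b) * \<psi> x \<partial>lebesgue))"
    and supp: "cpt_in (esupport (\<lambda>x. \<phi> x * indicator E x)) \<Omega>"
    and U: "open U" "cpt_in U \<Omega>" "esupport (\<lambda>x. \<phi> x * indicator E x) \<subseteq> U"
    and perU: "perim_rep gm w U (E \<inter> U) \<nu>U \<sigma>U"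
    and tr: "normal_traces gm w d U F g (E \<inter> U) \<nu>U \<sigma>U E1 Tri Tre"
  shows "(AE x in \<nu>U. x \<in> red_bdry d U \<nu>U \<sigma>U \<longrightarrow>
            Tri x = Tre x \<and> Tri x = (Tri x + Tre x) / 2 \<and> Tre x = (Tri x + Tre x) / 2)
         \<and> (\<integral>x. indicator E x * \<phi> x * g x \<partial>lebesgue)
             + (\<integral>x. indicator E x * (F x \<bullet> G x) \<partial>lebesgue)
           = (\<integral>x. indicator (red_bdry d \<Omega> \<nu> \<sigma>) x * \<phi> x * ((Tri x + Tre x) / 2) \<partial>\<nu>)"
proof -
  interpret stratified_metric gm w d using grp dist by unfold_locales
  let ?S = "esupport (\<lambda>x. \<phi> x * indicator E x)"
  let ?RU = "red_bdry d U \<nu>U \<sigma>U" and ?R = "red_bdry d \<Omega> \<nu> \<sigma>"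
  have clU: "compact (closure U)" "closure U \<subseteq> \<Omega>" using U(2) by (auto simp: cpt_in_def)
  have U\<Omega>: "U \<subseteq> \<Omega>" using clU(2) closure_subset by blast
  have clUb [measurable]: "closure U \<in> sets borel" by simp
  have Ub [measurable]: "U \<in> sets borel" using U(1) by simp
  have KclU: "compact K \<Longrightarrow> K \<subseteq> U \<Longrightarrow> K \<subseteq> closure U" for K using closure_subset by blast

  \<comment> \<open>\<open>main_part\<close> gives a Borel set that differs from \<open>E\<close> by
    a null set. Intersecting with \<open>U\<close> suits the hypotheses about \<open>U\<close>, and
    inside \<open>U\<close> nothing changes.\<close>
  define E' where "E' = main_part lborel E \<inter> U"
  have mp: "main_part lborel E \<in> sets borel" using main_part_sets[of E lborel] E(2) by simp
  have E'b [measurable]: "E' \<in> sets borel" using mp Ub by (simp add: E'_def)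
  have mpE: "AE x in lborel. x \<in> main_part lborel E \<longleftrightarrow> x \<in> E" by (rule AE_in_main_part[OF E(2)])
  have E'E: "AE x in lborel. x \<in> E' \<longleftrightarrow> x \<in> E \<inter> U"
    using mpE by eventually_elim (auto simp: E'_def)

  have P\<Omega>: "perim_s \<Omega> (indicator (main_part lborel E)) \<nu> \<sigma>"
    by (rule perim_rep_imp_perim_s[OF perE mp]) (use mpE in \<open>auto elim!: eventually_mono\<close>)
  have PU: "perim_s U (indicator E') \<nu>U \<sigma>U"
    by (rule perim_rep_imp_perim_s[OF perU E'b]) (use E'E in \<open>auto elim!: eventually_mono\<close>)
  \<comment> \<open>The restriction of \<nu> to \<open>U\<close> and the given measure
    \<open>\<nu>U\<close> represent the same derivative. Uniqueness identifies them, and with them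
    the reduced boundary in \<open>U\<close> and the part of the other one inside
    \<open>U\<close>.\<close>
  have "perim_s U (indicator E') (density \<nu> (indicator U)) \<sigma>"
    by (rule perim_s_restrict[OF \<Omega> U(1) U\<Omega> P\<Omega>]) (simp add: E'_def indicator_def)
  from perim_s_unique[OF U(1) this PU]
  have \<nu>U: "\<nu>U = density \<nu> (indicator U)" and \<sigma>eq: "AE x in \<nu>U. \<sigma> x = \<sigma>U x" by auto
  have snu: "sets \<nu> = sets borel" by (rule perim_sets[OF \<Omega> P\<Omega>])
  have snuU: "sets \<nu>U = sets borel" by (rule perim_sets[OF U(1) PU])
  have \<sigma>m: "\<sigma> \<in> borel_measurable borel" "\<sigma>U \<in> borel_measurable borel"
    using perim_sigma_measurable[OF \<Omega> P\<Omega>] perim_sigma_measurable[OF U(1) PU] .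
  have RU: "?RU = ?R \<inter> U"
    unfolding \<nu>U by (rule red_bdry_restrict[OF snu U(1) U\<Omega> \<sigma>m \<sigma>eq[unfolded \<nu>U]])
  \<comment> \<open>\<open>U\<close> is relatively compact in \<open>\<Omega>\<close>, so local
    finiteness of \<nu> becomes finiteness of \<open>\<nu>U\<close>. Measurability of the reduced
    boundary and integrability of the bounded traces depend on it.\<close>
  have finU: "finite_measure \<nu>U"
  proof
    have "emeasure \<nu>U UNIV = emeasure \<nu> (U \<inter> UNIV)"
      unfolding \<nu>U by (rule emeasure_density_indicator) (use Ub snu in auto)
    also have "\<dots> \<le> emeasure \<nu> (closure U)"
      using closure_subset[of U] snu by (intro emeasure_mono) auto
    also have "\<dots> < \<infinity>" by (rule perim_fin[OF \<Omega> P\<Omega> clU])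
    finally show "emeasure \<nu>U (space \<nu>U) \<noteq> \<infinity>" using perim_space[OF U(1) PU] by simp
  qed
  interpret nuU: finite_measure \<nu>U by (rule finU)
  have int\<sigma>: "integrable \<nu>U \<sigma>U"
    by (rule nuU.integrable_const_bound[where B = 1])
      (use perim_AE[OF U(1) PU] \<sigma>m(2) snuU in \<open>auto elim!: eventually_mono cong: measurable_cong_sets\<close>)
  have RUb [measurable]: "?RU \<in> sets borel" by (rule red_bdry_measurable[OF snuU finU int\<sigma> Ub])
  have RUsub: "?RU \<subseteq> U" by (auto simp: red_bdry_def)
  \<comment> \<open>\<open>N\<close> makes Lebesgue measure and \<open>\<nu>U\<close> mutually
    singular, which is the input of both comparison lemmas below.\<close>
  obtain N where N: "N \<in> sets borel" "emeasure lborel N = 0" "AE x in \<nu>U. x \<in> N"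
    using perim_singular[OF U(1) E'b PU] .
  have nuM: "f \<in> borel_measurable \<nu>U \<longleftrightarrow> f \<in> borel_measurable borel" for f :: "'a \<Rightarrow> real"
    using snuU by (auto cong: measurable_cong_sets)

  have Fm: "F \<in> borel_measurable lebesgue" and Fh: "\<And>x. x \<in> \<Omega> \<Longrightarrow> F x \<in> hlayer w 1"
    and Fbd: "\<And>W. open W \<and> cpt_in W \<Omega> \<Longrightarrow> \<exists>C. AE x in lebesgue. x \<in> W \<longrightarrow> norm (F x) \<le> C"
    and gm': "g \<in> borel_measurable lebesgue" and gint: "\<And>K. compact K \<and> K \<subseteq> \<Omega> \<Longrightarrow> set_integrable lebesgue K g"
    and Fdiv: "\<And>\<psi>. test_fun \<Omega> \<psi> \<Longrightarrow> - (\<integral>x. F x \<bullet> hgrad gm w \<psi> x \<partial>lebesgue) = (\<integral>x. \<psi> x * g x \<partial>lebesgue)"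
    using F unfolding DM_loc_ac_def by blast+
  obtain F' where F' [measurable]: "F' \<in> borel_measurable borel" and F'F: "AE x in lborel. F' x = F x"
    using lebesgue_vector_representative[OF Fm] .
  obtain g' where g' [measurable]: "g' \<in> borel_measurable borel" and g'g: "AE x in lborel. g' x = g x"
    using lebesgue_real_representative[OF gm'] .
  obtain G' where G' [measurable]: "G' \<in> borel_measurable borel" and G'G: "AE x in lborel. G' x = G x"
    using lebesgue_vector_representative[OF G(1)] .
  obtain C where "AE x in lebesgue. x \<in> U \<longrightarrow> norm (F x) \<le> C" using Fbd U(1,2) by blast
  then have C: "AE x in lborel. x \<in> U \<longrightarrow> norm (F x) \<le> C" by (simp add: AE_completion_iff)
  have F'C: "AE x in lborel. x \<in> U \<longrightarrow> \<bar>F' x \<bullet> b\<bar> \<le> C" if "b \<in> hbasis" for b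
    using C F'F
  proof eventually_elim
    case (elim x)
    show ?case
    proof
      assume "x \<in> U"
      then have "norm (F' x) \<le> C" using elim by simp
      moreover have "\<bar>F' x \<bullet> b\<bar> \<le> norm (F' x)" using that by (intro Basis_le_norm) simp
      ultimately show "\<bar>F' x \<bullet> b\<bar> \<le> C" by linarith
    qed
  qed
  have g'clU: "set_integrable lborel (closure U) g'"
    by (rule set_integrable_lborel_representative[OF gint g' g'g clUb]) (use clU in blast)
  have g'K: "set_integrable lborel K g'" if "compact K" "K \<subseteq> U" for K
    by (rule set_integrable_subset[OF g'clU]) (use that KclU in \<open>auto simp: compact_imp_closed\<close>)
  have div': "(\<integral>x. (\<Sum>b\<in>hbasis. (F' x \<bullet> b) * Xf gm b \<psi> x) \<partial>lborel) = - (\<integral>x. \<psi> x * g' x \<partial>lborel)"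
    if \<psi>: "test_fun U \<psi>" for \<psi>
  proof -
    have s: "smooth \<psi>" using \<psi> by (simp add: test_fun_iff)
    note [measurable] = borel_measurable_Xf[OF s] borel_measurable_smooth[OF s]
    have "(\<integral>x. F x \<bullet> hgrad gm w \<psi> x \<partial>lebesgue) = (\<integral>x. (\<Sum>b\<in>hbasis. (F' x \<bullet> b) * Xf gm b \<psi> x) \<partial>lborel)"
    proof (rule lebesgue_integral_eq_lborel)
      show "AE x in lborel. (\<Sum>b\<in>hbasis. (F' x \<bullet> b) * Xf gm b \<psi> x) = F x \<bullet> hgrad gm w \<psi> x"
        using F'F by eventually_elim (simp add: hgrad_inner)
    qed measurable
    moreover have "(\<integral>x. \<psi> x * g x \<partial>lebesgue) = (\<integral>x. \<psi> x * g' x \<partial>lborel)"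
    proof (rule lebesgue_integral_eq_lborel)
      show "AE x in lborel. \<psi> x * g' x = \<psi> x * g x" using g'g by eventually_elim simp
    qed measurable
    ultimately show ?thesis using Fdiv[OF test_fun_mono[OF \<psi> U\<Omega>]] by simp
  qed

  have E1s: "E1 \<subseteq> U - ?RU" and E1m: "E1 \<in> sets (completion (density lebesgue (\<lambda>x. ennreal \<bar>g x\<bar>)))"
    and Trm: "Tri \<in> borel_measurable \<nu>U" "Tre \<in> borel_measurable \<nu>U"
    and Trb: "\<exists>C. AE x in \<nu>U. x \<in> ?RU \<longrightarrow> \<bar>Tri x\<bar> \<le> C \<and> \<bar>Tre x\<bar> \<le> C"
    and tri: "\<And>\<psi>. test_fun U \<psi> \<Longrightarrow> - (\<integral>x. indicator (E \<inter> U) x * (F x \<bullet> hgrad gm w \<psi> x) \<partial>lebesgue)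
            = (\<integral>x. indicator E1 x * \<psi> x * g x \<partial>lebesgue) - (\<integral>x. indicator ?RU x * \<psi> x * Tri x \<partial>\<nu>U)"
    and tre: "\<And>\<psi>. test_fun U \<psi> \<Longrightarrow> - (\<integral>x. indicator (E \<inter> U) x * (F x \<bullet> hgrad gm w \<psi> x) \<partial>lebesgue)
            = (\<integral>x. indicator (E1 \<union> ?RU) x * \<psi> x * g x \<partial>lebesgue) - (\<integral>x. indicator ?RU x * \<psi> x * Tre x \<partial>\<nu>U)"
    using tr unfolding normal_traces_def Let_def by blast+
  obtain CT where CT: "AE x in \<nu>U. x \<in> ?RU \<longrightarrow> \<bar>Tri x\<bar> \<le> CT \<and> \<bar>Tre x\<bar> \<le> CT" using Trb by blast
  have Trb' [measurable]: "Tri \<in> borel_measurable borel" "Tre \<in> borel_measurable borel" using Trm by (simp_all add: nuM)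

  \<comment> \<open>\<open>E1\<close> is measurable only in the completion of
    \<open>|div F|\<close>, so where \<open>g\<close> vanishes its indicator may fail to be Lebesgue
    measurable. The product of the indicator with \<open>g\<close> is measurable in any case, and
    \<open>g1\<close> is a Borel version of it.\<close>
  obtain g1 where g1 [measurable]: "g1 \<in> borel_measurable borel" and g1g: "AE x in lborel. g1 x = indicator E1 x * g x"
  proof -
    let ?D = "density lebesgue (\<lambda>x. ennreal \<bar>g x\<bar>)"
    let ?M = "main_part ?D E1"
    have M: "?M \<in> sets lebesgue" using main_part_sets[OF E1m] by simp
    have "AE x in ?D. x \<in> ?M \<longleftrightarrow> x \<in> E1" by (rule AE_in_main_part[OF E1m])
    then have "AE x in lebesgue. 0 < ennreal \<bar>g x\<bar> \<longrightarrow> (x \<in> ?M \<longleftrightarrow> x \<in> E1)"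
      by (subst (asm) AE_density) (use gm' in auto)
    then have ae: "AE x in lborel. indicator ?M x * g x = indicator E1 x * g x"
      unfolding AE_completion_iff by eventually_elim (auto simp: indicator_def)
    have "(\<lambda>x. indicator ?M x * g x) \<in> borel_measurable lebesgue"
      using M gm' by (intro borel_measurable_times borel_measurable_indicator)
    then obtain h where h: "h \<in> borel_measurable borel" "AE x in lborel. h x = indicator ?M x * g x"
      by (rule lebesgue_real_representative)
    have "AE x in lborel. h x = indicator E1 x * g x" using h(2) ae by eventually_elim simp
    then show ?thesis by (rule that[OF h(1)])
  qed
  have g1U: "integrable lborel (\<lambda>x. indicator (closure U) x *\<^sub>R g1 x)"
  proof (rule Bochner_Integration.integrable_bound[OF g'clU[unfolded set_integrable_def]])
    show "AE x in lborel. norm (indicator (closure U) x *\<^sub>R g1 x) \<le> norm (indicator (closure U) x *\<^sub>R g' x)"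
      using g1g g'g by eventually_elim (auto simp: indicator_def)
  qed measurable
  have g1K: "set_integrable lborel K g1" if "compact K" "K \<subseteq> U" for K
    by (rule set_integrable_subset[OF g1U[folded set_integrable_def]]) (use that KclU in \<open>auto simp: compact_imp_closed\<close>)

  let ?v = "\<lambda>x. indicator ?RU x * Tri x" and ?ve = "\<lambda>x. indicator ?RU x * Tre x"
  have vb: "AE x in \<nu>U. \<bar>?v x\<bar> \<le> \<bar>CT\<bar>" "AE x in \<nu>U. \<bar>?ve x\<bar> \<le> \<bar>CT\<bar>"
    using CT by (auto elim!: eventually_mono simp: indicator_def)
  have vm: "?v \<in> borel_measurable borel" "?ve \<in> borel_measurable borel" by measurable
  have vi: "integrable \<nu>U ?v" "integrable \<nu>U ?ve"
    by (rule nuU.integrable_const_bound[where B = "\<bar>CT\<bar>"]; use vb vm in \<open>simp add: nuM\<close>)+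
  have siv: "set_integrable \<nu>U K f" if "integrable \<nu>U f" "compact K" for K and f :: "'a \<Rightarrow> real"
    unfolding set_integrable_def
    by (rule integrable_mult_indicator[OF _ that(1)]) (use that(2) snuU in \<open>simp add: compact_imp_closed\<close>)
  have FE: "(\<integral>x. indicator (E \<inter> U) x * (F x \<bullet> hgrad gm w \<psi> x) \<partial>lebesgue)
      = (\<integral>x. indicator E' x * (\<Sum>b\<in>hbasis. (F' x \<bullet> b) * Xf gm b \<psi> x) \<partial>lborel)" if \<psi>: "test_fun U \<psi>" for \<psi>
  proof (rule lebesgue_integral_eq_lborel)
    have s: "smooth \<psi>" using \<psi> by (simp add: test_fun_iff)
    note [measurable] = borel_measurable_Xf[OF s]
    show "(\<lambda>x. indicator E' x * (\<Sum>b\<in>hbasis. (F' x \<bullet> b) * Xf gm b \<psi> x)) \<in> borel_measurable borel" by measurable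
    show "AE x in lborel. indicator E' x * (\<Sum>b\<in>hbasis. (F' x \<bullet> b) * Xf gm b \<psi> x) = indicator (E \<inter> U) x * (F x \<bullet> hgrad gm w \<psi> x)"
      using F'F E'E by eventually_elim (simp add: hgrad_inner indicator_def)
  qed
  have tri': "- (\<integral>x. indicator E' x * (\<Sum>b\<in>hbasis. (F' x \<bullet> b) * Xf gm b \<psi> x) \<partial>lborel)
       = (\<integral>x. \<psi> x * g1 x \<partial>lborel) - (\<integral>x. \<psi> x * ?v x \<partial>\<nu>U)" if \<psi>: "test_fun U \<psi>" for \<psi>
  proof -
    have s: "smooth \<psi>" using \<psi> by (simp add: test_fun_iff)
    note [measurable] = borel_measurable_smooth[OF s]
    have "(\<integral>x. indicator E1 x * \<psi> x * g x \<partial>lebesgue) = (\<integral>x. \<psi> x * g1 x \<partial>lborel)"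
    proof (rule lebesgue_integral_eq_lborel)
      show "AE x in lborel. \<psi> x * g1 x = indicator E1 x * \<psi> x * g x" using g1g by eventually_elim simp
    qed measurable
    with tri[OF \<psi>] show ?thesis unfolding FE[OF \<psi>] by (simp only: mult.left_commute[of "\<psi> _"] mult.assoc)
  qed
  have tre': "- (\<integral>x. indicator E' x * (\<Sum>b\<in>hbasis. (F' x \<bullet> b) * Xf gm b \<psi> x) \<partial>lborel)
       = (\<integral>x. \<psi> x * (g1 x + indicator ?RU x * g' x) \<partial>lborel) - (\<integral>x. \<psi> x * ?ve x \<partial>\<nu>U)" if \<psi>: "test_fun U \<psi>" for \<psi>
  proof -
    have s: "smooth \<psi>" using \<psi> by (simp add: test_fun_iff)
    note [measurable] = borel_measurable_smooth[OF s]
    have "(\<integral>x. indicator (E1 \<union> ?RU) x * \<psi> x * g x \<partial>lebesgue) = (\<integral>x. \<psi> x * (g1 x + indicator ?RU x * g' x) \<partial>lborel)"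
    proof (rule lebesgue_integral_eq_lborel)
      show "AE x in lborel. \<psi> x * (g1 x + indicator ?RU x * g' x) = indicator (E1 \<union> ?RU) x * \<psi> x * g x"
        using g1g g'g by eventually_elim (use E1s in \<open>auto simp: indicator_def\<close>)
    qed measurable
    with tre[OF \<psi>] show ?thesis unfolding FE[OF \<psi>] by (simp only: mult.left_commute[of "\<psi> _"] mult.assoc)
  qed

  have rK: "set_integrable lborel K (\<lambda>x. indicator ?RU x * g' x)" if "compact K" "K \<subseteq> U" for K
  proof -
    have "integrable lborel (\<lambda>x. indicator ?RU x *\<^sub>R (indicator K x *\<^sub>R g' x))"
      by (rule integrable_mult_indicator) (use g'K[OF that] in \<open>simp_all add: set_integrable_def\<close>)
    then show ?thesis unfolding set_integrable_def by (simp add: mult.left_commute)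
  qed
  have test_i: "integrable lborel (\<lambda>x. \<psi> x * f x)"
    if \<psi>: "test_fun U \<psi>" and f: "\<And>K. compact K \<Longrightarrow> K \<subseteq> U \<Longrightarrow> set_integrable lborel K f" for \<psi> f :: "'a \<Rightarrow> real"
  proof -
    have s: "smooth \<psi>" and K: "compact (tsupport \<psi>)" "tsupport \<psi> \<subseteq> U" using \<psi> by (auto simp: test_fun_iff)
    have "integrable lborel (\<lambda>x. \<psi> x * (indicator (tsupport \<psi>) x * f x))"
      by (rule integrable_mult_continuous[OF sets_lborel _ K(1)])
        (use f[OF K] s in \<open>auto simp: set_integrable_def intro: smooth_continuous_on\<close>)
    moreover have "\<psi> x * (indicator (tsupport \<psi>) x * f x) = \<psi> x * f x" for x
      using tsupport_zero[of x \<psi>] by (cases "x \<in> tsupport \<psi>") auto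
    ultimately show ?thesis by simp
  qed
  have test_iU: "integrable \<nu>U (\<lambda>x. \<psi> x * f x)"
    if \<psi>: "test_fun U \<psi>" and f: "integrable \<nu>U f" for \<psi> f :: "'a \<Rightarrow> real"
  proof -
    have s: "smooth \<psi>" and K: "compact (tsupport \<psi>)" using \<psi> by (auto simp: test_fun_iff)
    have "integrable \<nu>U (\<lambda>x. \<psi> x * (indicator (tsupport \<psi>) x * f x))"
      by (rule integrable_mult_continuous[OF snuU _ K])
        (use siv[OF f K] s in \<open>auto simp: set_integrable_def intro: smooth_continuous_on\<close>)
    moreover have "\<psi> x * (indicator (tsupport \<psi>) x * f x) = \<psi> x * f x" for x
      using tsupport_zero[of x \<psi>] by (cases "x \<in> tsupport \<psi>") auto
    ultimately show ?thesis by simp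
  qed
  \<comment> \<open>Subtracting the two trace identities equates the part of \<open>div F\<close> on
    the reduced boundary, which is absolutely continuous, with the difference of the traces times
    the perimeter measure, which is singular.\<close>
  have "AE x in \<nu>U. x \<in> U \<longrightarrow> ?ve x - ?v x = 0"
  proof (rule AE_zero_if_equal_singular[OF U(1) snuU N rK])
    show "set_integrable \<nu>U K (\<lambda>x. ?ve x - ?v x)" if "compact K" for K
      by (rule siv[OF _ that]) (use vi in simp)
    fix \<psi> assume \<psi>: "test_fun U \<psi>"
    have "(\<integral>x. \<psi> x * (g1 x + indicator ?RU x * g' x) \<partial>lborel) = (\<integral>x. \<psi> x * g1 x \<partial>lborel) + (\<integral>x. \<psi> x * (indicator ?RU x * g' x) \<partial>lborel)"
      unfolding distrib_left by (rule Bochner_Integration.integral_add[OF test_i[OF \<psi> g1K] test_i[OF \<psi> rK]])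
    moreover have "(\<integral>x. \<psi> x * (?ve x - ?v x) \<partial>\<nu>U) = (\<integral>x. \<psi> x * ?ve x \<partial>\<nu>U) - (\<integral>x. \<psi> x * ?v x \<partial>\<nu>U)"
      unfolding right_diff_distrib by (rule Bochner_Integration.integral_diff[OF test_iU[OF \<psi> vi(2)] test_iU[OF \<psi> vi(1)]])
    ultimately show "(\<integral>x. \<psi> x * (indicator ?RU x * g' x) \<partial>lborel) = (\<integral>x. \<psi> x * (?ve x - ?v x) \<partial>\<nu>U)"
      using tri'[OF \<psi>] tre'[OF \<psi>] by linarith
  qed
  then have Treq: "AE x in \<nu>U. x \<in> ?RU \<longrightarrow> Tri x = Tre x"
    by eventually_elim (use RUsub in \<open>auto simp: indicator_def\<close>)

  \<comment> \<open>By the interior trace identity the difference between \<open>div F\<close> on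
    \<open>E\<close> and on \<open>E1\<close> is the pairing minus the trace term. The first is
    bounded through \<open>pairing_bound\<close>, the second through the bound on the trace, both by
    multiples of the singular measure \<open>\<nu>U\<close>.\<close>
  have g1eq: "AE x in lborel. x \<in> U \<longrightarrow> indicator E' x * g' x - g1 x = 0"
  proof (rule AE_zero_if_dominated_singular[OF U(1) snuU perim_fin[OF U(1) PU] N])
    have eK: "set_integrable lborel K (\<lambda>x. indicator E' x * g' x)" if "compact K" "K \<subseteq> U" for K
    proof -
      have "integrable lborel (\<lambda>x. indicator E' x *\<^sub>R (indicator K x *\<^sub>R g' x))"
        by (rule integrable_mult_indicator) (use g'K[OF that] in \<open>simp_all add: set_integrable_def\<close>)
      then show ?thesis unfolding set_integrable_def by (simp add: mult.left_commute)
    qed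
    show "set_integrable lborel K (\<lambda>x. indicator E' x * g' x - g1 x)" if "compact K" "K \<subseteq> U" for K
      by (rule set_integral_diff(1)[OF eK[OF that] g1K[OF that]])
    fix \<psi> assume \<psi>: "test_fun U \<psi>"
    let ?A = "\<integral>x. indicator E' x * (\<Sum>b\<in>hbasis. (F' x \<bullet> b) * Xf gm b \<psi> x) \<partial>lborel"
    let ?B = "\<integral>x. indicator E' x * \<psi> x * g' x \<partial>lborel"
    let ?V = "\<integral>x. \<psi> x * ?v x \<partial>\<nu>U"
    have "(\<integral>x. \<psi> x * (indicator E' x * g' x - g1 x) \<partial>lborel) = (\<integral>x. \<psi> x * (indicator E' x * g' x) \<partial>lborel) - (\<integral>x. \<psi> x * g1 x \<partial>lborel)"
      unfolding right_diff_distrib by (rule Bochner_Integration.integral_diff[OF test_i[OF \<psi> eK] test_i[OF \<psi> g1K]])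
    also have "(\<integral>x. \<psi> x * (indicator E' x * g' x) \<partial>lborel) = ?B" by (simp only: mult.assoc mult.left_commute)
    also have "?B - (\<integral>x. \<psi> x * g1 x \<partial>lborel) = ?A + ?B - ?V" using tri'[OF \<psi>] by linarith
    finally have eq: "(\<integral>x. \<psi> x * (indicator E' x * g' x - g1 x) \<partial>lborel) = ?A + ?B - ?V" .
    have "\<bar>?A + ?B\<bar> \<le> real (card hbasis) * \<bar>C\<bar> * (\<integral>x. \<bar>\<psi> x\<bar> \<partial>\<nu>U)"
      by (rule pairing_bound[OF U(1) E'b PU F' F'C g' g'K div' \<psi>])
    moreover have "\<bar>?V\<bar> \<le> \<bar>CT\<bar> * (\<integral>x. \<bar>\<psi> x\<bar> \<partial>\<nu>U)"
    proof -
      have i\<psi>: "integrable \<nu>U (\<lambda>x. \<bar>CT\<bar> * \<bar>\<psi> x\<bar>)" using test_iU[OF \<psi>, of "\<lambda>x. 1"] by simp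
      have "\<bar>?V\<bar> \<le> (\<integral>x. \<bar>\<psi> x * ?v x\<bar> \<partial>\<nu>U)" by (rule integral_abs_bound)
      also have "\<dots> \<le> (\<integral>x. \<bar>CT\<bar> * \<bar>\<psi> x\<bar> \<partial>\<nu>U)"
      proof (rule integral_mono_AE[OF integrable_abs[OF test_iU[OF \<psi> vi(1)]] i\<psi>])
        show "AE x in \<nu>U. \<bar>\<psi> x * ?v x\<bar> \<le> \<bar>CT\<bar> * \<bar>\<psi> x\<bar>"
          using vb(1)
        proof eventually_elim
          case (elim x)
          from mult_left_mono[OF this, of "\<bar>\<psi> x\<bar>"] show ?case by (simp only: abs_mult[of "\<psi> x"] mult.commute[of "\<bar>CT\<bar>"] abs_ge_zero)
        qed
      qed
      finally show ?thesis by simp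
    qed
    ultimately show "\<bar>\<integral>x. \<psi> x * (indicator E' x * g' x - g1 x) \<partial>lborel\<bar> \<le> (real (card hbasis) * \<bar>C\<bar> + \<bar>CT\<bar>) * (\<integral>x. \<bar>\<psi> x\<bar> \<partial>\<nu>U)"
      unfolding eq distrib_right by linarith
  qed

  \<comment> \<open>Nothing is known about \<open>\<phi>\<close> outside \<open>\<Omega>\<close>;
    the extension by 0 is Borel on the whole space.\<close>
  define f where "f = (\<lambda>x. indicator \<Omega> x *\<^sub>R \<phi> x)"
  have fm [measurable]: "f \<in> borel_measurable borel"
    unfolding f_def by (rule borel_measurable_continuous_on_indicator) (use \<phi>cont \<Omega> in auto)
  have fc: "isCont f x" if "x \<in> \<Omega>" for x
  proof -
    have "\<forall>\<^sub>F y in nhds x. f y = \<phi> y"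
      using eventually_nhds_in_open[OF \<Omega> that] by eventually_elim (simp add: f_def)
    from isCont_cong[OF this] show ?thesis using \<phi>cont \<Omega> that by (simp add: continuous_on_eq_continuous_at)
  qed
  have f\<phi>: "f x = \<phi> x" if "x \<in> \<Omega>" for x using that by (simp add: f_def)
  have G'i: "set_integrable lborel K (\<lambda>x. G' x \<bullet> b)" if "b \<in> hbasis" "compact K" "K \<subseteq> \<Omega>" for b K
  proof -
    have Kb: "K \<in> sets borel" using that by (simp add: compact_imp_closed)
    have n: "set_integrable lborel K (\<lambda>x. norm (G' x))"
      by (rule set_integrable_lborel_representative[OF G(3)[rule_format] _ _ Kb])
        (use that G'G in \<open>auto elim!: eventually_mono\<close>)
    show ?thesis unfolding set_integrable_def
    proof (rule Bochner_Integration.integrable_bound[OF n[unfolded set_integrable_def]])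
      show "(\<lambda>x. indicator K x *\<^sub>R (G' x \<bullet> b)) \<in> borel_measurable lborel" using Kb by measurable
      show "AE x in lborel. norm (indicator K x *\<^sub>R (G' x \<bullet> b)) \<le> norm (indicator K x *\<^sub>R norm (G' x))"
        using Basis_le_norm[of b] that(1) by (intro AE_I2) (auto simp: indicator_def)
    qed
  qed
  have weak: "(\<integral>x. f x * Xf gm b \<psi> x \<partial>lborel) = - (\<integral>x. \<psi> x * (G' x \<bullet> b) \<partial>lborel)"
    if b: "b \<in> hbasis" and \<psi>: "test_fun \<Omega> \<psi>" for b \<psi>
  proof -
    have s: "smooth \<psi>" using \<psi> by (simp add: test_fun_iff)
    note [measurable] = borel_measurable_Xf[OF s] borel_measurable_smooth[OF s]
    have "(\<integral>x. \<phi> x * Xf gm b \<psi> x \<partial>lebesgue) = (\<integral>x. f x * Xf gm b \<psi> x \<partial>lborel)"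
    proof (rule lebesgue_integral_eq_lborel)
      show "AE x in lborel. f x * Xf gm b \<psi> x = \<phi> x * Xf gm b \<psi> x"
      proof (rule AE_I2)
        fix x show "f x * Xf gm b \<psi> x = \<phi> x * Xf gm b \<psi> x"
          using Xf_zero_outside_test[OF \<psi>, of x b] f\<phi>[of x] by (cases "x \<in> \<Omega>") auto
      qed
    qed measurable
    moreover have "(\<integral>x. (G x \<bullet> b) * \<psi> x \<partial>lebesgue) = (\<integral>x. \<psi> x * (G' x \<bullet> b) \<partial>lborel)"
    proof (rule lebesgue_integral_eq_lborel)
      show "AE x in lborel. \<psi> x * (G' x \<bullet> b) = (G x \<bullet> b) * \<psi> x" using G'G by eventually_elim simp
    qed measurable
    ultimately show ?thesis using G(4)[rule_format, OF \<psi> b] by simp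
  qed
  have "AE x in lborel. x \<in> \<Omega> \<longrightarrow> f x = 0 \<longrightarrow> G' x \<bullet> b = 0" if b: "b \<in> hbasis" for b
    by (rule weak_derivative_zero_on_zero_set[OF \<Omega> fm fc _ G'i[OF b] weak[OF b]]) measurable
  then have Gz: "AE x in lborel. \<forall>b\<in>hbasis. x \<in> \<Omega> \<longrightarrow> f x = 0 \<longrightarrow> G' x \<bullet> b = 0"
    by (intro AE_finite_allI) auto

  have S: "compact ?S" "?S \<subseteq> \<Omega>" using supp unfolding cpt_in_def closure_closed[OF closed_esupport] by blast+
  \<comment> \<open>Since \<eta> is 1 on an open set around the support, the term with
    \<open>Xf gm b \<eta>\<close> vanishes there. On the rest of \<open>E\<close> the function
    \<open>\<phi>\<close>, and with it \<open>G'\<close>, is zero almost everywhere in the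
    horizontal components, so \<eta> leaves no trace in the final formula.\<close>
  obtain \<eta> W where \<eta>: "test_fun U \<eta>" "\<And>x. 0 \<le> \<eta> x \<and> \<eta> x \<le> 1" "open W" "?S \<subseteq> W" "\<And>x. x \<in> W \<Longrightarrow> \<eta> x = 1"
    using smooth_cutoff[OF S(1) U(1,3)] by blast
  have s\<eta>: "smooth \<eta>" using \<eta>(1) by (simp add: test_fun_iff)
  note [measurable] = borel_measurable_Xf[OF s\<eta>] borel_measurable_smooth[OF s\<eta>]
  have \<eta>z: "\<eta> x = 0" if "x \<notin> U" for x
    using \<eta>(1) that tsupport_zero[of x \<eta>] by (auto simp: test_fun_iff)
  have offS: "AE x in lborel. x \<notin> ?S \<longrightarrow> \<phi> x * indicator E x = 0" by (rule AE_zero_off_esupport)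

  let ?I = "\<lambda>x. indicator E' x * (\<Sum>b\<in>hbasis. (F' x \<bullet> b) * (\<eta> x * (G' x \<bullet> b) + f x * Xf gm b \<eta> x))"
  have identity: "- (\<integral>x. ?I x \<partial>lborel) = (\<integral>x. \<eta> x * f x * g1 x \<partial>lborel) - (\<integral>x. \<eta> x * f x * ?v x \<partial>\<nu>U)"
  proof (rule trace_identity_weak[OF U(1) E'b F' F'C g1 g1K snuU vm(1) siv[OF vi(1)] tri' fm fc G' G'i weak \<eta>(1)])
  qed (use U\<Omega> test_fun_mono in blast)+
  have I1: "(\<integral>x. indicator E x * (F x \<bullet> G x) \<partial>lebesgue) = (\<integral>x. ?I x \<partial>lborel)"
  proof (rule lebesgue_integral_eq_lborel)
    show "AE x in lborel. ?I x = indicator E x * (F x \<bullet> G x)"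
      using F'F G'G E'E Gz offS
    proof eventually_elim
      case (elim x)
      show ?case
      proof (cases "x \<in> E")
        case False
        then show ?thesis using elim(3) by simp
      next
        case True
        then have x\<Omega>: "x \<in> \<Omega>" using E(1) by blast
        have FG: "F x \<bullet> G x = (\<Sum>b\<in>hbasis. (F' x \<bullet> b) * (G' x \<bullet> b))"
          unfolding elim(1,2) by (rule hlayer_inner_eq_sum[OF Fh[OF x\<Omega>]])
        show ?thesis
        proof (cases "x \<in> ?S")
          case True
          then have xW: "x \<in> W" "x \<in> U" using \<eta>(4) U(3) by auto
          have "Xf gm b \<eta> x = 0" for b by (rule Xf_locally_constant[OF s\<eta> \<eta>(3,5) xW(1)])
          then show ?thesis using FG \<eta>(5)[OF xW(1)] elim(3) xW(2) \<open>x \<in> E\<close> by (simp add: indicator_def)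
        next
          case False
          then have f0: "f x = 0" using elim(5) \<open>x \<in> E\<close> f\<phi>[OF x\<Omega>] by simp
          then have "G' x \<bullet> b = 0" if "b \<in> hbasis" for b using elim(4) that x\<Omega> by blast
          then show ?thesis unfolding FG by (simp add: f0)
        qed
      qed
    qed
  qed measurable
  have I2: "(\<integral>x. indicator E x * \<phi> x * g x \<partial>lebesgue) = (\<integral>x. \<eta> x * f x * g1 x \<partial>lborel)"
  proof (rule lebesgue_integral_eq_lborel)
    show "AE x in lborel. \<eta> x * f x * g1 x = indicator E x * \<phi> x * g x"
      using g1eq g'g E'E offS
    proof eventually_elim
      case (elim x)
      show ?case
      proof (cases "x \<in> U")
        case True
        then have "g1 x = indicator E x * g x" using elim(1,2,3) by (simp add: indicator_def)
        moreover have "\<eta> x * \<phi> x * indicator E x = \<phi> x * indicator E x"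
        proof (cases "x \<in> ?S")
          case True
          then show ?thesis using \<eta>(4,5) by auto
        next
          case False
          then show ?thesis using elim(4) by (metis mult.assoc mult_zero_right)
        qed
        moreover have "f x = \<phi> x" using True U\<Omega> f\<phi> by blast
        ultimately show ?thesis by (metis mult.assoc mult.commute)
      next
        case False
        then have "x \<notin> ?S" using U(3) by blast
        then have "\<phi> x * indicator E x = 0" using elim(4) by blast
        then show ?thesis using \<eta>z[OF False] by auto
      qed
    qed
  qed measurable

  \<comment> \<open>If \<open>\<phi>\<close> were nonzero at such a point, it would be nonzero
    nearby, and \<open>E\<close> would be null near the point. The perimeter measure would then
    vanish on a small ball, against the positivity built into the reduced boundary.\<close>
  have \<phi>0: "\<phi> x = 0" if xR: "x \<in> ?R" and xS: "x \<notin> ?S" for x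
  proof (rule ccontr)
    assume nz: "\<phi> x \<noteq> 0"
    have x\<Omega>: "x \<in> \<Omega>" using xR by (simp add: red_bdry_def)
    obtain V where V: "open V" "x \<in> V" "AE y in lborel. y \<in> V \<longrightarrow> \<phi> y * indicator E y = 0"
      by (rule not_in_esupportE[OF xS])
    define V' where "V' = V \<inter> {y \<in> \<Omega>. \<phi> y \<noteq> 0}"
    have "open {y \<in> \<Omega>. \<phi> y \<noteq> 0}"
    proof -
      have "open (\<Omega> \<inter> \<phi> -` (- {0}))" using continuous_open_preimage[OF \<phi>cont \<Omega>] by blast
      moreover have "\<Omega> \<inter> \<phi> -` (- {0}) = {y \<in> \<Omega>. \<phi> y \<noteq> 0}" by auto
      ultimately show ?thesis by simp
    qed
    then have V': "open V'" "x \<in> V'" "V' \<subseteq> \<Omega>" using V x\<Omega> nz by (auto simp: V'_def)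
    have P': "perim_s V' (indicator (main_part lborel E)) (density \<nu> (indicator V')) \<sigma>"
      by (rule perim_s_restrict[OF \<Omega> V'(1,3) P\<Omega> refl])
    have "emeasure (density \<nu> (indicator V')) UNIV = 0"
    proof (rule perim_null_if_AE_empty[OF V'(1) P'])
      show "AE y in lborel. y \<in> V' \<longrightarrow> indicator (main_part lborel E) y = 0"
        using V(3) mpE by eventually_elim (auto simp: V'_def indicator_def)
    qed
    then have z: "emeasure \<nu> V' = 0"
      using emeasure_density_indicator[of V' \<nu> UNIV] V'(1) snu by simp
    obtain r where r: "r > 0" "hball d x r \<subseteq> V'" using hball_subset_open[OF V'(1,2)] .
    have "emeasure \<nu> (hball d x r) \<le> emeasure \<nu> V'" using r(2) V'(1) snu by (intro emeasure_mono) auto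
    moreover have "emeasure \<nu> (hball d x r) > 0" using xR r(1) by (simp add: red_bdry_def)
    ultimately show False using z by simp
  qed
  let ?t = "\<lambda>x. indicator ?R x * \<phi> x * ((Tri x + Tre x) / 2)" and ?u = "\<lambda>x. \<eta> x * f x * (indicator ?RU x * ((Tri x + Tre x) / 2))"
  have um: "?u \<in> borel_measurable borel" by measurable
  \<comment> \<open>An identity at every point: an exceptional Lebesgue null set could carry the
    whole perimeter measure.\<close>
  have tu: "?t x = indicator U x *\<^sub>R ?u x" for x
  proof (cases "x \<in> ?R")
    case False
    then show ?thesis using RU by (simp add: indicator_def)
  next
    case True
    then have x\<Omega>: "x \<in> \<Omega>" by (simp add: red_bdry_def)
    show ?thesis
    proof (cases "x \<in> ?S")
      case True
      then have "x \<in> U" "\<eta> x = 1" using U(3) \<eta>(4,5) by auto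
      then show ?thesis using \<open>x \<in> ?R\<close> RU f\<phi>[OF x\<Omega>] by (simp add: indicator_def)
    next
      case False
      then have "\<phi> x = 0" using \<phi>0 \<open>x \<in> ?R\<close> by blast
      then show ?thesis using f\<phi>[OF x\<Omega>] by simp
    qed
  qed
  have "(\<integral>x. ?t x \<partial>\<nu>) = (\<integral>x. indicator U x *\<^sub>R ?u x \<partial>\<nu>)" by (simp only: tu)
  also have "\<dots> = (\<integral>x. ?u x \<partial>density \<nu> (\<lambda>x. ennreal (indicator U x)))"
    by (rule integral_density[symmetric]) (use um snu Ub in \<open>auto cong: measurable_cong_sets\<close>)
  also have "\<dots> = (\<integral>x. ?u x \<partial>\<nu>U)" by (simp add: \<nu>U ennreal_indicator)
  also have "\<dots> = (\<integral>x. \<eta> x * f x * ?v x \<partial>\<nu>U)"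
  proof (rule integral_cong_AE)
    show "AE x in \<nu>U. ?u x = \<eta> x * f x * ?v x"
      using Treq by eventually_elim (auto simp: indicator_def)
    show "(\<lambda>x. \<eta> x * f x * ?v x) \<in> borel_measurable \<nu>U" unfolding nuM by measurable
  qed (use um in \<open>simp add: nuM\<close>)
  finally have I3: "(\<integral>x. ?t x \<partial>\<nu>) = (\<integral>x. \<eta> x * f x * ?v x \<partial>\<nu>U)" .
  show ?thesis
  proof
    show "AE x in \<nu>U. x \<in> ?RU \<longrightarrow> Tri x = Tre x \<and> Tri x = (Tri x + Tre x) / 2 \<and> Tre x = (Tri x + Tre x) / 2"
      using Treq by eventually_elim auto
    show "(\<integral>x. indicator E x * \<phi> x * g x \<partial>lebesgue) + (\<integral>x. indicator E x * (F x \<bullet> G x) \<partial>lebesgue) = (\<integral>x. ?t x \<partial>\<nu>)"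
      using identity unfolding I1 I2 I3 by linarith
  qed
qed

end
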